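(* Assume that $f_1(t,\omega)<\cdots<f_n(t,\omega)$ for all $(t,\omega)\in[0,T]\times\Omega$, and that $\mathbb{E}\big[\int_0^T|f_i(t)|\,\mu^A(dt)+\int_0^T|g_i(t)|\,\mu^P(dt)\big]<\infty$ for $i=1,\dots,n$. For $L\in\mathcal{L}^+$ set $$J(L):=\mathbb{E}\Big[\sum_{i=1}^n\Big(\int_{[0,T]}\big(g_i(t)\mathbf 1_{\{L_{t-}<i\}}\,\mu^P(dt)-f(t,L_{t-})\mathbf 1_{\{L_{t-}\ge i\}}\,\mu^A(dt)\big)-\xi\Big)\Big].$$ Then $$V^P=\sup_{L\in\mathcal{L}^+}J(L)=\sup_{L\in\mathcal{L}^+_0}J(L).$$ Moreover, the optimal solutions are related as follows. (i) Let $\widehat L^*\in\mathcal{L}^+$ be an optimal solution of $\sup_{L\in\mathcal{L}^+}J(L)$. Then the contract $$Y^{\widehat L^*}_t:=\mathbb{E}\Big[\xi+\int_{(t,T]}f(s,\widehat L^*_{s-})\,\mu^A(ds)\,\Big|\,\mathcal{F}_t\Big],\quad t\in[0,T],$$ is an optimal solution of the contract design problem defining $V^P$. Moreover, the smallest optimal stopping time of agent $i$ with respect to the contract $Y^{\widehat L^*}$ is $\hat\tau^*_i:=\inf\{t\ge0:\widehat L^*_t\ge i\}$, for $i=1,\dots,n$. (ii) Conversely, let $Y^*\in\mathcal{Y}$ be an optimal contract for the problem defining $V^P$, let $L^{Y^*}$ be an $\mathbb{F}$-optional real-valued process such that $$Y^*_\tau=\mathbb{E}\Big[\xi+\int_{(\tau,T]}f\big(t,\sup_{s\in[\tau,t)}L^{Y^*}_s\big)\,\mu^A(dt)\,\Big|\,\mathcal{F}_\tau\Big]\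 \text{ a.s. for all }\tau\in\mathcal{T},$$ and let $\widehat L^{Y^*}_t:=\big(0\vee\sup_{s\in[0,t)}L^{Y^*}_s\big)\wedge n$. Then $\widehat L^{Y^*}\in\mathcal{L}^+$ and it is an optimal solution of $\sup_{L\in\mathcal{L}^+}J(L)$. Moreover, the contract $\widehat Y_t:=\mathbb{E}\big[\xi+\int_{(t,T]}f(s,\widehat L^{Y^*}_{s-})\,\mu^A(ds)\,\big|\,\mathcal{F}_t\big]$, $t\in[0,T]$, is also an optimal contract for the problem defining $V^P$, and it induces, for each agent $i=1,\dots,n$, the same smallest optimal stopping time as the contract $Y^*$.
   Context: Setting: $(\Omega,\mathcal{F},\mathbb{P})$ is a complete probability space with a filtration $\mathbb{F}=(\mathcal{F}_t)_{t\in[0,T]}$ satisfying the usual conditions, $0<T<\infty$. $\mathcal{T}$ is the set of $\mathbb{F}$-stopping times with values in $[0,T]$. $n\ge1$ is an integer (number of agents); $\mu^A,\mu^P$ are deterministic atomless finite Borel measures on $[0,T]$; $f_i,g_i:[0,T]\times\Omega\to\mathbb{R}$, $i=1,\dots,n$, are progressively measurable; $\xi$ is an $\mathcal{F}_T$-measurable random variable with $\mathbb{E}|\xi|<\infty$. USCE: an optional process $Y$ of class (D) (i.e. $(Y_\tau)_{\tau\in\mathcal{T}}$ is uniformly integrable) is upper-semicontinuous in expectation (USCE) if for any $\tau\in\mathcal{T}$ and any sequence $(\tau_k)_{k\ge1}\subset\mathcal{T}$ with $\lim_k\tau_k=\tau$ such that either $(\tau_k)$ is non-decreasing with $\tau_k<\tau$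 on $\{\tau>0\}$ for each $k$, or $\tau_k\ge\tau$ a.s. for each $k$, one has $\mathbb{E}[Y_\tau]\ge\limsup_k\mathbb{E}[Y_{\tau_k}]$. Admissible contracts: $\mathcal{Y}$ is the set of $\mathbb{F}$-optional processes $Y$ that are USCE, of class (D), with $Y_T\ge\xi$. Agents: given $Y\in\mathcal{Y}$, agent $i$ solves $\sup_{\tau\in\mathcal{T}}\mathbb{E}\big[\int_{[0,\tau]}f_i(t)\,\mu^A(dt)+Y_\tau\big]$; for $Y\in\mathcal{Y}$ a smallest (a.s.) optimal stopping time exists and is denoted $\hat\tau_i=\hat\tau_i(Y)$. Contract design (principal's) problem: $V^P:=\sup_{Y\in\mathcal{Y}}\mathbb{E}\big[\sum_{i=1}^n\big(\int_{[0,\hat\tau_i]}g_i(t)\,\mu^P(dt)-Y_{\hat\tau_i}\big)\big]$; an optimal contract is a $Y\in\mathcal{Y}$ attaining this supremum. Interpolation: $f:[0,T]\times\Omega\times\mathbb{R}\to\mathbb{R}$ is $f(t,\omega,\ell)=f_1(t,\omega)+(\ell-1)$ for $\ell\le1$; $f(t,\omega,\ell)=(i+1-\ell)f_i(t,\omega)+(\ell-i)f_{i+1}(t,\omega)$ for $\ell\in[i,i+1]$, $i=1,\dots,n-1$; $f(t,\omega,\ell)=f_n(t,\omega)+(\ell-n)$ for $\ell\ge n$. Classes of controls: $\mathcal{L}$ is the set of $\mathbb{F}$-optional processes $L:[0,T]\times\Omega\to[0,n]$; $\mathcal{L}^+$ is the set of $L\in\mathcal{L}$ with non-decreasing paths;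 $\mathcal{L}^+_0$ is the set of $L\in\mathcal{L}^+$ with $L_t\in\{0,1,\dots,n\}$ for all $t\in[0,T]$, a.s. $L_{t-}$ is the left limit. Stopping times take values in $[0,T]$, so hitting times use the convention $\inf\emptyset=T$.
   Formalization: The measure $\mu^A$ is additionally assumed to have full support on $[0,T]$ (every nonempty relatively open subset has positive $\mu^A$-measure); without this $V^P=\sup J$ can fail (e.g. $\mu^A=0$), and (i) fails for suitable data whenever $\mu^A$ has a gap. *)

theory Defs
  imports "HOL-Probability.Probability"
begin

section \<open>Filtered probability space\<close>

text \<open>The time set is \<open>[0,T]\<close>. To use the library's \<^const>\<open>stopping_time\<close> and
  \<^locale>\<open>filtration\<close>, the filtration is a family indexed by all reals; its values outside
  \<open>[0,T]\<close> have no influence on any notion below (a filtration on \<open>[0,T]\<close> can be extended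
  constantly, and stopping times take values in \<open>[0,T]\<close>). Likewise a process is a function
  \<open>real \<Rightarrow> 'a \<Rightarrow> real\<close> of which only the values on \<open>[0,T] \<times> \<Omega>\<close> are used.\<close>

locale usual_filtered_prob_space = prob_space M + complete_measure M + filtration "space M" F
  for M :: "'a measure" and F :: "real \<Rightarrow> 'a measure" and T :: real +
  assumes horizon_pos: "0 < T"
    and subalgebra_F: "\<And>t. t \<in> {0..T} \<Longrightarrow> subalgebra M (F t)"
    and null_sets_F: "null_sets M \<subseteq> sets (F 0)"
    and right_continuous_F: "\<And>t. t \<in> {0..<T} \<Longrightarrow> sets (F t) = (\<Inter>s\<in>{t<..T}. sets (F s))"

definition stopping_times :: "'a measure \<Rightarrow> (real \<Rightarrow> 'a measure) \<Rightarrow> real \<Rightarrow> ('a \<Rightarrow> real) set" where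
  "stopping_times M F T = {\<tau>. stopping_time F \<tau> \<and> (\<forall>\<omega>\<in>space M. \<tau> \<omega> \<in> {0..T})}"

definition progressively_measurable ::
    "(real \<Rightarrow> 'a measure) \<Rightarrow> real \<Rightarrow> (real \<Rightarrow> 'a \<Rightarrow> real) \<Rightarrow> bool" where
  "progressively_measurable F T X \<longleftrightarrow>
     (\<forall>t\<in>{0..T}. (\<lambda>(s, \<omega>). X s \<omega>) \<in> borel_measurable (restrict_space borel {0..t} \<Otimes>\<^sub>M F t))"

definition cadlag_adapted ::
    "'a measure \<Rightarrow> (real \<Rightarrow> 'a measure) \<Rightarrow> real \<Rightarrow> (real \<Rightarrow> 'a \<Rightarrow> real) \<Rightarrow> bool" where
  "cadlag_adapted M F T X \<longleftrightarrow>
     (\<forall>t\<in>{0..T}. X t \<in> borel_measurable (F t)) \<and>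
     (\<forall>\<omega>\<in>space M.
        (\<forall>t\<in>{0..<T}. ((\<lambda>s. X s \<omega>) \<longlongrightarrow> X t \<omega>) (at_right t)) \<and>
        (\<forall>t\<in>{0<..T}. \<exists>l. ((\<lambda>s. X s \<omega>) \<longlongrightarrow> l) (at_left t)))"

definition optional_sigma ::
    "'a measure \<Rightarrow> (real \<Rightarrow> 'a measure) \<Rightarrow> real \<Rightarrow> (real \<times> 'a) measure" where
  "optional_sigma M F T = sigma ({0..T} \<times> space M)
     {{(t, \<omega>). t \<in> {0..T} \<and> \<omega> \<in> space M \<and> X t \<omega> \<in> B} | X B.
        cadlag_adapted M F T X \<and> B \<in> sets borel}"

definition optional_process ::
    "'a measure \<Rightarrow> (real \<Rightarrow> 'a measure) \<Rightarrow> real \<Rightarrow> (real \<Rightarrow> 'a \<Rightarrow> real) \<Rightarrow> bool" where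
  "optional_process M F T X \<longleftrightarrow> (\<lambda>(t, \<omega>). X t \<omega>) \<in> borel_measurable (optional_sigma M F T)"

definition uniformly_integrable :: "'a measure \<Rightarrow> ('a \<Rightarrow> real) set \<Rightarrow> bool" where
  "uniformly_integrable M S \<longleftrightarrow>
     (\<forall>X\<in>S. integrable M X) \<and>
     (\<forall>\<epsilon>>0. \<exists>K. \<forall>X\<in>S. (LINT \<omega>|M. \<bar>X \<omega>\<bar> * of_bool (K < \<bar>X \<omega>\<bar>)) \<le> \<epsilon>)"

definition class_D ::
    "'a measure \<Rightarrow> (real \<Rightarrow> 'a measure) \<Rightarrow> real \<Rightarrow> (real \<Rightarrow> 'a \<Rightarrow> real) \<Rightarrow> bool" where
  "class_D M F T Y \<longleftrightarrow>
     uniformly_integrable M ((\<lambda>\<tau> \<omega>. Y (\<tau> \<omega>) \<omega>) ` stopping_times M F T)"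

definition USCE ::
    "'a measure \<Rightarrow> (real \<Rightarrow> 'a measure) \<Rightarrow> real \<Rightarrow> (real \<Rightarrow> 'a \<Rightarrow> real) \<Rightarrow> bool" where
  "USCE M F T Y \<longleftrightarrow>
     (\<forall>\<tau>\<in>stopping_times M F T. \<forall>\<rho> :: nat \<Rightarrow> 'a \<Rightarrow> real.
        (\<forall>k. \<rho> k \<in> stopping_times M F T) \<longrightarrow>
        (AE \<omega> in M. (\<lambda>k. \<rho> k \<omega>) \<longlonglongrightarrow> \<tau> \<omega>) \<longrightarrow>
        (AE \<omega> in M. incseq (\<lambda>k. \<rho> k \<omega>) \<and> (\<tau> \<omega> > 0 \<longrightarrow> (\<forall>k. \<rho> k \<omega> < \<tau> \<omega>))) \<or>
        (\<forall>k. AE \<omega> in M. \<tau> \<omega> \<le> \<rho> k \<omega>) \<longrightarrow>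
        limsup (\<lambda>k. ereal (LINT \<omega>|M. Y (\<rho> k \<omega>) \<omega>)) \<le> ereal (LINT \<omega>|M. Y (\<tau> \<omega>) \<omega>))"


section \<open>Measures on the time interval\<close>

definition atomless_finite_borel :: "real \<Rightarrow> real measure \<Rightarrow> bool" where
  "atomless_finite_borel T \<mu> \<longleftrightarrow>
     finite_measure \<mu> \<and> sets \<mu> = sets (restrict_space borel {0..T}) \<and>
     (\<forall>t\<in>{0..T}. emeasure \<mu> {t} = 0)"

text \<open>Full support of \<open>\<mu>\<^sup>A\<close> is a tacit requirement: it is needed for the Bank--El Karoui
  representation of contracts, and for \<open>\<mu>\<^sup>A = 0\<close> all agents have the same stopping problem,
  so that for \<open>n = 2\<close>, \<open>\<xi> = 0\<close>, \<open>g\<^sub>1 = -1\<close>, \<open>g\<^sub>2 = 1\<close> and Lebesgue measure as \<open>\<mu>\<^sup>P\<close> the principal's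
  value is nonpositive whereas the control \<open>L = 1\<close> yields \<open>T\<close>.\<close>

definition full_support :: "real \<Rightarrow> real measure \<Rightarrow> bool" where
  "full_support T \<mu> \<longleftrightarrow>
     (\<forall>U. open U \<and> U \<inter> {0..T} \<noteq> {} \<longrightarrow> 0 < emeasure \<mu> (U \<inter> {0..T}))"


section \<open>Contracts and stopping problems\<close>

definition contracts ::
    "'a measure \<Rightarrow> (real \<Rightarrow> 'a measure) \<Rightarrow> real \<Rightarrow> ('a \<Rightarrow> real) \<Rightarrow> (real \<Rightarrow> 'a \<Rightarrow> real) set" where
  "contracts M F T \<xi> =
     {Y. optional_process M F T Y \<and> class_D M F T Y \<and> USCE M F T Y \<and> (AE \<omega> in M. \<xi> \<omega> \<le> Y T \<omega>)}"

definition agent_payoff ::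
    "'a measure \<Rightarrow> real measure \<Rightarrow> (real \<Rightarrow> 'a \<Rightarrow> real) \<Rightarrow> (real \<Rightarrow> 'a \<Rightarrow> real) \<Rightarrow> ('a \<Rightarrow> real) \<Rightarrow> real" where
  "agent_payoff M \<mu>A fi Y \<tau> =
     (LINT \<omega>|M. (LINT t:{0..\<tau> \<omega>}|\<mu>A. fi t \<omega>) + Y (\<tau> \<omega>) \<omega>)"

definition agent_optimal ::
    "'a measure \<Rightarrow> (real \<Rightarrow> 'a measure) \<Rightarrow> real \<Rightarrow> real measure \<Rightarrow> (real \<Rightarrow> 'a \<Rightarrow> real) \<Rightarrow>
     (real \<Rightarrow> 'a \<Rightarrow> real) \<Rightarrow> ('a \<Rightarrow> real) \<Rightarrow> bool" where
  "agent_optimal M F T \<mu>A fi Y \<tau> \<longleftrightarrow>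
     \<tau> \<in> stopping_times M F T \<and>
     ereal (agent_payoff M \<mu>A fi Y \<tau>) =
       (SUP \<sigma>\<in>stopping_times M F T. ereal (agent_payoff M \<mu>A fi Y \<sigma>))"

definition smallest_optimal ::
    "'a measure \<Rightarrow> (real \<Rightarrow> 'a measure) \<Rightarrow> real \<Rightarrow> real measure \<Rightarrow> (real \<Rightarrow> 'a \<Rightarrow> real) \<Rightarrow>
     (real \<Rightarrow> 'a \<Rightarrow> real) \<Rightarrow> ('a \<Rightarrow> real) \<Rightarrow> bool" where
  "smallest_optimal M F T \<mu>A fi Y \<tau> \<longleftrightarrow>
     agent_optimal M F T \<mu>A fi Y \<tau> \<and>
     (\<forall>\<sigma>. agent_optimal M F T \<mu>A fi Y \<sigma> \<longrightarrow> (AE \<omega> in M. \<tau> \<omega> \<le> \<sigma> \<omega>))"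

text \<open>The smallest optimal stopping time is only unique almost surely; the choice of a
  representative does not affect the principal's payoff.\<close>

definition tau_hat ::
    "'a measure \<Rightarrow> (real \<Rightarrow> 'a measure) \<Rightarrow> real \<Rightarrow> real measure \<Rightarrow> (real \<Rightarrow> 'a \<Rightarrow> real) \<Rightarrow>
     (real \<Rightarrow> 'a \<Rightarrow> real) \<Rightarrow> 'a \<Rightarrow> real" where
  "tau_hat M F T \<mu>A fi Y = (SOME \<tau>. smallest_optimal M F T \<mu>A fi Y \<tau>)"

definition principal_payoff ::
    "'a measure \<Rightarrow> (real \<Rightarrow> 'a measure) \<Rightarrow> real \<Rightarrow> nat \<Rightarrow> real measure \<Rightarrow> real measure \<Rightarrow>
     (nat \<Rightarrow> real \<Rightarrow> 'a \<Rightarrow> real) \<Rightarrow> (nat \<Rightarrow> real \<Rightarrow> 'a \<Rightarrow> real) \<Rightarrow> (real \<Rightarrow> 'a \<Rightarrow> real) \<Rightarrow> real" where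
  "principal_payoff M F T n \<mu>A \<mu>P f g Y =
     (LINT \<omega>|M. (\<Sum>i=1..n.
        (LINT t:{0..tau_hat M F T \<mu>A (f i) Y \<omega>}|\<mu>P. g i t \<omega>) -
        Y (tau_hat M F T \<mu>A (f i) Y \<omega>) \<omega>))"

definition V_P ::
    "'a measure \<Rightarrow> (real \<Rightarrow> 'a measure) \<Rightarrow> real \<Rightarrow> nat \<Rightarrow> real measure \<Rightarrow> real measure \<Rightarrow>
     (nat \<Rightarrow> real \<Rightarrow> 'a \<Rightarrow> real) \<Rightarrow> (nat \<Rightarrow> real \<Rightarrow> 'a \<Rightarrow> real) \<Rightarrow> ('a \<Rightarrow> real) \<Rightarrow> ereal" where
  "V_P M F T n \<mu>A \<mu>P f g \<xi> =
     (SUP Y\<in>contracts M F T \<xi>. ereal (principal_payoff M F T n \<mu>A \<mu>P f g Y))"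

definition optimal_contract ::
    "'a measure \<Rightarrow> (real \<Rightarrow> 'a measure) \<Rightarrow> real \<Rightarrow> nat \<Rightarrow> real measure \<Rightarrow> real measure \<Rightarrow>
     (nat \<Rightarrow> real \<Rightarrow> 'a \<Rightarrow> real) \<Rightarrow> (nat \<Rightarrow> real \<Rightarrow> 'a \<Rightarrow> real) \<Rightarrow> ('a \<Rightarrow> real) \<Rightarrow>
     (real \<Rightarrow> 'a \<Rightarrow> real) \<Rightarrow> bool" where
  "optimal_contract M F T n \<mu>A \<mu>P f g \<xi> Y \<longleftrightarrow>
     Y \<in> contracts M F T \<xi> \<and>
     ereal (principal_payoff M F T n \<mu>A \<mu>P f g Y) = V_P M F T n \<mu>A \<mu>P f g \<xi>"


section \<open>The control problem\<close>

definition interp ::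
    "nat \<Rightarrow> (nat \<Rightarrow> real \<Rightarrow> 'a \<Rightarrow> real) \<Rightarrow> real \<Rightarrow> 'a \<Rightarrow> real \<Rightarrow> real" where
  "interp n f t \<omega> l =
     (if l \<le> 1 then f 1 t \<omega> + (l - 1)
      else if real n \<le> l then f n t \<omega> + (l - real n)
      else let i = nat \<lfloor>l\<rfloor> in (real i + 1 - l) * f i t \<omega> + (l - real i) * f (i + 1) t \<omega>)"

text \<open>At time \<open>0\<close> the convention is \<open>L\<^sub>0\<^sub>- = 0\<close>; the value is irrelevant for atomless measures.\<close>

definition left_lim :: "(real \<Rightarrow> 'a \<Rightarrow> real) \<Rightarrow> real \<Rightarrow> 'a \<Rightarrow> real" where
  "left_lim L t \<omega> = (if t = 0 then 0 else Lim (at_left t) (\<lambda>s. L s \<omega>))"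

definition controls ::
    "'a measure \<Rightarrow> (real \<Rightarrow> 'a measure) \<Rightarrow> real \<Rightarrow> nat \<Rightarrow> (real \<Rightarrow> 'a \<Rightarrow> real) set" where
  "controls M F T n =
     {L. optional_process M F T L \<and> (\<forall>t\<in>{0..T}. \<forall>\<omega>\<in>space M. L t \<omega> \<in> {0..real n})}"

definition controls_mono ::
    "'a measure \<Rightarrow> (real \<Rightarrow> 'a measure) \<Rightarrow> real \<Rightarrow> nat \<Rightarrow> (real \<Rightarrow> 'a \<Rightarrow> real) set" where
  "controls_mono M F T n =
     {L \<in> controls M F T n. \<forall>\<omega>\<in>space M. mono_on {0..T} (\<lambda>t. L t \<omega>)}"

definition controls_int ::
    "'a measure \<Rightarrow> (real \<Rightarrow> 'a measure) \<Rightarrow> real \<Rightarrow> nat \<Rightarrow> (real \<Rightarrow> 'a \<Rightarrow> real) set" where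
  "controls_int M F T n =
     {L \<in> controls_mono M F T n. AE \<omega> in M. \<forall>t\<in>{0..T}. L t \<omega> \<in> real ` {0..n}}"

definition J ::
    "'a measure \<Rightarrow> real \<Rightarrow> nat \<Rightarrow> real measure \<Rightarrow> real measure \<Rightarrow>
     (nat \<Rightarrow> real \<Rightarrow> 'a \<Rightarrow> real) \<Rightarrow> (nat \<Rightarrow> real \<Rightarrow> 'a \<Rightarrow> real) \<Rightarrow> ('a \<Rightarrow> real) \<Rightarrow>
     (real \<Rightarrow> 'a \<Rightarrow> real) \<Rightarrow> real" where
  "J M T n \<mu>A \<mu>P f g \<xi> L =
     (LINT \<omega>|M. (\<Sum>i=1..n.
        (LINT t:{0..T}|\<mu>P. g i t \<omega> * of_bool (left_lim L t \<omega> < real i)) -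
        (LINT t:{0..T}|\<mu>A. interp n f t \<omega> (left_lim L t \<omega>) * of_bool (real i \<le> left_lim L t \<omega>)) -
        \<xi> \<omega>))"

definition optimal_control ::
    "'a measure \<Rightarrow> (real \<Rightarrow> 'a measure) \<Rightarrow> real \<Rightarrow> nat \<Rightarrow> real measure \<Rightarrow> real measure \<Rightarrow>
     (nat \<Rightarrow> real \<Rightarrow> 'a \<Rightarrow> real) \<Rightarrow> (nat \<Rightarrow> real \<Rightarrow> 'a \<Rightarrow> real) \<Rightarrow> ('a \<Rightarrow> real) \<Rightarrow>
     (real \<Rightarrow> 'a \<Rightarrow> real) \<Rightarrow> bool" where
  "optimal_control M F T n \<mu>A \<mu>P f g \<xi> L \<longleftrightarrow>
     L \<in> controls_mono M F T n \<and>
     ereal (J M T n \<mu>A \<mu>P f g \<xi> L) =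
       (SUP L'\<in>controls_mono M F T n. ereal (J M T n \<mu>A \<mu>P f g \<xi> L'))"

definition hitting_time :: "real \<Rightarrow> (real \<Rightarrow> 'a \<Rightarrow> real) \<Rightarrow> nat \<Rightarrow> 'a \<Rightarrow> real" where
  "hitting_time T L i \<omega> =
     (if \<exists>t\<in>{0..T}. real i \<le> L t \<omega> then Inf {t \<in> {0..T}. real i \<le> L t \<omega>} else T)"

text \<open>\<open>Y\<^sub>t = E[\<xi> + \<integral>\<^bsub>(t,T]\<^esub> f(s, L\<^sub>s\<^sub>-) \<mu>\<^sup>A(ds) | \<F>\<^sub>t]\<close> determines \<open>Y\<^sub>t\<close> only almost surely for each
  fixed \<open>t\<close>; as a process, \<open>Y\<close> is its cadlag version, unique up to indistinguishability.\<close>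

definition contract_of ::
    "'a measure \<Rightarrow> (real \<Rightarrow> 'a measure) \<Rightarrow> real \<Rightarrow> nat \<Rightarrow> real measure \<Rightarrow>
     (nat \<Rightarrow> real \<Rightarrow> 'a \<Rightarrow> real) \<Rightarrow> ('a \<Rightarrow> real) \<Rightarrow> (real \<Rightarrow> 'a \<Rightarrow> real) \<Rightarrow> (real \<Rightarrow> 'a \<Rightarrow> real) \<Rightarrow> bool" where
  "contract_of M F T n \<mu>A f \<xi> L Y \<longleftrightarrow>
     cadlag_adapted M F T Y \<and>
     (\<forall>t\<in>{0..T}. AE \<omega> in M. Y t \<omega> =
        real_cond_exp M (F t)
          (\<lambda>\<omega>. \<xi> \<omega> + (LINT s:{t<..T}|\<mu>A. interp n f s \<omega> (left_lim L s \<omega>))) \<omega>)"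

text \<open>The first three conjuncts say that the right-hand side of the representation is meaningful:
  the running supremum is finite, the inner integral exists, and its expectation exists.\<close>

definition represents ::
    "'a measure \<Rightarrow> (real \<Rightarrow> 'a measure) \<Rightarrow> real \<Rightarrow> nat \<Rightarrow> real measure \<Rightarrow>
     (nat \<Rightarrow> real \<Rightarrow> 'a \<Rightarrow> real) \<Rightarrow> ('a \<Rightarrow> real) \<Rightarrow> (real \<Rightarrow> 'a \<Rightarrow> real) \<Rightarrow> (real \<Rightarrow> 'a \<Rightarrow> real) \<Rightarrow> bool" where
  "represents M F T n \<mu>A f \<xi> L Y \<longleftrightarrow>
     (\<forall>\<tau>\<in>stopping_times M F T.
        (AE \<omega> in M. AE t in \<mu>A. t \<in> {\<tau> \<omega><..T} \<longrightarrow> bdd_above ((\<lambda>s. L s \<omega>) ` {\<tau> \<omega>..<t})) \<and>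
        (AE \<omega> in M. set_integrable \<mu>A {\<tau> \<omega><..T} (\<lambda>t. interp n f t \<omega> (SUP s\<in>{\<tau> \<omega>..<t}. L s \<omega>))) \<and>
        integrable M (\<lambda>\<omega>. LINT t:{\<tau> \<omega><..T}|\<mu>A. interp n f t \<omega> (SUP s\<in>{\<tau> \<omega>..<t}. L s \<omega>)) \<and>
        (AE \<omega> in M. Y (\<tau> \<omega>) \<omega> =
           real_cond_exp M (filtration.pre_sigma (space M) F \<tau>)
             (\<lambda>\<omega>. \<xi> \<omega> + (LINT t:{\<tau> \<omega><..T}|\<mu>A. interp n f t \<omega> (SUP s\<in>{\<tau> \<omega>..<t}. L s \<omega>))) \<omega>))"

text \<open>The supremum is taken in the extended reals, so that it is \<open>-\<infinity>\<close> for \<open>t = 0\<close> (empty set)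
  and may be \<open>\<infinity>\<close>; truncation makes the result finite.\<close>

definition truncated_sup :: "nat \<Rightarrow> (real \<Rightarrow> 'a \<Rightarrow> real) \<Rightarrow> real \<Rightarrow> 'a \<Rightarrow> real" where
  "truncated_sup n L t \<omega> =
     real_of_ereal (min (max 0 (SUP s\<in>{0..<t}. ereal (L s \<omega>))) (ereal (real n)))"

end

theory Submission
  imports Defs
begin

text \<open>
  A control \<open>L\<close> prescribes the payment rate \<open>f(t, L\<^sub>t\<^sub>-)\<close>, and its contract is the conditional expectation
  of \<open>\<xi>\<close> plus the payments that are still to come. Facing this contract, agent \<open>i\<close> earns the rate
  \<open>f\<^sub>i - f(t, L\<^sub>t\<^sub>-)\<close>, up to a constant. Since the interpolation is strictly increasing in its last argument
  and takes the value \<open>f\<^sub>i\<close> at \<open>i\<close>, this rate is positive before \<open>L\<close> reaches \<open>i\<close> and nonpositive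
  afterwards. So on every path it is best to stop at the hitting time of \<open>i\<close>, and full support of \<open>\<mu>\<^sup>A\<close>
  makes it strictly worse to stop earlier (\<open>hitting_time_smallest_optimal\<close>). As \<open>J(L)\<close> splits at the hitting
  times, it is the principal's payoff from the contract of \<open>L\<close> (\<open>contract_principal_payoff\<close>), so that
  \<open>sup J \<le> V\<close>.

  Conversely, let \<open>Y\<close> be any admissible contract. An agent with larger \<open>f\<^sub>i\<close> is more willing to wait, so the
  smallest optimal times are ordered (\<open>optimal_times_ordered\<close>); let \<open>L\<close> count the agents that have stopped.
  Between the stopping times of agents \<open>i\<close> and \<open>i + 1\<close> the contract \<open>Y\<close> must lose at least \<open>\<integral>f\<^sub>i\<close> in expectation,
  as agent \<open>i\<close> does not wait, whereas the contract of \<open>L\<close> loses exactly this amount, and it ends at \<open>\<xi>\<close>,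
  the least admissible value. Hence the contract of \<open>L\<close> induces the same stopping times and pays no more
  (\<open>claim_le_contract\<close>). As \<open>L\<close> is integer-valued, this proves both equalities of values, and
  (i) follows.

  For (ii), let \<open>L\<close> represent an optimal contract \<open>Y\<close> and let \<open>S\<close> be its truncated running supremum. Consider the
  time at which \<open>S\<close> crosses a level \<open>c\<close> just below \<open>i\<close>. Before it \<open>L\<close> stays below \<open>c\<close>, and after it the running
  supremum of \<open>L\<close> forgets everything that happened earlier. This allows a pathwise comparison of any
  stopping time with the crossing time (\<open>switching_path\<close>). For \<open>c \<longlongrightarrow> i\<close> it shows that the hitting time of \<open>i\<close>
  by \<open>S\<close> is the smallest optimal time of agent \<open>i\<close> for \<open>Y\<close> and that the contract of \<open>S\<close> costs at most as
  much there (\<open>switching_payoff\<close>, \<open>claim_le_represented\<close>); so \<open>S\<close> is optimal.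

  Three facts from stochastic analysis carry the argument. A smallest optimal stopping time exists
  (\<open>smallest_maximizer_exists\<close>, \<open>USCE_increasing\<close>). A closed martingale has a cadlag version
  (\<open>cadlag_version\<close>), whose values at stopping times are reached by discretisation (\<open>sampling\<close>). The
  running supremum of an optional process is adapted, by measurable projection (\<open>measurable_projection\<close>).
\<close>

lemmas LINT_add = Bochner_Integration.integral_add
  and LINT_diff = Bochner_Integration.integral_diff
  and LINT_cong = Bochner_Integration.integral_cong
  and LINT_sum = Bochner_Integration.integral_sum
  and LINT_integrable_add = Bochner_Integration.integrable_add
  and LINT_integrable_diff = Bochner_Integration.integrable_diff
  and LINT_integrable_sum = Bochner_Integration.integrable_sum

section \<open>Uniform integrability\<close>

context prob_space
begin

lemma integrable_tail:
 fixes X :: "'a \<Rightarrow> real"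
 assumes [measurable]: "integrable M X"
 shows "integrable M (\<lambda>\<omega>. \<bar>X \<omega>\<bar> * of_bool (K < \<bar>X \<omega>\<bar>))"
proof -
 have "integrable M (\<lambda>\<omega>. \<bar>X \<omega>\<bar> * indicator {\<omega>\<in>space M. K < \<bar>X \<omega>\<bar>} \<omega>)"
  using assms by (intro integrable_real_mult_indicator) auto
 also have "?this \<longleftrightarrow> ?thesis"
  by (intro Bochner_Integration.integrable_cong) (auto simp: indicator_def)
 finally show ?thesis .
qed

text \<open>Split \<open>\<bar>X\<bar>\<close> at the truncation level \<open>K\<close> of the family: the tail is uniformly small, and the rest
 contributes at most \<open>K * prob A\<close>.\<close>

lemma uniformly_integrable_small_sets:
 assumes UI: "uniformly_integrable M S" and "0 < \<epsilon>"
 obtains \<delta> where "0 < \<delta>"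
  "\<And>X A. X \<in> S \<Longrightarrow> A \<in> sets M \<Longrightarrow> prob A < \<delta> \<Longrightarrow> (LINT \<omega>|M. \<bar>X \<omega>\<bar> * indicator A \<omega>) \<le> \<epsilon>"
proof -
 obtain K where K: "\<And>X. X \<in> S \<Longrightarrow> (LINT \<omega>|M. \<bar>X \<omega>\<bar> * of_bool (K < \<bar>X \<omega>\<bar>)) \<le> \<epsilon>/2"
  using UI \<open>0 < \<epsilon>\<close> unfolding uniformly_integrable_def by (metis half_gt_zero)
 define K' where "K' = max K 1"
 have K': "0 < K'" "K \<le> K'" by (auto simp: K'_def)
 show thesis
 proof (rule that[of "\<epsilon> / (2 * K')"])
  show "0 < \<epsilon> / (2 * K')" using \<open>0 < \<epsilon>\<close> K' by simp
  fix X A assume X: "X \<in> S" and A[measurable]: "A \<in> sets M" and pA: "prob A < \<epsilon> / (2 * K')"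
  have iX[measurable]: "integrable M X" using UI X by (auto simp: uniformly_integrable_def)
  have "(LINT \<omega>|M. \<bar>X \<omega>\<bar> * indicator A \<omega>)
    \<le> (LINT \<omega>|M. K' * indicator A \<omega> + \<bar>X \<omega>\<bar> * of_bool (K < \<bar>X \<omega>\<bar>))"
  proof (rule integral_mono)
   show "integrable M (\<lambda>\<omega>. \<bar>X \<omega>\<bar> * indicator A \<omega>)"
    using iX by (intro integrable_real_mult_indicator) auto
   show "integrable M (\<lambda>\<omega>. K' * indicator A \<omega> + \<bar>X \<omega>\<bar> * of_bool (K < \<bar>X \<omega>\<bar>))"
    using iX by (intro LINT_integrable_add integrable_tail)
     (auto intro!: integrable_mult_right integrable_real_indicator simp: emeasure_eq_measure)
   show "\<And>\<omega>. \<omega> \<in> space M \<Longrightarrow> \<bar>X \<omega>\<bar> * indicator A \<omega> \<le> K' * indicator A \<omega> + \<bar>X \<omega>\<bar> * of_bool (K < \<bar>X \<omega>\<bar>)"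
    using K' by (auto simp: indicator_def)
  qed
  also have "\<dots> = K' * prob A + (LINT \<omega>|M. \<bar>X \<omega>\<bar> * of_bool (K < \<bar>X \<omega>\<bar>))"
   using iX by (subst LINT_add)
    (auto intro!: integrable_mult_right integrable_real_indicator integrable_tail simp: emeasure_eq_measure)
  also have "\<dots> \<le> \<epsilon>/2 + \<epsilon>/2"
   using K[OF X] pA K' by (intro add_mono) (auto simp: field_simps)
  finally show "(LINT \<omega>|M. \<bar>X \<omega>\<bar> * indicator A \<omega>) \<le> \<epsilon>" by simp
 qed
qed

lemma uniformly_integrable_singleton:
 fixes Z :: "'a \<Rightarrow> real"
 assumes Z: "integrable M Z"
 shows "uniformly_integrable M {Z}"
 unfolding uniformly_integrable_def
proof (intro conjI allI impI)
 have [measurable]: "Z \<in> borel_measurable M" using Z by auto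
 fix \<epsilon> :: real assume "0 < \<epsilon>"
 have "(\<lambda>k. LINT \<omega>|M. \<bar>Z \<omega>\<bar> * of_bool (real k < \<bar>Z \<omega>\<bar>)) \<longlonglongrightarrow> (LINT \<omega>|M. 0)"
 proof (rule integral_dominated_convergence[where w="\<lambda>\<omega>. \<bar>Z \<omega>\<bar>"])
  show "AE x in M. (\<lambda>k. \<bar>Z x\<bar> * of_bool (real k < \<bar>Z x\<bar>)) \<longlonglongrightarrow> 0"
  proof (rule AE_I2)
   fix x
   obtain N where N: "\<bar>Z x\<bar> < real N" using reals_Archimedean2 by blast
   show "(\<lambda>k. \<bar>Z x\<bar> * of_bool (real k < \<bar>Z x\<bar>)) \<longlonglongrightarrow> 0"
    by (rule tendsto_eventually) (use N in \<open>auto simp: eventually_sequentially intro!: exI[of _ N]\<close>)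
  qed
 qed (use Z in \<open>auto intro!: borel_measurable_integrable integrable_tail integrable_abs\<close>)
 then have "\<forall>\<^sub>F k in sequentially. (LINT \<omega>|M. \<bar>Z \<omega>\<bar> * of_bool (real k < \<bar>Z \<omega>\<bar>)) < \<epsilon>"
  using \<open>0 < \<epsilon>\<close> by (intro order_tendstoD(2)) auto
 then obtain k where "(LINT \<omega>|M. \<bar>Z \<omega>\<bar> * of_bool (real k < \<bar>Z \<omega>\<bar>)) < \<epsilon>"
  using eventually_happens'[OF sequentially_bot] by auto
 then show "\<exists>K. \<forall>X\<in>{Z}. (LINT \<omega>|M. \<bar>X \<omega>\<bar> * of_bool (K < \<bar>X \<omega>\<bar>)) \<le> \<epsilon>"
  by (intro exI[of _ "real k"]) auto
qed (use Z in auto)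

lemma integrable_small_sets:
 fixes Z :: "'a \<Rightarrow> real"
 assumes "integrable M Z" "0 < \<epsilon>"
 obtains \<delta> where "0 < \<delta>"
  "\<And>A. A \<in> sets M \<Longrightarrow> prob A < \<delta> \<Longrightarrow> (LINT \<omega>|M. \<bar>Z \<omega>\<bar> * indicator A \<omega>) \<le> \<epsilon>"
 using uniformly_integrable_small_sets[OF uniformly_integrable_singleton[OF assms(1)] assms(2)]
 by (metis insertI1)

text \<open>The tail condition below is what conditional expectations of variables dominated by \<open>W\<close>
 satisfy, since \<open>{K < \<bar>X\<bar>}\<close> belongs to the conditioning \<open>\<sigma>\<close>-algebra; Markov's inequality makes
 these events small uniformly over the family.\<close>

lemma uniformly_integrable_dominated:
 fixes W :: "'a \<Rightarrow> real"
 assumes W: "integrable M W" and S: "\<And>X. X \<in> S \<Longrightarrow> integrable M X"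
  and dom: "\<And>X K. X \<in> S \<Longrightarrow> 0 \<le> K \<Longrightarrow>
   (LINT \<omega>|M. \<bar>X \<omega>\<bar> * of_bool (K < \<bar>X \<omega>\<bar>)) \<le> (LINT \<omega>|M. \<bar>W \<omega>\<bar> * of_bool (K < \<bar>X \<omega>\<bar>))"
 shows "uniformly_integrable M S"
 unfolding uniformly_integrable_def
proof (intro conjI allI impI)
 fix \<epsilon> :: real assume "0 < \<epsilon>"
 obtain \<delta> where "0 < \<delta>" and \<delta>:
  "\<And>A. A \<in> sets M \<Longrightarrow> prob A < \<delta> \<Longrightarrow> (LINT \<omega>|M. \<bar>W \<omega>\<bar> * indicator A \<omega>) \<le> \<epsilon>"
  using integrable_small_sets[OF W \<open>0 < \<epsilon>\<close>] by blast
 define c where "c = (LINT \<omega>|M. \<bar>W \<omega>\<bar>)"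
 have c: "0 \<le> c" by (simp add: c_def)
 define K where "K = c / \<delta> + 1"
 have K: "0 < K" "c < K * \<delta>" using c \<open>0 < \<delta>\<close> by (auto simp: K_def field_simps add_nonneg_pos)
 have "(LINT \<omega>|M. \<bar>X \<omega>\<bar> * of_bool (K < \<bar>X \<omega>\<bar>)) \<le> \<epsilon>" if X: "X \<in> S" for X
 proof -
  note iX = S[OF X]
  have [measurable]: "X \<in> borel_measurable M" using iX by auto
  let ?A = "{\<omega>\<in>space M. K < \<bar>X \<omega>\<bar>}"
  have A: "?A \<in> sets M" by measurable
  have WA: "integrable M (\<lambda>\<omega>. \<bar>W \<omega>\<bar> * indicator ?A \<omega>)"
   using W A by (intro integrable_real_mult_indicator) auto
  have eq: "(LINT \<omega>|M. \<bar>W \<omega>\<bar> * of_bool (K < \<bar>X \<omega>\<bar>)) = (LINT \<omega>|M. \<bar>W \<omega>\<bar> * indicator ?A \<omega>)"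
   by (intro LINT_cong) (auto simp: indicator_def)
  have "K * prob ?A = (LINT \<omega>|M. K * indicator ?A \<omega>)" using A by simp
  also have "\<dots> \<le> (LINT \<omega>|M. \<bar>X \<omega>\<bar> * of_bool (K < \<bar>X \<omega>\<bar>))"
  proof (rule integral_mono)
   show "integrable M (\<lambda>\<omega>. K * indicator ?A \<omega>)"
    using A by (intro integrable_mult_right integrable_real_indicator) (auto simp: emeasure_eq_measure)
  qed (auto intro!: integrable_tail iX simp: indicator_def)
  also have "\<dots> \<le> (LINT \<omega>|M. \<bar>W \<omega>\<bar> * indicator ?A \<omega>)"
   using dom[OF X, of K] K eq by simp
  also have "\<dots> \<le> c"
   unfolding c_def using W WA by (intro integral_mono) (auto simp: indicator_def)
  finally have "K * prob ?A \<le> c" .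
  with K have "K * prob ?A < K * \<delta>" by linarith
  then have "prob ?A < \<delta>" using K by simp
  then show ?thesis using \<delta>[OF A] dom[OF X, of K] K eq by simp
 qed
 then show "\<exists>K. \<forall>X\<in>S. (LINT \<omega>|M. \<bar>X \<omega>\<bar> * of_bool (K < \<bar>X \<omega>\<bar>)) \<le> \<epsilon>" by blast
qed (use S in auto)

lemma uniformly_integrable_bounded:
 assumes UI: "uniformly_integrable M S"
 obtains C where "\<And>X. X \<in> S \<Longrightarrow> (LINT \<omega>|M. \<bar>X \<omega>\<bar>) \<le> C"
proof -
 obtain K where K: "\<And>X. X \<in> S \<Longrightarrow> (LINT \<omega>|M. \<bar>X \<omega>\<bar> * of_bool (K < \<bar>X \<omega>\<bar>)) \<le> 1"
  using UI unfolding uniformly_integrable_def by (metis zero_less_one)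
 have "(LINT \<omega>|M. \<bar>X \<omega>\<bar>) \<le> \<bar>K\<bar> + 1" if X: "X \<in> S" for X
 proof -
  have iX: "integrable M X" using UI X by (auto simp: uniformly_integrable_def)
  have "(LINT \<omega>|M. \<bar>X \<omega>\<bar>) \<le> (LINT \<omega>|M. \<bar>K\<bar> + \<bar>X \<omega>\<bar> * of_bool (K < \<bar>X \<omega>\<bar>))"
   using iX by (intro integral_mono LINT_integrable_add integrable_tail) auto
  also have "\<dots> = \<bar>K\<bar> + (LINT \<omega>|M. \<bar>X \<omega>\<bar> * of_bool (K < \<bar>X \<omega>\<bar>))"
   using iX by (subst LINT_add) (auto intro!: integrable_tail simp: prob_space)
  finally show ?thesis using K[OF X] by simp
 qed
 then show thesis using that by blast
qed

text \<open>Almost sure convergence implies convergence in probability; where \<open>X k\<close> is far from \<open>Y\<close>, both have small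
 integrals because that set is small.\<close>

theorem Vitali_convergence:
 assumes UI: "uniformly_integrable M S" and X: "\<And>k::nat. X k \<in> S"
  and lim: "AE \<omega> in M. (\<lambda>k. X k \<omega>) \<longlonglongrightarrow> Y \<omega>"
  and [measurable]: "Y \<in> borel_measurable M"
 shows "integrable M Y" and "(\<lambda>k. LINT \<omega>|M. \<bar>X k \<omega> - Y \<omega>\<bar>) \<longlonglongrightarrow> 0"
proof -
 have iX: "integrable M (X k)" for k using UI X by (auto simp: uniformly_integrable_def)
 then have [measurable]: "X k \<in> borel_measurable M" for k by auto
 obtain C where C: "\<And>k. (LINT \<omega>|M. \<bar>X k \<omega>\<bar>) \<le> C" using uniformly_integrable_bounded[OF UI] X by metis
 show iY: "integrable M Y"
 proof (rule integrableI_bounded)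
  have "(\<integral>\<^sup>+\<omega>. ennreal (norm (Y \<omega>)) \<partial>M) \<le> (\<integral>\<^sup>+\<omega>. liminf (\<lambda>k. ennreal \<bar>X k \<omega>\<bar>) \<partial>M)"
  proof (rule nn_integral_mono_AE)
   show "AE \<omega> in M. ennreal (norm (Y \<omega>)) \<le> liminf (\<lambda>k. ennreal \<bar>X k \<omega>\<bar>)"
    using lim
   proof eventually_elim
    case (elim \<omega>)
    then have "(\<lambda>k. ennreal \<bar>X k \<omega>\<bar>) \<longlonglongrightarrow> ennreal \<bar>Y \<omega>\<bar>"
     by (rule tendsto_ennrealI[OF tendsto_rabs])
    from lim_imp_Liminf[OF sequentially_bot this] show ?case by simp
   qed
  qed
  also have "\<dots> \<le> liminf (\<lambda>k. \<integral>\<^sup>+\<omega>. ennreal \<bar>X k \<omega>\<bar> \<partial>M)"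
   by (intro nn_integral_liminf) auto
  also have "\<dots> \<le> ennreal C"
  proof (rule Liminf_le, simp, rule always_eventually, rule allI)
   fix k
   have "(\<integral>\<^sup>+\<omega>. ennreal \<bar>X k \<omega>\<bar> \<partial>M) = ennreal (LINT \<omega>|M. \<bar>X k \<omega>\<bar>)"
    using iX by (intro nn_integral_eq_integral) auto
   then show "(\<integral>\<^sup>+\<omega>. ennreal \<bar>X k \<omega>\<bar> \<partial>M) \<le> ennreal C" using C by (simp add: ennreal_leI)
  qed
  finally show "(\<integral>\<^sup>+\<omega>. ennreal (norm (Y \<omega>)) \<partial>M) < \<infinity>"
   using le_less_trans by fastforce
 qed simp
 show "(\<lambda>k. LINT \<omega>|M. \<bar>X k \<omega> - Y \<omega>\<bar>) \<longlonglongrightarrow> 0"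
 proof (rule LIMSEQ_I)
  fix r :: real assume "0 < r"
  define \<epsilon> where "\<epsilon> = r / 4"
  have e: "0 < \<epsilon>" using \<open>0 < r\<close> by (simp add: \<epsilon>_def)
  obtain d1 where d1: "0 < d1"
   "\<And>Z A. Z \<in> S \<Longrightarrow> A \<in> sets M \<Longrightarrow> prob A < d1 \<Longrightarrow> (LINT \<omega>|M. \<bar>Z \<omega>\<bar> * indicator A \<omega>) \<le> \<epsilon>"
   using uniformly_integrable_small_sets[OF UI e] by blast
  obtain d2 where d2: "0 < d2"
   "\<And>A. A \<in> sets M \<Longrightarrow> prob A < d2 \<Longrightarrow> (LINT \<omega>|M. \<bar>Y \<omega>\<bar> * indicator A \<omega>) \<le> \<epsilon>"
   using integrable_small_sets[OF iY e] by blast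
  define A where "A k = {\<omega>\<in>space M. \<epsilon> < \<bar>X k \<omega> - Y \<omega>\<bar>}" for k
  have A[measurable]: "A k \<in> sets M" for k unfolding A_def by measurable
  have "(\<lambda>k. LINT \<omega>|M. indicator (A k) \<omega>) \<longlonglongrightarrow> (LINT \<omega>|M. (0::real))"
  proof (rule integral_dominated_convergence[where w="\<lambda>_. 1"])
   show "AE \<omega> in M. (\<lambda>k. indicat_real (A k) \<omega>) \<longlonglongrightarrow> 0"
    using lim
   proof eventually_elim
    case (elim \<omega>)
    then have "(\<lambda>k. \<bar>X k \<omega> - Y \<omega>\<bar>) \<longlonglongrightarrow> 0"
     by (simp add: LIM_zero_iff tendsto_rabs_zero_iff)
    then have "\<forall>\<^sub>F k in sequentially. \<bar>X k \<omega> - Y \<omega>\<bar> < \<epsilon>" using e by (rule order_tendstoD)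
    then show ?case
     by (intro tendsto_eventually) (auto elim!: eventually_mono simp: A_def indicator_def)
   qed
  qed auto
  then have "(\<lambda>k. prob (A k)) \<longlonglongrightarrow> 0" by simp
  then have "\<forall>\<^sub>F k in sequentially. prob (A k) < min d1 d2"
   using d1 d2 by (intro order_tendstoD) auto
  then obtain N where N: "\<And>k. k \<ge> N \<Longrightarrow> prob (A k) < min d1 d2" by (auto simp: eventually_sequentially)
  have "norm ((LINT \<omega>|M. \<bar>X k \<omega> - Y \<omega>\<bar>) - 0) < r" if "k \<ge> N" for k
  proof -
   have i1: "integrable M (\<lambda>\<omega>. \<bar>X k \<omega>\<bar> * indicator (A k) \<omega>)" "integrable M (\<lambda>\<omega>. \<bar>Y \<omega>\<bar> * indicator (A k) \<omega>)"
    using iX iY by (auto intro!: integrable_real_mult_indicator)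
   have "(LINT \<omega>|M. \<bar>X k \<omega> - Y \<omega>\<bar>) \<le> (LINT \<omega>|M. \<epsilon> + (\<bar>X k \<omega>\<bar> * indicator (A k) \<omega> + \<bar>Y \<omega>\<bar> * indicator (A k) \<omega>))"
    using iX iY i1 e by (intro integral_mono) (auto simp: A_def indicator_def)
   also have "\<dots> = \<epsilon> + ((LINT \<omega>|M. \<bar>X k \<omega>\<bar> * indicator (A k) \<omega>) + (LINT \<omega>|M. \<bar>Y \<omega>\<bar> * indicator (A k) \<omega>))"
    using i1 by (simp add: prob_space)
   also have "\<dots> \<le> \<epsilon> + (\<epsilon> + \<epsilon>)"
    using d1(2)[OF X[of k] A[of k]] d2(2)[OF A[of k]] N[OF that] by (intro add_mono) auto
   also have "\<dots> < r" using \<open>0 < r\<close> by (simp add: \<epsilon>_def)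
   finally show ?thesis by simp
  qed
  then show "\<exists>N. \<forall>k\<ge>N. norm ((LINT \<omega>|M. \<bar>X k \<omega> - Y \<omega>\<bar>) - 0) < r" by blast
 qed
qed

lemma Vitali_convergence_set:
 assumes UI: "uniformly_integrable M S" and X: "\<And>k::nat. X k \<in> S"
  and lim: "AE \<omega> in M. (\<lambda>k. X k \<omega>) \<longlonglongrightarrow> Y \<omega>"
  and [measurable]: "Y \<in> borel_measurable M" and A[measurable]: "A \<in> sets M"
 shows "(\<lambda>k. LINT \<omega>|M. X k \<omega> * indicator A \<omega>) \<longlonglongrightarrow> (LINT \<omega>|M. Y \<omega> * indicator A \<omega>)"
proof -
 note V = Vitali_convergence[OF UI X lim]
 have iX: "integrable M (X k)" for k using UI X by (auto simp: uniformly_integrable_def)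
 have iY: "integrable M Y" using V(1) by simp
 have "(\<lambda>k. (LINT \<omega>|M. X k \<omega> * indicator A \<omega>) - (LINT \<omega>|M. Y \<omega> * indicator A \<omega>)) \<longlonglongrightarrow> 0"
 proof (rule Lim_null_comparison[OF always_eventually])
  show "(\<lambda>k. LINT \<omega>|M. \<bar>X k \<omega> - Y \<omega>\<bar>) \<longlonglongrightarrow> 0" using V(2) by simp
  show "\<forall>k. norm ((LINT \<omega>|M. X k \<omega> * indicator A \<omega>) - (LINT \<omega>|M. Y \<omega> * indicator A \<omega>)) \<le> (LINT \<omega>|M. \<bar>X k \<omega> - Y \<omega>\<bar>)"
  proof
   fix k
   have "(LINT \<omega>|M. X k \<omega> * indicator A \<omega>) - (LINT \<omega>|M. Y \<omega> * indicator A \<omega>)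
    = (LINT \<omega>|M. (X k \<omega> - Y \<omega>) * indicator A \<omega>)"
    using iX iY by (subst LINT_diff[symmetric])
     (auto intro!: integrable_real_mult_indicator simp: left_diff_distrib)
   also have "norm \<dots> \<le> (LINT \<omega>|M. norm ((X k \<omega> - Y \<omega>) * indicator A \<omega>))"
    by (rule integral_norm_bound)
   also have "\<dots> \<le> (LINT \<omega>|M. \<bar>X k \<omega> - Y \<omega>\<bar>)"
   proof (rule integral_mono)
    show "integrable M (\<lambda>\<omega>. norm ((X k \<omega> - Y \<omega>) * indicator A \<omega>))"
     using iX iY by (intro integrable_norm integrable_real_mult_indicator) auto
   qed (use iX iY in \<open>auto simp: indicator_def\<close>)
   finally show "norm ((LINT \<omega>|M. X k \<omega> * indicator A \<omega>) - (LINT \<omega>|M. Y \<omega> * indicator A \<omega>)) \<le> (LINT \<omega>|M. \<bar>X k \<omega> - Y \<omega>\<bar>)" .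
  qed
 qed
 then show ?thesis by (simp add: LIM_zero_iff)
qed

end

section \<open>Stopping times under the usual conditions\<close>

context usual_filtered_prob_space
begin

abbreviation "ST \<equiv> stopping_times M F T"

lemma T_nonneg: "0 \<le> T" using horizon_pos by simp

lemma sets_F_subset: "t \<in> {0..T} \<Longrightarrow> sets (F t) \<subseteq> sets M"
 using subalgebra_F by (auto simp: subalgebra_def)

lemma sets_F_le: "s \<le> t \<Longrightarrow> A \<in> sets (F s) \<Longrightarrow> A \<in> sets (F t)"
 using sets_F_mono by blast

lemma measurable_F_le: "s \<le> t \<Longrightarrow> X \<in> F s \<rightarrow>\<^sub>M N \<Longrightarrow> X \<in> F t \<rightarrow>\<^sub>M N"
 using sets_F_mono[of s t] by (auto simp: measurable_def space_F)

lemma measurable_F_M: "t \<in> {0..T} \<Longrightarrow> X \<in> F t \<rightarrow>\<^sub>M N \<Longrightarrow> X \<in> M \<rightarrow>\<^sub>M N"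
 using sets_F_subset[of t] by (auto simp: measurable_def space_F)

lemma null_sets_in_F: "N \<in> null_sets M \<Longrightarrow> 0 \<le> t \<Longrightarrow> N \<in> sets (F t)"
 using null_sets_F sets_F_mono[of 0 t] by auto

text \<open>All null sets belong to \<open>F 0\<close>, so modifications on null sets preserve adaptedness.\<close>

lemma F_measurable_AE_cong:
 fixes X Y :: "'a \<Rightarrow> real"
 assumes X: "X \<in> borel_measurable (F t)" and eq: "AE \<omega> in M. X \<omega> = Y \<omega>" and t: "t \<in> {0..T}"
 shows "Y \<in> borel_measurable (F t)"
proof (rule measurableI)
 obtain N where N: "N \<in> null_sets M" "{\<omega>\<in>space M. X \<omega> \<noteq> Y \<omega>} \<subseteq> N"
  using AE_E[OF eq] by (metis (mono_tags, lifting) null_setsI)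
 fix B :: "real set" assume B: "B \<in> sets borel"
 have "Y -` B \<inter> space (F t) = ((X -` B \<inter> space (F t)) - N) \<union> (Y -` B \<inter> N \<inter> space M)"
  using N(2) by (auto simp: space_F)
 moreover have "X -` B \<inter> space (F t) \<in> sets (F t)" using X B by (rule measurable_sets)
 moreover have "N \<in> sets (F t)" using N(1) t by (intro null_sets_in_F) auto
 moreover have "Y -` B \<inter> N \<inter> space M \<in> null_sets M"
  using complete2[of "Y -` B \<inter> N \<inter> space M" N] N(1) by auto
 then have "Y -` B \<inter> N \<inter> space M \<in> sets (F t)" using t by (intro null_sets_in_F) auto
 ultimately show "Y -` B \<inter> space (F t) \<in> sets (F t)" by auto
qed auto

lemma STD_range: "\<tau> \<in> ST \<Longrightarrow> \<omega> \<in> space M \<Longrightarrow> 0 \<le> \<tau> \<omega> \<and> \<tau> \<omega> \<le> T"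
 by (auto simp: stopping_times_def)

lemma STD_stop: "\<tau> \<in> ST \<Longrightarrow> stopping_time F \<tau>"
 by (auto simp: stopping_times_def)

lemma STI:
 assumes "\<And>t. t \<in> {0..<T} \<Longrightarrow> {\<omega>\<in>space M. \<tau> \<omega> \<le> t} \<in> sets (F t)"
  and r: "\<And>\<omega>. \<omega> \<in> space M \<Longrightarrow> 0 \<le> \<tau> \<omega> \<and> \<tau> \<omega> \<le> T"
 shows "\<tau> \<in> ST"
 unfolding stopping_times_def
proof (intro CollectI conjI ballI stopping_timeI)
 fix t
 consider "t < 0" | "t \<in> {0..<T}" | "T \<le> t" by fastforce
 then have "{\<omega>\<in>space (F t). \<tau> \<omega> \<le> t} \<in> sets (F t)"
 proof cases
  case 1 then have "{\<omega>\<in>space (F t). \<tau> \<omega> \<le> t} = {}" using r by (force simp: space_F)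
  then show ?thesis by (metis sets.empty_sets)
 next
  case 2 then show ?thesis using assms(1)[OF 2] by (simp add: space_F)
 next
  case 3 then have "{\<omega>\<in>space (F t). \<tau> \<omega> \<le> t} = space (F t)" using r by (force simp: space_F)
  then show ?thesis by (metis sets.top)
 qed
 then show "Measurable.pred (F t) (\<lambda>\<omega>. \<tau> \<omega> \<le> t)" by (simp add: pred_def)
qed (use r in auto)

lemma STD_le: "\<tau> \<in> ST \<Longrightarrow> {\<omega>\<in>space M. \<tau> \<omega> \<le> t} \<in> sets (F t)"
 using stopping_timeD[OF STD_stop, of \<tau> t] by (simp add: pred_def space_F)

lemma STD_less: "\<tau> \<in> ST \<Longrightarrow> {\<omega>\<in>space M. \<tau> \<omega> < t} \<in> sets (F t)"
 using stopping_time_less_const[OF STD_stop, of \<tau> t] by (simp add: pred_def space_F)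

text \<open>By right-continuity of the filtration, optional times are stopping times.\<close>

lemma STI_less:
 assumes less: "\<And>t. t \<in> {0<..T} \<Longrightarrow> {\<omega>\<in>space M. \<tau> \<omega> < t} \<in> sets (F t)"
  and r: "\<And>\<omega>. \<omega> \<in> space M \<Longrightarrow> 0 \<le> \<tau> \<omega> \<and> \<tau> \<omega> \<le> T"
 shows "\<tau> \<in> ST"
proof (rule STI[OF _ r])
 fix t assume t: "t \<in> {0..<T}"
 have "{\<omega>\<in>space M. \<tau> \<omega> \<le> t} \<in> sets (F s)" if s: "s \<in> {t<..T}" for s
 proof -
  let ?u = "\<lambda>m::nat. t + (s - t) / (m + 1)"
  have u: "t < ?u m" "?u m \<le> s" for m
  proof -
   show "t < ?u m" using s by simp
   have "(s - t) / (m + 1) \<le> (s - t) / 1" using s by (intro divide_left_mono) auto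
   then show "?u m \<le> s" by (simp add: add.commute)
  qed
  have "{\<omega>\<in>space M. \<tau> \<omega> \<le> t} = (\<Inter>m. {\<omega>\<in>space M. \<tau> \<omega> < ?u m})"
  proof (intro equalityI subsetI)
   fix \<omega> assume "\<omega> \<in> (\<Inter>m. {\<omega>\<in>space M. \<tau> \<omega> < ?u m})"
   then have w: "\<omega> \<in> space M" "\<And>m. \<tau> \<omega> \<le> ?u m" by (auto intro: less_imp_le)
   have "(\<lambda>m. t + (s - t) * inverse (real (Suc m))) \<longlonglongrightarrow> t + (s - t) * 0"
    by (intro tendsto_intros LIMSEQ_inverse_real_of_nat)
   then have "(\<lambda>m. ?u m) \<longlonglongrightarrow> t" by (simp add: divide_inverse add.commute)
   then have "\<tau> \<omega> \<le> t" by (rule LIMSEQ_le_const) (use w in auto)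
   with w show "\<omega> \<in> {\<omega>\<in>space M. \<tau> \<omega> \<le> t}" by simp
  qed (use u in \<open>auto intro: le_less_trans\<close>)
  moreover have "{\<omega>\<in>space M. \<tau> \<omega> < ?u m} \<in> sets (F s)" for m
   using u[of m] s t by (intro sets_F_le[OF _ less]) auto
  ultimately show ?thesis by auto
 qed
 then show "{\<omega>\<in>space M. \<tau> \<omega> \<le> t} \<in> sets (F t)" using right_continuous_F[OF t] by auto
qed

lemma ST_borel: "\<tau> \<in> ST \<Longrightarrow> \<tau> \<in> borel_measurable M"
proof (rule borel_measurableI_le)
 fix t assume \<tau>: "\<tau> \<in> ST"
 show "{\<omega>\<in>space M. \<tau> \<omega> \<le> t} \<in> sets M"
 proof (cases "t \<in> {0..T}")
  case True then show ?thesis using STD_le[OF \<tau>, of t] sets_F_subset by auto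
 next
  case False
  then have "{\<omega>\<in>space M. \<tau> \<omega> \<le> t} = {} \<or> {\<omega>\<in>space M. \<tau> \<omega> \<le> t} = space M"
   using STD_range[OF \<tau>] by force
  then show ?thesis by (metis sets.empty_sets sets.top)
 qed
qed

lemma ST_const: "c \<in> {0..T} \<Longrightarrow> (\<lambda>_. c) \<in> ST"
 by (auto simp: stopping_times_def stopping_time_const)

lemma ST_min: "\<sigma> \<in> ST \<Longrightarrow> \<tau> \<in> ST \<Longrightarrow> (\<lambda>\<omega>. min (\<sigma> \<omega>) (\<tau> \<omega>)) \<in> ST"
 using stopping_time_min[of F \<sigma> \<tau>] STD_range[of \<sigma>] STD_range[of \<tau>]
 unfolding stopping_times_def by (fastforce simp: min_le_iff_disj le_max_iff_disj)

lemma ST_max: "\<sigma> \<in> ST \<Longrightarrow> \<tau> \<in> ST \<Longrightarrow> (\<lambda>\<omega>. max (\<sigma> \<omega>) (\<tau> \<omega>)) \<in> ST"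
 using stopping_time_max[of F \<sigma> \<tau>] STD_range[of \<sigma>] STD_range[of \<tau>]
 unfolding stopping_times_def by (fastforce simp: min_le_iff_disj le_max_iff_disj)

lemma ST_bdd:
 assumes "\<And>k. \<rho> k \<in> ST" "\<omega> \<in> space M"
 shows "bdd_above (range (\<lambda>k::nat. \<rho> k \<omega>))" "bdd_below (range (\<lambda>k::nat. \<rho> k \<omega>))"
 using STD_range[OF assms(1) assms(2)] by (auto intro!: bdd_aboveI[of _ T] bdd_belowI[of _ 0])

lemma ST_SUP:
 assumes \<rho>: "\<And>k::nat. \<rho> k \<in> ST"
 shows "(\<lambda>\<omega>. SUP k. \<rho> k \<omega>) \<in> ST"
proof (rule STI)
 fix t assume "t \<in> {0..<T}"
 have "{\<omega>\<in>space M. (SUP k. \<rho> k \<omega>) \<le> t} = (\<Inter>k. {\<omega>\<in>space M. \<rho> k \<omega> \<le> t})"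
  using ST_bdd[OF \<rho>] by (auto simp: cSUP_le_iff)
 then show "{\<omega>\<in>space M. (SUP k. \<rho> k \<omega>) \<le> t} \<in> sets (F t)" using STD_le[OF \<rho>] by auto
next
 fix \<omega> assume w: "\<omega> \<in> space M"
 have "\<rho> 0 \<omega> \<le> (SUP k. \<rho> k \<omega>)" using ST_bdd[OF \<rho> w] by (intro cSUP_upper) auto
 moreover have "(SUP k. \<rho> k \<omega>) \<le> T" using STD_range[OF \<rho> w] by (intro cSUP_least) auto
 ultimately show "0 \<le> (SUP k. \<rho> k \<omega>) \<and> (SUP k. \<rho> k \<omega>) \<le> T" using STD_range[OF \<rho> w, of 0] by auto
qed

lemma ST_INF:
 assumes \<rho>: "\<And>k::nat. \<rho> k \<in> ST"
 shows "(\<lambda>\<omega>. INF k. \<rho> k \<omega>) \<in> ST"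
proof (rule STI_less)
 fix t assume "t \<in> {0<..T}"
 have "{\<omega>\<in>space M. (INF k. \<rho> k \<omega>) < t} = (\<Union>k. {\<omega>\<in>space M. \<rho> k \<omega> < t})"
  using ST_bdd[OF \<rho>] by (auto simp: cINF_less_iff)
 then show "{\<omega>\<in>space M. (INF k. \<rho> k \<omega>) < t} \<in> sets (F t)" using STD_less[OF \<rho>] by auto
next
 fix \<omega> assume w: "\<omega> \<in> space M"
 have "(INF k. \<rho> k \<omega>) \<le> \<rho> 0 \<omega>" using ST_bdd[OF \<rho> w] by (intro cINF_lower) auto
 moreover have "0 \<le> (INF k. \<rho> k \<omega>)" using STD_range[OF \<rho> w] by (intro cINF_greatest) auto
 ultimately show "0 \<le> (INF k. \<rho> k \<omega>) \<and> (INF k. \<rho> k \<omega>) \<le> T" using STD_range[OF \<rho> w, of 0] by auto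
qed

lemma ST_integrable: "\<tau> \<in> ST \<Longrightarrow> integrable M \<tau>"
 using STD_range[of \<tau>] ST_borel[of \<tau>]
 by (intro integrable_const_bound[where B=T]) auto

section \<open>Existence of a smallest optimal stopping time\<close>

text \<open>Call a stopping time good if no later one does better. By modularity of \<open>H\<close> the good times are closed
 under minima, and by semicontinuity along decreasing sequences under decreasing limits; so there is
 a smallest good time \<open>r\<close>. Semicontinuity along increasing sequences shows that every stopping time is
 dominated, with respect to \<open>H\<close>, by a good one. Hence \<open>r\<close> maximises \<open>H\<close>, and since maximisers are good,
 \<open>r\<close> is the smallest of them.\<close>

theorem smallest_maximizer_exists:
 fixes H :: "('a \<Rightarrow> real) \<Rightarrow> real"
 assumes cong: "\<And>\<sigma> \<tau>. \<sigma> \<in> ST \<Longrightarrow> \<tau> \<in> ST \<Longrightarrow> AE \<omega> in M. \<sigma> \<omega> = \<tau> \<omega> \<Longrightarrow> H \<sigma> = H \<tau>"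
  and modular: "\<And>\<sigma> \<tau>. \<sigma> \<in> ST \<Longrightarrow> \<tau> \<in> ST \<Longrightarrow>
   H (\<lambda>\<omega>. min (\<sigma> \<omega>) (\<tau> \<omega>)) + H (\<lambda>\<omega>. max (\<sigma> \<omega>) (\<tau> \<omega>)) = H \<sigma> + H \<tau>"
  and usc_dec: "\<And>\<rho> \<epsilon>. (\<And>k::nat. \<rho> k \<in> ST) \<Longrightarrow> (\<And>\<omega>. \<omega> \<in> space M \<Longrightarrow> decseq (\<lambda>k. \<rho> k \<omega>)) \<Longrightarrow> 0 < \<epsilon> \<Longrightarrow>
   \<forall>\<^sub>F k in sequentially. H (\<rho> k) \<le> H (\<lambda>\<omega>. INF k. \<rho> k \<omega>) + \<epsilon>"
  and usc_inc: "\<And>\<rho> \<epsilon>. (\<And>k::nat. \<rho> k \<in> ST) \<Longrightarrow> (\<And>\<omega>. \<omega> \<in> space M \<Longrightarrow> incseq (\<lambda>k. \<rho> k \<omega>)) \<Longrightarrow> 0 < \<epsilon> \<Longrightarrow>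
   \<forall>\<^sub>F k in sequentially. H (\<rho> k) \<le> H (\<lambda>\<omega>. SUP k. \<rho> k \<omega>) + \<epsilon>"
 obtains \<tau> where "\<tau> \<in> ST" "\<And>\<sigma>. \<sigma> \<in> ST \<Longrightarrow> H \<sigma> \<le> H \<tau>"
  "\<And>\<sigma>. \<sigma> \<in> ST \<Longrightarrow> H \<sigma> = H \<tau> \<Longrightarrow> AE \<omega> in M. \<tau> \<omega> \<le> \<sigma> \<omega>"
proof -
 have le_eps: "a \<le> b" if "\<And>\<epsilon>::real. 0 < \<epsilon> \<Longrightarrow> a \<le> b + \<epsilon>" for a b
  using that field_le_epsilon by blast
 have le_lim: "a \<le> b" if "\<And>k::nat. a \<le> b + inverse (real (Suc k))" for a b :: real
 proof -
  have "(\<lambda>k. b + inverse (real (Suc k))) \<longlonglongrightarrow> b + 0" by (intro tendsto_intros LIMSEQ_inverse_real_of_nat)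
  then show ?thesis using that by (intro LIMSEQ_le_const[of "\<lambda>k. b + inverse (real (Suc k))" b a]) auto
 qed
 let ?E = "\<lambda>\<tau>. LINT \<omega>|M. \<tau> \<omega>"
 have E_mono: "?E \<sigma> \<le> ?E \<tau>" if "\<sigma> \<in> ST" "\<tau> \<in> ST" "\<And>\<omega>. \<omega> \<in> space M \<Longrightarrow> \<sigma> \<omega> \<le> \<tau> \<omega>" for \<sigma> \<tau>
  using that by (intro integral_mono ST_integrable) auto
 have E_nonneg: "0 \<le> ?E \<tau>" if "\<tau> \<in> ST" for \<tau>
  using STD_range[OF that] by (intro integral_nonneg_AE AE_I2) auto
 have E_le: "?E \<tau> \<le> T" if "\<tau> \<in> ST" for \<tau>
  using E_mono[OF that ST_const[of T]] STD_range[OF that] T_nonneg by (simp add: prob_space)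
 \<comment> \<open>Ordered stopping times with equal expectations agree; the expectation thus serves as a real-valued
  measure of lateness in the exhaustion arguments below.\<close>
 have E_eq: "AE \<omega> in M. \<sigma> \<omega> = \<tau> \<omega>"
  if st: "\<sigma> \<in> ST" "\<tau> \<in> ST" "\<And>\<omega>. \<omega> \<in> space M \<Longrightarrow> \<sigma> \<omega> \<le> \<tau> \<omega>" "?E \<tau> \<le> ?E \<sigma>" for \<sigma> \<tau>
 proof -
  have i: "integrable M \<sigma>" "integrable M \<tau>" using st by (auto intro: ST_integrable)
  have "(LINT \<omega>|M. \<tau> \<omega> - \<sigma> \<omega>) \<le> 0" using i st by simp
  moreover have "0 \<le> (LINT \<omega>|M. \<tau> \<omega> - \<sigma> \<omega>)" using st by (intro integral_nonneg_AE AE_I2) auto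
  ultimately have "(LINT \<omega>|M. \<tau> \<omega> - \<sigma> \<omega>) = 0" by simp
  then have "AE \<omega> in M. \<tau> \<omega> - \<sigma> \<omega> = 0"
   using i st by (subst (asm) integral_nonneg_eq_0_iff_AE) auto
  then show ?thesis by eventually_elim simp
 qed
 define U where "U = {\<rho>\<in>ST. \<forall>\<theta>\<in>ST. (\<forall>\<omega>\<in>space M. \<rho> \<omega> \<le> \<theta> \<omega>) \<longrightarrow> H \<theta> \<le> H \<rho>}"
 have U_ST: "\<rho> \<in> U \<Longrightarrow> \<rho> \<in> ST" for \<rho> by (simp add: U_def)
 have U_le: "H \<theta> \<le> H (\<lambda>\<omega>. min (\<theta> \<omega>) (\<rho> \<omega>))" if "\<rho> \<in> U" "\<theta> \<in> ST" for \<rho> \<theta>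
 proof -
  have "H (\<lambda>\<omega>. max (\<theta> \<omega>) (\<rho> \<omega>)) \<le> H \<rho>"
   using that ST_max[of \<theta> \<rho>] unfolding U_def by force
  then show ?thesis using modular[OF that(2) U_ST[OF that(1)]] by simp
 qed
 have U_min: "(\<lambda>\<omega>. min (\<rho>1 \<omega>) (\<rho>2 \<omega>)) \<in> U" if \<rho>: "\<rho>1 \<in> U" "\<rho>2 \<in> U" for \<rho>1 \<rho>2
  unfolding U_def
 proof (intro CollectI conjI ballI impI)
  show "(\<lambda>\<omega>. min (\<rho>1 \<omega>) (\<rho>2 \<omega>)) \<in> ST" using \<rho> by (intro ST_min U_ST)
  fix \<theta> assume \<theta>: "\<theta> \<in> ST" "\<forall>\<omega>\<in>space M. min (\<rho>1 \<omega>) (\<rho>2 \<omega>) \<le> \<theta> \<omega>"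
  have m: "(\<lambda>\<omega>. min (\<theta> \<omega>) (\<rho>1 \<omega>)) \<in> ST" using \<theta>(1) U_ST[OF \<rho>(1)] by (rule ST_min)
  have "H \<theta> \<le> H (\<lambda>\<omega>. min (\<theta> \<omega>) (\<rho>1 \<omega>))" by (rule U_le) fact+
  also have "\<dots> \<le> H (\<lambda>\<omega>. min (min (\<theta> \<omega>) (\<rho>1 \<omega>)) (\<rho>2 \<omega>))" by (rule U_le) fact+
  also have "\<dots> = H (\<lambda>\<omega>. min (\<rho>1 \<omega>) (\<rho>2 \<omega>))"
   by (rule cong[OF ST_min[OF m U_ST[OF \<rho>(2)]] ST_min[OF U_ST[OF \<rho>(1)] U_ST[OF \<rho>(2)]] AE_I2])
    (use \<theta>(2) in \<open>force simp: min_def split: if_splits\<close>)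
  finally show "H \<theta> \<le> H (\<lambda>\<omega>. min (\<rho>1 \<omega>) (\<rho>2 \<omega>))" .
 qed
 have TU: "(\<lambda>_. T) \<in> U"
  unfolding U_def
 proof (intro CollectI conjI ballI impI)
  show T: "(\<lambda>_. T) \<in> ST" using T_nonneg by (intro ST_const) auto
  fix \<theta> assume \<theta>: "\<theta> \<in> ST" "\<forall>\<omega>\<in>space M. T \<le> \<theta> \<omega>"
  have "H \<theta> = H (\<lambda>_. T)" using \<theta> STD_range[OF \<theta>(1)] by (intro cong \<theta> T AE_I2) force
  then show "H \<theta> \<le> H (\<lambda>_. T)" by simp
 qed
 define e where "e = (INF \<rho>\<in>U. ?E \<rho>)"
 have e_bdd: "bdd_below (?E ` U)" using E_nonneg U_ST by (intro bdd_belowI[of _ 0]) auto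
 have e_le: "e \<le> ?E \<rho>" if "\<rho> \<in> U" for \<rho> unfolding e_def using e_bdd that by (rule cINF_lower)
 have "\<exists>\<rho>\<in>U. ?E \<rho> < e + inverse (real (Suc k))" for k
  using cINF_less_iff[OF _ e_bdd, of "e + inverse (real (Suc k))"] TU by (auto simp: e_def)
 then obtain u where u: "\<And>k. u k \<in> U" "\<And>k. ?E (u k) < e + inverse (real (Suc k))" by metis
 \<comment> \<open>The running minima of a sequence in \<open>U\<close> whose expectations tend to the infimum.\<close>
 define v where "v = rec_nat (u 0) (\<lambda>k w. (\<lambda>\<omega>. min (w \<omega>) (u (Suc k) \<omega>)))"
 have v0: "v 0 = u 0" and vS: "v (Suc k) = (\<lambda>\<omega>. min (v k \<omega>) (u (Suc k) \<omega>))" for k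
  by (simp_all add: v_def)
 have vU: "v k \<in> U" for k by (induction k) (auto simp: v0 vS u intro: U_min)
 have vu: "v k \<omega> \<le> u k \<omega>" for k \<omega> by (cases k) (auto simp: v0 vS)
 have vdec: "decseq (\<lambda>k. v k \<omega>)" for \<omega> by (intro decseq_SucI) (simp add: vS)
 define r where "r = (\<lambda>\<omega>. INF k. v k \<omega>)"
 have rST: "r \<in> ST" unfolding r_def using vU by (intro ST_INF U_ST)
 have rv: "r \<omega> \<le> v k \<omega>" if "\<omega> \<in> space M" for k \<omega>
  unfolding r_def using ST_bdd(2)[OF U_ST[OF vU] that] by (intro cINF_lower) auto
 have rU: "r \<in> U"
  unfolding U_def
 proof (intro CollectI conjI ballI impI rST)
  fix \<theta> assume \<theta>: "\<theta> \<in> ST" "\<forall>\<omega>\<in>space M. r \<omega> \<le> \<theta> \<omega>"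
  let ?w = "\<lambda>k \<omega>. min (\<theta> \<omega>) (v k \<omega>)"
  have w: "?w k \<in> ST" for k using \<theta>(1) U_ST[OF vU] by (rule ST_min)
  have INFw: "(INF k. ?w k \<omega>) = r \<omega>" if o: "\<omega> \<in> space M" for \<omega>
  proof -
   have "(\<lambda>k. v k \<omega>) \<longlonglongrightarrow> r \<omega>"
    unfolding r_def using ST_bdd(2)[OF U_ST[OF vU] o] vdec by (intro LIMSEQ_decseq_INF)
   then have l1: "(\<lambda>k. ?w k \<omega>) \<longlonglongrightarrow> min (\<theta> \<omega>) (r \<omega>)" by (intro tendsto_min tendsto_const)
   have l2: "(\<lambda>k. ?w k \<omega>) \<longlonglongrightarrow> (INF k. ?w k \<omega>)"
    using ST_bdd(2)[OF w o] vdec[of \<omega>] by (intro LIMSEQ_decseq_INF) (auto simp: decseq_def min_le_iff_disj)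
   show ?thesis using LIMSEQ_unique[OF l2 l1] \<theta> o by (simp add: min_absorb2)
  qed
  have Hr: "H (\<lambda>\<omega>. INF k. ?w k \<omega>) = H r" using w INFw by (intro cong ST_INF rST AE_I2)
  show "H \<theta> \<le> H r"
  proof (rule le_eps)
   fix \<epsilon> :: real assume "0 < \<epsilon>"
   have "\<forall>\<^sub>F k in sequentially. H (?w k) \<le> H (\<lambda>\<omega>. INF k. ?w k \<omega>) + \<epsilon>"
    by (rule usc_dec) (use w vdec \<open>0 < \<epsilon>\<close> in \<open>auto simp: decseq_def min_le_iff_disj\<close>)
   then obtain k where "H (?w k) \<le> H r + \<epsilon>"
    unfolding Hr using eventually_happens'[OF sequentially_bot] by blast
   then show "H \<theta> \<le> H r + \<epsilon>" using U_le[OF vU \<theta>(1), of k] by simp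
  qed
 qed
 have r_le: "?E r \<le> e"
 proof (rule le_lim)
  fix k
  have "?E r \<le> ?E (u k)" using rv vu by (intro E_mono rST U_ST u) (meson order_trans)
  then show "?E r \<le> e + inverse (real (Suc k))" using u(2)[of k] by simp
 qed
 have r_min: "AE \<omega> in M. r \<omega> \<le> \<rho> \<omega>" if \<rho>: "\<rho> \<in> U" for \<rho>
 proof -
  have m: "(\<lambda>\<omega>. min (r \<omega>) (\<rho> \<omega>)) \<in> U" using rU \<rho> by (rule U_min)
  have "AE \<omega> in M. min (r \<omega>) (\<rho> \<omega>) = r \<omega>"
   using e_le[OF m] r_le by (intro E_eq U_ST[OF m] rST) auto
  then show ?thesis by eventually_elim (auto simp: min_def split: if_splits)
 qed
 \<comment> \<open>From any \<open>\<sigma>\<close>, exhaustion by later stopping times that are at least as good reaches \<open>U\<close>.\<close>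
 have climb: "\<exists>\<rho>\<in>U. H \<sigma> \<le> H \<rho>" if \<sigma>: "\<sigma> \<in> ST" for \<sigma>
 proof -
  \<comment> \<open>\<open>W \<theta>\<close> collects the later stopping times that are at least as good. Each \<open>\<theta> (Suc k)\<close> is chosen
   almost as late as possible in \<open>W (\<theta> k)\<close>, so nothing better lies beyond the limit.\<close>
  define W where "W \<theta> = {\<eta>\<in>ST. (\<forall>\<omega>\<in>space M. \<theta> \<omega> \<le> \<eta> \<omega>) \<and> H \<theta> \<le> H \<eta>}" for \<theta>
  have "\<exists>\<theta>. \<forall>k. \<theta> k \<in> W \<sigma> \<and> \<theta> (Suc k) \<in> W (\<theta> k) \<and> (\<forall>\<eta>\<in>W (\<theta> k). ?E \<eta> \<le> ?E (\<theta> (Suc k)) + inverse (real (Suc k)))"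
  proof (rule dependent_nat_choice)
   show "\<exists>x. x \<in> W \<sigma>" using \<sigma> by (auto simp: W_def)
   fix x :: "'a \<Rightarrow> real" and k assume x: "x \<in> W \<sigma>"
   define c where "c = (SUP \<eta>\<in>W x. ?E \<eta>)"
   have b: "bdd_above (?E ` W x)" using E_le by (intro bdd_aboveI[of _ T]) (auto simp: W_def)
   have ne: "W x \<noteq> {}" using x by (auto simp: W_def)
   obtain y where y: "y \<in> W x" "c - inverse (real (Suc k)) < ?E y"
    using less_cSUP_iff[OF ne b, of "c - inverse (real (Suc k))"] by (auto simp: c_def)
   have "?E \<eta> \<le> ?E y + inverse (real (Suc k))" if "\<eta> \<in> W x" for \<eta>
    using cSUP_upper[OF that b] y(2) by (simp add: c_def)
   moreover have "y \<in> W \<sigma>" using x y(1) unfolding W_def by (auto intro: order_trans)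
   ultimately show "\<exists>y. y \<in> W \<sigma> \<and> y \<in> W x \<and> (\<forall>\<eta>\<in>W x. ?E \<eta> \<le> ?E y + inverse (real (Suc k)))"
    using y(1) by blast
  qed
  then obtain \<theta> where \<theta>\<sigma>: "\<And>k. \<theta> k \<in> W \<sigma>" and \<theta>W: "\<And>k. \<theta> (Suc k) \<in> W (\<theta> k)"
   and \<theta>max: "\<And>k \<eta>. \<eta> \<in> W (\<theta> k) \<Longrightarrow> ?E \<eta> \<le> ?E (\<theta> (Suc k)) + inverse (real (Suc k))" by blast
  have \<theta>ST: "\<theta> k \<in> ST" for k using \<theta>\<sigma>[of k] by (simp add: W_def)
  have \<theta>inc: "incseq (\<lambda>k. \<theta> k \<omega>)" if "\<omega> \<in> space M" for \<omega>
   using \<theta>W that by (intro incseq_SucI) (simp add: W_def)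
  have Hinc: "incseq (\<lambda>k. H (\<theta> k))" using \<theta>W by (intro incseq_SucI) (simp add: W_def)
  define \<rho> where "\<rho> = (\<lambda>\<omega>. SUP k. \<theta> k \<omega>)"
  have \<rho>ST: "\<rho> \<in> ST" unfolding \<rho>_def using \<theta>ST by (rule ST_SUP)
  have \<theta>\<rho>: "\<theta> k \<omega> \<le> \<rho> \<omega>" if "\<omega> \<in> space M" for k \<omega>
   unfolding \<rho>_def using ST_bdd(1)[OF \<theta>ST that] by (intro cSUP_upper) auto
  have H\<theta>: "H (\<theta> j) \<le> H \<rho>" for j
  proof (rule le_eps)
   fix \<epsilon> :: real assume "0 < \<epsilon>"
   have "\<forall>\<^sub>F k in sequentially. H (\<theta> k) \<le> H \<rho> + \<epsilon>"
    unfolding \<rho>_def using \<theta>ST \<theta>inc \<open>0 < \<epsilon>\<close> by (rule usc_inc)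
   then have "\<forall>\<^sub>F k in sequentially. k \<ge> j \<and> H (\<theta> k) \<le> H \<rho> + \<epsilon>"
    by (intro eventually_conj eventually_ge_at_top)
   then obtain k where "k \<ge> j" "H (\<theta> k) \<le> H \<rho> + \<epsilon>" using eventually_happens'[OF sequentially_bot] by blast
   then show "H (\<theta> j) \<le> H \<rho> + \<epsilon>" using incseqD[OF Hinc, of j k] by simp
  qed
  have "\<rho> \<in> U"
   unfolding U_def
  proof (intro CollectI conjI ballI impI \<rho>ST)
   fix \<eta> assume \<eta>: "\<eta> \<in> ST" "\<forall>\<omega>\<in>space M. \<rho> \<omega> \<le> \<eta> \<omega>"
   show "H \<eta> \<le> H \<rho>"
   proof (rule ccontr)
    assume "\<not> H \<eta> \<le> H \<rho>"
    then have "\<eta> \<in> W (\<theta> k)" for k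
     using \<eta> H\<theta>[of k] order_trans[OF \<theta>\<rho>] by (auto simp: W_def)
    then have "?E \<eta> \<le> ?E \<rho> + inverse (real (Suc k))" for k
     using \<theta>max[of \<eta> k] E_mono[OF \<theta>ST \<rho>ST \<theta>\<rho>, of "Suc k"] by fastforce
    then have "?E \<eta> \<le> ?E \<rho>" by (rule le_lim)
    then have "AE \<omega> in M. \<rho> \<omega> = \<eta> \<omega>" using \<eta> by (intro E_eq \<rho>ST) auto
    then have "H \<rho> = H \<eta>" using \<rho>ST \<eta>(1) by (intro cong)
    with \<open>\<not> H \<eta> \<le> H \<rho>\<close> show False by simp
   qed
  qed
  moreover have "H \<sigma> \<le> H \<rho>" using \<theta>\<sigma>[of 0] H\<theta>[of 0] by (simp add: W_def)
  ultimately show ?thesis by blast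
 qed
 have max: "H \<sigma> \<le> H r" if \<sigma>: "\<sigma> \<in> ST" for \<sigma>
 proof -
  obtain \<rho> where \<rho>: "\<rho> \<in> U" "H \<sigma> \<le> H \<rho>" using climb[OF \<sigma>] by blast
  have m: "(\<lambda>\<omega>. max (r \<omega>) (\<rho> \<omega>)) \<in> ST" using rST U_ST[OF \<rho>(1)] by (rule ST_max)
  have "H (\<lambda>\<omega>. max (r \<omega>) (\<rho> \<omega>)) = H \<rho>"
   by (rule cong[OF m U_ST[OF \<rho>(1)]]) (use r_min[OF \<rho>(1)] in \<open>auto elim!: eventually_mono\<close>)
  moreover have "H (\<lambda>\<omega>. max (r \<omega>) (\<rho> \<omega>)) \<le> H r" using rU m by (force simp: U_def)
  ultimately show ?thesis using \<rho>(2) by simp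
 qed
 show thesis
 proof (rule that[OF rST max])
  fix \<sigma> assume \<sigma>: "\<sigma> \<in> ST" "H \<sigma> = H r"
  have "\<sigma> \<in> U" unfolding U_def using \<sigma> max by auto
  then show "AE \<omega> in M. r \<omega> \<le> \<sigma> \<omega>" by (rule r_min)
 qed
qed

lemma class_D_integrable: "class_D M F T Y \<Longrightarrow> \<tau> \<in> ST \<Longrightarrow> integrable M (\<lambda>\<omega>. Y (\<tau> \<omega>) \<omega>)"
 by (auto simp: class_D_def uniformly_integrable_def)

lemma USCE_eventually:
 assumes U: "USCE M F T Y" and "\<tau> \<in> ST" "\<And>k::nat. \<rho> k \<in> ST" "AE \<omega> in M. (\<lambda>k. \<rho> k \<omega>) \<longlonglongrightarrow> \<tau> \<omega>"
  and "(AE \<omega> in M. incseq (\<lambda>k. \<rho> k \<omega>) \<and> (\<tau> \<omega> > 0 \<longrightarrow> (\<forall>k. \<rho> k \<omega> < \<tau> \<omega>))) \<or> (\<forall>k. AE \<omega> in M. \<tau> \<omega> \<le> \<rho> k \<omega>)"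
  and "0 < \<epsilon>"
 shows "\<forall>\<^sub>F k in sequentially. (LINT \<omega>|M. Y (\<rho> k \<omega>) \<omega>) \<le> (LINT \<omega>|M. Y (\<tau> \<omega>) \<omega>) + \<epsilon>"
proof -
 have "limsup (\<lambda>k. ereal (LINT \<omega>|M. Y (\<rho> k \<omega>) \<omega>)) \<le> ereal (LINT \<omega>|M. Y (\<tau> \<omega>) \<omega>)"
  using U assms(2-5) unfolding USCE_def by blast
 also have "\<dots> < ereal ((LINT \<omega>|M. Y (\<tau> \<omega>) \<omega>) + \<epsilon>)" using \<open>0 < \<epsilon>\<close> by simp
 finally have "\<forall>\<^sub>F k in sequentially. ereal (LINT \<omega>|M. Y (\<rho> k \<omega>) \<omega>) < ereal ((LINT \<omega>|M. Y (\<tau> \<omega>) \<omega>) + \<epsilon>)"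
  by (rule Limsup_lessD)
 then show ?thesis by eventually_elim simp
qed

text \<open>Upper semicontinuity from the left is assumed along strictly increasing approximations only, but here
 \<open>\<rho> k\<close> may reach the limit \<open>R\<close> on a part of the space. The sequence is therefore modified. As long as \<open>\<rho> j\<close> is below \<open>R\<close> and below a deterministic bound \<open>r j < T\<close> it is kept; at the first
 \<open>j\<close> where this fails, an event known at time \<open>r j\<close>, it is replaced by times increasing to a
 deterministic \<open>s j > r j\<close>. The result increases strictly to its limit. The replacement costs little
 because \<open>s j\<close> almost minimises the expectation of \<open>Y\<close> on that event, and uniform integrability bounds
 the contribution of the remaining small events.\<close>

lemma USCE_increasing:
 assumes D: "class_D M F T Y" and U: "USCE M F T Y" and \<rho>: "\<And>k::nat. \<rho> k \<in> ST"
  and inc: "\<And>\<omega>. \<omega> \<in> space M \<Longrightarrow> incseq (\<lambda>k. \<rho> k \<omega>)" and "0 < \<epsilon>"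
 shows "\<forall>\<^sub>F k in sequentially. (LINT \<omega>|M. Y (\<rho> k \<omega>) \<omega>) \<le> (LINT \<omega>|M. Y (SUP k. \<rho> k \<omega>) \<omega>) + \<epsilon>"
proof -
 \<comment> \<open>Six error terms of size \<open>\<gamma>\<close> arise: one from semicontinuity, one from the replacement, four from
  small events.\<close>
 define \<gamma> where "\<gamma> = \<epsilon> / 6"
 have \<gamma>: "0 < \<gamma>" using \<open>0 < \<epsilon>\<close> by (simp add: \<gamma>_def)
 let ?S = "(\<lambda>\<tau> \<omega>. Y (\<tau> \<omega>) \<omega>) ` ST"
 have UI: "uniformly_integrable M ?S" using D by (simp add: class_D_def)
 note iY = class_D_integrable[OF D]
 have iYA: "integrable M (\<lambda>\<omega>. Y (\<tau> \<omega>) \<omega> * indicator A \<omega>)" if "\<tau> \<in> ST" "A \<in> sets M" for \<tau> A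
  using iY[OF that(1)] that(2) by (rule integrable_real_mult_indicator[rotated])
 have iYaA: "integrable M (\<lambda>\<omega>. \<bar>Y (\<tau> \<omega>) \<omega>\<bar> * indicator A \<omega>)" if "\<tau> \<in> ST" "A \<in> sets M" for \<tau> A
  using integrable_abs[OF iY[OF that(1)]] that(2) by (rule integrable_real_mult_indicator[rotated])
 obtain \<delta> where "0 < \<delta>" and \<delta>': "\<And>X A. X \<in> ?S \<Longrightarrow> A \<in> sets M \<Longrightarrow> prob A < \<delta> \<Longrightarrow> (LINT \<omega>|M. \<bar>X \<omega>\<bar> * indicator A \<omega>) \<le> \<gamma>"
  by (rule uniformly_integrable_small_sets[OF UI \<gamma>]) blast
 have \<delta>: "(LINT \<omega>|M. \<bar>Y (\<tau> \<omega>) \<omega>\<bar> * indicator A \<omega>) \<le> \<gamma>" if "\<tau> \<in> ST" "A \<in> sets M" "prob A < \<delta>" for \<tau> A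
  by (rule \<delta>') (use that in auto)
 obtain C0 where C0': "\<And>X. X \<in> ?S \<Longrightarrow> (LINT \<omega>|M. \<bar>X \<omega>\<bar>) \<le> C0"
  by (rule uniformly_integrable_bounded[OF UI]) blast
 have C0: "(LINT \<omega>|M. \<bar>Y (\<tau> \<omega>) \<omega>\<bar>) \<le> C0" if "\<tau> \<in> ST" for \<tau> by (rule C0') (use that in auto)
 define R where "R = (\<lambda>\<omega>. SUP k. \<rho> k \<omega>)"
 have RST: "R \<in> ST" unfolding R_def using \<rho> by (rule ST_SUP)
 have \<rho>R: "\<rho> k \<omega> \<le> R \<omega>" if "\<omega> \<in> space M" for k \<omega>
  unfolding R_def using ST_bdd(1)[OF \<rho> that] by (intro cSUP_upper) auto
 have \<rho>lim: "(\<lambda>k. \<rho> k \<omega>) \<longlonglongrightarrow> R \<omega>" if "\<omega> \<in> space M" for \<omega>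
  unfolding R_def using ST_bdd(1)[OF \<rho> that] inc[OF that] by (rule LIMSEQ_incseq_SUP)
 note [measurable] = ST_borel[OF \<rho>] ST_borel[OF RST]
 \<comment> \<open>On \<open>B\<close> the limit is approached strictly. The bounds \<open>r j\<close> are so close to \<open>T\<close> that with probability
  at most \<open>\<delta> / 2\<close> any of them is ever exceeded there.\<close>
 define B where "B = {\<omega>\<in>space M. \<forall>k. \<rho> k \<omega> < R \<omega>}"
 have [measurable]: "B \<in> sets M" unfolding B_def by measurable
 have "\<exists>r. 0 \<le> r \<and> r < T \<and> prob {\<omega>\<in>B. r \<le> \<rho> j \<omega>} < \<delta>/2 * (1/2)^Suc j" for j
 proof -
  let ?r = "\<lambda>m::nat. T - T * inverse (real (Suc m))"
  have r: "0 \<le> ?r m" "?r m < T" for m using horizon_pos by (auto simp: field_simps)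
  have rlim: "?r \<longlonglongrightarrow> T - T * 0" by (intro tendsto_intros LIMSEQ_inverse_real_of_nat)
  have "(\<lambda>m. prob {\<omega>\<in>B. ?r m \<le> \<rho> j \<omega>}) \<longlonglongrightarrow> prob (\<Inter>m. {\<omega>\<in>B. ?r m \<le> \<rho> j \<omega>})"
  proof (rule finite_Lim_measure_decseq)
   have m: "{\<omega>\<in>B. ?r m \<le> \<rho> j \<omega>} = {\<omega>\<in>space M. \<omega> \<in> B \<and> ?r m \<le> \<rho> j \<omega>}" for m by (auto simp: B_def)
   show "range (\<lambda>m. {\<omega>\<in>B. ?r m \<le> \<rho> j \<omega>}) \<subseteq> sets M" unfolding m by auto
   have rm: "?r m \<le> ?r n" if "m \<le> n" for m n using that horizon_pos by (auto intro!: mult_left_mono le_imp_inverse_le)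
   show "decseq (\<lambda>m. {\<omega>\<in>B. ?r m \<le> \<rho> j \<omega>})"
    unfolding decseq_def using order_trans[OF rm] by blast
  qed
  also have "(\<Inter>m. {\<omega>\<in>B. ?r m \<le> \<rho> j \<omega>}) = {}"
  proof (intro equals0I)
   fix \<omega> assume *: "\<omega> \<in> (\<Inter>m. {\<omega>\<in>B. ?r m \<le> \<rho> j \<omega>})"
   then have "T \<le> \<rho> j \<omega>" using LIMSEQ_le_const2[OF rlim, of "\<rho> j \<omega>"] by auto
   moreover have "\<rho> j \<omega> < R \<omega>" "R \<omega> \<le> T" using * STD_range[OF RST, of \<omega>] by (auto simp: B_def)
   ultimately show False by simp
  qed
  finally have "(\<lambda>m. prob {\<omega>\<in>B. ?r m \<le> \<rho> j \<omega>}) \<longlonglongrightarrow> 0" by simp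
  then have "\<forall>\<^sub>F m in sequentially. prob {\<omega>\<in>B. ?r m \<le> \<rho> j \<omega>} < \<delta>/2 * (1/2)^Suc j"
   using \<open>0 < \<delta>\<close> by (intro order_tendstoD) auto
  then show ?thesis using r eventually_happens'[OF sequentially_bot] by blast
 qed
 then obtain r' where r': "\<And>j. 0 \<le> r' j" "\<And>j. r' j < T" "\<And>j. prob {\<omega>\<in>B. r' j \<le> \<rho> j \<omega>} < \<delta>/2 * (1/2)^Suc j"
  by metis
 define r where "r j = Max (r' ` {..j})" for j :: nat
 have rj: "r' j \<le> r j" for j unfolding r_def by (intro Max_ge) auto
 have r0: "0 \<le> r j" for j using r'(1)[of j] rj[of j] by simp
 have rT: "r j < T" for j using r'(2) unfolding r_def by (subst Max_less_iff) auto
 have r_mono: "r i \<le> r j" if "i \<le> j" for i j unfolding r_def using that by (intro Max_mono) auto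
 have r_prob: "prob {\<omega>\<in>B. r j \<le> \<rho> j \<omega>} \<le> \<delta>/2 * (1/2)^Suc j" for j
 proof -
  have m: "{\<omega>\<in>B. r' j \<le> \<rho> j \<omega>} = {\<omega>\<in>space M. \<omega> \<in> B \<and> r' j \<le> \<rho> j \<omega>}" by (auto simp: B_def)
  have "prob {\<omega>\<in>B. r j \<le> \<rho> j \<omega>} \<le> prob {\<omega>\<in>B. r' j \<le> \<rho> j \<omega>}"
   using rj[of j] unfolding m by (intro finite_measure_mono) (auto simp: B_def)
  with r'(3)[of j] show ?thesis by simp
 qed
 define ok where "ok j = {\<omega>\<in>space M. \<rho> j \<omega> < R \<omega> \<and> \<rho> j \<omega> < r j}" for j
 have ok_le: "{\<omega>\<in>ok j. \<rho> j \<omega> \<le> t} \<in> sets (F t)" for j t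
 proof -
  have "Measurable.pred (pre_sigma (\<rho> j)) (\<lambda>\<omega>. \<rho> j \<omega> < R \<omega>)"
   by (intro stopping_time_less STD_stop \<rho> RST)
  moreover have "Measurable.pred (pre_sigma (\<rho> j)) (\<lambda>\<omega>. \<rho> j \<omega> < r j)"
   by (intro stopping_time_less STD_stop \<rho> stopping_time_const)
  ultimately have "Measurable.pred (pre_sigma (\<rho> j)) (\<lambda>\<omega>. \<rho> j \<omega> < R \<omega> \<and> \<rho> j \<omega> < r j)"
   by (rule pred_intros_logic)
  then have "ok j \<in> sets (pre_sigma (\<rho> j))" unfolding pred_def ok_def by (simp add: space_pre_sigma)
  then show ?thesis using sets_pre_sigmaD[OF STD_stop[OF \<rho>]] by blast
 qed
 have okF: "ok j \<in> sets (F (r j))" for j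
 proof -
  have "{\<omega>\<in>ok j. \<rho> j \<omega> \<le> r j} = ok j" by (auto simp: ok_def)
  then show ?thesis using ok_le[of j "r j"] by simp
 qed
 have ok_space: "ok j \<subseteq> space M" for j by (auto simp: ok_def)
 \<comment> \<open>\<open>C j\<close>: the original sequence is abandoned at step \<open>j\<close>.\<close>
 define C where "C j = {\<omega>\<in>space M. (\<forall>i<j. \<omega> \<in> ok i) \<and> \<omega> \<notin> ok j}" for j
 have CF: "C j \<in> sets (F (r j))" for j
 proof -
  have "C j = (\<Inter>i\<in>{..<j}. ok i) \<inter> space (F (r j)) - ok j" by (auto simp: C_def space_F)
  moreover have "(\<Inter>i\<in>{..<j}. ok i) \<inter> space (F (r j)) \<in> sets (F (r j))"
  proof (cases "j = 0")
   case False
   then have "(\<Inter>i\<in>{..<j}. ok i) \<in> sets (F (r j))"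
    by (intro sets.finite_INT) (auto intro!: sets_F_le[OF r_mono okF])
   then show ?thesis by auto
  qed auto
  ultimately show ?thesis using okF by auto
 qed
 have okM[measurable]: "ok j \<in> sets M" for j unfolding ok_def by measurable
 have CM[measurable]: "C j \<in> sets M" for j
  using CF[of j] sets_F_subset[of "r j"] r0[of j] rT[of j] by auto
 define \<phi> where "\<phi> j u = (LINT \<omega>|M. Y u \<omega> * indicator (C j) \<omega>)" for j u
 have \<phi>_bd: "- C0 \<le> \<phi> j u" if u: "u \<in> {0..T}" for j u
 proof -
  note us = ST_const[OF u]
  have "\<bar>\<phi> j u\<bar> \<le> (LINT \<omega>|M. \<bar>Y u \<omega> * indicator (C j) \<omega>\<bar>)" unfolding \<phi>_def by (rule integral_abs_bound)
  also have "\<dots> \<le> (LINT \<omega>|M. \<bar>Y u \<omega>\<bar>)"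
   using iYA[OF us CM[of j]] iY[OF us] by (intro integral_mono) (auto simp: indicator_def)
  also have "\<dots> \<le> C0" using C0[OF us] .
  finally show ?thesis by linarith
 qed
 \<comment> \<open>A near-minimiser of \<open>\<phi> j\<close> is the limit of times at which \<open>\<phi> j\<close> is not much smaller.\<close>
 have "\<exists>s. r j < s \<and> s < T \<and> (\<forall>u\<in>{r j<..<s}. \<phi> j s - \<gamma> * (1/2)^Suc j \<le> \<phi> j u)" for j
 proof -
  let ?I = "{r j<..<T}"
  have ne: "?I \<noteq> {}" using rT[of j] by simp
  have bd: "bdd_below (\<phi> j ` ?I)" using \<phi>_bd r0[of j] by (intro bdd_belowI[of _ "- C0"]) auto
  obtain s where s: "s \<in> ?I" "\<phi> j s < (INF u\<in>?I. \<phi> j u) + \<gamma> * (1/2)^Suc j"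
   using cINF_less_iff[OF ne bd, of "(INF u\<in>?I. \<phi> j u) + \<gamma> * (1/2)^Suc j"] \<gamma> by auto
  have "\<phi> j s - \<gamma> * (1/2)^Suc j \<le> \<phi> j u" if "u \<in> {r j<..<s}" for u
   using cINF_lower[OF bd, of u] s that by fastforce
  then show ?thesis using s(1) by auto
 qed
 then obtain s where s: "\<And>j. r j < s j" "\<And>j. s j < T"
  "\<And>j u. u \<in> {r j<..<s j} \<Longrightarrow> \<phi> j (s j) - \<gamma> * (1/2)^Suc j \<le> \<phi> j u" by metis
 define u where "u j k = s j - (s j - r j) * inverse (real (Suc (Suc k)))" for j k
 have u: "r j < u j k" "u j k < s j" for j k
 proof -
  have "(s j - r j) * inverse (real (Suc (Suc k))) < (s j - r j) * 1"
   using s(1)[of j] by (intro mult_strict_left_mono) (auto simp: field_simps)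
  then show "r j < u j k" by (simp add: u_def)
  show "u j k < s j" using s(1)[of j] by (simp add: u_def)
 qed
 have u_mono: "u j k \<le> u j l" if "k \<le> l" for j k l
  unfolding u_def using that s(1)[of j] by (intro diff_left_mono mult_left_mono le_imp_inverse_le) auto
 have u_lim: "u j \<longlonglongrightarrow> s j" for j
 proof -
  have "(\<lambda>k. s j - (s j - r j) * inverse (real (Suc (Suc k)))) \<longlonglongrightarrow> s j - (s j - r j) * 0"
   by (intro tendsto_intros LIMSEQ_Suc[OF LIMSEQ_inverse_real_of_nat])
  then show ?thesis unfolding u_def by simp
 qed
 have u0: "u j k \<in> {0..T}" "s j \<in> {0..T}" for j k using u[of j k] s[of j] r0[of j] by auto
 \<comment> \<open>\<open>N k\<close>: the original sequence is still followed at step \<open>k\<close>; \<open>N'\<close>: it is followed forever.\<close>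
 define N where "N k = {\<omega>\<in>space M. \<forall>i\<le>k. \<omega> \<in> ok i}" for k
 define N' where "N' = {\<omega>\<in>space M. \<forall>i. \<omega> \<in> ok i}"
 have [measurable]: "N k \<in> sets M" "N' \<in> sets M" for k unfolding N_def N'_def by measurable
 define first where "first \<omega> = (LEAST j. \<omega> \<notin> ok j)" for \<omega>
 have first: "\<omega> \<in> C j \<longleftrightarrow> j = first \<omega>" if w: "\<omega> \<in> space M" "\<omega> \<notin> N'" for \<omega> j
 proof -
  obtain i where "\<omega> \<notin> ok i" using w by (auto simp: N'_def)
  then have 1: "\<omega> \<notin> ok (first \<omega>)" unfolding first_def by (rule LeastI)
  have 2: "\<omega> \<in> ok i" if "i < first \<omega>" for i
   using not_less_Least[of i "\<lambda>j. \<omega> \<notin> ok j"] that unfolding first_def by simp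
  have "first \<omega> = j" if "\<omega> \<in> C j"
   unfolding first_def
  proof (rule Least_equality)
   show "\<omega> \<notin> ok j" using that by (simp add: C_def)
   show "j \<le> y" if "\<omega> \<notin> ok y" for y
    using \<open>\<omega> \<in> C j\<close> that by (rule_tac ccontr) (simp add: C_def)
  qed
  moreover have "\<omega> \<in> C (first \<omega>)" using 1 2 w by (simp add: C_def)
  ultimately show ?thesis by blast
 qed
 have N_iff: "\<omega> \<in> N k \<longleftrightarrow> k < first \<omega>" if "\<omega> \<in> space M" "\<omega> \<notin> N'" for \<omega> k
 proof -
  have *: "\<omega> \<in> C (first \<omega>)" using first[OF that] by blast
  show ?thesis
  proof
   assume "\<omega> \<in> N k"
   then show "k < first \<omega>" using * by (rule_tac ccontr) (simp add: N_def C_def)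
  next
   assume "k < first \<omega>"
   then show "\<omega> \<in> N k" using * by (simp add: N_def C_def)
  qed
 qed
 have N'N: "N' \<subseteq> N k" for k by (auto simp: N_def N'_def)
 define \<theta> where "\<theta> k \<omega> = (if \<omega> \<in> N k then \<rho> k \<omega> else u (first \<omega>) k)" for k \<omega>
 define \<theta>' where "\<theta>' \<omega> = (if \<omega> \<in> N' then R \<omega> else s (first \<omega>))" for \<omega>
 have \<theta>_range: "0 \<le> \<theta> k \<omega> \<and> \<theta> k \<omega> \<le> T" if "\<omega> \<in> space M" for k \<omega>
  using STD_range[OF \<rho> that] u0 by (auto simp: \<theta>_def)
 have \<theta>'_range: "0 \<le> \<theta>' \<omega> \<and> \<theta>' \<omega> \<le> T" if "\<omega> \<in> space M" for \<omega>
  using STD_range[OF RST that] u0 by (auto simp: \<theta>'_def)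
 have C_if: "{\<omega>\<in>C j. v \<le> t} \<in> sets (F t)" if "r j \<le> v" for j t v
 proof (cases "v \<le> t")
  case True then show ?thesis using sets_F_le[OF _ CF[of j], of t] that by simp
 qed simp
 have \<theta>ST: "\<theta> k \<in> ST" for k
 proof (rule STI)
  fix t assume t: "t \<in> {0..<T}"
  have eq: "{\<omega>\<in>space M. \<theta> k \<omega> \<le> t} = ((\<Inter>i\<in>{..k}. {\<omega>\<in>ok i. \<rho> i \<omega> \<le> t}) \<inter> {\<omega>\<in>space M. \<rho> k \<omega> \<le> t}) \<union> (\<Union>j\<in>{..k}. {\<omega>\<in>C j. u j k \<le> t})"
   (is "?L = ?R")
  proof (intro set_eqI iffI)
   fix \<omega> assume w: "\<omega> \<in> ?L"
   show "\<omega> \<in> ?R"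
   proof (cases "\<omega> \<in> N k")
    case True
    then show ?thesis using w incseqD[OF inc, of \<omega> _ k] by (force simp: \<theta>_def N_def)
   next
    case False
    then have "\<omega> \<notin> N'" using N'N by auto
    then have "\<omega> \<in> C (first \<omega>)" "first \<omega> \<le> k" using first[of \<omega>] N_iff[of \<omega> k] w False by auto
    then show ?thesis using w False by (auto simp: \<theta>_def)
   qed
  next
   fix \<omega> assume w: "\<omega> \<in> ?R"
   then have sp: "\<omega> \<in> space M" by (auto simp: C_def)
   show "\<omega> \<in> ?L"
   proof (cases "\<omega> \<in> N k")
    case True
    then have "\<omega> \<notin> C j" if "j \<le> k" for j using that by (auto simp: N_def C_def)
    then show ?thesis using w True by (auto simp: \<theta>_def)
   next
    case False
    then have "\<omega> \<notin> N'" using N'N by auto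
    have "\<exists>i\<le>k. \<omega> \<notin> ok i" using False sp by (auto simp: N_def)
    then show ?thesis using w False first[OF sp \<open>\<omega> \<notin> N'\<close>] sp by (auto simp: \<theta>_def)
   qed
  qed
  have a: "(\<Inter>i\<in>{..k}. {\<omega>\<in>ok i. \<rho> i \<omega> \<le> t}) \<in> sets (F t)"
   using ok_le by (intro sets.finite_INT) auto
  have b: "(\<Union>j\<in>{..k}. {\<omega>\<in>C j. u j k \<le> t}) \<in> sets (F t)"
   using u(1) by (intro sets.finite_UN C_if) (auto intro: less_imp_le)
  show "{\<omega>\<in>space M. \<theta> k \<omega> \<le> t} \<in> sets (F t)" unfolding eq by (intro sets.Un sets.Int a b STD_le \<rho>)
 qed (rule \<theta>_range)
 have \<theta>'ST: "\<theta>' \<in> ST"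
 proof (rule STI)
  fix t assume t: "t \<in> {0..<T}"
  have eq: "{\<omega>\<in>space M. \<theta>' \<omega> \<le> t} = ((\<Inter>i. {\<omega>\<in>ok i. \<rho> i \<omega> \<le> t}) \<inter> {\<omega>\<in>space M. R \<omega> \<le> t}) \<union> (\<Union>j. {\<omega>\<in>C j. s j \<le> t})"
   (is "?L = ?R")
  proof (intro set_eqI iffI)
   fix \<omega> assume w: "\<omega> \<in> ?L"
   show "\<omega> \<in> ?R"
   proof (cases "\<omega> \<in> N'")
    case True
    then have "R \<omega> \<le> t" "\<omega> \<in> space M" using w by (auto simp: \<theta>'_def)
    moreover have "\<rho> i \<omega> \<le> t" for i using \<rho>R[of \<omega> i] calculation by linarith
    ultimately show ?thesis using True by (auto simp: N'_def)
   next
    case False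
    then show ?thesis using w first by (auto simp: \<theta>'_def)
   qed
  next
   fix \<omega> assume w: "\<omega> \<in> ?R"
   then have sp: "\<omega> \<in> space M" by (auto simp: C_def)
   show "\<omega> \<in> ?L"
   proof (cases "\<omega> \<in> N'")
    case True
    then have "\<omega> \<notin> C j" for j by (auto simp: N'_def C_def)
    then show ?thesis using w True by (auto simp: \<theta>'_def)
   next
    case False
    then have "\<exists>i. \<omega> \<notin> ok i" using sp by (auto simp: N'_def)
    then show ?thesis using w False first[OF sp False] sp by (auto simp: \<theta>'_def)
   qed
  qed
  have a: "(\<Inter>i. {\<omega>\<in>ok i. \<rho> i \<omega> \<le> t}) \<in> sets (F t)" using ok_le by auto
  have b: "(\<Union>j. {\<omega>\<in>C j. s j \<le> t}) \<in> sets (F t)"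
   using s(1) by (intro sets.countable_UN) (auto intro!: C_if intro: less_imp_le)
  show "{\<omega>\<in>space M. \<theta>' \<omega> \<le> t} \<in> sets (F t)" unfolding eq by (intro sets.Un sets.Int a b STD_le RST)
 qed (rule \<theta>'_range)
 have \<theta>_inc: "incseq (\<lambda>k. \<theta> k \<omega>)" if w: "\<omega> \<in> space M" for \<omega>
 proof (rule incseq_SucI)
  fix k
  show "\<theta> k \<omega> \<le> \<theta> (Suc k) \<omega>"
  proof (cases "\<omega> \<in> N (Suc k)")
   case True
   then have "\<omega> \<in> N k" by (auto simp: N_def)
   then show ?thesis using True incseqD[OF inc[OF w], of k "Suc k"] by (simp add: \<theta>_def)
  next
   case False
   show ?thesis
   proof (cases "\<omega> \<in> N k")
    case True
    then have "\<rho> k \<omega> < r k" by (auto simp: N_def ok_def)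
    moreover have "\<omega> \<notin> N'" using False N'N by auto
    then have "k \<le> first \<omega>" using N_iff[OF w, of k] True by simp
    then have "r k \<le> r (first \<omega>)" by (rule r_mono)
    ultimately show ?thesis using True False u(1)[of "first \<omega>" "Suc k"] by (simp add: \<theta>_def)
   next
    case False2: False
    then show ?thesis using False u_mono[of k "Suc k"] by (simp add: \<theta>_def)
   qed
  qed
 qed
 have \<theta>_less: "\<theta> k \<omega> < \<theta>' \<omega>" if w: "\<omega> \<in> space M" for k \<omega>
 proof (cases "\<omega> \<in> N'")
  case True
  then have "\<omega> \<in> N k" "\<omega> \<in> ok k" using N'N by (auto simp: N'_def)
  then show ?thesis using True by (simp add: \<theta>_def \<theta>'_def ok_def)
 next
  case False
  show ?thesis
  proof (cases "\<omega> \<in> N k")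
   case True
   then have "\<rho> k \<omega> < r k" by (auto simp: N_def ok_def)
   moreover have "r k \<le> r (first \<omega>)" using N_iff[OF w False, of k] True by (intro r_mono) auto
   ultimately show ?thesis using True False s(1)[of "first \<omega>"] by (simp add: \<theta>_def \<theta>'_def)
  next
   case False2: False
   then show ?thesis using False u(2) by (simp add: \<theta>_def \<theta>'_def)
  qed
 qed
 have \<theta>_lim: "(\<lambda>k. \<theta> k \<omega>) \<longlonglongrightarrow> \<theta>' \<omega>" if w: "\<omega> \<in> space M" for \<omega>
 proof (cases "\<omega> \<in> N'")
  case True
  then have "\<theta> k \<omega> = \<rho> k \<omega>" for k using N'N[of k] by (auto simp: \<theta>_def)
  then show ?thesis using \<rho>lim[OF w] True by (simp add: \<theta>'_def)
 next
  case False
  have "\<forall>\<^sub>F k in sequentially. \<theta> k \<omega> = u (first \<omega>) k"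
   using eventually_ge_at_top[of "first \<omega>"] by eventually_elim (use N_iff[OF w False] in \<open>auto simp: \<theta>_def\<close>)
  then have "(\<lambda>k. \<theta> k \<omega>) \<longlonglongrightarrow> s (first \<omega>) \<longleftrightarrow> u (first \<omega>) \<longlonglongrightarrow> s (first \<omega>)" by (rule tendsto_cong)
  then show ?thesis using u_lim False by (simp add: \<theta>'_def)
 qed
 have ev1: "\<forall>\<^sub>F k in sequentially. (LINT \<omega>|M. Y (\<theta> k \<omega>) \<omega>) \<le> (LINT \<omega>|M. Y (\<theta>' \<omega>) \<omega>) + \<gamma>"
  using \<theta>_lim \<theta>_inc \<theta>_less \<gamma> by (intro USCE_eventually[OF U \<theta>'ST \<theta>ST]) auto
 have i\<phi>: "integrable M (\<lambda>\<omega>. Y v \<omega> * indicator (C j) \<omega>)" if "v \<in> {0..T}" for v j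
  using iYA[OF ST_const[OF that] CM] by simp
 have split: "(LINT \<omega>|M. Y (\<eta> \<omega>) \<omega>) = (LINT \<omega>|M. Y (\<eta> \<omega>) \<omega> * indicator (N k) \<omega>) + (\<Sum>j\<le>k. \<phi> j (v j))"
  if \<eta>: "\<eta> \<in> ST" and v: "\<And>j. v j \<in> {0..T}" and eq: "\<And>\<omega>. \<omega> \<notin> N k \<Longrightarrow> \<eta> \<omega> = v (first \<omega>)" for \<eta> v k
 proof -
  have "(LINT \<omega>|M. Y (\<eta> \<omega>) \<omega>) = (LINT \<omega>|M. Y (\<eta> \<omega>) \<omega> * indicator (N k) \<omega> + (\<Sum>j\<le>k. Y (v j) \<omega> * indicator (C j) \<omega>))"
  proof (rule LINT_cong[OF refl])
   fix \<omega> assume w: "\<omega> \<in> space M"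
   show "Y (\<eta> \<omega>) \<omega> = Y (\<eta> \<omega>) \<omega> * indicator (N k) \<omega> + (\<Sum>j\<le>k. Y (v j) \<omega> * indicator (C j) \<omega>)"
   proof (cases "\<omega> \<in> N k")
    case True
    then have "\<omega> \<notin> C j" if "j \<le> k" for j using that by (auto simp: N_def C_def)
    then have "(\<Sum>j\<le>k. Y (v j) \<omega> * indicator (C j) \<omega>) = 0" by (intro sum.neutral) auto
    then show ?thesis using True by simp
   next
    case False
    then have n: "\<omega> \<notin> N'" using N'N by auto
    have "(\<Sum>j\<le>k. Y (v j) \<omega> * indicator (C j) \<omega>) = (\<Sum>j\<le>k. if j = first \<omega> then Y (v j) \<omega> else 0)"
     using first[OF w n] by (intro sum.cong) (auto simp: indicator_def)
    also have "\<dots> = Y (v (first \<omega>)) \<omega>" using N_iff[OF w n] False by simp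
    finally show ?thesis using False by (simp add: eq)
   qed
  qed
  also have "\<dots> = (LINT \<omega>|M. Y (\<eta> \<omega>) \<omega> * indicator (N k) \<omega>) + (LINT \<omega>|M. (\<Sum>j\<le>k. Y (v j) \<omega> * indicator (C j) \<omega>))"
   by (intro LINT_add LINT_integrable_sum i\<phi> v iYA[OF \<eta>]) simp
  also have "(LINT \<omega>|M. (\<Sum>j\<le>k. Y (v j) \<omega> * indicator (C j) \<omega>)) = (\<Sum>j\<le>k. \<phi> j (v j))"
   unfolding \<phi>_def by (intro LINT_sum i\<phi> v)
  finally show ?thesis .
 qed
 have split\<theta>: "(LINT \<omega>|M. Y (\<theta> k \<omega>) \<omega>) = (LINT \<omega>|M. Y (\<rho> k \<omega>) \<omega> * indicator (N k) \<omega>) + (\<Sum>j\<le>k. \<phi> j (u j k))" for k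
 proof -
  have "(LINT \<omega>|M. Y (\<theta> k \<omega>) \<omega> * indicator (N k) \<omega>) = (LINT \<omega>|M. Y (\<rho> k \<omega>) \<omega> * indicator (N k) \<omega>)"
   by (rule LINT_cong[OF refl]) (simp add: \<theta>_def indicator_def)
  then show ?thesis using split[OF \<theta>ST u0(1), of k k] by (simp add: \<theta>_def)
 qed
 have split\<theta>': "(LINT \<omega>|M. Y (\<theta>' \<omega>) \<omega>) = (LINT \<omega>|M. Y (\<theta>' \<omega>) \<omega> * indicator (N k) \<omega>) + (\<Sum>j\<le>k. \<phi> j (s j))" for k
  by (rule split[OF \<theta>'ST u0(2)]) (use N'N[of k] in \<open>auto simp: \<theta>'_def\<close>)
 have sum_small: "(\<Sum>j\<le>k. \<phi> j (s j)) \<le> (\<Sum>j\<le>k. \<phi> j (u j k)) + \<gamma>" for k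
 proof -
  have "(\<Sum>j\<le>k. \<phi> j (s j)) \<le> (\<Sum>j\<le>k. \<phi> j (u j k) + \<gamma> * (1/2)^Suc j)"
   using s(3)[OF greaterThanLessThan_iff[THEN iffD2, OF conjI[OF u]]] by (intro sum_mono) (simp add: algebra_simps)
  also have "\<dots> = (\<Sum>j\<le>k. \<phi> j (u j k)) + \<gamma> * (\<Sum>j\<le>k. (1/2)^Suc j)"
   by (simp add: sum.distrib sum_distrib_left)
  also have "(\<Sum>j\<le>k. (1/2::real)^Suc j) \<le> 1"
  proof -
   have "(\<Sum>j\<le>k. (1/2::real)^Suc j) = 1 - (1/2)^Suc k" by (induction k) auto
   then show ?thesis by simp
  qed
  finally show ?thesis using \<gamma> by (simp add: mult_left_le)
 qed
 have pN: "(\<lambda>k. prob (N k - N')) \<longlonglongrightarrow> 0"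
 proof -
  have "(\<lambda>k. prob (N k - N')) \<longlonglongrightarrow> prob (\<Inter>k. N k - N')"
   by (rule finite_Lim_measure_decseq) (auto simp: decseq_def N_def)
  moreover have "(\<Inter>k. N k - N') = {}" by (auto simp: N_def N'_def)
  ultimately show ?thesis by (metis (no_types, lifting) measure_empty)
 qed
 have pB: "(\<lambda>k. prob ({\<omega>\<in>space M. \<rho> k \<omega> < R \<omega>} - B)) \<longlonglongrightarrow> 0"
 proof -
  have "(\<lambda>k. prob ({\<omega>\<in>space M. \<rho> k \<omega> < R \<omega>} - B)) \<longlonglongrightarrow> prob (\<Inter>k. {\<omega>\<in>space M. \<rho> k \<omega> < R \<omega>} - B)"
  proof (rule finite_Lim_measure_decseq)
   show "decseq (\<lambda>k. {\<omega>\<in>space M. \<rho> k \<omega> < R \<omega>} - B)"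
    unfolding decseq_def using inc by (auto simp: incseq_def intro: le_less_trans)
  qed auto
  moreover have "(\<Inter>k. {\<omega>\<in>space M. \<rho> k \<omega> < R \<omega>} - B) = {}" by (auto simp: B_def)
  ultimately show ?thesis by (metis (no_types, lifting) measure_empty)
 qed
 have BN': "prob (B - N') \<le> \<delta>/2"
 proof -
  let ?A = "\<lambda>j. {\<omega>\<in>B. r j \<le> \<rho> j \<omega>}"
  have mA: "?A j = {\<omega>\<in>space M. \<omega> \<in> B \<and> r j \<le> \<rho> j \<omega>}" for j by (auto simp: B_def)
  have A[measurable]: "?A j \<in> sets M" for j unfolding mA by measurable
  have sm: "(\<lambda>j. \<delta>/2 * (1/2)^Suc j) sums (\<delta>/2)"
   using sums_mult[OF power_half_series, of "\<delta>/2"] by simp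
  have smA: "summable (\<lambda>j. prob (?A j))"
   by (rule summable_comparison_test'[OF sums_summable[OF sm], of 0]) (use r_prob in auto)
  have "prob (B - N') \<le> prob (\<Union>j. ?A j)"
   by (intro finite_measure_mono) (auto simp: B_def N'_def ok_def not_le)
  also have "\<dots> \<le> (\<Sum>j. prob (?A j))"
   by (rule finite_measure_subadditive_countably) (use smA in auto)
  also have "\<dots> \<le> (\<Sum>j. \<delta>/2 * (1/2)^Suc j)"
   using r_prob smA sums_summable[OF sm] by (intro suminf_le) auto
  finally show ?thesis using sums_unique[OF sm] by simp
 qed
 have "\<forall>\<^sub>F k in sequentially. prob (N k - N') < \<delta>" using order_tendstoD(2)[OF pN \<open>0 < \<delta>\<close>] .
 moreover have "\<forall>\<^sub>F k in sequentially. prob ({\<omega>\<in>space M. \<rho> k \<omega> < R \<omega>} - B) < \<delta>/2"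
  using \<open>0 < \<delta>\<close> by (intro order_tendstoD(2)[OF pB]) simp
 ultimately show ?thesis using ev1
 proof eventually_elim
  case (elim k)
  let ?e = "\<lambda>\<tau> A. LINT \<omega>|M. Y (\<tau> \<omega>) \<omega> * indicator A \<omega>" and ?a = "\<lambda>\<tau> A. LINT \<omega>|M. \<bar>Y (\<tau> \<omega>) \<omega>\<bar> * indicator A \<omega>"
  define G where "G = {\<omega>\<in>space M. \<omega> \<notin> N k \<and> \<rho> k \<omega> < R \<omega>}"
  have [measurable]: "G \<in> sets M" unfolding G_def by measurable
  have "prob G \<le> prob ((B - N') \<union> ({\<omega>\<in>space M. \<rho> k \<omega> < R \<omega>} - B))"
   using N'N[of k] by (intro finite_measure_mono) (auto simp: G_def)
  also have "\<dots> \<le> prob (B - N') + prob ({\<omega>\<in>space M. \<rho> k \<omega> < R \<omega>} - B)"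
   by (rule measure_Un_le) measurable
  also have "\<dots> < \<delta>" using BN' elim(2) by simp
  finally have pG: "prob G < \<delta>" .
  have 1: "?e (\<rho> k) (N k) \<le> ?e \<theta>' (N k) + 2 * \<gamma>"
   using elim(3) split\<theta>[of k] split\<theta>'[of k] sum_small[of k] by simp
  have 2: "?e \<theta>' (N k) - ?e R (N k) \<le> ?a \<theta>' (N k - N') + ?a R (N k - N')"
  proof -
   have "?e \<theta>' (N k) - ?e R (N k) = (LINT \<omega>|M. Y (\<theta>' \<omega>) \<omega> * indicator (N k) \<omega> - Y (R \<omega>) \<omega> * indicator (N k) \<omega>)"
    using iYA \<theta>'ST RST by simp
   also have "\<dots> \<le> (LINT \<omega>|M. \<bar>Y (\<theta>' \<omega>) \<omega>\<bar> * indicator (N k - N') \<omega> + \<bar>Y (R \<omega>) \<omega>\<bar> * indicator (N k - N') \<omega>)"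
   proof (rule integral_mono)
    show "integrable M (\<lambda>\<omega>. Y (\<theta>' \<omega>) \<omega> * indicator (N k) \<omega> - Y (R \<omega>) \<omega> * indicator (N k) \<omega>)"
     by (intro LINT_integrable_diff iYA \<theta>'ST RST) simp_all
    show "integrable M (\<lambda>\<omega>. \<bar>Y (\<theta>' \<omega>) \<omega>\<bar> * indicator (N k - N') \<omega> + \<bar>Y (R \<omega>) \<omega>\<bar> * indicator (N k - N') \<omega>)"
     by (intro LINT_integrable_add iYaA \<theta>'ST RST) simp_all
   qed (auto simp: indicator_def \<theta>'_def)
   also have "\<dots> = ?a \<theta>' (N k - N') + ?a R (N k - N')" using iYaA \<theta>'ST RST by simp
   finally show ?thesis .
  qed
  have 3: "(LINT \<omega>|M. Y (\<rho> k \<omega>) \<omega>) - (LINT \<omega>|M. Y (R \<omega>) \<omega>) \<le> (?e (\<rho> k) (N k) - ?e R (N k)) + (?a (\<rho> k) G + ?a R G)"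
  proof -
   have "(LINT \<omega>|M. Y (\<rho> k \<omega>) \<omega>) - (LINT \<omega>|M. Y (R \<omega>) \<omega>) = (LINT \<omega>|M. Y (\<rho> k \<omega>) \<omega> - Y (R \<omega>) \<omega>)"
    using iY \<rho> RST by simp
   also have "\<dots> \<le> (LINT \<omega>|M. (Y (\<rho> k \<omega>) \<omega> * indicator (N k) \<omega> - Y (R \<omega>) \<omega> * indicator (N k) \<omega>)
     + (\<bar>Y (\<rho> k \<omega>) \<omega>\<bar> * indicator G \<omega> + \<bar>Y (R \<omega>) \<omega>\<bar> * indicator G \<omega>))"
   proof (rule integral_mono)
    fix \<omega> assume w: "\<omega> \<in> space M"
    have "\<rho> k \<omega> = R \<omega>" if "\<omega> \<notin> G" "\<omega> \<notin> N k" using that w \<rho>R[OF w, of k] by (auto simp: G_def)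
    then show "Y (\<rho> k \<omega>) \<omega> - Y (R \<omega>) \<omega> \<le> (Y (\<rho> k \<omega>) \<omega> * indicator (N k) \<omega> - Y (R \<omega>) \<omega> * indicator (N k) \<omega>)
     + (\<bar>Y (\<rho> k \<omega>) \<omega>\<bar> * indicator G \<omega> + \<bar>Y (R \<omega>) \<omega>\<bar> * indicator G \<omega>)"
     by (auto simp: indicator_def)
   qed (use iY iYA iYaA \<rho> RST in auto)
   also have "\<dots> = (?e (\<rho> k) (N k) - ?e R (N k)) + (?a (\<rho> k) G + ?a R G)"
    using iYA iYaA \<rho> RST by simp
   finally show ?thesis .
  qed
  have a: "?a \<theta>' (N k - N') \<le> \<gamma>" "?a R (N k - N') \<le> \<gamma>" "?a (\<rho> k) G \<le> \<gamma>" "?a R G \<le> \<gamma>"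
   using \<delta>[OF \<theta>'ST _ elim(1)] \<delta>[OF RST _ elim(1)] \<delta>[OF \<rho> _ pG] \<delta>[OF RST _ pG] by auto
  have "(LINT \<omega>|M. Y (\<rho> k \<omega>) \<omega>) - (LINT \<omega>|M. Y (R \<omega>) \<omega>) \<le> 6 * \<gamma>" using 1 2 3 a by linarith
  then show ?case by (simp add: R_def \<gamma>_def)
 qed
qed

end

section \<open>Measurable projection\<close>

text \<open>Dependent choice in the form in which it is used below, once for Choquet's argument and once for
 Koenig's lemma.\<close>

lemma sequence_of_prefixes:
 assumes "P []" "\<And>l. P l \<Longrightarrow> \<exists>p. P (l @ [p])"
 shows "\<exists>s :: nat \<Rightarrow> 'a. \<forall>m. P (map s [0..<m])"
proof -
 define L where "L = rec_nat [] (\<lambda>_ l. l @ [SOME p. P (l @ [p])])"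
 have L: "L 0 = []" "L (Suc m) = L m @ [SOME p. P (L m @ [p])]" for m by (simp_all add: L_def)
 define s where "s m = (SOME p. P (L m @ [p]))" for m
 have "P (L m) \<and> L m = map s [0..<m]" for m
 proof (induction m)
  case (Suc m)
  then have "P (L m @ [s m])" unfolding s_def using assms(2) by (auto intro: someI_ex)
  then show ?case using Suc L(2)[of m] by (simp add: s_def)
 qed (use assms L in auto)
 then have "P (map s [0..<m])" for m by metis
 then show ?thesis by blast
qed

text \<open>Souslin sets over the paving of rectangles with a compact time side. The condition number
 \<open>k\<close> on the index sequence looks at finitely many of its entries only; this uniformity is what
 Koenig's lemma needs below.\<close>

definition souslin_scheme ::
  "real set \<Rightarrow> 'a measure \<Rightarrow> (real \<times> 'a) set \<Rightarrow> (nat \<Rightarrow> (nat \<Rightarrow> nat) \<Rightarrow> (real \<times> 'a) set) \<Rightarrow> bool" where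
 "souslin_scheme I N A C \<longleftrightarrow>
  (\<forall>k s. \<exists>K E. compact K \<and> K \<subseteq> I \<and> E \<in> sets N \<and> C k s = K \<times> E) \<and>
  (\<forall>k. \<exists>m. \<forall>s s'. (\<forall>j<m. s j = s' j) \<longrightarrow> C k s = C k s') \<and>
  A = {x. \<exists>s. \<forall>k. x \<in> C k s}"

definition souslin_rect :: "real set \<Rightarrow> 'a measure \<Rightarrow> (real \<times> 'a) set \<Rightarrow> bool" where
 "souslin_rect I N A \<longleftrightarrow> (\<exists>C. souslin_scheme I N A C)"

lemma souslin_schemeD:
 assumes S: "souslin_scheme I N A C"
 shows "\<exists>K E. compact K \<and> K \<subseteq> I \<and> E \<in> sets N \<and> C k s = K \<times> E"
  and "\<exists>m. \<forall>s s'. (\<forall>j<m. s j = s' j) \<longrightarrow> C k s = C k s'"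
  and "A = {x. \<exists>s. \<forall>k. x \<in> C k s}"
 by (rule S[unfolded souslin_scheme_def, THEN conjunct1, THEN spec, THEN spec, of k s],
  rule S[unfolded souslin_scheme_def, THEN conjunct2, THEN conjunct1, THEN spec, of k],
  rule S[unfolded souslin_scheme_def, THEN conjunct2, THEN conjunct2])

lemma souslin_rectangle:
 assumes "compact K" "K \<subseteq> I" "E \<in> sets N"
 shows "souslin_rect I N (K \<times> E)"
proof -
 have "\<exists>K' E'. compact K' \<and> K' \<subseteq> I \<and> E' \<in> sets N \<and> K \<times> E = K' \<times> E'"
  by (intro exI[of _ K] exI[of _ E] conjI assms refl)
 then have "souslin_scheme I N (K \<times> E) (\<lambda>k s. K \<times> E)" by (simp add: souslin_scheme_def)
 then show ?thesis unfolding souslin_rect_def by blast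
qed

text \<open>A pairing function merges the index sequences of all members into one.\<close>

lemma souslin_INT:
 assumes "\<And>i::nat. souslin_rect I N (A i)"
 shows "souslin_rect I N (\<Inter>i. A i)"
proof -
 from assms obtain C where C: "\<And>i. souslin_scheme I N (A i) (C i)" unfolding souslin_rect_def by metis
 have
  C1: "\<And>i k s. \<exists>K E. compact K \<and> K \<subseteq> I \<and> E \<in> sets N \<and> C i k s = K \<times> E" and
  C2: "\<And>i k. \<exists>m. \<forall>s s'. (\<forall>j<m. s j = s' j) \<longrightarrow> C i k s = C i k s'" and
  C3: "\<And>i. A i = {x. \<exists>s. \<forall>k. x \<in> C i k s}"
  by (rule souslin_schemeD[OF C])+
 let ?i = "\<lambda>k. fst (prod_decode k)" and ?k = "\<lambda>k. snd (prod_decode k)"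
 show ?thesis unfolding souslin_rect_def souslin_scheme_def
 proof (rule exI[of _ "\<lambda>k s. C (?i k) (?k k) (\<lambda>j. s (prod_encode (?i k, j)))"], intro conjI allI)
  show "\<exists>K E. compact K \<and> K \<subseteq> I \<and> E \<in> sets N \<and> C (?i k) (?k k) (\<lambda>j. s (prod_encode (?i k, j))) = K \<times> E" for k s
   by (rule C1)
  fix k
  obtain m where m: "\<And>s s'. (\<forall>j<m. s j = s' j) \<Longrightarrow> C (?i k) (?k k) s = C (?i k) (?k k) s'" using C2 by blast
  obtain m' where m': "\<And>j. j < m \<Longrightarrow> prod_encode (?i k, j) < m'"
  proof
   show "prod_encode (?i k, j) < Suc (\<Sum>j<m. prod_encode (?i k, j))" if "j < m" for j
    using member_le_sum[of j "{..<m}" "\<lambda>j. prod_encode (?i k, j)"] that by simp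
  qed
  show "\<exists>m. \<forall>s s'. (\<forall>j<m. s j = s' j) \<longrightarrow>
   C (?i k) (?k k) (\<lambda>j. s (prod_encode (?i k, j))) = C (?i k) (?k k) (\<lambda>j. s' (prod_encode (?i k, j)))"
   by (rule exI[of _ m']) (use m m' in auto)
 next
  show "(\<Inter>i. A i) = {x. \<exists>s. \<forall>k. x \<in> C (?i k) (?k k) (\<lambda>j. s (prod_encode (?i k, j)))}"
  proof (intro set_eqI iffI)
   fix x assume "x \<in> (\<Inter>i. A i)"
   then obtain s where s: "\<And>i k. x \<in> C i k (s i)" unfolding C3 by (auto; metis)
   let ?s = "\<lambda>p. s (?i p) (?k p)"
   have "x \<in> C (?i k) (?k k) (\<lambda>j. ?s (prod_encode (?i k, j)))" for k using s by simp
   then show "x \<in> {x. \<exists>s. \<forall>k. x \<in> C (?i k) (?k k) (\<lambda>j. s (prod_encode (?i k, j)))}"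
    by (intro CollectI exI[of _ ?s] allI)
  next
   fix x assume "x \<in> {x. \<exists>s. \<forall>k. x \<in> C (?i k) (?k k) (\<lambda>j. s (prod_encode (?i k, j)))}"
   then obtain s where s: "\<And>k. x \<in> C (?i k) (?k k) (\<lambda>j. s (prod_encode (?i k, j)))" by blast
   have "x \<in> C i k (\<lambda>j. s (prod_encode (i, j)))" for i k using s[of "prod_encode (i, k)"] by simp
   then show "x \<in> (\<Inter>i. A i)" unfolding C3 by blast
  qed
 qed
qed

lemma souslin_UN:
 assumes I: "compact I" and "\<And>i::nat. souslin_rect I N (A i)"
 shows "souslin_rect I N (\<Union>i. A i)"
proof -
 from assms(2) obtain C where C: "\<And>i. souslin_scheme I N (A i) (C i)" unfolding souslin_rect_def by metis
 have
  C1: "\<And>i k s. \<exists>K E. compact K \<and> K \<subseteq> I \<and> E \<in> sets N \<and> C i k s = K \<times> E" and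
  C2: "\<And>i k. \<exists>m. \<forall>s s'. (\<forall>j<m. s j = s' j) \<longrightarrow> C i k s = C i k s'" and
  C3: "\<And>i. A i = {x. \<exists>s. \<forall>k. x \<in> C i k s}"
  by (rule souslin_schemeD[OF C])+
 let ?i = "\<lambda>k. fst (prod_decode k)" and ?k = "\<lambda>k. snd (prod_decode k)"
 \<comment> \<open>The first entry of the new index sequence selects the member of the union.\<close>
 let ?C = "\<lambda>k s. if s 0 = ?i k then C (?i k) (?k k) (\<lambda>j. s (Suc j)) else I \<times> space N"
 have CI: "C i k s \<subseteq> I \<times> space N" for i k s
  using C1[of i k s] sets.sets_into_space by fastforce
 show ?thesis unfolding souslin_rect_def souslin_scheme_def
 proof (rule exI[of _ ?C], intro conjI allI)
  show "\<exists>K E. compact K \<and> K \<subseteq> I \<and> E \<in> sets N \<and> ?C k s = K \<times> E" for k s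
   using C1[of "?i k" "?k k" "\<lambda>j. s (Suc j)"] I by auto
  fix k
  obtain m where m: "\<And>s s'. (\<forall>j<m. s j = s' j) \<Longrightarrow> C (?i k) (?k k) s = C (?i k) (?k k) s'" using C2 by blast
  have "?C k s = ?C k s'" if "\<forall>j<Suc m. s j = s' j" for s s'
   using m[of "\<lambda>j. s (Suc j)" "\<lambda>j. s' (Suc j)"] that by auto
  then show "\<exists>m. \<forall>s s'. (\<forall>j<m. s j = s' j) \<longrightarrow> ?C k s = ?C k s'" by blast
 next
  show "(\<Union>i. A i) = {x. \<exists>s. \<forall>k. x \<in> ?C k s}"
  proof (intro set_eqI iffI)
   fix x assume "x \<in> (\<Union>i. A i)"
   then obtain i s where s: "\<And>k. x \<in> C i k s" unfolding C3 by auto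
   have "x \<in> ?C k (case_nat i s)" for k using s CI[of i 0 s] by auto
   then show "x \<in> {x. \<exists>s. \<forall>k. x \<in> ?C k s}" by blast
  next
   fix x assume "x \<in> {x. \<exists>s. \<forall>k. x \<in> ?C k s}"
   then obtain s where s: "\<And>k. x \<in> ?C k s" by blast
   have "x \<in> C (s 0) k (\<lambda>j. s (Suc j))" for k using s[of "prod_encode (s 0, k)"] by simp
   then show "x \<in> (\<Union>i. A i)" unfolding C3 by blast
  qed
 qed
qed

lemma souslin_Un:
 assumes "compact I" "souslin_rect I N A" "souslin_rect I N B"
 shows "souslin_rect I N (A \<union> B)"
proof -
 have "souslin_rect I N (\<Union>i::nat. case i of 0 \<Rightarrow> A | Suc _ \<Rightarrow> B)"
  using assms by (intro souslin_UN) (auto split: nat.split)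
 also have "(\<Union>i::nat. case i of 0 \<Rightarrow> A | Suc _ \<Rightarrow> B) = A \<union> B"
  by (rule antisym) (force split: nat.splits, auto intro: UN_I[of 0] UN_I[of 1])
 finally show ?thesis .
qed

lemma souslin_Int:
 assumes "souslin_rect I N A" "souslin_rect I N B"
 shows "souslin_rect I N (A \<inter> B)"
proof -
 have "souslin_rect I N (\<Inter>i::nat. case i of 0 \<Rightarrow> A | Suc _ \<Rightarrow> B)"
  using assms by (intro souslin_INT) (auto split: nat.split)
 also have "(\<Inter>i::nat. case i of 0 \<Rightarrow> A | Suc _ \<Rightarrow> B) = A \<inter> B"
 proof (intro equalityI subsetI)
  fix x assume x: "x \<in> (\<Inter>i::nat. case i of 0 \<Rightarrow> A | Suc _ \<Rightarrow> B)"
  show "x \<in> A \<inter> B" using INT_D[OF x, of 0] INT_D[OF x, of 1] by simp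
 qed (auto split: nat.split)
 finally show ?thesis .
qed

text \<open>The scheme is not closed under complements, so sets and complements are treated together.\<close>

lemma souslin_borel_time:
 fixes a b :: real
 assumes "X \<in> sets borel"
 shows "souslin_rect {a..b} N ((X \<inter> {a..b}) \<times> space N) \<and> souslin_rect {a..b} N (({a..b} - X) \<times> space N)"
proof -
 have "X \<in> sigma_sets UNIV (range (\<lambda>c::real. {..c}))"
  using assms unfolding borel_eq_atMost by (simp add: sets_measure_of_conv)
 then show ?thesis
 proof induction
  case (Basic X)
  then obtain c where X: "X = {..c}" by auto
  have 1: "compact (X \<inter> {a..b})" by (auto simp: X intro!: closed_Int_compact)
  have "({a..b} - X) \<times> space N = (\<Union>m::nat. ({c + inverse (real (Suc m))..} \<inter> {a..b}) \<times> space N)"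
  proof (intro set_eqI iffI)
   fix x assume x: "x \<in> ({a..b} - X) \<times> space N"
   then have "0 < fst x - c" by (auto simp: X)
   then obtain m where "inverse (real (Suc m)) < fst x - c" using reals_Archimedean by blast
   then show "x \<in> (\<Union>m::nat. ({c + inverse (real (Suc m))..} \<inter> {a..b}) \<times> space N)"
    using x by (cases x) (auto intro!: exI[of _ m])
  next
   fix x assume "x \<in> (\<Union>m::nat. ({c + inverse (real (Suc m))..} \<inter> {a..b}) \<times> space N)"
   then obtain m where m: "fst x \<ge> c + inverse (real (Suc m))" "fst x \<in> {a..b}" "snd x \<in> space N" by auto
   moreover have "0 < inverse (real (Suc m))" by simp
   ultimately have "c < fst x" by linarith
   then show "x \<in> ({a..b} - X) \<times> space N" using m by (cases x) (auto simp: X)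
  qed
  moreover have "souslin_rect {a..b} N (\<Union>m::nat. ({c + inverse (real (Suc m))..} \<inter> {a..b}) \<times> space N)"
   by (intro souslin_UN souslin_rectangle) (auto intro!: closed_Int_compact)
  ultimately show ?case using 1 by (auto intro!: souslin_rectangle)
 next
  case Empty
  show ?case by (auto intro!: souslin_rectangle[of "{}", simplified] souslin_rectangle)
 next
  case (Compl X)
  have "(UNIV - X) \<inter> {a..b} = {a..b} - X" "{a..b} - (UNIV - X) = X \<inter> {a..b}" by auto
  then show ?case using Compl.IH by simp
 next
  case (Union X)
  have eq: "(\<Union>(range X) \<inter> {a..b}) \<times> space N = (\<Union>i. (X i \<inter> {a..b}) \<times> space N)"
   "({a..b} - \<Union>(range X)) \<times> space N = (\<Inter>i. ({a..b} - X i) \<times> space N)" by auto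
  show ?case unfolding eq using Union.IH by (intro conjI souslin_UN souslin_INT compact_Icc) blast+
 qed
qed

lemma souslin_product_measurable:
 fixes a b :: real
 assumes "A \<in> sets (restrict_space borel {a..b} \<Otimes>\<^sub>M N)"
 shows "souslin_rect {a..b} N A"
proof -
 let ?O = "{a..b} \<times> space N"
 have "A \<in> sigma_sets ?O {x \<times> y |x y. x \<in> sets (restrict_space borel {a..b}) \<and> y \<in> sets N}"
  using assms unfolding sets_pair_measure by (simp add: space_restrict_space)
 then have "souslin_rect {a..b} N A \<and> souslin_rect {a..b} N (?O - A)"
 proof induction
  case (Basic A)
  then obtain x y where A: "A = x \<times> y" "x \<in> sets (restrict_space borel {a..b})" "y \<in> sets N" by blast
  then obtain X where X: "X \<in> sets borel" "x = X \<inter> {a..b}" by (auto simp: sets_restrict_space)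
  have ysp: "y \<subseteq> space N" using A sets.sets_into_space by auto
  have "A = ((X \<inter> {a..b}) \<times> space N) \<inter> ({a..b} \<times> y)" using A X ysp by auto
  moreover have "?O - A = ({a..b} - X) \<times> space N \<union> {a..b} \<times> (space N - y)" using A X ysp by auto
  moreover have "souslin_rect {a..b} N ({a..b} \<times> y)" "souslin_rect {a..b} N ({a..b} \<times> (space N - y))"
   using A(3) by (auto intro!: souslin_rectangle)
  ultimately show ?case using souslin_borel_time[OF X(1), of a b N]
   by (auto intro!: souslin_Int souslin_Un)
 next
  case Empty
  show ?case using souslin_rectangle[of "{}" "{a..b}" "{}" N] by (auto intro!: souslin_rectangle)
 next
  case (Compl A)
  have "A \<in> sets (restrict_space borel {a..b} \<Otimes>\<^sub>M N)"
   using Compl.hyps unfolding sets_pair_measure by (simp add: space_restrict_space)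
  from sets.sets_into_space[OF this] have "A \<subseteq> ?O" by (simp add: space_pair_measure space_restrict_space)
  then have "?O - (?O - A) = A" by auto
  with Compl.IH show ?case by simp
 next
  case (Union A)
  have eq: "?O - \<Union>(range A) = (\<Inter>i. ?O - A i)" by auto
  show ?case unfolding eq using Union.IH by (intro conjI souslin_UN souslin_INT compact_Icc) blast+
 qed
 then show ?thesis by simp
qed

text \<open>Choquet's capacitability argument: bounding the entries of the index sequence one after the
 other loses arbitrarily little outer measure of the projection, and once all entries are bounded,
 compactness lets the projection commute with the intersection over the conditions.\<close>

lemma souslin_projection_inner:
 assumes N: "finite_measure N" and A: "souslin_rect I N A" and I: "compact I"
  and c: "c < outer_measure_of N (snd ` A)"
 shows "\<exists>E\<in>sets N. E \<subseteq> snd ` A \<and> c \<le> emeasure N E"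
proof -
 interpret finite_measure N by (rule N)
 obtain C where C: "souslin_scheme I N A C" using A unfolding souslin_rect_def by blast
 note C1 = souslin_schemeD(1)[OF C] and C2' = souslin_schemeD(2)[OF C] and C3 = souslin_schemeD(3)[OF C]
 obtain K E where KE: "\<And>k s. compact (K k s)" "\<And>k s. K k s \<subseteq> I" "\<And>k s. E k s \<in> sets N" "\<And>k s. C k s = K k s \<times> E k s"
  using C1 by metis
 have "\<forall>k. \<exists>m. \<forall>s s'. (\<forall>j<m. s j = s' j) \<longrightarrow> C k s = C k s'" using C2' by blast
 then obtain d where "\<forall>k. \<forall>s s'. (\<forall>j<d k. s j = s' j) \<longrightarrow> C k s = C k s'" by (rule choice[THEN exE])
 then have C2: "C k s = C k s'" if "\<forall>j<d k. s j = s' j" for k s s' using that by blast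
 define AA where "AA l = {x. \<exists>s. (\<forall>j<length l. s j \<le> l ! j) \<and> (\<forall>k. x \<in> C k s)}" for l :: "nat list"
 have AA_space: "snd ` AA l \<subseteq> space N" for l
 proof
  fix w assume "w \<in> snd ` AA l"
  then obtain x where x: "x \<in> AA l" "w = snd x" by blast
  then obtain s where "\<forall>k. x \<in> C k s" by (auto simp: AA_def)
  then have "x \<in> C 0 s" by blast
  then show "w \<in> space N" using sets.sets_into_space[OF KE(3)[of 0 s]] x(2) by (auto simp: KE(4))
 qed
 \<comment> \<open>Continuity of the outer measure along increasing sequences allows a bound for the next entry.\<close>
 have step: "\<exists>p. c < outer_measure_of N (snd ` AA (l @ [p]))" if "c < outer_measure_of N (snd ` AA l)" for l
 proof -
  have "snd ` AA l = (\<Union>p. snd ` AA (l @ [p]))"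
  proof -
   have "AA l = (\<Union>p. AA (l @ [p]))"
   proof (intro set_eqI iffI)
    fix x assume "x \<in> AA l"
    then obtain s where s: "\<forall>j<length l. s j \<le> l ! j" "\<forall>k. x \<in> C k s" by (auto simp: AA_def)
    then have "x \<in> AA (l @ [s (length l)])" unfolding AA_def
     by (auto intro!: exI[of _ s] simp: nth_append less_Suc_eq)
    then show "x \<in> (\<Union>p. AA (l @ [p]))" by blast
   next
    fix x assume "x \<in> (\<Union>p. AA (l @ [p]))"
    then obtain p s where s: "\<forall>j<length (l @ [p]). s j \<le> (l @ [p]) ! j" "\<forall>k. x \<in> C k s" by (auto simp: AA_def)
    have "\<forall>j<length l. s j \<le> l ! j"
    proof (intro allI impI)
     fix j assume "j < length l" then show "s j \<le> l ! j" using s(1)[rule_format, of j] by (simp add: nth_append)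
    qed
    with s(2) show "x \<in> AA l" by (auto simp: AA_def)
   qed
   then show ?thesis by auto
  qed
  moreover have "incseq (\<lambda>p. snd ` AA (l @ [p]))"
  proof (intro monoI image_mono subsetI)
   fix p q :: nat and x assume "p \<le> q" "x \<in> AA (l @ [p])"
   then obtain s where s: "\<forall>j<length (l @ [p]). s j \<le> (l @ [p]) ! j" "\<forall>k. x \<in> C k s" by (auto simp: AA_def)
   have "\<forall>j<length (l @ [q]). s j \<le> (l @ [q]) ! j"
   proof (intro allI impI)
    fix j assume "j < length (l @ [q])"
    then show "s j \<le> (l @ [q]) ! j" using s(1)[rule_format, of j] \<open>p \<le> q\<close>
     by (cases "j = length l") (auto simp: nth_append)
   qed
   with s(2) show "x \<in> AA (l @ [q])" by (auto simp: AA_def)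
  qed
  ultimately have "(SUP p. outer_measure_of N (snd ` AA (l @ [p]))) = outer_measure_of N (snd ` AA l)"
   using SUP_outer_measure_of_incseq[of "\<lambda>p. snd ` AA (l @ [p])" N] AA_space by simp
  with that have "c < (SUP p. outer_measure_of N (snd ` AA (l @ [p])))" by simp
  then show ?thesis unfolding less_SUP_iff by blast
 qed
 have "AA [] = A" by (simp add: AA_def C3)
 then have "c < outer_measure_of N (snd ` AA [])" using c by simp
 then have "\<exists>n. \<forall>m. c < outer_measure_of N (snd ` AA (map n [0..<m]))"
  by (rule sequence_of_prefixes[of "\<lambda>l. c < outer_measure_of N (snd ` AA l)", OF _ step])
 then obtain n where n: "\<And>m. c < outer_measure_of N (snd ` AA (map n [0..<m]))" by blast
 \<comment> \<open>With all entries bounded by \<open>n\<close>, the sets \<open>D m\<close> impose the first \<open>m\<close> conditions. Only finitely many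
  entries matter for each of them, so their projections are measurable.\<close>
 define Box where "Box = {s::nat \<Rightarrow> nat. \<forall>j. s j \<le> n j}"
 define D where "D m = {x. \<exists>s\<in>Box. \<forall>k\<le>m. x \<in> C k s}" for m :: nat
 have D_dec: "decseq (\<lambda>m. snd ` D m)" unfolding decseq_def D_def
  by (intro allI impI image_mono Collect_mono) (meson le_trans)
 have D_c: "c < outer_measure_of N (snd ` D m)" for m
 proof -
  define q where "q = (\<Sum>k\<le>m. d k)"
  have q: "d k \<le> q" if "k \<le> m" for k unfolding q_def using that by (intro member_le_sum) auto
  have "AA (map n [0..<q]) \<subseteq> D m"
  proof
   fix x assume "x \<in> AA (map n [0..<q])"
   then obtain s where s: "\<And>j. j < q \<Longrightarrow> s j \<le> n j" "\<And>k. x \<in> C k s" by (auto simp: AA_def)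
   have "C k (\<lambda>j. min (s j) (n j)) = C k s" if "k \<le> m" for k
    by (rule C2) (use s(1) q[OF that] in \<open>auto simp: min_def\<close>)
   then show "x \<in> D m" unfolding D_def Box_def
    using s(2) by (auto intro!: exI[of _ "\<lambda>j. min (s j) (n j)"])
  qed
  then have "outer_measure_of N (snd ` AA (map n [0..<q])) \<le> outer_measure_of N (snd ` D m)"
   by (intro outer_measure_of_mono image_mono)
  with n[of q] show ?thesis by simp
 qed
 have D_meas: "snd ` D m \<in> sets N" for m
 proof -
  define q where "q = (\<Sum>k\<le>m. d k)"
  have q: "d k \<le> q" if "k \<le> m" for k unfolding q_def using that by (intro member_le_sum) auto
  define t where "t l = (\<lambda>j. if j < q then l ! j else (0::nat))" for l
  define Ls where "Ls = {l :: nat list. t l \<in> Box}"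
  have "D m = (\<Union>l\<in>Ls. {x. \<forall>k\<le>m. x \<in> C k (t l)})"
  proof (intro set_eqI iffI)
   fix x assume "x \<in> D m"
   then obtain s where s: "s \<in> Box" "\<forall>k\<le>m. x \<in> C k s" by (auto simp: D_def)
   let ?l = "map s [0..<q]"
   have "C k (t ?l) = C k s" if "k \<le> m" for k by (rule C2) (use q[OF that] in \<open>auto simp: t_def\<close>)
   moreover have "?l \<in> Ls" using s(1) by (auto simp: Ls_def Box_def t_def)
   ultimately show "x \<in> (\<Union>l\<in>Ls. {x. \<forall>k\<le>m. x \<in> C k (t l)})" using s(2) by (auto intro!: bexI[of _ ?l])
  qed (auto simp: D_def Ls_def)
  then have "snd ` D m = (\<Union>l\<in>Ls. snd ` {x. \<forall>k\<le>m. x \<in> C k (t l)})" by auto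
  moreover have "snd ` {x. \<forall>k\<le>m. x \<in> C k s} \<in> sets N" for s
  proof -
   have "{x. \<forall>k\<le>m. x \<in> C k s} = (\<Inter>k\<in>{..m}. K k s) \<times> (\<Inter>k\<in>{..m}. E k s)" by (auto simp: KE(4))
   then have "snd ` {x. \<forall>k\<le>m. x \<in> C k s} = (if (\<Inter>k\<in>{..m}. K k s) = {} then {} else (\<Inter>k\<in>{..m}. E k s))"
    by (simp only:) auto
   moreover have "(\<Inter>k\<in>{..m}. E k s) \<in> sets N" using KE(3) by (intro sets.finite_INT) auto
   ultimately show ?thesis by simp
  qed
  ultimately show ?thesis by (simp only:) (intro sets.countable_UN'' , auto)
 qed
 have sub: "(\<Inter>m. snd ` D m) \<subseteq> snd ` A"
 proof
  fix w assume w: "w \<in> (\<Inter>m. snd ` D m)"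
  have "\<exists>v s. s \<in> Box \<and> (\<forall>k\<le>m. (v, w) \<in> C k s)" for m
  proof -
   have "w \<in> snd ` D m" using w by blast
   then show ?thesis by (force simp: D_def)
  qed
  then obtain v s where vs: "\<And>m::nat. s m \<in> Box" "\<And>m k. k \<le> m \<Longrightarrow> (v m, w) \<in> C k (s m)" by metis
  \<comment> \<open>Koenig's lemma: some \<open>z\<close> agrees with infinitely many \<open>s m\<close> on each finite initial segment.\<close>
  have "\<exists>z. \<forall>p. infinite {m. \<forall>j<length (map z [0..<p]). s m j = map z [0..<p] ! j}"
  proof (rule sequence_of_prefixes[of "\<lambda>l. infinite {m. \<forall>j<length l. s m j = l ! j}"])
   fix l :: "nat list" assume inf: "infinite {m. \<forall>j<length l. s m j = l ! j}"
   have "{m. \<forall>j<length l. s m j = l ! j} \<subseteq> (\<Union>p\<in>{..n (length l)}. {m. \<forall>j<length (l @ [p]). s m j = (l @ [p]) ! j})"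
   proof
    fix m assume "m \<in> {m. \<forall>j<length l. s m j = l ! j}"
    moreover have "s m (length l) \<le> n (length l)" using vs(1)[of m] by (simp add: Box_def)
    ultimately show "m \<in> (\<Union>p\<in>{..n (length l)}. {m. \<forall>j<length (l @ [p]). s m j = (l @ [p]) ! j})"
     by (auto simp: nth_append less_Suc_eq)
   qed
   with inf show "\<exists>p. infinite {m. \<forall>j<length (l @ [p]). s m j = (l @ [p]) ! j}"
    by (metis (no_types, lifting) finite_UN finite_atMost finite_subset)
  qed simp
  then obtain z where z: "\<And>p. infinite {m. \<forall>j<length (map z [0..<p]). s m j = map z [0..<p] ! j}" by blast
  have "\<exists>m\<ge>p. \<forall>j<p. s m j = z j" for p
  proof -
   have "{m. \<forall>j<length (map z [0..<p]). s m j = map z [0..<p] ! j} = {m. \<forall>j<p. s m j = z j}" by auto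
   then have "infinite {m. \<forall>j<p. s m j = z j}" using z[of p] by simp
   then show ?thesis unfolding infinite_nat_iff_unbounded_le by blast
  qed
  then obtain g where g: "\<And>p. p \<le> g p" "\<And>p j. j < p \<Longrightarrow> s (g p) j = z j" by metis
  have "v (g p) \<in> I" for p using vs(2)[of 0 "g p"] KE(2) by (auto simp: KE(4))
  then obtain x r where r: "x \<in> I" "strict_mono r" "((\<lambda>p. v (g p)) \<circ> r) \<longlonglongrightarrow> x"
   using I unfolding compact_def by metis
  have "(x, w) \<in> C k z" for k
  proof -
   have ev: "v (g (r p)) \<in> K k z \<and> w \<in> E k z" if "p \<ge> max k (d k)" for p
   proof -
    have "r p \<ge> p" using r(2) by (rule seq_suble)
    then have "C k (s (g (r p))) = C k z" using that by (intro C2) (auto intro!: g(2))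
    moreover have "(v (g (r p)), w) \<in> C k (s (g (r p)))"
     using that \<open>r p \<ge> p\<close> g(1)[of "r p"] by (intro vs(2)) auto
    ultimately show ?thesis by (simp add: KE(4))
   qed
   have "x \<in> K k z"
   proof (rule closed_sequentially[OF compact_imp_closed[OF KE(1)]])
    show "(\<lambda>p. v (g (r (p + max k (d k))))) \<longlonglongrightarrow> x"
     using LIMSEQ_ignore_initial_segment[OF r(3), of "max k (d k)"] by (simp add: o_def)
    show "v (g (r (p + max k (d k)))) \<in> K k z" for p using ev[of "p + max k (d k)"] by simp
   qed
   then show ?thesis using ev[of "max k (d k)"] by (simp add: KE(4))
  qed
  then show "w \<in> snd ` A" unfolding C3 by (force intro!: image_eqI[of _ _ "(x, w)"])
 qed
 have "c \<le> emeasure N (\<Inter>m. snd ` D m)"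
 proof -
  have "emeasure N (\<Inter>m. snd ` D m) = (INF m. emeasure N (snd ` D m))"
   using D_meas D_dec by (intro INF_emeasure_decseq[symmetric]) auto
  moreover have "c \<le> emeasure N (snd ` D m)" for m
   using D_c[of m] outer_measure_of_eq[OF D_meas[of m]] by simp
  ultimately show ?thesis by (simp add: le_INF_iff)
 qed
 then show ?thesis using sub D_meas by (intro bexI[of _ "\<Inter>m. snd ` D m"]) auto
qed

text \<open>The projection has measurable subsets of measure arbitrarily close to its outer measure, hence is
 measurable up to a null set; completeness does the rest.\<close>

theorem measurable_projection:
 fixes a b :: real
 assumes N: "finite_measure N" and compl: "complete_measure N"
  and A: "A \<in> sets (restrict_space borel {a..b} \<Otimes>\<^sub>M N)"
 shows "snd ` A \<in> sets N"
proof -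
 interpret finite_measure N by (rule N)
 have S: "souslin_rect {a..b} N A" by (rule souslin_product_measurable[OF A])
 have Asp: "snd ` A \<subseteq> space N" using sets.sets_into_space[OF A] by (auto simp: space_pair_measure)
 obtain H where H: "H \<in> sets N" "snd ` A \<subseteq> H" "outer_measure_of N (snd ` A) = emeasure N H"
  using outer_measure_of_attain[OF Asp] by blast
 define p where "p = measure N H"
 have p: "outer_measure_of N (snd ` A) = ennreal p" using H(3) by (simp add: p_def emeasure_eq_measure)
 have "\<exists>E\<in>sets N. E \<subseteq> snd ` A \<and> p - inverse (real (Suc i)) \<le> measure N E" for i
 proof (cases "p - inverse (real (Suc i)) \<le> 0")
  case True then show ?thesis by (intro bexI[of _ "{}"]) auto
 next
  case False
  have i: "0 < inverse (real (Suc i))" by simp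
  then have "0 < p" using False by linarith
  then have "ennreal (p - inverse (real (Suc i))) < outer_measure_of N (snd ` A)"
   unfolding p using i by (intro ennreal_lessI) linarith+
  from souslin_projection_inner[OF N S _ this] obtain E
   where E: "E \<in> sets N" "E \<subseteq> snd ` A" "ennreal (p - inverse (real (Suc i))) \<le> emeasure N E" by auto
  then show ?thesis by (auto simp: emeasure_eq_measure)
 qed
 then obtain E where E: "\<And>i. E i \<in> sets N" "\<And>i. E i \<subseteq> snd ` A"
  "\<And>i. p - inverse (real (Suc i)) \<le> measure N (E i)" by metis
 let ?E = "\<Union>i. E i"
 have Em: "?E \<in> sets N" using E(1) by auto
 have "p - inverse (real (Suc i)) \<le> measure N ?E" for i
  using E(3)[of i] finite_measure_mono[of "E i" ?E] Em by force
 moreover have "(\<lambda>i. p - inverse (real (Suc i))) \<longlonglongrightarrow> p - 0"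
  by (intro tendsto_intros LIMSEQ_inverse_real_of_nat)
 ultimately have "p \<le> measure N ?E" by (intro LIMSEQ_le_const2[of _ p]) auto
 then have "measure N (H - ?E) \<le> 0"
  using E(2) H Em by (subst finite_measure_Diff) (auto simp: p_def)
 then have "H - ?E \<in> null_sets N" using H(1) Em by (auto simp: null_sets_def emeasure_eq_measure measure_le_0_iff)
 then have "snd ` A - ?E \<in> sets N"
  using complete_measure.complete[OF compl, of "snd ` A - ?E" "H - ?E"] H(2) by auto
 moreover have "snd ` A = (snd ` A - ?E) \<union> ?E" using E(2) by auto
 ultimately show ?thesis using Em by (metis sets.Un)
qed

lemma (in usual_filtered_prob_space) measurable_projection_F:
 assumes t: "t \<in> {0..T}" and A: "A \<in> sets (restrict_space borel {0..t} \<Otimes>\<^sub>M F t)"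
 shows "snd ` A \<in> sets (F t)"
proof -
 let ?N = "restr_to_subalg M (F t)"
 note sub = subalgebra_F[OF t]
 have sN: "sets ?N = sets (F t)" by (rule sets_restr_to_subalg[OF sub])
 have "finite_measure ?N" using finite_measure_restr_to_subalg[OF sub] emeasure_space_1
  by (auto intro!: finite_measureI simp: space_restr_to_subalg emeasure_restr_to_subalg[OF sub] subalgebra_def)
 moreover have "complete_measure ?N"
 proof
  fix A B assume "B \<subseteq> A" "A \<in> null_sets ?N"
  then have "B \<in> null_sets M" using null_sets_restr_to_subalg[OF sub] complete2[of B A] by auto
  then show "B \<in> sets ?N" using null_sets_in_F[of B t] t sN by auto
 qed
 moreover have "A \<in> sets (restrict_space borel {0..t} \<Otimes>\<^sub>M ?N)"
  using A sets_pair_measure_cong[OF refl sN[symmetric], of "restrict_space borel {0..t}"] by simp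
 ultimately show ?thesis using measurable_projection[of ?N A 0 t] sN by simp
qed

section \<open>Optional and progressively measurable processes\<close>

lemma fst_restrict_borel: "fst \<in> borel_measurable (restrict_space borel A \<Otimes>\<^sub>M N)"
proof -
 have "(\<lambda>x. x) \<in> borel_measurable (restrict_space borel A)" by (intro measurable_restrict_space1) simp
 from measurable_compose[OF measurable_fst[of "restrict_space borel A" N] this] show ?thesis by simp
qed

context usual_filtered_prob_space
begin

lemma progressiveD: "progressively_measurable F T X \<Longrightarrow> t \<in> {0..T} \<Longrightarrow>
  (\<lambda>(s, \<omega>). X s \<omega>) \<in> borel_measurable (restrict_space borel {0..t} \<Otimes>\<^sub>M F t)"
 by (auto simp: progressively_measurable_def)

lemma progressive_section:
 assumes "progressively_measurable F T X" "t \<in> {0..T}" "s \<in> {0..t}"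
 shows "X s \<in> borel_measurable (F t)"
proof -
 have "Pair s \<in> F t \<rightarrow>\<^sub>M restrict_space borel {0..t} \<Otimes>\<^sub>M F t"
  using assms(3) by (intro measurable_Pair1') (simp add: space_restrict_space)
 from measurable_compose[OF this progressiveD[OF assms(1,2)]] show ?thesis by simp
qed

text \<open>Right-continuity makes \<open>X\<close> on \<open>[0,t]\<close> a pointwise limit of step processes that look ahead to the next
 grid point, but not beyond \<open>t\<close>.\<close>

lemma cadlag_progressive:
 assumes X: "cadlag_adapted M F T X"
 shows "progressively_measurable F T X"
 unfolding progressively_measurable_def
proof
 fix t assume t: "t \<in> {0..T}"
 let ?N = "restrict_space borel {0..t} \<Otimes>\<^sub>M F t"
 define q where "q k s = max 0 (min t ((real_of_int \<lfloor>s * real (Suc k)\<rfloor> + 1) / real (Suc k)))" for k :: nat and s :: real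
 show "(\<lambda>(s, \<omega>). X s \<omega>) \<in> borel_measurable ?N"
 proof (rule borel_measurable_LIMSEQ_real[where u="\<lambda>k x. X (q k (fst x)) (snd x)"])
  fix k
  have "(\<lambda>x. (\<lambda>(j::int) x. X (max 0 (min t ((real_of_int j + 1) / real (Suc k)))) (snd x)) \<lfloor>fst x * real (Suc k)\<rfloor> x) \<in> borel_measurable ?N"
  proof (rule measurable_compose_countable[where f="\<lambda>j x. X (max 0 (min t ((real_of_int j + 1) / real (Suc k)))) (snd x)"
    and g="\<lambda>x. \<lfloor>fst x * real (Suc k)\<rfloor>"])
   fix j :: int
   let ?u = "max 0 (min t ((real_of_int j + 1) / real (Suc k)))"
   have u: "?u \<in> {0..T}" "?u \<le> t" using t by auto
   have "X ?u \<in> borel_measurable (F ?u)" using X u(1) unfolding cadlag_adapted_def by blast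
   then have "X ?u \<in> borel_measurable (F t)" using u(2) measurable_F_le by blast
   then show "(\<lambda>x. X ?u (snd x)) \<in> borel_measurable ?N" by (rule measurable_compose[OF measurable_snd])
  next
   have "(\<lambda>x. fst x * real (Suc k)) \<in> borel_measurable ?N"
    using fst_restrict_borel by (intro borel_measurable_times) auto
   then show "(\<lambda>x. \<lfloor>fst x * real (Suc k)\<rfloor>) \<in> ?N \<rightarrow>\<^sub>M count_space UNIV"
    by (rule measurable_compose[OF _ measurable_real_floor])
  qed
  then show "(\<lambda>x. X (q k (fst x)) (snd x)) \<in> borel_measurable ?N" by (simp add: q_def)
 next
  fix x assume "x \<in> space ?N"
  then obtain s \<omega> where x: "x = (s, \<omega>)" "0 \<le> s" "s \<le> t" "\<omega> \<in> space M"
   by (auto simp: space_pair_measure space_restrict_space space_F)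
  have qb: "s < (real_of_int \<lfloor>s * real (Suc k)\<rfloor> + 1) / real (Suc k)"
   "(real_of_int \<lfloor>s * real (Suc k)\<rfloor> + 1) / real (Suc k) \<le> s + inverse (real (Suc k))" for k
  proof -
   show "s < (real_of_int \<lfloor>s * real (Suc k)\<rfloor> + 1) / real (Suc k)"
    by (subst pos_less_divide_eq) (simp, linarith)
   have "real_of_int \<lfloor>s * real (Suc k)\<rfloor> + 1 \<le> (s + inverse (real (Suc k))) * real (Suc k)"
    by (simp add: distrib_right del: of_nat_Suc)
   then show "(real_of_int \<lfloor>s * real (Suc k)\<rfloor> + 1) / real (Suc k) \<le> s + inverse (real (Suc k))"
    by (subst pos_divide_le_eq) simp_all
  qed
  show "(\<lambda>k. X (q k (fst x)) (snd x)) \<longlonglongrightarrow> (case x of (s, \<omega>) \<Rightarrow> X s \<omega>)"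
  proof (cases "s = t")
   case True
   then have "q k s = s" for k using qb(1)[of k] x by (simp add: q_def)
   then show ?thesis using x by simp
  next
   case False
   then have st: "s < t" using x by simp
   have q1: "s < q k s" for k using qb(1)[of k] x st by (simp add: q_def)
   have q2: "q k s \<le> s + inverse (real (Suc k))" for k
    using qb[of k] x by (auto simp: q_def)
   have "(\<lambda>k. s + inverse (real (Suc k))) \<longlonglongrightarrow> s + 0" by (intro tendsto_intros LIMSEQ_inverse_real_of_nat)
   then have "(\<lambda>k. q k s) \<longlonglongrightarrow> s"
    by (intro tendsto_sandwich[of "\<lambda>_. s" "\<lambda>k. q k s" sequentially "\<lambda>k. s + inverse (real (Suc k))"])
     (use q1 q2 in \<open>auto intro!: always_eventually less_imp_le\<close>)
   then have "filterlim (\<lambda>k. q k s) (at_right s) sequentially"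
   proof -
    have "q k s \<in> {s<..} \<and> q k s \<noteq> s" for k using q1[of k] by simp
    with \<open>(\<lambda>k. q k s) \<longlonglongrightarrow> s\<close> show ?thesis unfolding filterlim_at by simp
   qed
   moreover have "((\<lambda>s. X s \<omega>) \<longlongrightarrow> X s \<omega>) (at_right s)"
    using X x st t unfolding cadlag_adapted_def by auto
   ultimately have "(\<lambda>k. X (q k s) \<omega>) \<longlonglongrightarrow> X s \<omega>" by (rule filterlim_compose[rotated])
   then show ?thesis using x by simp
  qed
 qed
qed

lemma space_optional_sigma: "space (optional_sigma M F T) = {0..T} \<times> space M"
 unfolding optional_sigma_def by (rule space_measure_of) auto

lemma optional_progressive:
 assumes X: "optional_process M F T X"
 shows "progressively_measurable F T X"
 unfolding progressively_measurable_def
proof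
 fix t assume t: "t \<in> {0..T}"
 let ?N = "restrict_space borel {0..t} \<Otimes>\<^sub>M F t"
 have spN: "space ?N = {0..t} \<times> space M" by (simp add: space_pair_measure space_restrict_space space_F)
 have "(\<lambda>x. x) \<in> ?N \<rightarrow>\<^sub>M optional_sigma M F T"
  unfolding optional_sigma_def
 proof (rule measurable_measure_of)
  show "(\<lambda>x. x) \<in> space ?N \<rightarrow> {0..T} \<times> space M" using t by (auto simp: spN)
  fix y assume "y \<in> {{(t, \<omega>). t \<in> {0..T} \<and> \<omega> \<in> space M \<and> X t \<omega> \<in> B} |X B. cadlag_adapted M F T X \<and> B \<in> sets borel}"
  then obtain X B where XB: "cadlag_adapted M F T X" "B \<in> sets borel"
   and y: "y = {(t, \<omega>). t \<in> {0..T} \<and> \<omega> \<in> space M \<and> X t \<omega> \<in> B}" by blast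
  have "(\<lambda>(s, \<omega>). X s \<omega>) -` B \<inter> space ?N \<in> sets ?N"
   using progressiveD[OF cadlag_progressive[OF XB(1)] t] XB(2) by (rule measurable_sets)
  also have "(\<lambda>(s, \<omega>). X s \<omega>) -` B \<inter> space ?N = (\<lambda>x. x) -` y \<inter> space ?N"
   using t by (auto simp: spN y)
  finally show "(\<lambda>x. x) -` y \<inter> space ?N \<in> sets ?N" .
 qed auto
 from measurable_compose[OF this X[unfolded optional_process_def]]
 show "(\<lambda>(s, \<omega>). X s \<omega>) \<in> borel_measurable ?N" by simp
qed

lemma optional_adapted: "optional_process M F T X \<Longrightarrow> t \<in> {0..T} \<Longrightarrow> X t \<in> borel_measurable (F t)"
 by (rule progressive_section[OF optional_progressive]) auto

lemma optional_cong:
 assumes "\<And>t \<omega>. t \<in> {0..T} \<Longrightarrow> \<omega> \<in> space M \<Longrightarrow> X t \<omega> = Z t \<omega>"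
 shows "optional_process M F T X \<longleftrightarrow> optional_process M F T Z"
 unfolding optional_process_def by (rule measurable_cong) (use assms in \<open>auto simp: space_optional_sigma\<close>)

lemma cadlag_optional:
 assumes X: "cadlag_adapted M F T X"
 shows "optional_process M F T X"
 unfolding optional_process_def
proof (rule measurableI)
 fix B :: "real set" assume B: "B \<in> sets borel"
 have "(\<lambda>(t, \<omega>). X t \<omega>) -` B \<inter> space (optional_sigma M F T) = {(t, \<omega>). t \<in> {0..T} \<and> \<omega> \<in> space M \<and> X t \<omega> \<in> B}"
  by (auto simp: space_optional_sigma)
 moreover have "{(t, \<omega>). t \<in> {0..T} \<and> \<omega> \<in> space M \<and> X t \<omega> \<in> B} \<in> sets (optional_sigma M F T)"
  unfolding optional_sigma_def using X B by (subst sets_measure_of) (auto intro!: sigma_sets.Basic)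
 ultimately show "(\<lambda>(t, \<omega>). X t \<omega>) -` B \<inter> space (optional_sigma M F T) \<in> sets (optional_sigma M F T)" by simp
qed auto

lemma cadlag_step:
 assumes c: "c \<in> {0..T}" and Z: "Z \<in> borel_measurable (F c)"
 shows "cadlag_adapted M F T (\<lambda>t \<omega>. Z \<omega> * indicator {c..} t)"
 unfolding cadlag_adapted_def
proof (intro conjI ballI)
 fix t
 show "(\<lambda>\<omega>. Z \<omega> * indicator {c..} t) \<in> borel_measurable (F t)"
 proof (cases "c \<le> t")
  case True then show ?thesis using measurable_F_le[OF True Z] by simp
 qed simp
next
 fix \<omega> t
 have "\<forall>\<^sub>F s in at_right t. Z \<omega> * indicator {c..} s = Z \<omega> * indicator {c..} t"
 proof (cases "c \<le> t")
  case True
  from eventually_at_right_less[of t] show ?thesis by (rule eventually_mono) (use True in \<open>auto simp: indicator_def\<close>)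
 next
  case False
  then have "\<forall>\<^sub>F s in at_right t. s < c" by (intro eventually_at_right_real order_tendstoD(2)[OF tendsto_ident_at]) auto
  then show ?thesis by (rule eventually_mono) (use False in \<open>auto simp: indicator_def\<close>)
 qed
 then show "((\<lambda>s. Z \<omega> * indicator {c..} s) \<longlongrightarrow> Z \<omega> * indicator {c..} t) (at_right t)" by (rule tendsto_eventually)
 show "\<exists>l. ((\<lambda>s. Z \<omega> * indicator {c..} s) \<longlongrightarrow> l) (at_left t)"
 proof (cases "c < t")
  case True
  then have "\<forall>\<^sub>F s in at_left t. c < s" by (intro order_tendstoD(1)[OF tendsto_ident_at])
  then have "\<forall>\<^sub>F s in at_left t. Z \<omega> * indicator {c..} s = Z \<omega>"
   by (rule eventually_mono) (auto simp: indicator_def)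
  then show ?thesis by (intro exI[of _ "Z \<omega>"] tendsto_eventually)
 next
  case False
  have "\<forall>\<^sub>F s in at_left t. s < t" by (simp add: eventually_at_filter)
  then have "\<forall>\<^sub>F s in at_left t. Z \<omega> * indicator {c..} s = 0"
   by (rule eventually_mono) (use False in \<open>auto simp: indicator_def\<close>)
  then show ?thesis by (intro exI[of _ 0] tendsto_eventually)
 qed
qed

text \<open>Limit of the cadlag steps at times decreasing to \<open>a\<close>.\<close>

lemma optional_late_step:
 assumes a: "a \<in> {0..<T}" and Z: "Z \<in> borel_measurable (F a)"
 shows "optional_process M F T (\<lambda>t \<omega>. Z \<omega> * indicator {a<..} t)"
proof -
 define c where "c m = a + (T - a) * inverse (real (Suc m))" for m
 have c: "a < c m" "c m \<le> T" for m
 proof -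
  show "a < c m" using a by (simp add: c_def)
  have "(T - a) * inverse (real (Suc m)) \<le> (T - a) * 1" using a by (intro mult_left_mono) (auto simp: field_simps)
  then show "c m \<le> T" by (simp add: c_def)
 qed
 show ?thesis unfolding optional_process_def
 proof (rule borel_measurable_LIMSEQ_real[where u="\<lambda>m x. Z (snd x) * indicator {c m..} (fst x)"])
 fix m
 have "cadlag_adapted M F T (\<lambda>t \<omega>. Z \<omega> * indicator {c m..} t)"
  using c[of m] a by (intro cadlag_step measurable_F_le[OF _ Z]) auto
 from cadlag_optional[OF this]
 show "(\<lambda>x. Z (snd x) * indicator {c m..} (fst x)) \<in> borel_measurable (optional_sigma M F T)"
  by (simp only: optional_process_def case_prod_beta')
next
 fix x :: "real \<times> 'a"
 obtain t \<omega> where x: "x = (t, \<omega>)" by (cases x)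
 have lim: "c \<longlonglongrightarrow> a + (T - a) * 0" unfolding c_def by (intro tendsto_intros LIMSEQ_inverse_real_of_nat)
 have "\<forall>\<^sub>F m in sequentially. Z \<omega> * indicator {c m..} t = Z \<omega> * indicator {a<..} t"
 proof (cases "a < t")
  case True
  then have "\<forall>\<^sub>F m in sequentially. c m < t" using lim by (intro order_tendstoD(2)) auto
  then show ?thesis by (rule eventually_mono) (use True in \<open>auto simp: indicator_def\<close>)
 next
  case False
  have "a < c m" for m using a by (simp add: c_def)
  then have "\<not> c m \<le> t" for m using False by (meson le_less_trans less_le_trans not_less)
  then show ?thesis using False by simp
 qed
 then show "(\<lambda>m. Z (snd x) * indicator {c m..} (fst x)) \<longlonglongrightarrow> (case x of (t, \<omega>) \<Rightarrow> Z \<omega> * indicator {a<..} t)"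
  using x by (simp add: tendsto_eventually)
 qed
qed

text \<open>For a non-decreasing non-negative process \<open>A\<close>, the supremum below is its left limit; as a
 countable supremum of left-continuous steps it is optional.\<close>

definition sup_before :: "(real \<Rightarrow> 'a \<Rightarrow> real) \<Rightarrow> real \<Rightarrow> 'a \<Rightarrow> real" where
 "sup_before A t \<omega> = (SUP q\<in>\<rat> \<inter> {0..<T}. A q \<omega> * indicator {q<..} t)"

lemma sup_before_optional:
 assumes A: "\<And>q. q \<in> {0..<T} \<Longrightarrow> A q \<in> borel_measurable (F q)"
  and b: "\<And>q \<omega>. q \<in> {0..<T} \<Longrightarrow> \<omega> \<in> space M \<Longrightarrow> 0 \<le> A q \<omega> \<and> A q \<omega> \<le> c"
 shows "optional_process M F T (sup_before A)"
proof -
 have "(\<lambda>x. SUP q\<in>\<rat> \<inter> {0..<T}. A q (snd x) * indicator {q<..} (fst x)) \<in> borel_measurable (optional_sigma M F T)"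
 proof (rule borel_measurable_cSUP[where F="\<lambda>q x. A q (snd x) * indicator {q<..} (fst x)" and I="\<rat> \<inter> {0..<T}"])
  show "countable (\<rat> \<inter> {0..<T})" by (simp add: countable_rat countable_Int1)
  show "(\<lambda>x. A q (snd x) * indicator {q<..} (fst x)) \<in> borel_measurable (optional_sigma M F T)"
   if "q \<in> \<rat> \<inter> {0..<T}" for q
  proof -
   have q: "q \<in> {0..<T}" using that by simp
   from optional_late_step[OF q A[OF q]] show ?thesis by (simp only: optional_process_def case_prod_beta')
  qed
  fix x assume "x \<in> space (optional_sigma M F T)"
  then have w: "snd x \<in> space M" by (auto simp: space_optional_sigma)
  show "bdd_above ((\<lambda>q. A q (snd x) * indicator {q<..} (fst x)) ` (\<rat> \<inter> {0..<T}))"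
  proof (rule bdd_aboveI2)
   fix q assume "q \<in> \<rat> \<inter> {0..<T}"
   then show "A q (snd x) * indicator {q<..} (fst x) \<le> c" using b[of q "snd x"] w by (auto simp: indicator_def)
  qed
 qed
 then show ?thesis by (simp only: optional_process_def sup_before_def case_prod_beta')
qed

lemma sup_before_props:
 assumes mono: "mono_on {0..T} (\<lambda>t. L t \<omega>)" and b: "\<And>t. t \<in> {0..T} \<Longrightarrow> 0 \<le> L t \<omega> \<and> L t \<omega> \<le> c"
 shows sup_before_ge: "0 \<le> s \<Longrightarrow> s < t \<Longrightarrow> t \<le> T \<Longrightarrow> L s \<omega> \<le> sup_before L t \<omega>"
  and sup_before_le: "t \<in> {0..T} \<Longrightarrow> 0 \<le> d \<Longrightarrow> (\<And>s. 0 \<le> s \<Longrightarrow> s < t \<Longrightarrow> L s \<omega> \<le> d) \<Longrightarrow> sup_before L t \<omega> \<le> d"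
  and sup_before_nonneg: "t \<in> {0..T} \<Longrightarrow> 0 \<le> sup_before L t \<omega>"
  and sup_before_tendsto: "0 < t \<Longrightarrow> t \<le> T \<Longrightarrow> ((\<lambda>s. L s \<omega>) \<longlongrightarrow> sup_before L t \<omega>) (at_left t)"
proof -
 have zero: "0 \<in> \<rat> \<inter> {0..<T}" using horizon_pos by simp
 have bdd: "bdd_above ((\<lambda>q. L q \<omega> * indicator {q<..} t) ` (\<rat> \<inter> {0..<T}))" for t
 proof (rule bdd_aboveI2)
  fix q assume "q \<in> \<rat> \<inter> {0..<T}"
  then show "L q \<omega> * indicator {q<..} t \<le> c" using b[of q] by (auto simp: indicator_def)
 qed
 have up: "L q \<omega> \<le> sup_before L t \<omega>" if "q \<in> \<rat>" "0 \<le> q" "q < t" "t \<le> T" for q t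
  unfolding sup_before_def using cSUP_upper[OF _ bdd, of q t] that by simp
 show ge: "L s \<omega> \<le> sup_before L t \<omega>" if s: "0 \<le> s" "s < t" "t \<le> T" for s t
 proof -
  obtain q where q: "q \<in> \<rat>" "s < q" "q < t" using Rats_dense_in_real[OF s(2)] by blast
  have "L s \<omega> \<le> L q \<omega>" using monotone_onD[OF mono, of s q] q s by auto
  also have "\<dots> \<le> sup_before L t \<omega>" using up[of q t] q s by simp
  finally show ?thesis .
 qed
 show le: "sup_before L t \<omega> \<le> d" if "t \<in> {0..T}" "0 \<le> d" "\<And>s. 0 \<le> s \<Longrightarrow> s < t \<Longrightarrow> L s \<omega> \<le> d" for t d
  unfolding sup_before_def using zero that by (intro cSUP_least) (auto simp: indicator_def)
 show nn: "0 \<le> sup_before L t \<omega>" if t: "t \<in> {0..T}" for t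
 proof -
  have "0 \<le> L 0 \<omega> * indicator {0<..} t" using b[of 0] T_nonneg by (simp add: indicator_def)
  also have "\<dots> \<le> sup_before L t \<omega>" unfolding sup_before_def by (rule cSUP_upper[OF zero bdd])
  finally show ?thesis .
 qed
 assume t: "0 < t" "t \<le> T"
 show "((\<lambda>s. L s \<omega>) \<longlongrightarrow> sup_before L t \<omega>) (at_left t)"
 proof (rule order_tendstoI)
  fix y assume y: "y < sup_before L t \<omega>"
  then obtain q where q: "q \<in> \<rat> \<inter> {0..<T}" "y < L q \<omega> * indicator {q<..} t"
   unfolding sup_before_def using less_cSUP_iff[OF _ bdd] zero by blast
  define p where "p = (if q < t then q else 0)"
  have p: "0 \<le> p" "p < t" "y < L p \<omega>"
   using q t b[of 0] T_nonneg by (auto simp: p_def indicator_def split: if_splits intro: less_le_trans)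
  have "y < L s \<omega>" if "s \<in> {p<..<t}" for s
   using monotone_onD[OF mono, of p s] that p t by auto
  then show "\<forall>\<^sub>F s in at_left t. y < L s \<omega>"
   using p eventually_at_left_real[OF p(2)] by (auto elim!: eventually_mono)
 next
  fix y assume "sup_before L t \<omega> < y"
  then have "L s \<omega> < y" if "s \<in> {0<..<t}" for s using ge[of s t] that t by auto
  then show "\<forall>\<^sub>F s in at_left t. L s \<omega> < y"
   using eventually_at_left_real[OF t(1)] by (auto elim!: eventually_mono)
 qed
qed

lemma controls_monoD:
 assumes "L \<in> controls_mono M F T n"
 shows "optional_process M F T L" "\<omega> \<in> space M \<Longrightarrow> mono_on {0..T} (\<lambda>t. L t \<omega>)"
  "t \<in> {0..T} \<Longrightarrow> \<omega> \<in> space M \<Longrightarrow> 0 \<le> L t \<omega> \<and> L t \<omega> \<le> real n"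
 using assms by (auto simp: controls_mono_def controls_def)

lemma left_lim_eq:
 assumes L: "L \<in> controls_mono M F T n" and t: "t \<in> {0..T}" and w: "\<omega> \<in> space M"
 shows "left_lim L t \<omega> = sup_before L t \<omega>"
proof (cases "t = 0")
 case True
 have "(\<lambda>q. L q \<omega> * indicator {q<..} t) ` (\<rat> \<inter> {0..<T}) = {0}"
  using True horizon_pos by (auto simp: indicator_def image_def intro!: bexI[of _ 0])
 then show ?thesis using True by (simp add: left_lim_def sup_before_def)
next
 case False
 then have "((\<lambda>s. L s \<omega>) \<longlongrightarrow> sup_before L t \<omega>) (at_left t)"
  using t w by (intro sup_before_tendsto[where L=L and \<omega>=\<omega> and c="real n", OF controls_monoD(2)[OF L w] controls_monoD(3)[OF L _ w]]) auto
 then show ?thesis using False by (auto simp: left_lim_def intro!: tendsto_Lim)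
qed

lemma left_lim_props:
 assumes L: "L \<in> controls_mono M F T n" and w: "\<omega> \<in> space M"
 shows left_lim_ge: "0 \<le> s \<Longrightarrow> s < t \<Longrightarrow> t \<le> T \<Longrightarrow> L s \<omega> \<le> left_lim L t \<omega>"
  and left_lim_le: "t \<in> {0..T} \<Longrightarrow> 0 \<le> d \<Longrightarrow> (\<And>s. 0 \<le> s \<Longrightarrow> s < t \<Longrightarrow> L s \<omega> \<le> d) \<Longrightarrow> left_lim L t \<omega> \<le> d"
  and left_lim_range: "t \<in> {0..T} \<Longrightarrow> 0 \<le> left_lim L t \<omega> \<and> left_lim L t \<omega> \<le> real n"
proof -
 note m = controls_monoD(2)[OF L w] and b = controls_monoD(3)[OF L _ w]
 show "L s \<omega> \<le> left_lim L t \<omega>" if "0 \<le> s" "s < t" "t \<le> T" for s t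
  using sup_before_ge[where L=L and \<omega>=\<omega> and c="real n", OF m b that] that by (simp add: left_lim_eq[OF L _ w])
 show le: "left_lim L t \<omega> \<le> d" if "t \<in> {0..T}" "0 \<le> d" "\<And>s. 0 \<le> s \<Longrightarrow> s < t \<Longrightarrow> L s \<omega> \<le> d" for t d
  using sup_before_le[where L=L and \<omega>=\<omega> and c="real n", OF m b that] that by (simp add: left_lim_eq[OF L _ w])
 show "0 \<le> left_lim L t \<omega> \<and> left_lim L t \<omega> \<le> real n" if "t \<in> {0..T}" for t
  using sup_before_nonneg[where L=L and \<omega>=\<omega> and c="real n", OF m b that] le[OF that, of "real n"] b that by (auto simp: left_lim_eq[OF L _ w])
qed

lemma left_lim_optional:
 assumes L: "L \<in> controls_mono M F T n"
 shows "optional_process M F T (left_lim L)"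
proof -
 have "optional_process M F T (sup_before L)"
  using controls_monoD(3)[OF L] optional_adapted[OF controls_monoD(1)[OF L]]
  by (intro sup_before_optional[where c="real n"]) auto
 then show ?thesis using optional_cong[of "left_lim L" "sup_before L"] left_lim_eq[OF L] by simp
qed

end

section \<open>The interpolated coefficient\<close>

lemma interp_nat:
 assumes "i \<in> {1..n}"
 shows "interp n f t \<omega> (real i) = f i t \<omega>"
proof -
 have "i = 1" if "real i \<le> 1" using that assms by simp
 moreover have "i = n" if "real n \<le> real i" using that assms by simp
 ultimately show ?thesis by (auto simp: interp_def Let_def)
qed

text \<open>This form exhibits the interpolation as a combination of non-decreasing \<open>1\<close>-Lipschitz functions
 of the level; the coefficients are positive if \<open>f\<close> increases in \<open>i\<close>, which yields monotonicity.\<close>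

lemma interp_eq:
 assumes n: "n \<ge> 1"
 shows "interp n f t \<omega> l = f 1 t \<omega> + (min l 1 - 1)
  + (\<Sum>i=1..<n. max 0 (min 1 (l - real i)) * (f (Suc i) t \<omega> - f i t \<omega>)) + max (l - real n) 0"
proof -
 let ?S = "\<Sum>i=1..<n. max 0 (min 1 (l - real i)) * (f (Suc i) t \<omega> - f i t \<omega>)"
 have tel: "(\<Sum>i=1..<m. f (Suc i) t \<omega> - f i t \<omega>) = f m t \<omega> - f 1 t \<omega>" if "1 \<le> m" for m
  using sum_Suc_diff'[OF that, of "\<lambda>i. f i t \<omega>"] by simp
 consider "l \<le> 1" | "1 < l" "real n \<le> l" | "1 < l" "l < real n" by linarith
 then show ?thesis
 proof cases
  case 1
  have "?S = 0" using 1 by (intro sum.neutral) (auto simp: max_def min_def)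
  then show ?thesis using 1 n by (simp add: interp_def)
 next
  case 2
  have "?S = (\<Sum>i=1..<n. f (Suc i) t \<omega> - f i t \<omega>)"
  proof (intro sum.cong refl)
   fix i assume i: "i \<in> {1..<n}"
   then have "real i + 1 \<le> real n" by simp
   then show "max 0 (min 1 (l - real i)) * (f (Suc i) t \<omega> - f i t \<omega>) = f (Suc i) t \<omega> - f i t \<omega>" using 2 by simp
  qed
  then show ?thesis using 2 tel[OF n] by (simp add: interp_def)
 next
  case 3
  define m where "m = nat \<lfloor>l\<rfloor>"
  have m: "real m \<le> l" "l < real m + 1" "1 \<le> m" "m < n" using 3 unfolding m_def by linarith+
  have "{1..<n} = {1..<m} \<union> {m} \<union> {Suc m..<n}" using m by auto
  then have "?S = (\<Sum>i\<in>{1..<m} \<union> {m}. max 0 (min 1 (l - real i)) * (f (Suc i) t \<omega> - f i t \<omega>))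
    + (\<Sum>i=Suc m..<n. max 0 (min 1 (l - real i)) * (f (Suc i) t \<omega> - f i t \<omega>))"
   by (simp only:) (intro sum.union_disjoint, auto)
  also have "(\<Sum>i=Suc m..<n. max 0 (min 1 (l - real i)) * (f (Suc i) t \<omega> - f i t \<omega>)) = 0"
  proof (intro sum.neutral ballI)
   fix i assume "i \<in> {Suc m..<n}"
   then have "real m + 1 \<le> real i" by simp
   then show "max 0 (min 1 (l - real i)) * (f (Suc i) t \<omega> - f i t \<omega>) = 0" using m by simp
  qed
  also have "(\<Sum>i\<in>{1..<m} \<union> {m}. max 0 (min 1 (l - real i)) * (f (Suc i) t \<omega> - f i t \<omega>))
    = (\<Sum>i=1..<m. max 0 (min 1 (l - real i)) * (f (Suc i) t \<omega> - f i t \<omega>)) + (l - real m) * (f (Suc m) t \<omega> - f m t \<omega>)"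
   using m by (subst sum.union_disjoint) auto
  also have "(\<Sum>i=1..<m. max 0 (min 1 (l - real i)) * (f (Suc i) t \<omega> - f i t \<omega>)) = (\<Sum>i=1..<m. f (Suc i) t \<omega> - f i t \<omega>)"
  proof (intro sum.cong refl)
   fix i assume i: "i \<in> {1..<m}"
   then have "real i + 1 \<le> real m" by simp
   then show "max 0 (min 1 (l - real i)) * (f (Suc i) t \<omega> - f i t \<omega>) = f (Suc i) t \<omega> - f i t \<omega>" using m by simp
  qed
  finally show ?thesis using 3 tel[OF m(3)] by (simp add: interp_def m_def[symmetric] algebra_simps)
 qed
qed

lemma interp_strict_mono:
 assumes n: "n \<ge> 1" and f: "\<And>i. i \<in> {1..<n} \<Longrightarrow> f i t \<omega> < f (Suc i) t \<omega>" and l: "l < l'"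
 shows "interp n f t \<omega> l < interp n f t \<omega> l'"
proof -
 define d where "d i = max 0 (min 1 (l' - real i)) - max 0 (min 1 (l - real i))" for i :: nat
 define d0 where "d0 = min l' 1 - min l 1"
 define dn where "dn = max (l' - real n) 0 - max (l - real n) 0"
 have d: "0 \<le> d i" "0 \<le> d0" "0 \<le> dn" for i using l by (auto simp: d_def d0_def dn_def)
 have diff: "interp n h t \<omega> l' - interp n h t \<omega> l = d0 + (\<Sum>i=1..<n. d i * (h (Suc i) t \<omega> - h i t \<omega>)) + dn" for h
  unfolding interp_eq[OF n] d0_def dn_def d_def by (simp add: left_diff_distrib sum_subtractf)
 have id: "interp n (\<lambda>i t \<omega>. real i) t \<omega> l = l" for l
  by (auto simp: interp_def Let_def algebra_simps)
 have sum: "l' - l = d0 + (\<Sum>i=1..<n. d i) + dn" using diff[of "\<lambda>i t \<omega>. real i"] id by simp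
 have nn: "0 \<le> d i * (f (Suc i) t \<omega> - f i t \<omega>)" if "i \<in> {1..<n}" for i using d f[OF that] by simp
 have "0 < d0 + (\<Sum>i=1..<n. d i * (f (Suc i) t \<omega> - f i t \<omega>)) + dn"
 proof (rule ccontr)
  assume *: "\<not> ?thesis"
  have s: "0 \<le> (\<Sum>i=1..<n. d i * (f (Suc i) t \<omega> - f i t \<omega>))" using nn by (rule sum_nonneg)
  then have z: "d0 = 0" "dn = 0" "(\<Sum>i=1..<n. d i * (f (Suc i) t \<omega> - f i t \<omega>)) = 0" using * d by linarith+
  have "\<forall>i\<in>{1..<n}. d i * (f (Suc i) t \<omega> - f i t \<omega>) = 0"
   using z(3) nn by (subst (asm) sum_nonneg_eq_0_iff) auto
  then have "d i = 0" if "i \<in> {1..<n}" for i using f[OF that] that by auto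
  then have "(\<Sum>i=1..<n. d i) = 0" by simp
  with sum z l show False by simp
 qed
 with diff[of f] show ?thesis by simp
qed

lemma interp_mono:
 assumes "n \<ge> 1" "\<And>i. i \<in> {1..<n} \<Longrightarrow> f i t \<omega> < f (Suc i) t \<omega>" "l \<le> l'"
 shows "interp n f t \<omega> l \<le> interp n f t \<omega> l'"
 using interp_strict_mono[of n f t \<omega> l l'] assms by (cases "l = l'") auto

lemma interp_bound:
 assumes n: "n \<ge> 1" and l: "0 \<le> l" "l \<le> real n"
 shows "\<bar>interp n f t \<omega> l\<bar> \<le> 1 + (\<Sum>i=1..n. \<bar>f i t \<omega>\<bar>)"
proof -
 have le: "\<bar>f i t \<omega>\<bar> \<le> (\<Sum>i=1..n. \<bar>f i t \<omega>\<bar>)" if "i \<in> {1..n}" for i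
  using that by (intro member_le_sum) auto
 consider "l \<le> 1" | "1 < l" "real n \<le> l" | "1 < l" "l < real n" by linarith
 then show ?thesis
 proof cases
  case 1
  then show ?thesis using le[of 1] n l by (simp add: interp_def)
 next
  case 2
  then show ?thesis using le[of n] n l by (simp add: interp_def)
 next
  case 3
  define m where "m = nat \<lfloor>l\<rfloor>"
  have m: "real m \<le> l" "l < real m + 1" "1 \<le> m" "m < n" using 3 unfolding m_def by linarith+
  have "\<bar>interp n f t \<omega> l\<bar> = \<bar>(real m + 1 - l) * f m t \<omega> + (l - real m) * f (m + 1) t \<omega>\<bar>"
   using 3 by (simp add: interp_def m_def[symmetric])
  also have "\<dots> \<le> (real m + 1 - l) * \<bar>f m t \<omega>\<bar> + (l - real m) * \<bar>f (m + 1) t \<omega>\<bar>"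
   using m abs_triangle_ineq[of "(real m + 1 - l) * f m t \<omega>" "(l - real m) * f (m + 1) t \<omega>"] by (simp add: abs_mult)
  also have "\<dots> \<le> (real m + 1 - l) * (\<Sum>i=1..n. \<bar>f i t \<omega>\<bar>) + (l - real m) * (\<Sum>i=1..n. \<bar>f i t \<omega>\<bar>)"
   using m le[of m] le[of "m + 1"] by (intro add_mono mult_left_mono) auto
  also have "\<dots> = (\<Sum>i=1..n. \<bar>f i t \<omega>\<bar>)" by (simp add: algebra_simps)
  finally show ?thesis by simp
 qed
qed

lemma interp_measurable:
 assumes n: "n \<ge> 1" and f: "\<And>i. i \<in> {1..n} \<Longrightarrow> (\<lambda>x. f i (a x) (b x)) \<in> borel_measurable N"
  and l: "l \<in> borel_measurable N"
 shows "(\<lambda>x. interp n f (a x) (b x) (l x)) \<in> borel_measurable N"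
proof -
 have "(\<lambda>x. max 0 (min 1 (l x - real i)) * (f (Suc i) (a x) (b x) - f i (a x) (b x))) \<in> borel_measurable N"
  if i: "i \<in> {1..<n}" for i
 proof -
  have [measurable]: "(\<lambda>x. f i (a x) (b x)) \<in> borel_measurable N" "(\<lambda>x. f (Suc i) (a x) (b x)) \<in> borel_measurable N"
   by (rule f, use i in simp)+
  note [measurable] = l
  show ?thesis by measurable
 qed
 then have [measurable]: "(\<lambda>x. \<Sum>i=1..<n. max 0 (min 1 (l x - real i)) * (f (Suc i) (a x) (b x) - f i (a x) (b x))) \<in> borel_measurable N"
  by (rule borel_measurable_sum)
 have [measurable]: "(\<lambda>x. f 1 (a x) (b x)) \<in> borel_measurable N" by (rule f) (use n in simp)
 note [measurable] = l
 show ?thesis unfolding interp_eq[OF n] by measurable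
qed

section \<open>Path integrals up to a stopping time\<close>

locale timed_prob_space = usual_filtered_prob_space M F T
 for M :: "'a measure" and F T +
 fixes \<mu> :: "real measure"
 assumes atomless: "atomless_finite_borel T \<mu>"
begin

lemma sets_\<mu>: "sets \<mu> = sets (restrict_space borel {0..T})"
 using atomless by (simp add: atomless_finite_borel_def)

lemma space_\<mu>: "space \<mu> = {0..T}"
 using sets_eq_imp_space_eq[OF sets_\<mu>] by (simp add: space_restrict_space)

sublocale time: finite_measure \<mu>
 using atomless by (simp add: atomless_finite_borel_def)

sublocale joint: pair_sigma_finite \<mu> M ..

lemma AE_\<mu>_neq: "AE t in \<mu>. t \<noteq> r"
proof (cases "r \<in> {0..T}")
 case True
 then have "emeasure \<mu> {r} = 0" using atomless by (simp add: atomless_finite_borel_def)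
 moreover have "{r} \<in> sets \<mu>"
 proof -
  have "{0..T} \<inter> {r} \<in> sets \<mu>" unfolding sets_\<mu> sets_restrict_space by (rule imageI) simp
  then show ?thesis using True by simp
 qed
 ultimately have "{r} \<in> null_sets \<mu>" by (simp add: null_sets_def)
 from AE_not_in[OF this] show ?thesis by simp
next
 case False
 then show ?thesis by (intro AE_I2) (auto simp: space_\<mu>)
qed

lemma \<mu>_sets_interval: "{0..T} \<inter> {a..b} \<in> sets \<mu>"
 unfolding sets_\<mu> sets_restrict_space by (rule imageI) simp

lemma borel_\<mu>: "h \<in> borel_measurable borel \<Longrightarrow> h \<in> borel_measurable \<mu>"
 unfolding measurable_cong_sets[OF sets_\<mu> refl] by (rule measurable_restrict_space1)

lemma fst_joint: "fst \<in> borel_measurable (\<mu> \<Otimes>\<^sub>M M)"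
proof -
 have "(\<lambda>x. x) \<in> borel_measurable \<mu>" by (rule borel_\<mu>) simp
 from measurable_compose[OF measurable_fst[of \<mu> M] this] show ?thesis by simp
qed

text \<open>Integrability over time and scenarios jointly: then almost every path is integrable, and its
 integrals up to stopping times have expectations.\<close>

definition jint :: "(real \<Rightarrow> 'a \<Rightarrow> real) \<Rightarrow> bool" where
 "jint \<phi> \<longleftrightarrow> integrable (\<mu> \<Otimes>\<^sub>M M) (\<lambda>(t, \<omega>). \<phi> t \<omega>)"

lemma progressive_joint:
 assumes X: "progressively_measurable F T X"
 shows "(\<lambda>(t, \<omega>). X t \<omega>) \<in> borel_measurable (\<mu> \<Otimes>\<^sub>M M)"
proof -
 have "(\<lambda>x. (fst x, snd x)) \<in> \<mu> \<Otimes>\<^sub>M M \<rightarrow>\<^sub>M restrict_space borel {0..T} \<Otimes>\<^sub>M F T"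
 proof (rule measurable_Pair)
  show "fst \<in> \<mu> \<Otimes>\<^sub>M M \<rightarrow>\<^sub>M restrict_space borel {0..T}"
   using measurable_fst[of \<mu> M] unfolding measurable_cong_sets[OF refl sets_\<mu>] .
  have "(\<lambda>x. x) \<in> M \<rightarrow>\<^sub>M F T" using T_nonneg by (intro measurable_F_M[of T]) auto
  from measurable_compose[OF measurable_snd[of \<mu> M] this] show "snd \<in> \<mu> \<Otimes>\<^sub>M M \<rightarrow>\<^sub>M F T" by simp
 qed
 from measurable_compose[OF this progressiveD[OF X, of T]] show ?thesis using T_nonneg by simp
qed

lemma adapted_integral:
 assumes X: "progressively_measurable F T X" and t: "t \<in> {0..T}"
 shows "(\<lambda>\<omega>. LINT s:{0..t}|\<mu>. X s \<omega>) \<in> borel_measurable (F t)"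
proof -
 let ?R = "restrict_space \<mu> {0..t}"
 have I: "{0..t} \<inter> space \<mu> \<in> sets \<mu>" using \<mu>_sets_interval[of 0 t] by (simp add: space_\<mu> Int_commute)
 have sR: "sets ?R = sets (restrict_space borel {0..t})"
 proof -
  have "sets ?R = (\<inter>) {0..t} ` sets (restrict_space borel {0..T})" by (simp add: sets_restrict_space sets_\<mu>)
  also have "\<dots> = sets (restrict_space (restrict_space borel {0..T}) {0..t})" by (simp add: sets_restrict_space)
  also have "\<dots> = sets (restrict_space borel ({0..T} \<inter> {0..t}))" by (subst restrict_restrict_space) auto
  also have "{0..T} \<inter> {0..t} = {0..t}" using t by auto
  finally show ?thesis .
 qed
 interpret R: finite_measure ?R 
 proof (rule finite_measure_restrict_space[OF time.finite_measure_axioms])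
  have "{0..T} \<inter> {0..t} = {0..t}" using t by auto
  then show "{0..t} \<in> sets \<mu>" using \<mu>_sets_interval[of 0 t] by metis
 qed
 have "(\<lambda>(s, \<omega>). X s \<omega>) \<in> borel_measurable (?R \<Otimes>\<^sub>M F t)"
  using progressiveD[OF X t] measurable_cong_sets[OF sets_pair_measure_cong[OF sR refl] refl] by blast
 from measurable_pair_swap[OF this] have "(\<lambda>(\<omega>, s). X s \<omega>) \<in> borel_measurable (F t \<Otimes>\<^sub>M ?R)"
  by (simp add: case_prod_beta')
 then have "(\<lambda>\<omega>. LINT s|?R. X s \<omega>) \<in> borel_measurable (F t)"
  by (rule R.borel_measurable_lebesgue_integral)
 then show ?thesis unfolding integral_restrict_space[OF I] by (simp add: set_lebesgue_integral_def)
qed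

lemma jint_measurable: "jint \<phi> \<Longrightarrow> (\<lambda>(t, \<omega>). \<phi> t \<omega>) \<in> borel_measurable (\<mu> \<Otimes>\<^sub>M M)"
 unfolding jint_def by (rule borel_measurable_integrable)

lemma jintI_nn:
 assumes X: "(\<lambda>(t, \<omega>). X t \<omega>) \<in> borel_measurable (\<mu> \<Otimes>\<^sub>M M)"
  and fin: "(\<integral>\<^sup>+\<omega>. (\<integral>\<^sup>+t. ennreal \<bar>X t \<omega>\<bar> \<partial>\<mu>) \<partial>M) < \<infinity>"
 shows "jint X"
proof -
 let ?X = "\<lambda>x. X (fst x) (snd x)"
 have X': "?X \<in> borel_measurable (\<mu> \<Otimes>\<^sub>M M)" using X by (simp only: case_prod_beta')
 have m: "(\<lambda>x. ennreal (norm (?X x))) \<in> borel_measurable (\<mu> \<Otimes>\<^sub>M M)"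
  by (rule measurable_compose[OF X' measurable_compose[OF borel_measurable_norm measurable_ennreal]])
 have eq: "(\<integral>\<^sup>+x. ennreal (norm (?X x)) \<partial>(\<mu> \<Otimes>\<^sub>M M)) = (\<integral>\<^sup>+\<omega>. (\<integral>\<^sup>+t. ennreal \<bar>X t \<omega>\<bar> \<partial>\<mu>) \<partial>M)"
  using joint.nn_integral_snd[OF m] by (simp only: fst_conv snd_conv real_norm_def)
 have fin': "(\<integral>\<^sup>+x. ennreal (norm (?X x)) \<partial>(\<mu> \<Otimes>\<^sub>M M)) < \<infinity>" unfolding eq by (rule fin)
 have "integrable (\<mu> \<Otimes>\<^sub>M M) ?X" by (rule integrableI_bounded[OF X' fin'])
 then show ?thesis by (simp only: jint_def case_prod_beta')
qed

lemma jint_AE: "jint \<phi> \<Longrightarrow> AE \<omega> in M. integrable \<mu> (\<lambda>t. \<phi> t \<omega>)"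
 unfolding jint_def by (rule joint.AE_integrable_snd)

lemma jint_integral: "jint \<phi> \<Longrightarrow> integrable M (\<lambda>\<omega>. LINT t|\<mu>. \<phi> t \<omega>)"
 unfolding jint_def by (rule joint.integrable_snd)

lemma jint_bound:
 assumes w: "jint w" and \<phi>: "(\<lambda>(t, \<omega>). \<phi> t \<omega>) \<in> borel_measurable (\<mu> \<Otimes>\<^sub>M M)"
  and b: "\<And>t \<omega>. t \<in> {0..T} \<Longrightarrow> \<omega> \<in> space M \<Longrightarrow> \<bar>\<phi> t \<omega>\<bar> \<le> w t \<omega>"
 shows "jint \<phi>"
 unfolding jint_def
proof (rule Bochner_Integration.integrable_bound[OF w[unfolded jint_def] \<phi>])
 show "AE x in \<mu> \<Otimes>\<^sub>M M. norm (case x of (t, \<omega>) \<Rightarrow> \<phi> t \<omega>) \<le> norm (case x of (t, \<omega>) \<Rightarrow> w t \<omega>)"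
 proof (rule AE_I2)
  fix x assume "x \<in> space (\<mu> \<Otimes>\<^sub>M M)"
  then obtain t \<omega> where x: "x = (t, \<omega>)" "t \<in> {0..T}" "\<omega> \<in> space M" by (auto simp: space_pair_measure space_\<mu>)
  show "norm (case x of (t, \<omega>) \<Rightarrow> \<phi> t \<omega>) \<le> norm (case x of (t, \<omega>) \<Rightarrow> w t \<omega>)"
   using b[OF x(2,3)] x(1) by simp
 qed
qed

lemma jint_add: "jint \<phi> \<Longrightarrow> jint \<psi> \<Longrightarrow> jint (\<lambda>t \<omega>. \<phi> t \<omega> + \<psi> t \<omega>)"
 unfolding jint_def using LINT_integrable_add[of "\<mu> \<Otimes>\<^sub>M M" "\<lambda>(t, \<omega>). \<phi> t \<omega>" "\<lambda>(t, \<omega>). \<psi> t \<omega>"]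
 by (simp add: case_prod_beta')

lemma jint_diff: "jint \<phi> \<Longrightarrow> jint \<psi> \<Longrightarrow> jint (\<lambda>t \<omega>. \<phi> t \<omega> - \<psi> t \<omega>)"
 unfolding jint_def using LINT_integrable_diff[of "\<mu> \<Otimes>\<^sub>M M" "\<lambda>(t, \<omega>). \<phi> t \<omega>" "\<lambda>(t, \<omega>). \<psi> t \<omega>"]
 by (simp add: case_prod_beta')

lemma jint_abs: "jint \<phi> \<Longrightarrow> jint (\<lambda>t \<omega>. \<bar>\<phi> t \<omega>\<bar>)"
 unfolding jint_def using integrable_abs[of "\<mu> \<Otimes>\<^sub>M M" "\<lambda>(t, \<omega>). \<phi> t \<omega>"] by (simp add: case_prod_beta')

lemma jint_sum: "(\<And>i. i \<in> I \<Longrightarrow> jint (\<phi> i)) \<Longrightarrow> jint (\<lambda>t \<omega>. \<Sum>i\<in>I. \<phi> i t \<omega>)"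
 unfolding jint_def using LINT_integrable_sum[of I "\<mu> \<Otimes>\<^sub>M M" "\<lambda>i (t, \<omega>). \<phi> i t \<omega>"]
 by (simp add: case_prod_beta')

lemma jint_const: "jint (\<lambda>t \<omega>. c)"
proof -
 interpret J: finite_measure "\<mu> \<Otimes>\<^sub>M M"
  by (rule finite_measure_pair_measure) (rule time.finite_measure_axioms finite_measure_axioms)+
 show ?thesis by (simp add: jint_def case_prod_beta')
qed

lemma jint_window:
 assumes \<phi>: "jint \<phi>" and a[measurable]: "a \<in> borel_measurable M" and b[measurable]: "b \<in> borel_measurable M"
 shows "jint (\<lambda>t \<omega>. indicator {a \<omega><..b \<omega>} t * \<phi> t \<omega>)" and "jint (\<lambda>t \<omega>. indicator {a \<omega>..b \<omega>} t * \<phi> t \<omega>)"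
proof -
 note [measurable] = fst_joint jint_measurable[OF \<phi>]
 have m: "(\<lambda>x. \<phi> (fst x) (snd x)) \<in> borel_measurable (\<mu> \<Otimes>\<^sub>M M)"
  using jint_measurable[OF \<phi>] by (simp add: case_prod_beta')
 have p: "Measurable.pred (\<mu> \<Otimes>\<^sub>M M) (\<lambda>x. a (snd x) < fst x \<and> fst x \<le> b (snd x))"
  "Measurable.pred (\<mu> \<Otimes>\<^sub>M M) (\<lambda>x. a (snd x) \<le> fst x \<and> fst x \<le> b (snd x))" by measurable
 have "(\<lambda>x. indicator {x\<in>space (\<mu> \<Otimes>\<^sub>M M). a (snd x) < fst x \<and> fst x \<le> b (snd x)} x * \<phi> (fst x) (snd x)) \<in> borel_measurable (\<mu> \<Otimes>\<^sub>M M)"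
  "(\<lambda>x. indicator {x\<in>space (\<mu> \<Otimes>\<^sub>M M). a (snd x) \<le> fst x \<and> fst x \<le> b (snd x)} x * \<phi> (fst x) (snd x)) \<in> borel_measurable (\<mu> \<Otimes>\<^sub>M M)"
  using p m by (auto intro!: borel_measurable_times simp: pred_def)
 then have m1: "(\<lambda>(t, \<omega>). indicator {a \<omega><..b \<omega>} t * \<phi> t \<omega>) \<in> borel_measurable (\<mu> \<Otimes>\<^sub>M M)"
  and m2: "(\<lambda>(t, \<omega>). indicator {a \<omega>..b \<omega>} t * \<phi> t \<omega>) \<in> borel_measurable (\<mu> \<Otimes>\<^sub>M M)"
  by (auto elim!: measurable_cong[THEN iffD1, rotated] simp: indicator_def)
 show "jint (\<lambda>t \<omega>. indicator {a \<omega><..b \<omega>} t * \<phi> t \<omega>)"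
  by (rule jint_bound[OF jint_abs[OF \<phi>] m1]) (auto simp: indicator_def)
 show "jint (\<lambda>t \<omega>. indicator {a \<omega>..b \<omega>} t * \<phi> t \<omega>)"
  by (rule jint_bound[OF jint_abs[OF \<phi>] m2]) (auto simp: indicator_def)
qed

lemma set_LINT_\<mu>: "(LINT t:A|\<mu>. h t) = (LINT t|\<mu>. indicator A t * h t)" for h :: "real \<Rightarrow> real"
 by (simp add: set_lebesgue_integral_def)

lemma integrable_window:
 fixes h :: "real \<Rightarrow> real"
 assumes "integrable \<mu> h"
 shows "integrable \<mu> (\<lambda>t. indicator {a<..b} t * h t)" "integrable \<mu> (\<lambda>t. indicator {a..b} t * h t)"
proof -
 have m: "(\<lambda>t. indicat_real {a<..b} t) \<in> borel_measurable \<mu>" "(\<lambda>t. indicat_real {a..b} t) \<in> borel_measurable \<mu>"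
  by (auto intro!: borel_\<mu>)
 show "integrable \<mu> (\<lambda>t. indicator {a<..b} t * h t)"
  by (rule Bochner_Integration.integrable_bound[OF assms borel_measurable_times[OF m(1) borel_measurable_integrable[OF assms]]])
   (auto simp: indicator_def)
 show "integrable \<mu> (\<lambda>t. indicator {a..b} t * h t)"
  by (rule Bochner_Integration.integrable_bound[OF assms borel_measurable_times[OF m(2) borel_measurable_integrable[OF assms]]])
   (auto simp: indicator_def)
qed

lemma LINT_split:
 fixes h :: "real \<Rightarrow> real"
 assumes h: "integrable \<mu> h" and ab: "0 \<le> a" "a \<le> b" "b \<le> T"
 shows LINT_split_upto: "(LINT t:{0..b}|\<mu>. h t) = (LINT t:{0..a}|\<mu>. h t) + (LINT t:{a<..b}|\<mu>. h t)"
  and LINT_split_after: "(LINT t:{a<..T}|\<mu>. h t) = (LINT t:{a<..b}|\<mu>. h t) + (LINT t:{b<..T}|\<mu>. h t)"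
  and LINT_split_total: "(LINT t|\<mu>. h t) = (LINT t:{0..a}|\<mu>. h t) + (LINT t:{a<..T}|\<mu>. h t)"
proof -
 note i = integrable_window[OF h]
 have add: "(LINT t|\<mu>. u t * h t) = (LINT t|\<mu>. v t * h t) + (LINT t|\<mu>. w t * h t)"
  if "integrable \<mu> (\<lambda>t. v t * h t)" "integrable \<mu> (\<lambda>t. w t * h t)" "\<And>t. t \<in> {0..T} \<Longrightarrow> u t = v t + w t"
  for u v w :: "real \<Rightarrow> real"
 proof -
  have "(LINT t|\<mu>. v t * h t) + (LINT t|\<mu>. w t * h t) = (LINT t|\<mu>. v t * h t + w t * h t)"
   by (rule LINT_add[symmetric, OF that(1,2)])
  also have "\<dots> = (LINT t|\<mu>. u t * h t)"
   by (rule LINT_cong) (auto simp: that(3) space_\<mu> distrib_right)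
  finally show ?thesis by simp
 qed
 show "(LINT t:{0..b}|\<mu>. h t) = (LINT t:{0..a}|\<mu>. h t) + (LINT t:{a<..b}|\<mu>. h t)"
  unfolding set_LINT_\<mu> by (rule add[OF i(2) i(1)]) (use ab in \<open>auto simp: indicator_def\<close>)
 show "(LINT t:{a<..T}|\<mu>. h t) = (LINT t:{a<..b}|\<mu>. h t) + (LINT t:{b<..T}|\<mu>. h t)"
  unfolding set_LINT_\<mu> by (rule add[OF i(1) i(1)]) (use ab in \<open>auto simp: indicator_def\<close>)
 have "(LINT t|\<mu>. h t) = (LINT t|\<mu>. 1 * h t)" by simp
 also have "\<dots> = (LINT t:{0..a}|\<mu>. h t) + (LINT t:{a<..T}|\<mu>. h t)"
  unfolding set_LINT_\<mu> by (rule add[OF i(2) i(1)]) (use ab in \<open>auto simp: indicator_def\<close>)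
 finally show "(LINT t|\<mu>. h t) = (LINT t:{0..a}|\<mu>. h t) + (LINT t:{a<..T}|\<mu>. h t)" .
qed

lemma LINT_tendsto:
 fixes h :: "real \<Rightarrow> real"
 assumes h: "integrable \<mu> h" and r: "(r \<longlongrightarrow> c) (sequentially)"
 shows LINT_upto_tendsto: "(\<lambda>k. LINT t:{0..r k}|\<mu>. h t) \<longlonglongrightarrow> (LINT t:{0..c}|\<mu>. h t)"
  and LINT_after_tendsto: "(\<lambda>k. LINT t:{r k<..T}|\<mu>. h t) \<longlonglongrightarrow> (LINT t:{c<..T}|\<mu>. h t)"
proof -
 note i = integrable_window[OF h]
 have ev: "\<forall>\<^sub>F k in sequentially. (t \<le> r k) = (t \<le> c)" if "t \<noteq> c" for t
 proof (cases "t < c")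
  case True
  then have "\<forall>\<^sub>F k in sequentially. t < r k" using r by (intro order_tendstoD(1))
  then show ?thesis using True by (auto elim!: eventually_mono)
 next
  case False
  then have "\<forall>\<^sub>F k in sequentially. r k < t" using r that by (intro order_tendstoD(2)) auto
  then show ?thesis using False that by (auto elim!: eventually_mono)
 qed
 show "(\<lambda>k. LINT t:{0..r k}|\<mu>. h t) \<longlonglongrightarrow> (LINT t:{0..c}|\<mu>. h t)"
  unfolding set_LINT_\<mu>
 proof (rule integral_dominated_convergence[where w="\<lambda>t. \<bar>h t\<bar>"])
  show "AE t in \<mu>. (\<lambda>k. indicator {0..r k} t * h t) \<longlonglongrightarrow> indicator {0..c} t * h t"
   using AE_\<mu>_neq[of c]
  proof eventually_elim
   case (elim t)
   show ?case by (rule tendsto_eventually, rule eventually_mono[OF ev[OF elim]]) (auto simp: indicator_def)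
  qed
 qed (use h i in \<open>auto simp: indicator_def intro!: AE_I2\<close>)
 show "(\<lambda>k. LINT t:{r k<..T}|\<mu>. h t) \<longlonglongrightarrow> (LINT t:{c<..T}|\<mu>. h t)"
  unfolding set_LINT_\<mu>
 proof (rule integral_dominated_convergence[where w="\<lambda>t. \<bar>h t\<bar>"])
  show "AE t in \<mu>. (\<lambda>k. indicator {r k<..T} t * h t) \<longlonglongrightarrow> indicator {c<..T} t * h t"
   using AE_\<mu>_neq[of c]
  proof eventually_elim
   case (elim t)
   show ?case by (rule tendsto_eventually, rule eventually_mono[OF ev[OF elim]]) (auto simp: indicator_def)
  qed
 qed (use h i in \<open>auto simp: indicator_def intro!: AE_I2\<close>)
qed

lemma jint_ST:
 assumes \<phi>: "jint \<phi>" and \<sigma>: "\<sigma> \<in> ST"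
 shows jint_upto: "integrable M (\<lambda>\<omega>. LINT t:{0..\<sigma> \<omega>}|\<mu>. \<phi> t \<omega>)"
  and jint_after: "integrable M (\<lambda>\<omega>. LINT t:{\<sigma> \<omega><..T}|\<mu>. \<phi> t \<omega>)"
 unfolding set_LINT_\<mu>
 by (rule jint_integral[OF jint_window(2)[OF \<phi> borel_measurable_const ST_borel[OF \<sigma>]]],
  rule jint_integral[OF jint_window(1)[OF \<phi> ST_borel[OF \<sigma>] borel_measurable_const]])

lemma jint_between:
 assumes \<phi>: "jint \<phi>" and \<sigma>: "\<sigma> \<in> ST" and \<tau>: "\<tau> \<in> ST"
 shows "integrable M (\<lambda>\<omega>. LINT t:{\<sigma> \<omega><..\<tau> \<omega>}|\<mu>. \<phi> t \<omega>)"
 unfolding set_LINT_\<mu> by (rule jint_integral[OF jint_window(1)[OF \<phi> ST_borel[OF \<sigma>] ST_borel[OF \<tau>]]])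

lemma path_abs_le:
 fixes h :: "real \<Rightarrow> real"
 assumes "integrable \<mu> h"
 shows "\<bar>LINT t:{a..b}|\<mu>. h t\<bar> \<le> (LINT t|\<mu>. \<bar>h t\<bar>)" "\<bar>LINT t:{a<..b}|\<mu>. h t\<bar> \<le> (LINT t|\<mu>. \<bar>h t\<bar>)"
proof -
 note i = integrable_window[OF assms]
 have "\<bar>LINT t:{a..b}|\<mu>. h t\<bar> \<le> (LINT t|\<mu>. \<bar>indicator {a..b} t * h t\<bar>)" unfolding set_LINT_\<mu> by (rule integral_abs_bound)
 also have "\<dots> \<le> (LINT t|\<mu>. \<bar>h t\<bar>)" using assms i by (intro integral_mono) (auto simp: indicator_def)
 finally show "\<bar>LINT t:{a..b}|\<mu>. h t\<bar> \<le> (LINT t|\<mu>. \<bar>h t\<bar>)" .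
 have "\<bar>LINT t:{a<..b}|\<mu>. h t\<bar> \<le> (LINT t|\<mu>. \<bar>indicator {a<..b} t * h t\<bar>)" unfolding set_LINT_\<mu> by (rule integral_abs_bound)
 also have "\<dots> \<le> (LINT t|\<mu>. \<bar>h t\<bar>)" using assms i by (intro integral_mono) (auto simp: indicator_def)
 finally show "\<bar>LINT t:{a<..b}|\<mu>. h t\<bar> \<le> (LINT t|\<mu>. \<bar>h t\<bar>)" .
qed

lemma jint_ST_tendsto:
 assumes \<phi>: "jint \<phi>" and \<rho>: "\<And>k::nat. \<rho> k \<in> ST" and r: "r \<in> ST"
  and lim: "AE \<omega> in M. (\<lambda>k. \<rho> k \<omega>) \<longlonglongrightarrow> r \<omega>"
 shows jint_upto_tendsto: "(\<lambda>k. LINT \<omega>|M. (LINT t:{0..\<rho> k \<omega>}|\<mu>. \<phi> t \<omega>)) \<longlonglongrightarrow> (LINT \<omega>|M. (LINT t:{0..r \<omega>}|\<mu>. \<phi> t \<omega>))"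
  and jint_after_tendsto: "(\<lambda>k. LINT \<omega>|M. (LINT t:{\<rho> k \<omega><..T}|\<mu>. \<phi> t \<omega>)) \<longlonglongrightarrow> (LINT \<omega>|M. (LINT t:{r \<omega><..T}|\<mu>. \<phi> t \<omega>))"
proof -
 have w: "integrable M (\<lambda>\<omega>. LINT t|\<mu>. \<bar>\<phi> t \<omega>\<bar>)" by (intro jint_integral jint_abs \<phi>)
 show "(\<lambda>k. LINT \<omega>|M. (LINT t:{0..\<rho> k \<omega>}|\<mu>. \<phi> t \<omega>)) \<longlonglongrightarrow> (LINT \<omega>|M. (LINT t:{0..r \<omega>}|\<mu>. \<phi> t \<omega>))"
 proof (rule integral_dominated_convergence[OF _ _ w])
  show "AE \<omega> in M. (\<lambda>k. LINT t:{0..\<rho> k \<omega>}|\<mu>. \<phi> t \<omega>) \<longlonglongrightarrow> (LINT t:{0..r \<omega>}|\<mu>. \<phi> t \<omega>)"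
   using lim jint_AE[OF \<phi>] by eventually_elim (rule LINT_upto_tendsto)
  show "AE \<omega> in M. norm (LINT t:{0..\<rho> k \<omega>}|\<mu>. \<phi> t \<omega>) \<le> (LINT t|\<mu>. \<bar>\<phi> t \<omega>\<bar>)" for k
   using jint_AE[OF \<phi>] by eventually_elim (use path_abs_le(1) in auto)
 qed (rule borel_measurable_integrable[OF jint_upto[OF \<phi> r]], rule borel_measurable_integrable[OF jint_upto[OF \<phi> \<rho>]])
 show "(\<lambda>k. LINT \<omega>|M. (LINT t:{\<rho> k \<omega><..T}|\<mu>. \<phi> t \<omega>)) \<longlonglongrightarrow> (LINT \<omega>|M. (LINT t:{r \<omega><..T}|\<mu>. \<phi> t \<omega>))"
 proof (rule integral_dominated_convergence[OF _ _ w])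
  show "AE \<omega> in M. (\<lambda>k. LINT t:{\<rho> k \<omega><..T}|\<mu>. \<phi> t \<omega>) \<longlonglongrightarrow> (LINT t:{r \<omega><..T}|\<mu>. \<phi> t \<omega>)"
   using lim jint_AE[OF \<phi>] by eventually_elim (rule LINT_after_tendsto)
  show "AE \<omega> in M. norm (LINT t:{\<rho> k \<omega><..T}|\<mu>. \<phi> t \<omega>) \<le> (LINT t|\<mu>. \<bar>\<phi> t \<omega>\<bar>)" for k
   using jint_AE[OF \<phi>] by eventually_elim (use path_abs_le(2) in auto)
 qed (rule borel_measurable_integrable[OF jint_after[OF \<phi> r]], rule borel_measurable_integrable[OF jint_after[OF \<phi> \<rho>]])
qed

text \<open>A property that holds almost everywhere is met in every open interval.\<close>

lemma full_support_witness:
 assumes fs: "full_support T \<mu>" and ab: "0 \<le> a" "a < b" "b \<le> T" and P: "AE t in \<mu>. P t"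
 shows "\<exists>t\<in>{a<..<b}. P t"
proof (rule ccontr)
 assume neg: "\<not> ?thesis"
 have "((a + b) / 2) \<in> {a<..<b} \<inter> {0..T}" using ab by auto
 then have "{a<..<b} \<inter> {0..T} \<noteq> {}" by (metis empty_iff)
 then have "open {a<..<b} \<and> {a<..<b} \<inter> {0..T} \<noteq> {}" by simp
 from fs[unfolded full_support_def, THEN spec, THEN mp, OF this]
 have pos: "0 < emeasure \<mu> ({a<..<b} \<inter> {0..T})" .
 have s: "{a<..<b} \<inter> {0..T} \<in> sets \<mu>"
  unfolding sets_\<mu> sets_restrict_space by (subst Int_commute, rule imageI) simp
 have ae: "AE t in \<mu>. t \<notin> {a<..<b} \<inter> {0..T}" using P by eventually_elim (use neg in auto)
 have eq: "{t\<in>space \<mu>. \<not> t \<notin> {a<..<b} \<inter> {0..T}} = {a<..<b} \<inter> {0..T}" by (auto simp: space_\<mu>)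
 from AE_iff_measurable[OF s eq, THEN iffD1, OF ae] pos show False by simp
qed

section \<open>The stopping problem of one agent\<close>

lemma agent_optimal_iff:
 "agent_optimal M F T \<mu> \<phi> Y \<tau> \<longleftrightarrow>
  \<tau> \<in> ST \<and> (\<forall>\<sigma>\<in>ST. agent_payoff M \<mu> \<phi> Y \<sigma> \<le> agent_payoff M \<mu> \<phi> Y \<tau>)"
proof -
 have "ereal (agent_payoff M \<mu> \<phi> Y \<tau>) = (SUP \<sigma>\<in>ST. ereal (agent_payoff M \<mu> \<phi> Y \<sigma>)) \<longleftrightarrow>
  (\<forall>\<sigma>\<in>ST. agent_payoff M \<mu> \<phi> Y \<sigma> \<le> agent_payoff M \<mu> \<phi> Y \<tau>)" if \<tau>: "\<tau> \<in> ST"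
 proof
  assume eq: "ereal (agent_payoff M \<mu> \<phi> Y \<tau>) = (SUP \<sigma>\<in>ST. ereal (agent_payoff M \<mu> \<phi> Y \<sigma>))"
  show "\<forall>\<sigma>\<in>ST. agent_payoff M \<mu> \<phi> Y \<sigma> \<le> agent_payoff M \<mu> \<phi> Y \<tau>"
  proof
   fix \<sigma> assume "\<sigma> \<in> ST"
   then have "ereal (agent_payoff M \<mu> \<phi> Y \<sigma>) \<le> ereal (agent_payoff M \<mu> \<phi> Y \<tau>)" unfolding eq by (rule SUP_upper)
   then show "agent_payoff M \<mu> \<phi> Y \<sigma> \<le> agent_payoff M \<mu> \<phi> Y \<tau>" by simp
  qed
 next
  assume "\<forall>\<sigma>\<in>ST. agent_payoff M \<mu> \<phi> Y \<sigma> \<le> agent_payoff M \<mu> \<phi> Y \<tau>"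
  then show "ereal (agent_payoff M \<mu> \<phi> Y \<tau>) = (SUP \<sigma>\<in>ST. ereal (agent_payoff M \<mu> \<phi> Y \<sigma>))"
   using \<tau> by (intro antisym SUP_upper SUP_least) auto
 qed
 then show ?thesis unfolding agent_optimal_def by (rule conj_cong[OF refl])
qed

lemma agent_payoff_split:
 assumes \<phi>: "jint \<phi>" and D: "class_D M F T Y" and \<tau>: "\<tau> \<in> ST"
 shows "agent_payoff M \<mu> \<phi> Y \<tau> = (LINT \<omega>|M. (LINT t:{0..\<tau> \<omega>}|\<mu>. \<phi> t \<omega>)) + (LINT \<omega>|M. Y (\<tau> \<omega>) \<omega>)"
 unfolding agent_payoff_def by (rule LINT_add[OF jint_upto[OF \<phi> \<tau>] class_D_integrable[OF D \<tau>]])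

text \<open>The payoff is a path functional evaluated at the stopping time, so at minimum and maximum together it
 takes the same two values as at the two times.\<close>

lemma agent_payoff_modular:
 assumes \<phi>: "jint \<phi>" and D: "class_D M F T Y" and \<sigma>: "\<sigma> \<in> ST" and \<tau>: "\<tau> \<in> ST"
 shows "agent_payoff M \<mu> \<phi> Y (\<lambda>\<omega>. min (\<sigma> \<omega>) (\<tau> \<omega>)) + agent_payoff M \<mu> \<phi> Y (\<lambda>\<omega>. max (\<sigma> \<omega>) (\<tau> \<omega>))
  = agent_payoff M \<mu> \<phi> Y \<sigma> + agent_payoff M \<mu> \<phi> Y \<tau>"
proof -
 define G where "G r \<omega> = (LINT t:{0..r}|\<mu>. \<phi> t \<omega>) + Y r \<omega>" for r \<omega>
 have i: "integrable M (\<lambda>\<omega>. G (\<theta> \<omega>) \<omega>)" if "\<theta> \<in> ST" for \<theta>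
  unfolding G_def using jint_upto[OF \<phi> that] class_D_integrable[OF D that] by (rule LINT_integrable_add)
 have p: "agent_payoff M \<mu> \<phi> Y \<theta> = (LINT \<omega>|M. G (\<theta> \<omega>) \<omega>)" for \<theta> by (simp add: agent_payoff_def G_def)
 have "(LINT \<omega>|M. G (min (\<sigma> \<omega>) (\<tau> \<omega>)) \<omega>) + (LINT \<omega>|M. G (max (\<sigma> \<omega>) (\<tau> \<omega>)) \<omega>)
  = (LINT \<omega>|M. G (min (\<sigma> \<omega>) (\<tau> \<omega>)) \<omega> + G (max (\<sigma> \<omega>) (\<tau> \<omega>)) \<omega>)"
  by (rule LINT_add[symmetric, OF i[OF ST_min[OF \<sigma> \<tau>]] i[OF ST_max[OF \<sigma> \<tau>]]])
 also have "\<dots> = (LINT \<omega>|M. G (\<sigma> \<omega>) \<omega> + G (\<tau> \<omega>) \<omega>)"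
  by (rule LINT_cong[OF refl]) (simp add: min_def max_def)
 also have "\<dots> = (LINT \<omega>|M. G (\<sigma> \<omega>) \<omega>) + (LINT \<omega>|M. G (\<tau> \<omega>) \<omega>)"
  by (rule LINT_add[OF i[OF \<sigma>] i[OF \<tau>]])
 finally show ?thesis unfolding p .
qed

lemma agent_payoff_cong:
 assumes \<phi>: "jint \<phi>" and D: "class_D M F T Y" and st: "\<sigma> \<in> ST" "\<tau> \<in> ST" "AE \<omega> in M. \<sigma> \<omega> = \<tau> \<omega>"
 shows "agent_payoff M \<mu> \<phi> Y \<sigma> = agent_payoff M \<mu> \<phi> Y \<tau>"
 unfolding agent_payoff_def
proof (rule integral_cong_AE)
 have "(\<lambda>\<omega>. (LINT t:{0..\<theta> \<omega>}|\<mu>. \<phi> t \<omega>) + Y (\<theta> \<omega>) \<omega>) \<in> borel_measurable M" if "\<theta> \<in> ST" for \<theta>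
  using jint_upto[OF \<phi> that] class_D_integrable[OF D that] by (intro borel_measurable_add borel_measurable_integrable)
 then show "(\<lambda>\<omega>. (LINT t:{0..\<sigma> \<omega>}|\<mu>. \<phi> t \<omega>) + Y (\<sigma> \<omega>) \<omega>) \<in> borel_measurable M"
  "(\<lambda>\<omega>. (LINT t:{0..\<tau> \<omega>}|\<mu>. \<phi> t \<omega>) + Y (\<tau> \<omega>) \<omega>) \<in> borel_measurable M" using st by auto
 show "AE \<omega> in M. (LINT t:{0..\<sigma> \<omega>}|\<mu>. \<phi> t \<omega>) + Y (\<sigma> \<omega>) \<omega> = (LINT t:{0..\<tau> \<omega>}|\<mu>. \<phi> t \<omega>) + Y (\<tau> \<omega>) \<omega>"
  using st(3) by eventually_elim simp
qed

lemma agent_payoff_increasing: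
 assumes \<phi>: "jint \<phi>" and D: "class_D M F T Y" and U: "USCE M F T Y" and \<rho>: "\<And>k::nat. \<rho> k \<in> ST"
  and inc: "\<And>\<omega>. \<omega> \<in> space M \<Longrightarrow> incseq (\<lambda>k. \<rho> k \<omega>)" and "0 < \<epsilon>"
 shows "\<forall>\<^sub>F k in sequentially. agent_payoff M \<mu> \<phi> Y (\<rho> k) \<le> agent_payoff M \<mu> \<phi> Y (\<lambda>\<omega>. SUP k. \<rho> k \<omega>) + \<epsilon>"
proof -
 have R: "(\<lambda>\<omega>. SUP k. \<rho> k \<omega>) \<in> ST" using \<rho> by (rule ST_SUP)
 have "(\<lambda>k. \<rho> k \<omega>) \<longlonglongrightarrow> (SUP k. \<rho> k \<omega>)" if "\<omega> \<in> space M" for \<omega>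
  using ST_bdd(1)[OF \<rho> that] inc[OF that] by (rule LIMSEQ_incseq_SUP)
 then have "(\<lambda>k. LINT \<omega>|M. (LINT t:{0..\<rho> k \<omega>}|\<mu>. \<phi> t \<omega>)) \<longlonglongrightarrow> (LINT \<omega>|M. (LINT t:{0..(SUP k. \<rho> k \<omega>)}|\<mu>. \<phi> t \<omega>))"
  by (intro jint_upto_tendsto[OF \<phi> \<rho> R] AE_I2)
 then have "\<forall>\<^sub>F k in sequentially. (LINT \<omega>|M. (LINT t:{0..\<rho> k \<omega>}|\<mu>. \<phi> t \<omega>)) < (LINT \<omega>|M. (LINT t:{0..(SUP k. \<rho> k \<omega>)}|\<mu>. \<phi> t \<omega>)) + \<epsilon>/2"
  using \<open>0 < \<epsilon>\<close> by (intro order_tendstoD(2)) auto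
 moreover have "\<forall>\<^sub>F k in sequentially. (LINT \<omega>|M. Y (\<rho> k \<omega>) \<omega>) \<le> (LINT \<omega>|M. Y (SUP k. \<rho> k \<omega>) \<omega>) + \<epsilon>/2"
  using \<open>0 < \<epsilon>\<close> by (intro USCE_increasing[OF D U \<rho> inc]) auto
 ultimately show ?thesis
  by eventually_elim (simp add: agent_payoff_split[OF \<phi> D] \<rho> R)
qed

lemma agent_payoff_decreasing:
 assumes \<phi>: "jint \<phi>" and D: "class_D M F T Y" and U: "USCE M F T Y" and \<rho>: "\<And>k::nat. \<rho> k \<in> ST"
  and dec: "\<And>\<omega>. \<omega> \<in> space M \<Longrightarrow> decseq (\<lambda>k. \<rho> k \<omega>)" and "0 < \<epsilon>"
 shows "\<forall>\<^sub>F k in sequentially. agent_payoff M \<mu> \<phi> Y (\<rho> k) \<le> agent_payoff M \<mu> \<phi> Y (\<lambda>\<omega>. INF k. \<rho> k \<omega>) + \<epsilon>"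
proof -
 have R: "(\<lambda>\<omega>. INF k. \<rho> k \<omega>) \<in> ST" using \<rho> by (rule ST_INF)
 have lim: "(\<lambda>k. \<rho> k \<omega>) \<longlonglongrightarrow> (INF k. \<rho> k \<omega>)" if "\<omega> \<in> space M" for \<omega>
  using ST_bdd(2)[OF \<rho> that] dec[OF that] by (rule LIMSEQ_decseq_INF)
 have ge: "(INF k. \<rho> k \<omega>) \<le> \<rho> k \<omega>" if "\<omega> \<in> space M" for \<omega> k
  using ST_bdd(2)[OF \<rho> that] by (intro cINF_lower) auto
 have "(\<lambda>k. LINT \<omega>|M. (LINT t:{0..\<rho> k \<omega>}|\<mu>. \<phi> t \<omega>)) \<longlonglongrightarrow> (LINT \<omega>|M. (LINT t:{0..(INF k. \<rho> k \<omega>)}|\<mu>. \<phi> t \<omega>))"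
  using lim by (intro jint_upto_tendsto[OF \<phi> \<rho> R] AE_I2)
 then have "\<forall>\<^sub>F k in sequentially. (LINT \<omega>|M. (LINT t:{0..\<rho> k \<omega>}|\<mu>. \<phi> t \<omega>)) < (LINT \<omega>|M. (LINT t:{0..(INF k. \<rho> k \<omega>)}|\<mu>. \<phi> t \<omega>)) + \<epsilon>/2"
  using \<open>0 < \<epsilon>\<close> by (intro order_tendstoD(2)) auto
 moreover have "\<forall>\<^sub>F k in sequentially. (LINT \<omega>|M. Y (\<rho> k \<omega>) \<omega>) \<le> (LINT \<omega>|M. Y (INF k. \<rho> k \<omega>) \<omega>) + \<epsilon>/2"
  using \<open>0 < \<epsilon>\<close> lim ge by (intro USCE_eventually[OF U R \<rho>]) auto
 ultimately show ?thesis
  by eventually_elim (simp add: agent_payoff_split[OF \<phi> D] \<rho> R)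
qed

theorem smallest_optimal_exists:
 assumes \<phi>: "jint \<phi>" and D: "class_D M F T Y" and U: "USCE M F T Y"
 shows "\<exists>\<tau>. smallest_optimal M F T \<mu> \<phi> Y \<tau>"
proof -
 let ?H = "agent_payoff M \<mu> \<phi> Y"
 have "\<exists>\<tau>\<in>ST. (\<forall>\<sigma>\<in>ST. ?H \<sigma> \<le> ?H \<tau>) \<and> (\<forall>\<sigma>\<in>ST. ?H \<sigma> = ?H \<tau> \<longrightarrow> (AE \<omega> in M. \<tau> \<omega> \<le> \<sigma> \<omega>))"
 proof (rule smallest_maximizer_exists[of ?H])
  show "?H \<sigma> = ?H \<tau>" if "\<sigma> \<in> ST" "\<tau> \<in> ST" "AE \<omega> in M. \<sigma> \<omega> = \<tau> \<omega>" for \<sigma> \<tau>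
   by (rule agent_payoff_cong[OF \<phi> D that])
  show "?H (\<lambda>\<omega>. min (\<sigma> \<omega>) (\<tau> \<omega>)) + ?H (\<lambda>\<omega>. max (\<sigma> \<omega>) (\<tau> \<omega>)) = ?H \<sigma> + ?H \<tau>"
   if "\<sigma> \<in> ST" "\<tau> \<in> ST" for \<sigma> \<tau>
   by (rule agent_payoff_modular[OF \<phi> D that])
  show "\<forall>\<^sub>F k in sequentially. ?H (\<rho> k) \<le> ?H (\<lambda>\<omega>. INF k. \<rho> k \<omega>) + \<epsilon>"
   if "\<And>k::nat. \<rho> k \<in> ST" "\<And>\<omega>. \<omega> \<in> space M \<Longrightarrow> decseq (\<lambda>k. \<rho> k \<omega>)" "0 < \<epsilon>" for \<rho> \<epsilon>
   by (rule agent_payoff_decreasing[OF \<phi> D U that])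
  show "\<forall>\<^sub>F k in sequentially. ?H (\<rho> k) \<le> ?H (\<lambda>\<omega>. SUP k. \<rho> k \<omega>) + \<epsilon>"
   if "\<And>k::nat. \<rho> k \<in> ST" "\<And>\<omega>. \<omega> \<in> space M \<Longrightarrow> incseq (\<lambda>k. \<rho> k \<omega>)" "0 < \<epsilon>" for \<rho> \<epsilon>
   by (rule agent_payoff_increasing[OF \<phi> D U that])
  fix \<tau> assume \<tau>: "\<tau> \<in> ST" and "\<And>\<sigma>. \<sigma> \<in> ST \<Longrightarrow> ?H \<sigma> \<le> ?H \<tau>"
   and "\<And>\<sigma>. \<sigma> \<in> ST \<Longrightarrow> ?H \<sigma> = ?H \<tau> \<Longrightarrow> AE \<omega> in M. \<tau> \<omega> \<le> \<sigma> \<omega>"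
  then show ?thesis by (intro bexI[OF _ \<tau>] conjI ballI impI)
 qed
 then obtain \<tau> where \<tau>: "\<tau> \<in> ST" "\<forall>\<sigma>\<in>ST. ?H \<sigma> \<le> ?H \<tau>"
  "\<forall>\<sigma>\<in>ST. ?H \<sigma> = ?H \<tau> \<longrightarrow> (AE \<omega> in M. \<tau> \<omega> \<le> \<sigma> \<omega>)" by blast
 have "AE \<omega> in M. \<tau> \<omega> \<le> \<sigma> \<omega>" if \<sigma>: "agent_optimal M F T \<mu> \<phi> Y \<sigma>" for \<sigma>
 proof -
  have s: "\<sigma> \<in> ST" "?H \<tau> \<le> ?H \<sigma>" using \<sigma> \<tau>(1) unfolding agent_optimal_iff by blast+
  have "?H \<sigma> = ?H \<tau>" using \<tau>(2) s by (intro antisym) blast+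
  then show ?thesis using \<tau>(3) s(1) by blast
 qed
 then have "smallest_optimal M F T \<mu> \<phi> Y \<tau>"
  unfolding smallest_optimal_def using \<tau>(1,2) agent_optimal_iff by blast
 then show ?thesis by blast
qed

end

section \<open>Cadlag versions of closed martingales\<close>

text \<open>\<open>holding\<close> is the position of a trader who buys below \<open>a\<close> and sells above \<open>b\<close>; a completed trade is
 an upcrossing.\<close>

fun holding :: "real \<Rightarrow> real \<Rightarrow> (nat \<Rightarrow> real) \<Rightarrow> nat \<Rightarrow> bool" where
 "holding a b x 0 = (x 0 < a)"
| "holding a b x (Suc j) = (if holding a b x j then x (Suc j) \<le> b else x (Suc j) < a)"

fun upcrossings :: "real \<Rightarrow> real \<Rightarrow> (nat \<Rightarrow> real) \<Rightarrow> nat \<Rightarrow> nat" where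
 "upcrossings a b x 0 = 0"
| "upcrossings a b x (Suc j) = upcrossings a b x j + (if holding a b x j \<and> b < x (Suc j) then 1 else 0)"

text \<open>Buying below \<open>a\<close> and selling above \<open>b\<close> earns at least \<open>b - a\<close> per upcrossing, up to the loss
 on the position that is still open.\<close>

lemma upcrossings_gain:
 assumes "a < b"
 shows "(b - a) * real (upcrossings a b x j) + (if holding a b x j then x j - a else 0)
  \<le> (\<Sum>i<j. of_bool (holding a b x i) * (x (Suc i) - x i))"
proof (induction j)
 case (Suc j)
 then show ?case using assms by (cases "holding a b x j") (auto simp: algebra_simps split: if_splits)
qed simp

lemma upcrossings_mono: "i \<le> j \<Longrightarrow> upcrossings a b x i \<le> upcrossings a b x j"
 by (induction rule: dec_induct) auto

lemma upcrossings_step: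
 assumes ab: "a < b" and pq: "p < q" and p: "x p < a" and q: "b < x q"
 shows "upcrossings a b x p + 1 \<le> upcrossings a b x q"
proof -
 have h: "holding a b x p" using p ab by (cases p) auto
 have "holding a b x j \<or> upcrossings a b x p + 1 \<le> upcrossings a b x j" if "p \<le> j" for j
  using that
 proof (induction rule: dec_induct)
  case (step j)
  then show ?case using upcrossings_mono[of p j a b x] by auto
 qed (use h in simp)
 from this[of "q - 1"] show ?thesis using pq q upcrossings_mono[of p "q - 1" a b x] by (cases q) auto
qed

text \<open>If the limit inferior and superior differed, rational levels between them would be crossed frequently.\<close>

lemma limit_if_no_oscillation:
 fixes h :: "real \<Rightarrow> real"
 assumes G: "G \<noteq> bot" and bnd: "\<forall>\<^sub>F x in G. \<bar>h x\<bar> \<le> c"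
  and no: "\<And>a b. a \<in> \<rat> \<Longrightarrow> b \<in> \<rat> \<Longrightarrow> a < b \<Longrightarrow> (\<exists>\<^sub>F x in G. h x < a) \<Longrightarrow> (\<exists>\<^sub>F x in G. b < h x) \<Longrightarrow> False"
 shows "\<exists>l. (h \<longlongrightarrow> l) G"
proof -
 define S where "S = {y. \<exists>\<^sub>F x in G. y < h x}"
 have ne: "- c - 1 \<in> S"
 proof -
  have "\<forall>\<^sub>F x in G. - c - 1 < h x" using bnd by eventually_elim auto
  then show ?thesis unfolding S_def using eventually_frequently[OF G] by simp
 qed
 have bd: "bdd_above S"
 proof (rule bdd_aboveI[of _ c])
  fix y assume "y \<in> S"
  then have fr: "\<exists>\<^sub>F x in G. y < h x" by (simp add: S_def)
  show "y \<le> c"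
  proof (rule ccontr)
   assume "\<not> y \<le> c"
   with bnd have "\<forall>\<^sub>F x in G. \<not> y < h x" by (auto elim!: eventually_mono)
   with fr show False by (simp add: frequently_def)
  qed
 qed
 have "(h \<longlongrightarrow> Sup S) G"
 proof (rule order_tendstoI)
  fix y assume "y < Sup S"
  then obtain b where b: "b \<in> \<rat>" "y < b" "b < Sup S" using Rats_dense_in_real by blast
  obtain a where a: "a \<in> \<rat>" "y < a" "a < b" using Rats_dense_in_real[OF b(2)] by blast
  obtain s where s: "s \<in> S" "b < s" using b(3) less_cSup_iff[OF _ bd] ne by blast
  have "\<exists>\<^sub>F x in G. b < h x" using s unfolding S_def by (auto elim!: frequently_elim1)
  then have "\<not> (\<exists>\<^sub>F x in G. h x < a)" using no[OF a(1) b(1) a(3)] by blast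
  then have "\<forall>\<^sub>F x in G. \<not> h x < a" by (simp add: frequently_def)
  then show "\<forall>\<^sub>F x in G. y < h x" by eventually_elim (use a in auto)
 next
  fix y assume "Sup S < y"
  then obtain z where z: "Sup S < z" "z < y" using dense by blast
  have "z \<notin> S" using z(1) cSup_upper[OF _ bd] by force
  then have "\<forall>\<^sub>F x in G. \<not> z < h x" unfolding S_def by (simp add: frequently_def)
  then show "\<forall>\<^sub>F x in G. h x < y" by eventually_elim (use z in auto)
 qed
 then show ?thesis by blast
qed

context usual_filtered_prob_space
begin

text \<open>\<open>N\<close> is a martingale closed by \<open>Z\<close>; the defining identity of conditional expectations is used
 directly, so that any version qualifies.\<close>

definition closes :: "('a \<Rightarrow> real) \<Rightarrow> (real \<Rightarrow> 'a \<Rightarrow> real) \<Rightarrow> bool" where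
 "closes Z N \<longleftrightarrow> integrable M Z \<and> (\<forall>t\<in>{0..T}. N t \<in> borel_measurable (F t) \<and> integrable M (N t) \<and>
  (\<forall>A\<in>sets (F t). (LINT \<omega>|M. N t \<omega> * indicator A \<omega>) = (LINT \<omega>|M. Z \<omega> * indicator A \<omega>)))"

lemma cond_exp_subalgebra: "t \<in> {0..T} \<Longrightarrow> finite_measure_subalgebra M (F t)"
 using subalgebra_F by (simp add: finite_measure_subalgebra_def finite_measure_subalgebra_axioms_def finite_measure_axioms)

lemma closes_cond_exp:
 assumes Z: "integrable M Z"
 shows "closes Z (\<lambda>t. real_cond_exp M (F t) Z)"
 unfolding closes_def
proof (intro conjI ballI Z)
 fix t assume t: "t \<in> {0..T}"
 interpret S: finite_measure_subalgebra M "F t" by (rule cond_exp_subalgebra[OF t])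
 show "real_cond_exp M (F t) Z \<in> borel_measurable (F t)" by simp
 show "integrable M (real_cond_exp M (F t) Z)" by (rule S.real_cond_exp_int(1)[OF Z])
 show "(LINT \<omega>|M. real_cond_exp M (F t) Z \<omega> * indicator A \<omega>) = (LINT \<omega>|M. Z \<omega> * indicator A \<omega>)" if "A \<in> sets (F t)" for A
  using S.real_cond_exp_intA[OF Z that] by (simp add: set_lebesgue_integral_def mult.commute)
qed

lemma closesD:
 assumes "closes Z N" "t \<in> {0..T}"
 shows "N t \<in> borel_measurable (F t)" "integrable M (N t)"
  "A \<in> sets (F t) \<Longrightarrow> (LINT \<omega>|M. N t \<omega> * indicator A \<omega>) = (LINT \<omega>|M. Z \<omega> * indicator A \<omega>)"
 using assms by (auto simp: closes_def)

lemma abs_cond_le: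
 fixes X Z :: "'a \<Rightarrow> real"
 assumes t: "t \<in> {0..T}" and X: "X \<in> borel_measurable (F t)" "integrable M X" and Z: "integrable M Z"
  and eq: "\<And>A. A \<in> sets (F t) \<Longrightarrow> (LINT \<omega>|M. X \<omega> * indicator A \<omega>) = (LINT \<omega>|M. Z \<omega> * indicator A \<omega>)"
  and A: "A \<in> sets (F t)"
 shows "(LINT \<omega>|M. \<bar>X \<omega>\<bar> * indicator A \<omega>) \<le> (LINT \<omega>|M. \<bar>Z \<omega>\<bar> * indicator A \<omega>)"
proof -
 let ?P = "{\<omega>\<in>space M. 0 \<le> X \<omega>}" and ?Q = "{\<omega>\<in>space M. X \<omega> < 0}"
 have P: "?P \<in> sets (F t)" "?Q \<in> sets (F t)" using X(1) unfolding space_F[of t, symmetric] by measurable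
 have AP: "A \<inter> ?P \<in> sets (F t)" "A \<inter> ?Q \<in> sets (F t)" using A P by auto
 have M: "A \<in> sets M" "A \<inter> ?P \<in> sets M" "A \<inter> ?Q \<in> sets M" using sets_F_subset[OF t] A AP by auto
 have i: "integrable M (\<lambda>\<omega>. X \<omega> * indicator B \<omega>)" "integrable M (\<lambda>\<omega>. Z \<omega> * indicator B \<omega>)" if "B \<in> sets M" for B
  using X(2) Z that by (auto intro: integrable_real_mult_indicator)
 have "(LINT \<omega>|M. \<bar>X \<omega>\<bar> * indicator A \<omega>) = (LINT \<omega>|M. X \<omega> * indicator (A \<inter> ?P) \<omega> - X \<omega> * indicator (A \<inter> ?Q) \<omega>)"
  by (rule LINT_cong[OF refl]) (auto simp: indicator_def)
 also have "\<dots> = (LINT \<omega>|M. X \<omega> * indicator (A \<inter> ?P) \<omega>) - (LINT \<omega>|M. X \<omega> * indicator (A \<inter> ?Q) \<omega>)"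
  by (rule LINT_diff) (intro i M)+
 also have "\<dots> = (LINT \<omega>|M. Z \<omega> * indicator (A \<inter> ?P) \<omega>) - (LINT \<omega>|M. Z \<omega> * indicator (A \<inter> ?Q) \<omega>)"
  unfolding eq[OF AP(1)] eq[OF AP(2)] ..
 also have "\<dots> = (LINT \<omega>|M. Z \<omega> * indicator (A \<inter> ?P) \<omega> - Z \<omega> * indicator (A \<inter> ?Q) \<omega>)"
  by (rule LINT_diff[symmetric]) (intro i M)+
 also have "\<dots> \<le> (LINT \<omega>|M. \<bar>Z \<omega>\<bar> * indicator A \<omega>)"
 proof (rule integral_mono)
  show "integrable M (\<lambda>\<omega>. Z \<omega> * indicator (A \<inter> ?P) \<omega> - Z \<omega> * indicator (A \<inter> ?Q) \<omega>)"
   by (rule LINT_integrable_diff) (intro i M)+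
  show "integrable M (\<lambda>\<omega>. \<bar>Z \<omega>\<bar> * indicator A \<omega>)" using Z M(1) by (auto intro: integrable_real_mult_indicator)
 qed (auto simp: indicator_def)
 finally show ?thesis .
qed

lemma closes_abs_le:
 assumes N: "closes Z N" "t \<in> {0..T}" "A \<in> sets (F t)"
 shows "(LINT \<omega>|M. \<bar>N t \<omega>\<bar> * indicator A \<omega>) \<le> (LINT \<omega>|M. \<bar>Z \<omega>\<bar> * indicator A \<omega>)"
 using N closesD[OF N(1,2)] by (intro abs_cond_le[OF N(2)]) (auto simp: closes_def)

text \<open>The events \<open>{K < \<bar>N t\<bar>}\<close> belong to \<open>F t\<close>, where \<open>\<bar>Z\<bar>\<close> dominates \<open>\<bar>N t\<bar>\<close> in the mean.\<close>

lemma closes_UI: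
 assumes N: "closes Z N"
 shows "uniformly_integrable M (N ` {0..T})"
proof (rule uniformly_integrable_dominated)
 show "integrable M Z" using N by (simp add: closes_def)
 show "integrable M X" if "X \<in> N ` {0..T}" for X using that closesD(2)[OF N] by auto
 fix X and K :: real assume "X \<in> N ` {0..T}"
 then obtain t where t: "t \<in> {0..T}" "X = N t" by auto
 let ?A = "{\<omega>\<in>space M. K < \<bar>N t \<omega>\<bar>}"
 have A: "?A \<in> sets (F t)" using closesD(1)[OF N t(1)] unfolding space_F[of t, symmetric] by measurable
 have "(LINT \<omega>|M. \<bar>Y \<omega>\<bar> * of_bool (K < \<bar>N t \<omega>\<bar>)) = (LINT \<omega>|M. \<bar>Y \<omega>\<bar> * indicator ?A \<omega>)" for Y :: "'a \<Rightarrow> real"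
  by (rule LINT_cong) (auto simp: indicator_def)
 then show "(LINT \<omega>|M. \<bar>X \<omega>\<bar> * of_bool (K < \<bar>X \<omega>\<bar>)) \<le> (LINT \<omega>|M. \<bar>Z \<omega>\<bar> * of_bool (K < \<bar>X \<omega>\<bar>))"
  using closes_abs_le[OF N t(1) A] t(2) by simp
qed

definition grid :: "nat \<Rightarrow> nat \<Rightarrow> real" where "grid m j = T * real j / 2 ^ m"

definition dyadic :: "real set" where "dyadic = (\<Union>m. grid m ` {..2 ^ m})"

lemma grid_range: "j \<le> 2 ^ m \<Longrightarrow> grid m j \<in> {0..T}"
proof -
 assume "j \<le> 2 ^ m"
 then have "real j \<le> 2 ^ m" by (metis of_nat_le_iff of_nat_numeral of_nat_power)
 then have "T * real j \<le> T * 2 ^ m" by (rule mult_left_mono[OF _ T_nonneg])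
 then have "grid m j \<le> T" unfolding grid_def by (subst pos_divide_le_eq) simp_all
 moreover have "0 \<le> grid m j" unfolding grid_def by (intro divide_nonneg_nonneg mult_nonneg_nonneg T_nonneg) simp_all
 ultimately show ?thesis by simp
qed

lemma grid_strict_mono: "i < j \<Longrightarrow> grid m i < grid m j"
 unfolding grid_def using horizon_pos by (intro divide_strict_right_mono mult_strict_left_mono) simp_all

lemma grid_le: "i \<le> j \<Longrightarrow> grid m i \<le> grid m j"
 using grid_strict_mono[of i j m] by (cases "i = j") auto

lemma grid_less_iff: "grid m i < grid m j \<longleftrightarrow> i < j"
proof
 show "i < j" if "grid m i < grid m j" by (rule ccontr) (use that grid_le[of j i m] in simp)
qed (rule grid_strict_mono)

lemma grid_refine: "grid (m + k) (j * 2 ^ k) = grid m j"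
 by (simp add: grid_def power_add)

lemma dyadicI: "j \<le> 2 ^ m \<Longrightarrow> grid m j \<in> dyadic"
 unfolding dyadic_def by (intro UN_I[of m] imageI) simp_all

lemma dyadicE:
 assumes "q \<in> dyadic"
 obtains m j where "q = grid m j" "j \<le> 2 ^ m"
proof -
 from assms obtain m where "q \<in> grid m ` {..2 ^ m}" unfolding dyadic_def by (rule UN_E)
 then obtain j where "q = grid m j" "j \<in> {..2 ^ m}" by (rule imageE)
 then show thesis by (intro that[of m j]) simp_all
qed

lemma dyadic_range: "q \<in> dyadic \<Longrightarrow> q \<in> {0..T}"
 by (erule dyadicE) (simp only: grid_range)

lemma dyadic_eventually:
 assumes "v \<in> dyadic"
 shows "\<forall>\<^sub>F m in sequentially. \<exists>j\<le>2 ^ m. grid m j = v"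
proof -
 obtain m0 j where v: "v = grid m0 j" "j \<le> 2 ^ m0" by (rule dyadicE[OF assms])
 show ?thesis
  using eventually_ge_at_top[of m0]
 proof eventually_elim
  case (elim m)
  define k where "k = m - m0"
  have k: "m = m0 + k" using elim by (simp add: k_def)
  have "j * 2 ^ k \<le> 2 ^ m0 * 2 ^ k" using v(2) by (rule mult_le_mono1)
  then have "j * 2 ^ k \<le> 2 ^ m" by (simp only: k power_add)
  moreover have "grid m (j * 2 ^ k) = v" by (simp only: k v(1) grid_refine)
  ultimately show ?case by blast
 qed
qed

text \<open>The grid point of order \<open>k\<close> strictly to the right of \<open>t\<close>.\<close>

definition above :: "nat \<Rightarrow> real \<Rightarrow> real" where "above k t = grid k (Suc (nat \<lfloor>t * 2 ^ k / T\<rfloor>))"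

lemma above:
 assumes t: "0 \<le> t" "t < T"
 shows "above k t \<in> dyadic" "t < above k t" "above k t \<le> t + T * (1/2) ^ k"
proof -
 define y where "y = t * 2 ^ k / T"
 have "t * 2 ^ k < 2 ^ k * T" by (subst mult.commute, rule mult_strict_left_mono[OF t(2)]) simp
 then have y: "0 \<le> y" "t = T * y / 2 ^ k" "y < 2 ^ k"
  using t horizon_pos by (simp_all add: y_def pos_divide_less_eq)
 define j where "j = nat \<lfloor>y\<rfloor>"
 have j: "real j \<le> y" "y < real j + 1" using y(1) unfolding j_def by linarith+
 have a: "above k t = grid k (Suc j)" by (simp add: above_def j_def y_def)
 have "real j < 2 ^ k" using j y by linarith
 then have "j < 2 ^ k" by (metis of_nat_less_iff of_nat_numeral of_nat_power)
 then show "above k t \<in> dyadic" unfolding a by (intro dyadicI) (simp only: Suc_le_eq)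
 have "T * y < T * real (Suc j)" using j horizon_pos by (intro mult_strict_left_mono) auto
 then have "T * y / 2 ^ k < T * real (Suc j) / 2 ^ k" by (rule divide_strict_right_mono) simp
 then show "t < above k t" unfolding a grid_def by (simp only: y(2)[symmetric])
 have "T * real (Suc j) \<le> T * (y + 1)" using j horizon_pos by (intro mult_left_mono) auto
 then have "grid k (Suc j) \<le> T * (y + 1) / 2 ^ k" unfolding grid_def by (rule divide_right_mono) simp
 also have "\<dots> = T * y / 2 ^ k + T * (1/2) ^ k" by (simp add: add_divide_distrib distrib_left power_one_over)
 also have "\<dots> = t + T * (1/2) ^ k" by (simp only: y(2)[symmetric])
 finally show "above k t \<le> t + T * (1/2) ^ k" unfolding a .
qed

lemma above_tendsto: "0 \<le> t \<Longrightarrow> t < T \<Longrightarrow> (\<lambda>k. above k t) \<longlonglongrightarrow> t"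
proof -
 assume t: "0 \<le> t" "t < T"
 have "(\<lambda>k. t + T * (1/2) ^ k) \<longlonglongrightarrow> t + T * 0" by (intro tendsto_intros LIMSEQ_power_zero) simp
 then show ?thesis using above(2,3)[OF t]
  by (intro tendsto_sandwich[of "\<lambda>_. t" "\<lambda>k. above k t" sequentially "\<lambda>k. t + T * (1/2) ^ k"])
   (auto intro!: always_eventually less_imp_le)
qed

lemma dyadic_dense_right: "0 \<le> t \<Longrightarrow> t < T \<Longrightarrow> t < s \<Longrightarrow> \<exists>q\<in>dyadic. t < q \<and> q < s"
proof -
 assume t: "0 \<le> t" "t < T" and s: "t < s"
 have "\<forall>\<^sub>F k in sequentially. above k t < s" using above_tendsto[OF t] s by (rule order_tendstoD)
 then obtain k where "above k t < s" using eventually_happens'[OF sequentially_bot] by blast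
 then show ?thesis using above(1,2)[OF t, of k] by blast
qed

text \<open>Infinitely many upcrossings along the dyadic times, expressed through the finite grids.\<close>

definition oscillates :: "real \<Rightarrow> real \<Rightarrow> (real \<Rightarrow> real) \<Rightarrow> bool" where
 "oscillates a b h \<longleftrightarrow> (\<forall>k. \<forall>\<^sub>F m in sequentially. k \<le> upcrossings a b (\<lambda>j. h (grid m j)) (2 ^ m))"

lemma oscillatesI:
 assumes "\<And>k. \<exists>v. \<forall>\<^sub>F m in sequentially. \<exists>j\<le>2 ^ m. grid m j = v \<and> k \<le> upcrossings a b (\<lambda>j. h (grid m j)) j"
 shows "oscillates a b h"
 unfolding oscillates_def
proof
 fix k
 obtain v where "\<forall>\<^sub>F m in sequentially. \<exists>j\<le>2 ^ m. grid m j = v \<and> k \<le> upcrossings a b (\<lambda>j. h (grid m j)) j"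
  using assms by blast
 then show "\<forall>\<^sub>F m in sequentially. k \<le> upcrossings a b (\<lambda>j. h (grid m j)) (2 ^ m)"
 proof eventually_elim
  case (elim m)
  then obtain j where "j \<le> 2 ^ m" "k \<le> upcrossings a b (\<lambda>j. h (grid m j)) j" by blast
  then show ?case using upcrossings_mono[of j "2 ^ m" a b "\<lambda>j. h (grid m j)"] by simp
 qed
qed

lemma oscillates_step:
 assumes ab: "a < b" and vpq: "v < p" "p < q" "p \<in> dyadic" "q \<in> dyadic" "h p < a" "b < h q"
  and v: "\<forall>\<^sub>F m in sequentially. \<exists>j\<le>2 ^ m. grid m j = v \<and> k \<le> upcrossings a b (\<lambda>j. h (grid m j)) j"
 shows "\<forall>\<^sub>F m in sequentially. \<exists>j\<le>2 ^ m. grid m j = q \<and> Suc k \<le> upcrossings a b (\<lambda>j. h (grid m j)) j"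
 using v dyadic_eventually[OF vpq(3)] dyadic_eventually[OF vpq(4)]
proof eventually_elim
 case (elim m)
 obtain jv jp jq where j: "grid m jv = v" "k \<le> upcrossings a b (\<lambda>j. h (grid m j)) jv" "grid m jp = p" "grid m jq = q" "jq \<le> 2 ^ m"
  using elim by blast
 have "jv < jp" "jp < jq" using vpq(1,2) j grid_less_iff by blast+
 then have "upcrossings a b (\<lambda>j. h (grid m j)) jv + 1 \<le> upcrossings a b (\<lambda>j. h (grid m j)) jq"
  using upcrossings_step[OF ab, of jp jq "\<lambda>j. h (grid m j)"] upcrossings_mono[of jv jp a b "\<lambda>j. h (grid m j)"] vpq(5,6) j by simp
 then show ?case using j by (intro exI[of _ jq]) simp
qed

lemma frequently_at_within_right:
 "(\<exists>\<^sub>F x in at t within S \<inter> {t<..}. P x) \<longleftrightarrow> (\<forall>s>t. \<exists>x\<in>S. t < x \<and> x < s \<and> P x)" for t :: real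
proof -
 have "eventually Q (at t within S \<inter> {t<..}) \<longleftrightarrow> (\<exists>s>t. \<forall>x\<in>S. t < x \<and> x < s \<longrightarrow> Q x)" for Q
 proof
  assume "eventually Q (at t within S \<inter> {t<..})"
  from this[unfolded eventually_at] obtain d
   where d: "0 < d" "\<forall>x\<in>S \<inter> {t<..}. x \<noteq> t \<and> dist x t < d \<longrightarrow> Q x" by (elim exE conjE)
  have "Q x" if "x \<in> S" "t < x \<and> x < (t + d)" for x
   using d(2)[THEN bspec, of x] that by (simp add: dist_real_def)
  then show "\<exists>s>t. \<forall>x\<in>S. t < x \<and> x < s \<longrightarrow> Q x" using d(1) by (intro exI[of _ "t + d"]) simp
 next
  assume "\<exists>s>t. \<forall>x\<in>S. t < x \<and> x < s \<longrightarrow> Q x"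
  then obtain s where s: "t < s" "\<forall>x\<in>S. t < x \<and> x < s \<longrightarrow> Q x" by (elim exE conjE)
  have "Q x" if "x \<in> S \<inter> {t<..}" "dist x t < s - t" for x
   using s(2)[THEN bspec, of x] that by (simp add: dist_real_def)
  then show "eventually Q (at t within S \<inter> {t<..})"
   unfolding eventually_at using s(1) by (intro exI[of _ "s - t"]) simp
 qed
 from this[of "\<lambda>x. \<not> P x"] show ?thesis unfolding frequently_def by simp
qed

lemma frequently_at_within_left:
 "(\<exists>\<^sub>F x in at t within S \<inter> {..<t}. P x) \<longleftrightarrow> (\<forall>s<t. \<exists>x\<in>S. s < x \<and> x < t \<and> P x)" for t :: real
proof -
 have "eventually Q (at t within S \<inter> {..<t}) \<longleftrightarrow> (\<exists>s<t. \<forall>x\<in>S. s < x \<and> x < t \<longrightarrow> Q x)" for Q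
 proof
  assume "eventually Q (at t within S \<inter> {..<t})"
  from this[unfolded eventually_at] obtain d
   where d: "0 < d" "\<forall>x\<in>S \<inter> {..<t}. x \<noteq> t \<and> dist x t < d \<longrightarrow> Q x" by (elim exE conjE)
  have "Q x" if "x \<in> S" "(t - d) < x \<and> x < t" for x
   using d(2)[THEN bspec, of x] that by (simp add: dist_real_def)
  then show "\<exists>s<t. \<forall>x\<in>S. s < x \<and> x < t \<longrightarrow> Q x" using d(1) by (intro exI[of _ "t - d"]) simp
 next
  assume "\<exists>s<t. \<forall>x\<in>S. s < x \<and> x < t \<longrightarrow> Q x"
  then obtain s where s: "s < t" "\<forall>x\<in>S. s < x \<and> x < t \<longrightarrow> Q x" by (elim exE conjE)
  have "Q x" if "x \<in> S \<inter> {..<t}" "dist x t < t - s" for x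
   using s(2)[THEN bspec, of x] that by (simp add: dist_real_def)
  then show "eventually Q (at t within S \<inter> {..<t})"
   unfolding eventually_at using s(1) by (intro exI[of _ "t - s"]) simp
 qed
 from this[of "\<lambda>x. \<not> P x"] show ?thesis unfolding frequently_def by simp
qed

text \<open>Close to \<open>t\<close> on the right there are, arbitrarily near to \<open>t\<close>, dyadic times with values below \<open>a\<close> and above \<open>b\<close>;
 the upcrossings are therefore collected from right to left.\<close>

lemma oscillates_right:
 assumes ab: "a < b" and lo: "\<exists>\<^sub>F x in at t within dyadic \<inter> {t<..}. h x < a"
  and hi: "\<exists>\<^sub>F x in at t within dyadic \<inter> {t<..}. b < h x"
 shows "oscillates a b h"
proof -
 note lo' = lo[unfolded frequently_at_within_right] and hi' = hi[unfolded frequently_at_within_right]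
 have key: "\<forall>s>t. \<exists>v. t < v \<and> v < s \<and> (\<forall>\<^sub>F m in sequentially. \<exists>j\<le>2 ^ m. grid m j = v \<and> k \<le> upcrossings a b (\<lambda>j. h (grid m j)) j)" for k
 proof (induction k)
  case 0
  show ?case
  proof (intro allI impI)
   fix s assume "t < s"
   then obtain v where "v \<in> dyadic" "t < v" "v < s" using lo' by blast
   then show "\<exists>v. t < v \<and> v < s \<and> (\<forall>\<^sub>F m in sequentially. \<exists>j\<le>2 ^ m. grid m j = v \<and> 0 \<le> upcrossings a b (\<lambda>j. h (grid m j)) j)"
    using dyadic_eventually[of v] by (intro exI[of _ v]) simp
  qed
 next
  case (Suc k)
  show ?case
  proof (intro allI impI)
   fix s assume "t < s"
   then obtain q where q: "q \<in> dyadic" "t < q" "q < s" "b < h q" using hi' by blast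
   then obtain p where p: "p \<in> dyadic" "t < p" "p < q" "h p < a" using lo' by blast
   obtain v where v: "t < v" "v < p"
    "\<forall>\<^sub>F m in sequentially. \<exists>j\<le>2 ^ m. grid m j = v \<and> k \<le> upcrossings a b (\<lambda>j. h (grid m j)) j"
    using Suc[THEN spec, THEN mp, OF p(2)] by (elim exE conjE) (rule that)
   from oscillates_step[OF ab v(2) p(3) p(1) q(1) p(4) q(4) v(3)]
   show "\<exists>v. t < v \<and> v < s \<and> (\<forall>\<^sub>F m in sequentially. \<exists>j\<le>2 ^ m. grid m j = v \<and> Suc k \<le> upcrossings a b (\<lambda>j. h (grid m j)) j)"
    using q by (intro exI[of _ q]) simp
  qed
 qed
 obtain s where s: "t < s" using gt_ex by blast
 show ?thesis
 proof (rule oscillatesI)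
  fix k
  from key[THEN spec, THEN mp, OF s, of k]
  show "\<exists>v. \<forall>\<^sub>F m in sequentially. \<exists>j\<le>2 ^ m. grid m j = v \<and> k \<le> upcrossings a b (\<lambda>j. h (grid m j)) j"
   by (elim exE conjE) (rule exI)
 qed
qed

lemma oscillates_left:
 assumes ab: "a < b" and lo: "\<exists>\<^sub>F x in at t within dyadic \<inter> {..<t}. h x < a"
  and hi: "\<exists>\<^sub>F x in at t within dyadic \<inter> {..<t}. b < h x"
 shows "oscillates a b h"
proof -
 note lo' = lo[unfolded frequently_at_within_left] and hi' = hi[unfolded frequently_at_within_left]
 have key: "\<exists>v. v < t \<and> (\<forall>\<^sub>F m in sequentially. \<exists>j\<le>2 ^ m. grid m j = v \<and> k \<le> upcrossings a b (\<lambda>j. h (grid m j)) j)" for k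
 proof (induction k)
  case 0
  obtain s where "s < t" using lt_ex by blast
  from lo'[THEN spec, THEN mp, OF this] obtain v where "v \<in> dyadic" "v < t" by blast
  then show ?case using dyadic_eventually[of v] by (intro exI[of _ v]) simp
 next
  case (Suc k)
  then obtain v where v: "v < t"
   "\<forall>\<^sub>F m in sequentially. \<exists>j\<le>2 ^ m. grid m j = v \<and> k \<le> upcrossings a b (\<lambda>j. h (grid m j)) j" by blast
  obtain p where p: "p \<in> dyadic" "v < p" "p < t" "h p < a" using lo' v(1) by blast
  obtain q where q: "q \<in> dyadic" "p < q" "q < t" "b < h q" using hi' p(3) by blast
  from oscillates_step[OF ab p(2) q(2) p(1) q(1) p(4) q(4) v(2)] show ?case
   using q by (intro exI[of _ q]) simp
 qed
 show ?thesis
 proof (rule oscillatesI)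
  fix k
  from key[of k] show "\<exists>v. \<forall>\<^sub>F m in sequentially. \<exists>j\<le>2 ^ m. grid m j = v \<and> k \<le> upcrossings a b (\<lambda>j. h (grid m j)) j"
   by (elim exE conjE) (rule exI)
 qed
qed

lemma path_limits:
 assumes no: "\<And>a b. a \<in> \<rat> \<Longrightarrow> b \<in> \<rat> \<Longrightarrow> a < b \<Longrightarrow> \<not> oscillates a b h" and bnd: "\<And>q. q \<in> dyadic \<Longrightarrow> \<bar>h q\<bar> \<le> c"
 shows right_limit_exists: "0 \<le> t \<Longrightarrow> t < T \<Longrightarrow> \<exists>l. (h \<longlongrightarrow> l) (at t within dyadic \<inter> {t<..})"
  and left_limit_exists: "\<exists>l. (h \<longlongrightarrow> l) (at t within dyadic \<inter> {..<t})"
proof -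
 have ev: "\<forall>\<^sub>F x in at t within dyadic \<inter> S. \<bar>h x\<bar> \<le> c" for t S
 proof -
  have "\<forall>x\<in>dyadic \<inter> S. x \<noteq> t \<and> dist x t < 1 \<longrightarrow> \<bar>h x\<bar> \<le> c"
  proof (intro ballI impI)
   fix x assume "x \<in> dyadic \<inter> S"
   then have "x \<in> dyadic" by (rule IntD1)
   then show "\<bar>h x\<bar> \<le> c" by (rule bnd)
  qed
  from conjI[OF zero_less_one this] show ?thesis unfolding eventually_at by (rule exI)
 qed
 show "\<exists>l. (h \<longlongrightarrow> l) (at t within dyadic \<inter> {t<..})" if t: "0 \<le> t" "t < T"
 proof (rule limit_if_no_oscillation[OF _ ev])
  have "\<exists>x\<in>dyadic. t < x \<and> x < s \<and> True" if "t < s" for s using dyadic_dense_right[OF t that] by simp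
  then have "\<exists>\<^sub>F x in at t within dyadic \<inter> {t<..}. True" unfolding frequently_at_within_right by simp
  then show "at t within dyadic \<inter> {t<..} \<noteq> bot" by (auto simp: frequently_def)
  show False if "a \<in> \<rat>" "b \<in> \<rat>" "a < b" "\<exists>\<^sub>F x in at t within dyadic \<inter> {t<..}. h x < a"
   "\<exists>\<^sub>F x in at t within dyadic \<inter> {t<..}. b < h x" for a b
   using no[OF that(1-3)] oscillates_right[OF that(3-5)] by simp
 qed
 show "\<exists>l. (h \<longlongrightarrow> l) (at t within dyadic \<inter> {..<t})"
 proof (cases "at t within dyadic \<inter> {..<t} = bot")
  case False
  then show ?thesis
  proof (rule limit_if_no_oscillation[OF _ ev])
   show False if "a \<in> \<rat>" "b \<in> \<rat>" "a < b" "\<exists>\<^sub>F x in at t within dyadic \<inter> {..<t}. h x < a"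
    "\<exists>\<^sub>F x in at t within dyadic \<inter> {..<t}. b < h x" for a b
    using no[OF that(1-3)] oscillates_left[OF that(3-5)] by simp
  qed
 qed simp
qed

lemma closes_measurable:
 assumes N: "closes Z N" and ij: "i \<le> j" "j \<le> 2 ^ m"
 shows "N (grid m i) \<in> borel_measurable (F (grid m j))"
proof -
 have "i \<le> 2 ^ m" using ij by (rule le_trans)
 from closesD(1)[OF N grid_range[OF this]] show ?thesis by (rule measurable_F_le[OF grid_le[OF ij(1)]])
qed

lemma holding_measurable:
 assumes N: "closes Z N" and j: "j \<le> 2 ^ m"
 shows "Measurable.pred (F (grid m j)) (\<lambda>\<omega>. holding a b (\<lambda>i. N (grid m i) \<omega>) j)"
 using j
proof (induction j)
 case 0
 have [measurable]: "N (grid m 0) \<in> borel_measurable (F (grid m 0))" by (rule closes_measurable[OF N]) simp_all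
 show ?case unfolding holding.simps by measurable
next
 case (Suc j)
 let ?G = "F (grid m (Suc j))"
 have [measurable]: "N (grid m (Suc j)) \<in> borel_measurable ?G" by (rule closes_measurable[OF N order_refl Suc.prems])
 have "j \<le> 2 ^ m" using Suc.prems by simp
 from measurable_F_le[OF grid_le[of j "Suc j"] Suc.IH[OF this]]
 have [measurable]: "Measurable.pred ?G (\<lambda>\<omega>. holding a b (\<lambda>i. N (grid m i) \<omega>) j)" by simp
 show ?case unfolding holding.simps by measurable
qed

lemma upcrossings_measurable:
 assumes N: "closes Z N" and j: "j \<le> 2 ^ m"
 shows "(\<lambda>\<omega>. real (upcrossings a b (\<lambda>i. N (grid m i) \<omega>) j)) \<in> borel_measurable M"
 using j
proof (induction j)
 case (Suc j)
 have j: "j \<le> 2 ^ m" using Suc.prems by simp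
 have g: "grid m j \<in> {0..T}" "grid m (Suc j) \<in> {0..T}" by (rule grid_range[OF j], rule grid_range[OF Suc.prems])
 have [measurable]: "N (grid m (Suc j)) \<in> borel_measurable M"
  by (rule measurable_F_M[OF g(2) closesD(1)[OF N g(2)]])
 have [measurable]: "Measurable.pred M (\<lambda>\<omega>. holding a b (\<lambda>i. N (grid m i) \<omega>) j)"
  by (rule measurable_F_M[OF g(1) holding_measurable[OF N j]])
 note [measurable] = Suc.IH[OF j]
 have "(\<lambda>\<omega>. real (upcrossings a b (\<lambda>i. N (grid m i) \<omega>) j) +
   (if holding a b (\<lambda>i. N (grid m i) \<omega>) j \<and> b < N (grid m (Suc j)) \<omega> then 1 else 0)) \<in> borel_measurable M"
  by measurable
 moreover have "(\<lambda>\<omega>. real (upcrossings a b (\<lambda>i. N (grid m i) \<omega>) (Suc j))) = (\<lambda>\<omega>. real (upcrossings a b (\<lambda>i. N (grid m i) \<omega>) j) +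
   (if holding a b (\<lambda>i. N (grid m i) \<omega>) j \<and> b < N (grid m (Suc j)) \<omega> then 1 else 0))" by (rule ext) simp
 ultimately show ?case by (simp only:)
qed simp

text \<open>The trading gains have mean zero because the position is known when it is held; the loss on an open
 position is at most \<open>\<bar>N T\<bar> + \<bar>a\<bar>\<close>.\<close>

lemma upcrossings_expectation:
 assumes N: "closes Z N" and ab: "a < b"
 shows "(\<integral>\<^sup>+\<omega>. ennreal (real (upcrossings a b (\<lambda>i. N (grid m i) \<omega>) (2 ^ m))) \<partial>M)
  \<le> ennreal (((LINT \<omega>|M. \<bar>Z \<omega>\<bar>) + \<bar>a\<bar>) / (b - a))"
proof -
 define U where "U \<omega> = real (upcrossings a b (\<lambda>i. N (grid m i) \<omega>) (2 ^ m))" for \<omega>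
 have Um[measurable]: "U \<in> borel_measurable M" unfolding U_def by (rule upcrossings_measurable[OF N]) simp
 define H where "H i = {\<omega>\<in>space M. holding a b (\<lambda>i. N (grid m i) \<omega>) i}" for i
 define G where "G \<omega> = (\<Sum>i<2 ^ m. (N (grid m (Suc i)) \<omega> * indicator (H i) \<omega> - N (grid m i) \<omega> * indicator (H i) \<omega>))" for \<omega>
 have g: "grid m i \<in> {0..T}" if "i \<le> 2 ^ m" for i by (rule grid_range[OF that])
 have HF: "H i \<in> sets (F (grid m i))" if "i \<le> 2 ^ m" for i unfolding H_def using holding_measurable[OF N that, of a b] by (simp only: pred_def space_F)
 have HM: "H i \<in> sets M" if "i \<le> 2 ^ m" for i using HF[OF that] sets_F_subset[OF g[OF that]] by auto
 have iN: "integrable M (\<lambda>\<omega>. N (grid m j) \<omega> * indicator (H i) \<omega>)" if "i \<le> 2 ^ m" "j \<le> 2 ^ m" for i j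
  by (rule integrable_real_mult_indicator[OF HM[OF that(1)] closesD(2)[OF N g[OF that(2)]]])
 have iG: "integrable M G" unfolding G_def by (intro LINT_integrable_sum LINT_integrable_diff iN) auto
 have "(LINT \<omega>|M. G \<omega>) = (\<Sum>i<2 ^ m. LINT \<omega>|M. (N (grid m (Suc i)) \<omega> * indicator (H i) \<omega> - N (grid m i) \<omega> * indicator (H i) \<omega>))"
  unfolding G_def by (intro LINT_sum LINT_integrable_diff iN) auto
 also have "\<dots> = 0"
 proof (intro sum.neutral ballI)
  fix i assume "i \<in> {..<2 ^ m::nat}"
  then have i: "i \<le> 2 ^ m" "Suc i \<le> 2 ^ m" by auto
  have HF': "H i \<in> sets (F (grid m (Suc i)))" using sets_F_le[OF grid_le HF[OF i(1)], of "Suc i"] by simp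
  have "(LINT \<omega>|M. (N (grid m (Suc i)) \<omega> * indicator (H i) \<omega> - N (grid m i) \<omega> * indicator (H i) \<omega>))
   = (LINT \<omega>|M. N (grid m (Suc i)) \<omega> * indicator (H i) \<omega>) - (LINT \<omega>|M. N (grid m i) \<omega> * indicator (H i) \<omega>)"
   by (rule LINT_diff[OF iN[OF i(1,2)] iN[OF i(1,1)]])
  then show "(LINT \<omega>|M. (N (grid m (Suc i)) \<omega> * indicator (H i) \<omega> - N (grid m i) \<omega> * indicator (H i) \<omega>)) = 0"
   using closesD(3)[OF N g[OF i(2)] HF'] closesD(3)[OF N g[OF i(1)] HF[OF i(1)]] by simp
 qed
 finally have G0: "(LINT \<omega>|M. G \<omega>) = 0" .
 let ?x = "N (grid m (2 ^ m))"
 have ix: "integrable M ?x" by (rule closesD(2)[OF N g]) simp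
 have pw: "(b - a) * U \<omega> \<le> G \<omega> + \<bar>?x \<omega>\<bar> + \<bar>a\<bar>" if w: "\<omega> \<in> space M" for \<omega>
 proof -
  have "(\<Sum>i<2 ^ m. of_bool (holding a b (\<lambda>i. N (grid m i) \<omega>) i) * (N (grid m (Suc i)) \<omega> - N (grid m i) \<omega>)) = G \<omega>"
   unfolding G_def H_def using w by (intro sum.cong) (auto simp: indicator_def)
  then show ?thesis using upcrossings_gain[OF ab, of "\<lambda>i. N (grid m i) \<omega>" "2 ^ m"]
   by (auto simp: U_def split: if_splits)
 qed
 have U0: "0 \<le> U \<omega>" for \<omega> by (simp add: U_def)
 have iU: "integrable M U"
 proof (rule Bochner_Integration.integrable_bound[of _ "\<lambda>\<omega>. (G \<omega> + \<bar>?x \<omega>\<bar> + \<bar>a\<bar>) / (b - a)"])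
  show "integrable M (\<lambda>\<omega>. (G \<omega> + \<bar>?x \<omega>\<bar> + \<bar>a\<bar>) / (b - a))" using iG ix by auto
  show "AE \<omega> in M. norm (U \<omega>) \<le> norm ((G \<omega> + \<bar>?x \<omega>\<bar> + \<bar>a\<bar>) / (b - a))"
  proof (rule AE_I2)
   fix \<omega> assume "\<omega> \<in> space M"
   then have "U \<omega> \<le> (G \<omega> + \<bar>?x \<omega>\<bar> + \<bar>a\<bar>) / (b - a)" using pw[of \<omega>] ab by (simp add: field_simps)
   also have "\<dots> \<le> norm ((G \<omega> + \<bar>?x \<omega>\<bar> + \<bar>a\<bar>) / (b - a))" unfolding real_norm_def by (rule abs_ge_self)
   finally show "norm (U \<omega>) \<le> norm ((G \<omega> + \<bar>?x \<omega>\<bar> + \<bar>a\<bar>) / (b - a))" by (simp only: real_norm_def abs_of_nonneg[OF U0])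
  qed
 qed (rule Um)
 have "(LINT \<omega>|M. U \<omega>) \<le> (LINT \<omega>|M. (G \<omega> + \<bar>?x \<omega>\<bar> + \<bar>a\<bar>) / (b - a))"
  using iU iG ix pw ab by (intro integral_mono) (auto simp: field_simps)
 also have "\<dots> = ((LINT \<omega>|M. \<bar>?x \<omega>\<bar>) + \<bar>a\<bar>) / (b - a)" using iG ix G0 by (simp add: prob_space)
 also have "\<dots> \<le> ((LINT \<omega>|M. \<bar>Z \<omega>\<bar>) + \<bar>a\<bar>) / (b - a)"
 proof -
  have "(LINT \<omega>|M. \<bar>?x \<omega>\<bar>) = (LINT \<omega>|M. \<bar>?x \<omega>\<bar> * indicator (space M) \<omega>)" "(LINT \<omega>|M. \<bar>Z \<omega>\<bar>) = (LINT \<omega>|M. \<bar>Z \<omega>\<bar> * indicator (space M) \<omega>)"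
   by (auto intro!: LINT_cong)
  moreover have "space M \<in> sets (F (grid m (2 ^ m)))" by (metis sets.top space_F)
  ultimately have "(LINT \<omega>|M. \<bar>?x \<omega>\<bar>) \<le> (LINT \<omega>|M. \<bar>Z \<omega>\<bar>)" using closes_abs_le[OF N g[of "2 ^ m"], of "space M"] by simp
  then show ?thesis using ab by (intro divide_right_mono) auto
 qed
 finally have le: "(LINT \<omega>|M. U \<omega>) \<le> ((LINT \<omega>|M. \<bar>Z \<omega>\<bar>) + \<bar>a\<bar>) / (b - a)" .
 have "(\<integral>\<^sup>+\<omega>. ennreal (U \<omega>) \<partial>M) = ennreal (LINT \<omega>|M. U \<omega>)"
  by (rule nn_integral_eq_integral[OF iU]) (simp add: U_def)
 then show ?thesis using le unfolding U_def by (simp add: ennreal_leI)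
qed

text \<open>By Fatou's lemma the number of upcrossings along all grids is almost surely finite.\<close>

lemma AE_not_oscillates:
 assumes N: "closes Z N" and ab: "a < b"
 shows "AE \<omega> in M. \<not> oscillates a b (\<lambda>t. N t \<omega>)"
proof -
 let ?U = "\<lambda>m \<omega>. ennreal (real (upcrossings a b (\<lambda>i. N (grid m i) \<omega>) (2 ^ m)))"
 have m[measurable]: "?U m \<in> borel_measurable M" for m using upcrossings_measurable[OF N, of "2 ^ m" m a b] by simp
 have "(\<integral>\<^sup>+\<omega>. liminf (\<lambda>m. ?U m \<omega>) \<partial>M) \<le> liminf (\<lambda>m. \<integral>\<^sup>+\<omega>. ?U m \<omega> \<partial>M)" by (rule nn_integral_liminf) (rule m)
 also have "\<dots> \<le> ennreal (((LINT \<omega>|M. \<bar>Z \<omega>\<bar>) + \<bar>a\<bar>) / (b - a))"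
  by (rule Liminf_le, simp, rule always_eventually, rule allI, rule upcrossings_expectation[OF N ab])
 finally have "(\<integral>\<^sup>+\<omega>. liminf (\<lambda>m. ?U m \<omega>) \<partial>M) < top" by (rule le_less_trans[OF _ ennreal_less_top])
 then have "(\<integral>\<^sup>+\<omega>. liminf (\<lambda>m. ?U m \<omega>) \<partial>M) \<noteq> \<infinity>" by simp
 then have "AE \<omega> in M. liminf (\<lambda>m. ?U m \<omega>) \<noteq> \<infinity>" by (intro nn_integral_noteq_infinite) measurable
 then show ?thesis
 proof eventually_elim
  case (elim \<omega>)
  show ?case
  proof
   assume osc: "oscillates a b (\<lambda>t. N t \<omega>)"
   have ge: "of_nat k \<le> liminf (\<lambda>m. ?U m \<omega>)" for k
   proof (rule Liminf_bounded)
    show "\<forall>\<^sub>F m in sequentially. of_nat k \<le> ?U m \<omega>"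
     using osc[unfolded oscillates_def, THEN spec, of k]
     by eventually_elim (simp add: ennreal_of_nat_eq_real_of_nat ennreal_leI)
   qed
   have "liminf (\<lambda>m. ?U m \<omega>) < top" using elim by (simp add: less_top)
   from ennreal_Ex_less_of_nat[OF this] obtain k where "liminf (\<lambda>m. ?U m \<omega>) < of_nat k" ..
   with ge[of k] show False by simp
  qed
 qed
qed

text \<open>Decompose according to the first grid time at which \<open>l\<close> is exceeded; that event is known then, so
 \<open>\<bar>Z\<bar>\<close> has mean at least \<open>l\<close> times its probability there.\<close>

lemma maximal_inequality:
 assumes N: "closes Z N" and l: "0 < l"
 shows "prob {\<omega>\<in>space M. \<exists>j\<le>2 ^ m. l < \<bar>N (grid m j) \<omega>\<bar>} \<le> (LINT \<omega>|M. \<bar>Z \<omega>\<bar>) / l"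
proof -
 define A where "A j = {\<omega>\<in>space M. l < \<bar>N (grid m j) \<omega>\<bar> \<and> (\<forall>i<j. \<not> l < \<bar>N (grid m i) \<omega>\<bar>)}" for j
 have iZ: "integrable M Z" using N by (simp add: closes_def)
 have g: "grid m i \<in> {0..T}" if "i \<le> 2 ^ m" for i by (rule grid_range[OF that])
 have AF: "A j \<in> sets (F (grid m j))" if j: "j \<le> 2 ^ m" for j
 proof -
  have [measurable]: "N (grid m i) \<in> borel_measurable (F (grid m j))" if "i \<le> j" for i
   by (rule closes_measurable[OF N that j])
  have B: "{\<omega>\<in>space M. l < \<bar>N (grid m i) \<omega>\<bar>} \<in> sets (F (grid m j))" if "i \<le> j" for i
   using closes_measurable[OF N that j] unfolding space_F[of "grid m j", symmetric] by measurable
  have "A j = {\<omega>\<in>space M. l < \<bar>N (grid m j) \<omega>\<bar>} - (\<Union>i\<in>{..<j}. {\<omega>\<in>space M. l < \<bar>N (grid m i) \<omega>\<bar>})"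
   by (auto simp: A_def)
  also have "\<dots> \<in> sets (F (grid m j))" by (intro sets.Diff sets.finite_UN B) auto
  finally show ?thesis .
 qed
 have AM: "A j \<in> sets M" if "j \<le> 2 ^ m" for j using AF[OF that] sets_F_subset[OF g[OF that]] by auto
 have disj: "disjoint_family_on A {..2 ^ m}"
  unfolding disjoint_family_on_def A_def by (auto; metis linorder_neqE_nat)
 have eq: "{\<omega>\<in>space M. \<exists>j\<le>2 ^ m. l < \<bar>N (grid m j) \<omega>\<bar>} = (\<Union>j\<in>{..2 ^ m}. A j)"
 proof (intro equalityI subsetI)
  fix \<omega> assume "\<omega> \<in> {\<omega>\<in>space M. \<exists>j\<le>2 ^ m. l < \<bar>N (grid m j) \<omega>\<bar>}"
  then obtain j where w: "\<omega> \<in> space M" "j \<le> 2 ^ m" "l < \<bar>N (grid m j) \<omega>\<bar>" by blast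
  define k where "k = (LEAST j. l < \<bar>N (grid m j) \<omega>\<bar>)"
  have "l < \<bar>N (grid m k) \<omega>\<bar>" unfolding k_def using w(3) by (rule LeastI)
  moreover have "k \<le> j" unfolding k_def using w(3) by (rule Least_le)
  moreover have "\<not> l < \<bar>N (grid m i) \<omega>\<bar>" if "i < k" for i
   using not_less_Least[of i "\<lambda>j. l < \<bar>N (grid m j) \<omega>\<bar>"] that unfolding k_def by simp
  ultimately show "\<omega> \<in> (\<Union>j\<in>{..2 ^ m}. A j)" using w by (intro UN_I[of k]) (auto simp: A_def)
 qed (auto simp: A_def)
 have iA: "integrable M (\<lambda>\<omega>. \<bar>Z \<omega>\<bar> * indicator (A j) \<omega>)" if "j \<le> 2 ^ m" for j
  by (rule integrable_real_mult_indicator[OF AM[OF that] integrable_abs[OF iZ]])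
 have "l * prob (\<Union>j\<in>{..2 ^ m}. A j) = (\<Sum>j\<le>2 ^ m. l * prob (A j))"
  using disj AM by (subst finite_measure_finite_Union) (auto simp: sum_distrib_left)
 also have "\<dots> \<le> (\<Sum>j\<le>2 ^ m. LINT \<omega>|M. \<bar>Z \<omega>\<bar> * indicator (A j) \<omega>)"
 proof (rule sum_mono)
  fix j assume "j \<in> {..2 ^ m::nat}"
  then have j: "j \<le> 2 ^ m" by simp
  have "l * prob (A j) = (LINT \<omega>|M. l * indicator (A j) \<omega>)" using AM[OF j] by simp
  also have "\<dots> \<le> (LINT \<omega>|M. \<bar>N (grid m j) \<omega>\<bar> * indicator (A j) \<omega>)"
  proof (rule integral_mono)
   show "integrable M (\<lambda>\<omega>. l * indicator (A j) \<omega>)"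
    using AM[OF j] by (intro integrable_mult_right integrable_real_indicator) (auto simp: emeasure_eq_measure)
   show "integrable M (\<lambda>\<omega>. \<bar>N (grid m j) \<omega>\<bar> * indicator (A j) \<omega>)"
    by (rule integrable_real_mult_indicator[OF AM[OF j] integrable_abs[OF closesD(2)[OF N g[OF j]]]])
  qed (auto simp: A_def indicator_def)
  also have "\<dots> \<le> (LINT \<omega>|M. \<bar>Z \<omega>\<bar> * indicator (A j) \<omega>)" by (rule closes_abs_le[OF N g[OF j] AF[OF j]])
  finally show "l * prob (A j) \<le> (LINT \<omega>|M. \<bar>Z \<omega>\<bar> * indicator (A j) \<omega>)" .
 qed
 also have "\<dots> = (LINT \<omega>|M. (\<Sum>j\<le>2 ^ m. \<bar>Z \<omega>\<bar> * indicator (A j) \<omega>))"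
  by (rule LINT_sum[symmetric]) (use iA in simp)
 also have "\<dots> \<le> (LINT \<omega>|M. \<bar>Z \<omega>\<bar>)"
 proof (rule integral_mono)
  show "integrable M (\<lambda>\<omega>. \<Sum>j\<le>2 ^ m. \<bar>Z \<omega>\<bar> * indicator (A j) \<omega>)"
   by (rule LINT_integrable_sum) (use iA in simp)
  show "integrable M (\<lambda>\<omega>. \<bar>Z \<omega>\<bar>)" using iZ by simp
  fix \<omega>
  have "(\<Sum>j\<le>2 ^ m. indicat_real (A j) \<omega>) = indicator (\<Union>j\<in>{..2 ^ m}. A j) \<omega>"
   using disj by (subst indicator_UN_disjoint) auto
  then have "(\<Sum>j\<le>2 ^ m. \<bar>Z \<omega>\<bar> * indicator (A j) \<omega>) = \<bar>Z \<omega>\<bar> * indicator (\<Union>j\<in>{..2 ^ m}. A j) \<omega>"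
   by (simp add: sum_distrib_left[symmetric])
  also have "\<dots> \<le> \<bar>Z \<omega>\<bar>" by (simp add: indicator_def)
  finally show "(\<Sum>j\<le>2 ^ m. \<bar>Z \<omega>\<bar> * indicator (A j) \<omega>) \<le> \<bar>Z \<omega>\<bar>" .
 qed
 finally show ?thesis unfolding eq using l by (simp add: field_simps)
qed

lemma AE_dyadic_bounded:
 assumes N: "closes Z N"
 shows "AE \<omega> in M. \<exists>c. \<forall>q\<in>dyadic. \<bar>N q \<omega>\<bar> \<le> c"
proof -
 define E where "E l m = {\<omega>\<in>space M. \<exists>j\<le>2 ^ m. real (Suc l) < \<bar>N (grid m j) \<omega>\<bar>}" for l m :: nat
 have EM: "E l m \<in> sets M" for l m
 proof -
  have "E l m = (\<Union>j\<in>{..2 ^ m}. {\<omega>\<in>space M. real (Suc l) < \<bar>N (grid m j) \<omega>\<bar>})" by (auto simp: E_def)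
  moreover have "{\<omega>\<in>space M. real (Suc l) < \<bar>N (grid m j) \<omega>\<bar>} \<in> sets M" if "j \<le> 2 ^ m" for j
   using measurable_F_M[OF grid_range[OF that] closesD(1)[OF N grid_range[OF that]]] by measurable
  ultimately show ?thesis by auto
 qed
 define c where "c = (LINT \<omega>|M. \<bar>Z \<omega>\<bar>)"
 have Einc: "incseq (E l)" for l
 proof (rule incseq_SucI, rule subsetI)
  fix m \<omega> assume "\<omega> \<in> E l m"
  then obtain j where j: "\<omega> \<in> space M" "j \<le> 2 ^ m" "real (Suc l) < \<bar>N (grid m j) \<omega>\<bar>" unfolding E_def by blast
  have "grid (Suc m) (j * 2) = grid m j" using grid_refine[of m 1 j] by simp
  then show "\<omega> \<in> E l (Suc m)" using j unfolding E_def by (intro CollectI conjI exI[of _ "j * 2"]) auto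
 qed
 have P: "prob (\<Union>m. E l m) \<le> c / real (Suc l)" for l
 proof (rule LIMSEQ_le_const2)
  show "(\<lambda>m. prob (E l m)) \<longlonglongrightarrow> prob (\<Union>m. E l m)" using EM Einc by (intro finite_Lim_measure_incseq) auto
  show "\<exists>N. \<forall>m\<ge>N. prob (E l m) \<le> c / real (Suc l)"
   unfolding E_def c_def using maximal_inequality[OF N, of "real (Suc _)"] by (intro exI[of _ 0] allI impI) simp
 qed
 have "prob (\<Inter>l. \<Union>m. E l m) \<le> c * inverse (real (Suc l))" for l
 proof -
  have "prob (\<Inter>l. \<Union>m. E l m) \<le> prob (\<Union>m. E l m)" using EM by (intro finite_measure_mono) auto
  then show ?thesis using P[of l] by (simp add: divide_inverse)
 qed
 moreover have "(\<lambda>l. c * inverse (real (Suc l))) \<longlonglongrightarrow> c * 0" by (intro tendsto_intros LIMSEQ_inverse_real_of_nat)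
 ultimately have "prob (\<Inter>l. \<Union>m. E l m) \<le> 0" by (intro LIMSEQ_le_const[of "\<lambda>l. c * inverse (real (Suc l))"]) auto
 then have "emeasure M (\<Inter>l. \<Union>m. E l m) = 0" by (simp add: emeasure_eq_measure measure_le_0_iff)
 then have "(\<Inter>l. \<Union>m. E l m) \<in> null_sets M" using EM by (intro null_setsI) auto
 then have "AE \<omega> in M. \<omega> \<notin> (\<Inter>l. \<Union>m. E l m)" by (rule AE_not_in)
 moreover have "AE \<omega> in M. \<omega> \<in> space M" by simp
 ultimately show ?thesis
 proof eventually_elim
  case (elim \<omega>)
  then obtain l where l: "\<And>m. \<omega> \<notin> E l m" by blast
  have "\<bar>N q \<omega>\<bar> \<le> real (Suc l)" if "q \<in> dyadic" for q
  proof -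
   obtain m j where q: "q = grid m j" "j \<le> 2 ^ m" by (rule dyadicE[OF \<open>q \<in> dyadic\<close>])
   show ?thesis using l[of m] elim(2) q unfolding E_def by force
  qed
  then show ?case by blast
 qed
qed

text \<open>Along dyadic times almost every path is bounded and does not oscillate, so it has one-sided limits; the
 version is the right limit. Uniform integrability identifies the limit of the closing identities, and
 right-continuity of the filtration makes it adapted.\<close>

theorem cadlag_version:
 assumes Z: "integrable M Z"
 obtains X where "cadlag_adapted M F T X" "closes Z X"
proof -
 define N where "N t = real_cond_exp M (F t) Z" for t
 have N: "closes Z N" unfolding N_def by (rule closes_cond_exp[OF Z])
 have "AE \<omega> in M. \<forall>p\<in>\<rat> \<times> \<rat>. fst p < snd p \<longrightarrow> \<not> oscillates (fst p) (snd p) (\<lambda>t. N t \<omega>)"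
 proof (subst AE_ball_countable)
  show "countable (\<rat> \<times> \<rat> :: (real \<times> real) set)" by (intro countable_SIGMA countable_rat)
  show "\<forall>p\<in>\<rat> \<times> \<rat>. AE \<omega> in M. fst p < snd p \<longrightarrow> \<not> oscillates (fst p) (snd p) (\<lambda>t. N t \<omega>)"
  proof
   fix p :: "real \<times> real" assume "p \<in> \<rat> \<times> \<rat>"
   show "AE \<omega> in M. fst p < snd p \<longrightarrow> \<not> oscillates (fst p) (snd p) (\<lambda>t. N t \<omega>)"
   proof (cases "fst p < snd p")
    case True then show ?thesis using AE_not_oscillates[OF N True] by simp
   qed simp
  qed
 qed
 with AE_dyadic_bounded[OF N]
 have "AE \<omega> in M. (\<exists>c. \<forall>q\<in>dyadic. \<bar>N q \<omega>\<bar> \<le> c) \<and> (\<forall>p\<in>\<rat> \<times> \<rat>. fst p < snd p \<longrightarrow> \<not> oscillates (fst p) (snd p) (\<lambda>t. N t \<omega>))"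
  by (rule AE_conjI)
 from AE_E[OF this] obtain B where B': "{\<omega>\<in>space M. \<not> ((\<exists>c. \<forall>q\<in>dyadic. \<bar>N q \<omega>\<bar> \<le> c) \<and> (\<forall>p\<in>\<rat> \<times> \<rat>. fst p < snd p \<longrightarrow> \<not> oscillates (fst p) (snd p) (\<lambda>t. N t \<omega>)))} \<subseteq> B"
  "emeasure M B = 0" "B \<in> sets M" by blast
 then have B: "B \<in> null_sets M" by (simp add: null_setsI)
 have good: "\<exists>c. \<forall>q\<in>dyadic. \<bar>N q \<omega>\<bar> \<le> c" "\<And>a b. a \<in> \<rat> \<Longrightarrow> b \<in> \<rat> \<Longrightarrow> a < b \<Longrightarrow> \<not> oscillates a b (\<lambda>t. N t \<omega>)"
  if w: "\<omega> \<in> space M" "\<omega> \<notin> B" for \<omega>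
 proof -
  have *: "(\<exists>c. \<forall>q\<in>dyadic. \<bar>N q \<omega>\<bar> \<le> c) \<and> (\<forall>p\<in>\<rat> \<times> \<rat>. fst p < snd p \<longrightarrow> \<not> oscillates (fst p) (snd p) (\<lambda>t. N t \<omega>))"
   using B'(1) w by blast
  then show "\<exists>c. \<forall>q\<in>dyadic. \<bar>N q \<omega>\<bar> \<le> c" by (rule conjunct1)
  show "\<not> oscillates a b (\<lambda>t. N t \<omega>)" if "a \<in> \<rat>" "b \<in> \<rat>" "a < b" for a b
   using conjunct2[OF *, THEN bspec, of "(a, b)"] that by simp
 qed
 let ?R = "\<lambda>t. at t within dyadic \<inter> {t<..}" and ?L = "\<lambda>t. at t within dyadic \<inter> {..<t}"
 define X where "X t \<omega> = (if \<omega> \<in> B then 0 else if t < T then Lim (?R t) (\<lambda>q. N q \<omega>) else N T \<omega>)" for t \<omega>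
 have Rnt: "?R t \<noteq> bot" if t: "0 \<le> t" "t < T" for t
 proof -
  have "\<exists>x\<in>dyadic. t < x \<and> x < s \<and> True" if "t < s" for s using dyadic_dense_right[OF t that] by simp
  then have "\<exists>\<^sub>F x in ?R t. True" unfolding frequently_at_within_right by simp
  then show ?thesis by (auto simp: frequently_def)
 qed
 have Rlim: "((\<lambda>q. N q \<omega>) \<longlongrightarrow> X t \<omega>) (?R t)" if w: "\<omega> \<in> space M" "\<omega> \<notin> B" and t: "0 \<le> t" "t < T" for t \<omega>
 proof -
  obtain c where c: "\<And>q. q \<in> dyadic \<Longrightarrow> \<bar>N q \<omega>\<bar> \<le> c" using good(1)[OF w] by blast
  obtain l where l: "((\<lambda>q. N q \<omega>) \<longlongrightarrow> l) (?R t)" using right_limit_exists[OF good(2)[OF w] c t] by blast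
  then have "Lim (?R t) (\<lambda>q. N q \<omega>) = l" using Rnt[OF t] by (intro tendsto_Lim)
  then show ?thesis using l w t by (simp add: X_def)
 qed
 have Llim: "\<exists>l. ((\<lambda>q. N q \<omega>) \<longlongrightarrow> l) (?L t)" if w: "\<omega> \<in> space M" "\<omega> \<notin> B" for t \<omega>
 proof -
  obtain c where c: "\<And>q. q \<in> dyadic \<Longrightarrow> \<bar>N q \<omega>\<bar> \<le> c" using good(1)[OF w] by blast
  show ?thesis by (rule left_limit_exists[OF good(2)[OF w] c])
 qed
 \<comment> \<open>Where all \<open>N q \<omega>\<close> with dyadic \<open>q\<close> in an open interval are close to \<open>y\<close>, so is \<open>X s \<omega>\<close> for \<open>s\<close> in it.\<close>
 have close: "\<bar>X s \<omega> - y\<bar> \<le> e" if w: "\<omega> \<in> space M" "\<omega> \<notin> B" and s: "0 \<le> s" "s < T" "u < s" "s < v"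
  and near: "\<And>q. q \<in> dyadic \<Longrightarrow> u < q \<Longrightarrow> q < v \<Longrightarrow> \<bar>N q \<omega> - y\<bar> \<le> e" for s u v y e \<omega>
 proof (rule tendsto_upperbound[OF _ _ Rnt[OF s(1,2)]])
  show "((\<lambda>q. \<bar>N q \<omega> - y\<bar>) \<longlongrightarrow> \<bar>X s \<omega> - y\<bar>) (?R s)" by (intro tendsto_intros Rlim[OF w s(1,2)])
  have "\<forall>x\<in>dyadic \<inter> {s<..}. x \<noteq> s \<and> dist x s < v - s \<longrightarrow> \<bar>N x \<omega> - y\<bar> \<le> e"
   using near s by (auto simp: dist_real_def)
  then show "\<forall>\<^sub>F q in ?R s. \<bar>N q \<omega> - y\<bar> \<le> e"
   unfolding eventually_at using s(4) by (intro exI[of _ "v - s"]) simp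
 qed
 have Xlim: "(\<lambda>k. N (above k t) \<omega>) \<longlonglongrightarrow> X t \<omega>" if w: "\<omega> \<in> space M" "\<omega> \<notin> B" and t: "0 \<le> t" "t < T" for t \<omega>
 proof (rule filterlim_compose[OF Rlim[OF w t]])
  have "above k t \<in> dyadic \<inter> {t<..} \<and> above k t \<noteq> t" for k using above(1,2)[OF t, of k] by auto
  then show "filterlim (\<lambda>k. above k t) (?R t) sequentially"
   unfolding filterlim_at using above_tendsto[OF t] by simp
 qed
 have Xadapted: "X t \<in> borel_measurable (F t)" if t: "t \<in> {0..T}" for t
 proof (cases "t < T")
  case False
  then have tT: "t = T" using t by simp
  have "N T \<in> borel_measurable (F T)" by (rule closesD(1)[OF N]) (use T_nonneg in simp)
  moreover have "AE \<omega> in M. N T \<omega> = X T \<omega>" using AE_not_in[OF B] by eventually_elim (simp add: X_def)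
  ultimately show ?thesis unfolding tT by (rule F_measurable_AE_cong) (use T_nonneg in simp)
 next
  case True
  have t0: "0 \<le> t" using t by simp
  have Xs: "X t \<in> borel_measurable (F s)" if s: "s \<in> {t<..T}" for s
  proof -
   obtain K where K: "\<And>k. k \<ge> K \<Longrightarrow> above k t < s"
    using order_tendstoD(2)[OF above_tendsto[OF t0 True], of s] s by (auto simp: eventually_sequentially)
   have sB: "space M - B \<in> sets (F s)"
   proof -
    have "B \<in> sets (F s)" by (rule null_sets_in_F[OF B]) (use s t0 in auto)
    then have "space (F s) - B \<in> sets (F s)" by (rule sets.compl_sets)
    then show ?thesis by (simp add: space_F)
   qed
   show ?thesis
   proof (rule borel_measurable_LIMSEQ_real[where u="\<lambda>k \<omega>. N (above (k + K) t) \<omega> * indicator (space M - B) \<omega>"])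
    fix k
    have "above (k + K) t \<le> s" using K[of "k + K"] by simp
    moreover have "N (above (k + K) t) \<in> borel_measurable (F (above (k + K) t))"
     by (rule closesD(1)[OF N dyadic_range[OF above(1)[OF t0 True]]])
    ultimately have "N (above (k + K) t) \<in> borel_measurable (F s)" by (rule measurable_F_le)
    then show "(\<lambda>\<omega>. N (above (k + K) t) \<omega> * indicator (space M - B) \<omega>) \<in> borel_measurable (F s)"
     using sB by (intro borel_measurable_times borel_measurable_indicator)
   next
    fix \<omega> assume "\<omega> \<in> space (F s)"
    then have w: "\<omega> \<in> space M" by (simp add: space_F)
    show "(\<lambda>k. N (above (k + K) t) \<omega> * indicator (space M - B) \<omega>) \<longlonglongrightarrow> X t \<omega>"
    proof (cases "\<omega> \<in> B")
     case True then show ?thesis by (simp add: X_def)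
    next
     case False
     have "(\<lambda>k. N (above (k + K) t) \<omega>) \<longlonglongrightarrow> X t \<omega>"
      by (rule LIMSEQ_ignore_initial_segment[OF Xlim[OF w False t0 \<open>t < T\<close>]])
     then show ?thesis using False w by simp
    qed
   qed
  qed
  show ?thesis
  proof (rule measurableI)
   fix C :: "real set" assume C: "C \<in> sets borel"
   have "X t -` C \<inter> space M \<in> sets (F s)" if "s \<in> {t<..T}" for s
    using measurable_sets[OF Xs[OF that] C] by (simp add: space_F)
   then have "X t -` C \<inter> space M \<in> sets (F t)" using right_continuous_F[of t] t0 True by auto
   then show "X t -` C \<inter> space (F t) \<in> sets (F t)" by (simp add: space_F)
  qed simp
 qed
 have Xc: "closes Z X"
  unfolding closes_def
 proof (intro conjI ballI Z Xadapted)
  fix t assume t: "t \<in> {0..T}"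
  show "t \<in> {0..T}" by (rule t)
  have Xm: "X t \<in> borel_measurable M" by (rule measurable_F_M[OF t Xadapted[OF t]])
  have "\<exists>Nk. (\<forall>k. Nk k \<in> {t..T}) \<and> (AE \<omega> in M. (\<lambda>k::nat. N (Nk k) \<omega>) \<longlonglongrightarrow> X t \<omega>)"
  proof (cases "t < T")
   case True
   have t0: "0 \<le> t" using t by simp
   have "AE \<omega> in M. (\<lambda>k. N (above k t) \<omega>) \<longlonglongrightarrow> X t \<omega>"
    using AE_not_in[OF B] AE_space by eventually_elim (rule Xlim[OF _ _ t0 True])
   moreover have "\<forall>k. above k t \<in> {t..T}" using above(2)[OF t0 True] dyadic_range[OF above(1)[OF t0 True]] by (auto intro: less_imp_le)
   ultimately show ?thesis by (intro exI[of _ "\<lambda>k. above k t"] conjI)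
  next
   case False
   then have "t = T" using t by simp
   moreover have "AE \<omega> in M. (\<lambda>k::nat. N T \<omega>) \<longlonglongrightarrow> X T \<omega>" using AE_not_in[OF B] by eventually_elim (simp add: X_def)
   ultimately show ?thesis by (intro exI[of _ "\<lambda>_. T"]) simp
  qed
  then obtain q where q: "\<And>k. q k \<in> {t..T}" "AE \<omega> in M. (\<lambda>k::nat. N (q k) \<omega>) \<longlonglongrightarrow> X t \<omega>" by blast
  have q0: "q k \<in> {0..T}" for k using q(1)[of k] t by auto
  have S: "N (q k) \<in> N ` {0..T}" for k using q0 by simp
  show "integrable M (X t)" by (rule Vitali_convergence(1)[OF closes_UI[OF N] S q(2) Xm])
  show "(LINT \<omega>|M. X t \<omega> * indicator A \<omega>) = (LINT \<omega>|M. Z \<omega> * indicator A \<omega>)" if A: "A \<in> sets (F t)" for A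
  proof -
   have AM: "A \<in> sets M" using A sets_F_subset[OF t] by auto
   have lim: "(\<lambda>k. LINT \<omega>|M. N (q k) \<omega> * indicator A \<omega>) \<longlonglongrightarrow> (LINT \<omega>|M. X t \<omega> * indicator A \<omega>)"
    by (rule Vitali_convergence_set[OF closes_UI[OF N] S q(2) Xm AM])
   have "(LINT \<omega>|M. N (q k) \<omega> * indicator A \<omega>) = (LINT \<omega>|M. Z \<omega> * indicator A \<omega>)" for k
    using closesD(3)[OF N q0 sets_F_le[OF _ A]] q(1)[of k] by simp
   then have "(\<lambda>k. LINT \<omega>|M. Z \<omega> * indicator A \<omega>) \<longlonglongrightarrow> (LINT \<omega>|M. X t \<omega> * indicator A \<omega>)" using lim by simp
   from LIMSEQ_unique[OF this tendsto_const] show ?thesis .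
  qed
 qed
 have "cadlag_adapted M F T X"
  unfolding cadlag_adapted_def
 proof (intro conjI ballI Xadapted)
  fix \<omega> t assume w: "\<omega> \<in> space M" and t: "t \<in> {0..<T}"
  show "((\<lambda>s. X s \<omega>) \<longlongrightarrow> X t \<omega>) (at_right t)"
  proof (cases "\<omega> \<in> B")
   case True then show ?thesis by (simp add: X_def)
  next
   case False
   show ?thesis
   proof (rule tendstoI)
    fix e :: real assume "0 < e"
    have "\<forall>\<^sub>F q in ?R t. dist (N q \<omega>) (X t \<omega>) < e/2"
     using tendstoD[OF Rlim[OF w False], of t "e/2"] t \<open>0 < e\<close> by simp
    from this[unfolded eventually_at dist_real_def] obtain d where d0: "0 < d"
     and d': "\<forall>q\<in>dyadic \<inter> {t<..}. q \<noteq> t \<and> \<bar>q - t\<bar> < d \<longrightarrow> \<bar>N q \<omega> - X t \<omega>\<bar> < e/2" by (elim exE conjE) (rule that)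
    have d: "\<bar>N q \<omega> - X t \<omega>\<bar> \<le> e/2" if "q \<in> dyadic" "t < q" "q < t + d" for q
     using d'[THEN bspec, of q] that by simp
    have near: "dist (X s \<omega>) (X t \<omega>) < e" if s: "s \<in> {t<..<min (t + d) T}" for s
     using close[OF w False, of s t "t + d" "X t \<omega>" "e/2"] s t d \<open>0 < e\<close> by (simp add: dist_real_def)
    have "t < min (t + d) T" using d0 t by simp
    from eventually_at_right_real[OF this] show "\<forall>\<^sub>F s in at_right t. dist (X s \<omega>) (X t \<omega>) < e"
     by (rule eventually_mono) (rule near)
   qed
  qed
 next
  fix \<omega> t assume w: "\<omega> \<in> space M" and t: "t \<in> {0<..T}"
  show "\<exists>l. ((\<lambda>s. X s \<omega>) \<longlongrightarrow> l) (at_left t)"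
  proof (cases "\<omega> \<in> B")
   case True then show ?thesis by (intro exI[of _ 0]) (simp add: X_def)
  next
   case False
   obtain l where l: "((\<lambda>q. N q \<omega>) \<longlongrightarrow> l) (?L t)" using Llim[OF w False] by blast
   have "((\<lambda>s. X s \<omega>) \<longlongrightarrow> l) (at_left t)"
   proof (rule tendstoI)
    fix e :: real assume "0 < e"
    have "\<forall>\<^sub>F q in ?L t. dist (N q \<omega>) l < e/2" using tendstoD[OF l, of "e/2"] \<open>0 < e\<close> by simp
    from this[unfolded eventually_at dist_real_def] obtain d where d0: "0 < d"
     and d': "\<forall>q\<in>dyadic \<inter> {..<t}. q \<noteq> t \<and> \<bar>q - t\<bar> < d \<longrightarrow> \<bar>N q \<omega> - l\<bar> < e/2" by (elim exE conjE) (rule that)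
    have d: "\<bar>N q \<omega> - l\<bar> \<le> e/2" if "q \<in> dyadic" "t - d < q" "q < t" for q
     using d'[THEN bspec, of q] that by simp
    have near: "dist (X s \<omega>) l < e" if s: "s \<in> {max (t - d) 0<..<t}" for s
     using close[OF w False, of s "t - d" t l "e/2"] s t d \<open>0 < e\<close> by (simp add: dist_real_def)
    have "max (t - d) 0 < t" using d0 t by simp
    from eventually_at_left_real[OF this] show "\<forall>\<^sub>F s in at_left t. dist (X s \<omega>) l < e"
     by (rule eventually_mono) (rule near)
   qed
   then show ?thesis by blast
  qed
 qed
 then show thesis using Xc by (rule that)
qed

end

section \<open>Sampling a cadlag process along stopping times\<close>

text \<open>By Fatou's lemma the tail bound passes to limits; the strict inequality in the truncation makes the
 truncated absolute value lower semicontinuous.\<close>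

lemma (in prob_space) uniformly_integrable_limits:
 fixes S S' :: "('a \<Rightarrow> real) set"
 assumes UI: "uniformly_integrable M S"
  and lim: "\<And>Y. Y \<in> S' \<Longrightarrow> Y \<in> borel_measurable M \<and> (\<exists>X. (\<forall>k::nat. X k \<in> S) \<and> (AE \<omega> in M. (\<lambda>k. X k \<omega>) \<longlonglongrightarrow> Y \<omega>))"
 shows "uniformly_integrable M S'"
 unfolding uniformly_integrable_def
proof (intro conjI allI impI ballI)
 show "integrable M Y" if "Y \<in> S'" for Y
 proof -
  from lim[OF that] obtain X where Y: "Y \<in> borel_measurable M" and X: "\<And>k::nat. X k \<in> S" "AE \<omega> in M. (\<lambda>k. X k \<omega>) \<longlonglongrightarrow> Y \<omega>"
   by blast
  show ?thesis by (rule Vitali_convergence(1)[OF UI X Y])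
 qed
 fix \<epsilon> :: real assume "0 < \<epsilon>"
 then obtain K where K: "\<And>X. X \<in> S \<Longrightarrow> (LINT \<omega>|M. \<bar>X \<omega>\<bar> * of_bool (K < \<bar>X \<omega>\<bar>)) \<le> \<epsilon>"
  using UI unfolding uniformly_integrable_def by meson
 have "(LINT \<omega>|M. \<bar>Y \<omega>\<bar> * of_bool (K < \<bar>Y \<omega>\<bar>)) \<le> \<epsilon>" if "Y \<in> S'" for Y
 proof -
  from lim[OF that] obtain X where Y: "Y \<in> borel_measurable M" and X: "\<And>k::nat. X k \<in> S" "AE \<omega> in M. (\<lambda>k. X k \<omega>) \<longlonglongrightarrow> Y \<omega>"
   by blast
  have iY: "integrable M Y" by (rule Vitali_convergence(1)[OF UI X Y])
  have iX: "integrable M (X k)" for k using UI X(1)[of k] by (simp add: uniformly_integrable_def)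
  let ?t = "\<lambda>x::real. \<bar>x\<bar> * of_bool (K < \<bar>x\<bar>)"
  have nnX: "(\<integral>\<^sup>+\<omega>. ennreal (?t (X k \<omega>)) \<partial>M) \<le> ennreal \<epsilon>" for k
   using nn_integral_eq_integral[OF integrable_tail[OF iX[of k], of K]] K[OF X(1)[of k]] by (simp add: ennreal_leI)
  have m: "(\<lambda>\<omega>. ennreal (?t (X k \<omega>))) \<in> borel_measurable M" for k
   by (rule measurable_compose[OF borel_measurable_integrable[OF integrable_tail[OF iX[of k], of K]] measurable_ennreal])
  have "(\<integral>\<^sup>+\<omega>. ennreal (?t (Y \<omega>)) \<partial>M) \<le> (\<integral>\<^sup>+\<omega>. liminf (\<lambda>k. ennreal (?t (X k \<omega>))) \<partial>M)"
  proof (rule nn_integral_mono_AE)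
   show "AE \<omega> in M. ennreal (?t (Y \<omega>)) \<le> liminf (\<lambda>k. ennreal (?t (X k \<omega>)))"
    using X(2)
   proof eventually_elim
    case (elim \<omega>)
    show ?case
    proof (cases "K < \<bar>Y \<omega>\<bar>")
     case True
     have a: "(\<lambda>k. \<bar>X k \<omega>\<bar>) \<longlonglongrightarrow> \<bar>Y \<omega>\<bar>" by (rule tendsto_rabs[OF elim])
     from order_tendstoD(1)[OF this True] have "\<forall>\<^sub>F k in sequentially. ?t (X k \<omega>) = \<bar>X k \<omega>\<bar>" by eventually_elim simp
     then have "(\<lambda>k. ?t (X k \<omega>)) \<longlonglongrightarrow> \<bar>Y \<omega>\<bar>" using a by (rule tendsto_cong[THEN iffD2])
     from lim_imp_Liminf[OF sequentially_bot tendsto_ennrealI[OF this]] show ?thesis using True by simp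
    qed simp
   qed
  qed
  also have "\<dots> \<le> liminf (\<lambda>k. \<integral>\<^sup>+\<omega>. ennreal (?t (X k \<omega>)) \<partial>M)" by (rule nn_integral_liminf) (rule m)
  also have "\<dots> \<le> ennreal \<epsilon>" by (rule Liminf_le, simp, rule always_eventually, rule allI, rule nnX)
  finally have "ennreal (LINT \<omega>|M. ?t (Y \<omega>)) \<le> ennreal \<epsilon>"
   using nn_integral_eq_integral[OF integrable_tail[OF iY, of K]] by simp
  then show ?thesis using \<open>0 < \<epsilon>\<close> by (simp add: ennreal_le_iff)
 qed
 then show "\<exists>K. \<forall>X\<in>S'. (LINT \<omega>|M. \<bar>X \<omega>\<bar> * of_bool (K < \<bar>X \<omega>\<bar>)) \<le> \<epsilon>" by (intro exI[of _ K] ballI)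
qed

context usual_filtered_prob_space
begin

text \<open>The discretisation of a stopping time from above on the dyadic grid of order \<open>k\<close>: the cell of
 index \<open>j\<close> carries the value \<open>grid k j\<close>; the last cell also collects \<open>\<tau> = T\<close>.\<close>

definition cell :: "('a \<Rightarrow> real) \<Rightarrow> nat \<Rightarrow> nat \<Rightarrow> 'a set" where
 "cell \<tau> k j = {\<omega>\<in>space M. grid k (j - 1) \<le> \<tau> \<omega> \<and> (j < 2 ^ k \<longrightarrow> \<tau> \<omega> < grid k j)}"

definition cell_index :: "('a \<Rightarrow> real) \<Rightarrow> nat \<Rightarrow> 'a \<Rightarrow> nat" where
 "cell_index \<tau> k \<omega> = min (2 ^ k) (Suc (nat \<lfloor>\<tau> \<omega> * 2 ^ k / T\<rfloor>))"

lemma cell_index_range: "cell_index \<tau> k \<omega> \<in> {1..2 ^ k}"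
 by (simp add: cell_index_def)

lemma cell_iff:
 assumes \<tau>: "\<tau> \<in> ST" and w: "\<omega> \<in> space M" and j: "j \<in> {1..2 ^ k}"
 shows "\<omega> \<in> cell \<tau> k j \<longleftrightarrow> j = cell_index \<tau> k \<omega>"
proof -
 define y where "y = \<tau> \<omega> * 2 ^ k / T"
 have y: "0 \<le> y" "\<tau> \<omega> = T * y / 2 ^ k" using STD_range[OF \<tau> w] horizon_pos by (simp_all add: y_def)
 have g: "grid k i \<le> \<tau> \<omega> \<longleftrightarrow> real i \<le> y" for i
  unfolding grid_def y(2) using horizon_pos by (simp add: divide_le_cancel mult_le_cancel_left_pos)
 define i where "i = nat \<lfloor>y\<rfloor>"
 have i: "real i \<le> y" "y < real i + 1" using y(1) unfolding i_def by linarith+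
 have gi: "grid k l \<le> \<tau> \<omega> \<longleftrightarrow> l \<le> i" for l
 proof -
  have "real l \<le> y \<longleftrightarrow> l \<le> i" using i by linarith
  then show ?thesis using g by simp
 qed
 have "\<omega> \<in> cell \<tau> k j \<longleftrightarrow> j - 1 \<le> i \<and> (j < 2 ^ k \<longrightarrow> \<not> j \<le> i)"
  using w by (simp add: cell_def gi not_le[symmetric] del: not_le)
 also have "\<dots> \<longleftrightarrow> j = min (2 ^ k) (Suc i)" using j by (auto simp: min_def)
 finally show ?thesis unfolding cell_index_def i_def y_def .
qed

lemma cell_F:
 assumes \<tau>: "\<tau> \<in> ST" and j: "j \<in> {1..2 ^ k}"
 shows "cell \<tau> k j \<in> sets (F (grid k j))"
proof -
 have 1: "{\<omega>\<in>space M. \<tau> \<omega> < grid k (j - 1)} \<in> sets (F (grid k j))"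
  by (rule sets_F_le[OF grid_le STD_less[OF \<tau>]]) simp
 have 2: "{\<omega>\<in>space M. \<tau> \<omega> < grid k j} \<in> sets (F (grid k j))" by (rule STD_less[OF \<tau>])
 have sp: "space M \<in> sets (F (grid k j))" by (metis sets.top space_F)
 have "cell \<tau> k j = (space M - {\<omega>\<in>space M. \<tau> \<omega> < grid k (j - 1)}) \<inter> (if j < 2 ^ k then {\<omega>\<in>space M. \<tau> \<omega> < grid k j} else space M)"
  by (auto simp: cell_def not_less)
 also have "\<dots> \<in> sets (F (grid k j))" using 1 2 sp by (intro sets.Int sets.Diff) auto
 finally show ?thesis .
qed

definition discretise :: "('a \<Rightarrow> real) \<Rightarrow> nat \<Rightarrow> 'a \<Rightarrow> real" where
 "discretise \<tau> k \<omega> = grid k (cell_index \<tau> k \<omega>)"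

lemma discretise_props:
 assumes \<tau>: "\<tau> \<in> ST" and w: "\<omega> \<in> space M"
 shows "discretise \<tau> k \<omega> \<in> {0..T}" and "\<tau> \<omega> = T \<Longrightarrow> discretise \<tau> k \<omega> = T"
  and "\<tau> \<omega> < T \<Longrightarrow> \<tau> \<omega> < discretise \<tau> k \<omega>" and "(\<lambda>k. discretise \<tau> k \<omega>) \<longlonglongrightarrow> \<tau> \<omega>"
proof -
 show r: "discretise \<tau> k \<omega> \<in> {0..T}" for k
  unfolding discretise_def using cell_index_range[of \<tau> k \<omega>] by (intro grid_range) simp
 show T: "discretise \<tau> k \<omega> = T" if "\<tau> \<omega> = T" for k
 proof -
  have "\<lfloor>\<tau> \<omega> * 2 ^ k / T\<rfloor> = 2 ^ k"
   using that horizon_pos by (metis floor_of_int nonzero_mult_div_cancel_left of_int_numeral of_int_power order_less_irrefl)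
  then have "cell_index \<tau> k \<omega> = 2 ^ k" by (simp add: cell_index_def nat_power_eq)
  then show ?thesis by (simp add: discretise_def grid_def)
 qed
 have eq: "discretise \<tau> k \<omega> = above k (\<tau> \<omega>)" if "\<tau> \<omega> < T" for k
 proof -
  have t0: "0 \<le> \<tau> \<omega>" using STD_range[OF \<tau> w] by simp
  obtain j where j: "above k (\<tau> \<omega>) = grid k (Suc j)" "j = nat \<lfloor>\<tau> \<omega> * 2 ^ k / T\<rfloor>" by (simp add: above_def)
  have "grid k (Suc j) \<le> grid k (2 ^ k)"
   using dyadic_range[OF above(1)[OF t0 that, of k]] j(1) by (simp add: grid_def[of k "2 ^ k"])
  then have "Suc j \<le> 2 ^ k" using grid_less_iff[of k "2 ^ k" "Suc j"] by linarith
  then show ?thesis using j by (simp add: discretise_def cell_index_def)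
 qed
 show "\<tau> \<omega> < discretise \<tau> k \<omega>" if "\<tau> \<omega> < T" unfolding eq[OF that] using STD_range[OF \<tau> w] that by (intro above(2)) auto
 show "(\<lambda>k. discretise \<tau> k \<omega>) \<longlonglongrightarrow> \<tau> \<omega>"
 proof (cases "\<tau> \<omega> < T")
  case True
  then show ?thesis unfolding eq[OF True] using STD_range[OF \<tau> w] by (intro above_tendsto) auto
 next
  case False
  then have "\<tau> \<omega> = T" using STD_range[OF \<tau> w] by simp
  then show ?thesis using T by simp
 qed
qed

lemma discretise_sum:
 fixes h :: "real \<Rightarrow> real"
 assumes \<tau>: "\<tau> \<in> ST" and w: "\<omega> \<in> space M"
 shows "h (discretise \<tau> k \<omega>) = (\<Sum>j\<in>{1..2 ^ k}. h (grid k j) * indicator (cell \<tau> k j) \<omega>)"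
proof -
 have "(\<Sum>j\<in>{1..2 ^ k}. h (grid k j) * indicator (cell \<tau> k j) \<omega>)
   = (\<Sum>j\<in>{1..2 ^ k}. if j = cell_index \<tau> k \<omega> then h (grid k j) else 0)"
  using cell_iff[OF \<tau> w] by (intro sum.cong refl) (simp add: indicator_def)
 also have "\<dots> = h (grid k (cell_index \<tau> k \<omega>))" using cell_index_range[of \<tau> k \<omega>] by simp
 finally show ?thesis by (simp add: discretise_def)
qed

text \<open>On the cell of a grid point \<open>t\<close>, an event of \<open>F t\<close>, the process \<open>Y t\<close> has the same mean as \<open>Z t\<close>. So the
 discretised values of \<open>Y\<close> are dominated in the mean by \<open>W\<close>, hence uniformly integrable, and
 right-continuity carries both conclusions to \<open>\<tau>\<close>. Here \<open>Z\<close> may depend on time, unlike the closing variable of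
 a martingale.\<close>

lemma sampling:
 assumes Y: "cadlag_adapted M F T Y" and W: "integrable M W"
  and Z: "\<And>t. t \<in> {0..T} \<Longrightarrow> integrable M (Z t)" and ZW: "\<And>t. t \<in> {0..T} \<Longrightarrow> AE \<omega> in M. \<bar>Z t \<omega>\<bar> \<le> W \<omega>"
  and iY: "\<And>t. t \<in> {0..T} \<Longrightarrow> integrable M (Y t)"
  and YZ: "\<And>t A. t \<in> {0..T} \<Longrightarrow> A \<in> sets (F t) \<Longrightarrow> (LINT \<omega>|M. Y t \<omega> * indicator A \<omega>) = (LINT \<omega>|M. Z t \<omega> * indicator A \<omega>)"
 shows sampling_UI: "uniformly_integrable M ((\<lambda>\<tau> \<omega>. Y (\<tau> \<omega>) \<omega>) ` ST)"
  and sampling_eq: "\<tau> \<in> ST \<Longrightarrow> (\<lambda>k. LINT \<omega>|M. Z (discretise \<tau> k \<omega>) \<omega>) \<longlonglongrightarrow> (LINT \<omega>|M. Y (\<tau> \<omega>) \<omega>)"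
proof -
 have g: "grid k j \<in> {0..T}" if "j \<in> {1..2 ^ k}" for j k using that by (intro grid_range) simp
 have cM: "cell \<tau> k j \<in> sets M" if "\<tau> \<in> ST" "j \<in> {1..2 ^ k}" for \<tau> j k
  using cell_F[OF that] sets_F_subset[OF g[OF that(2)]] by (rule rev_subsetD)
 have Yd: "Y (grid k j) \<in> borel_measurable (F (grid k j))" if "j \<in> {1..2 ^ k}" for j k
  using Y g[OF that] unfolding cadlag_adapted_def by (elim conjE) (erule bspec)
 have sumY: "(\<lambda>\<omega>. \<Sum>j\<in>{1..2 ^ k}. X (grid k j) \<omega> * indicator (cell \<tau> k j) \<omega>) \<in> borel_measurable M"
  if "\<tau> \<in> ST" "\<And>t. t \<in> {0..T} \<Longrightarrow> integrable M (X t)" for \<tau> k and X :: "real \<Rightarrow> 'a \<Rightarrow> real"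
  by (intro borel_measurable_sum borel_measurable_times borel_measurable_integrable[OF that(2)] borel_measurable_indicator g cM that(1))
 have sumI: "integrable M (\<lambda>\<omega>. \<Sum>j\<in>{1..2 ^ k}. X (grid k j) \<omega> * indicator (cell \<tau> k j) \<omega>)"
  if "\<tau> \<in> ST" "\<And>t. t \<in> {0..T} \<Longrightarrow> integrable M (X t)" for \<tau> k and X :: "real \<Rightarrow> 'a \<Rightarrow> real"
  by (intro LINT_integrable_sum integrable_real_mult_indicator cM that g)
 have Yk_m: "(\<lambda>\<omega>. Y (discretise \<tau> k \<omega>) \<omega>) \<in> borel_measurable M" if "\<tau> \<in> ST" for \<tau> k
  by (rule measurable_cong[THEN iffD2, OF _ sumY[OF that iY]]) (rule discretise_sum[OF that])
 have Yk_i: "integrable M (\<lambda>\<omega>. Y (discretise \<tau> k \<omega>) \<omega>)" if "\<tau> \<in> ST" for \<tau> k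
  by (rule Bochner_Integration.integrable_cong[THEN iffD2, OF refl _ sumI[OF that iY]]) (rule discretise_sum[OF that])
 have lim: "(\<lambda>k. Y (discretise \<tau> k \<omega>) \<omega>) \<longlonglongrightarrow> Y (\<tau> \<omega>) \<omega>" if \<tau>: "\<tau> \<in> ST" and w: "\<omega> \<in> space M" for \<tau> \<omega>
 proof (cases "\<tau> \<omega> < T")
  case True
  have "((\<lambda>s. Y s \<omega>) \<longlongrightarrow> Y (\<tau> \<omega>) \<omega>) (at_right (\<tau> \<omega>))"
   using Y w True STD_range[OF \<tau> w] unfolding cadlag_adapted_def by simp
  moreover have "filterlim (\<lambda>k. discretise \<tau> k \<omega>) (at_right (\<tau> \<omega>)) sequentially"
  proof -
   have "discretise \<tau> k \<omega> \<in> {\<tau> \<omega><..} \<and> discretise \<tau> k \<omega> \<noteq> \<tau> \<omega>" for k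
    using discretise_props(3)[OF \<tau> w True, of k] by simp
   then show ?thesis unfolding filterlim_at using discretise_props(4)[OF \<tau> w] by simp
  qed
  ultimately show ?thesis by (rule filterlim_compose)
 next
  case False
  then have "\<tau> \<omega> = T" using STD_range[OF \<tau> w] by simp
  then show ?thesis using discretise_props(2)[OF \<tau> w] by simp
 qed
 have Y\<tau>_m: "(\<lambda>\<omega>. Y (\<tau> \<omega>) \<omega>) \<in> borel_measurable M" if "\<tau> \<in> ST" for \<tau>
  by (rule borel_measurable_LIMSEQ_real[OF lim[OF that] Yk_m[OF that]])
 define S where "S = {\<lambda>\<omega>. Y (discretise \<tau> k \<omega>) \<omega> |\<tau> k. \<tau> \<in> ST}"
 have S: "(\<lambda>\<omega>. Y (discretise \<tau> k \<omega>) \<omega>) \<in> S" if "\<tau> \<in> ST" for \<tau> k unfolding S_def using that by blast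
 have UIS: "uniformly_integrable M S"
 proof (rule uniformly_integrable_dominated[OF W])
  fix X assume "X \<in> S"
  then obtain \<tau> k where X: "X = (\<lambda>\<omega>. Y (discretise \<tau> k \<omega>) \<omega>)" and \<tau>: "\<tau> \<in> ST" unfolding S_def by blast
  show "integrable M X" unfolding X by (rule Yk_i[OF \<tau>])
  fix K :: real
  define G where "G j = cell \<tau> k j \<inter> {\<omega>\<in>space M. K < \<bar>Y (grid k j) \<omega>\<bar>}" for j
  have GF: "G j \<in> sets (F (grid k j))" if "j \<in> {1..2 ^ k}" for j
  proof -
   have "{\<omega>\<in>space M. K < \<bar>Y (grid k j) \<omega>\<bar>} \<in> sets (F (grid k j))"
    using Yd[OF that] unfolding space_F[of "grid k j", symmetric] by measurable
   then show ?thesis unfolding G_def using cell_F[OF \<tau> that] by (rule sets.Int[rotated])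
  qed
  have GM: "G j \<in> sets M" if "j \<in> {1..2 ^ k}" for j
   using GF[OF that] sets_F_subset[OF g[OF that]] by (rule rev_subsetD)
  have split: "\<bar>V \<omega>\<bar> * of_bool (K < \<bar>X \<omega>\<bar>) = (\<Sum>j\<in>{1..2 ^ k}. \<bar>V \<omega>\<bar> * indicator (G j) \<omega>)" if w: "\<omega> \<in> space M" for V :: "'a \<Rightarrow> real" and \<omega>
  proof -
   have "(\<Sum>j\<in>{1..2 ^ k}. \<bar>V \<omega>\<bar> * indicator (G j) \<omega>) = (\<Sum>j\<in>{1..2 ^ k}. (\<bar>V \<omega>\<bar> * of_bool (K < \<bar>Y (grid k j) \<omega>\<bar>)) * indicator (cell \<tau> k j) \<omega>)"
    using w by (intro sum.cong refl) (auto simp: G_def indicator_def)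
   also have "\<dots> = \<bar>V \<omega>\<bar> * of_bool (K < \<bar>X \<omega>\<bar>)"
    unfolding X by (rule discretise_sum[OF \<tau> w, of "\<lambda>t. \<bar>V \<omega>\<bar> * of_bool (K < \<bar>Y t \<omega>\<bar>)", symmetric])
   finally show ?thesis by (rule sym)
  qed
  have splitX: "\<bar>X \<omega>\<bar> * of_bool (K < \<bar>X \<omega>\<bar>) = (\<Sum>j\<in>{1..2 ^ k}. \<bar>Y (grid k j) \<omega>\<bar> * indicator (G j) \<omega>)" if w: "\<omega> \<in> space M" for \<omega>
  proof -
   have "(\<Sum>j\<in>{1..2 ^ k}. \<bar>Y (grid k j) \<omega>\<bar> * indicator (G j) \<omega>) = (\<Sum>j\<in>{1..2 ^ k}. (\<bar>Y (grid k j) \<omega>\<bar> * of_bool (K < \<bar>Y (grid k j) \<omega>\<bar>)) * indicator (cell \<tau> k j) \<omega>)"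
    using w by (intro sum.cong refl) (auto simp: G_def indicator_def)
   also have "\<dots> = \<bar>X \<omega>\<bar> * of_bool (K < \<bar>X \<omega>\<bar>)"
    unfolding X by (rule discretise_sum[OF \<tau> w, of "\<lambda>t. \<bar>Y t \<omega>\<bar> * of_bool (K < \<bar>Y t \<omega>\<bar>)", symmetric])
   finally show ?thesis by (rule sym)
  qed
  have "(LINT \<omega>|M. \<bar>X \<omega>\<bar> * of_bool (K < \<bar>X \<omega>\<bar>)) = (LINT \<omega>|M. (\<Sum>j\<in>{1..2 ^ k}. \<bar>Y (grid k j) \<omega>\<bar> * indicator (G j) \<omega>))"
   by (rule LINT_cong[OF refl splitX])
  also have "\<dots> = (\<Sum>j\<in>{1..2 ^ k}. LINT \<omega>|M. \<bar>Y (grid k j) \<omega>\<bar> * indicator (G j) \<omega>)"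
   by (intro LINT_sum integrable_real_mult_indicator integrable_abs iY g GM)
  also have "\<dots> \<le> (\<Sum>j\<in>{1..2 ^ k}. LINT \<omega>|M. \<bar>W \<omega>\<bar> * indicator (G j) \<omega>)"
  proof (rule sum_mono)
   fix j assume j: "j \<in> {1..2 ^ k::nat}"
   have "(LINT \<omega>|M. \<bar>Y (grid k j) \<omega>\<bar> * indicator (G j) \<omega>) \<le> (LINT \<omega>|M. \<bar>Z (grid k j) \<omega>\<bar> * indicator (G j) \<omega>)"
    by (rule abs_cond_le[OF g[OF j] Yd[OF j] iY[OF g[OF j]] Z[OF g[OF j]] YZ[OF g[OF j]] GF[OF j]])
   also have "\<dots> \<le> (LINT \<omega>|M. \<bar>W \<omega>\<bar> * indicator (G j) \<omega>)"
   proof (rule integral_mono_AE)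
    show "AE \<omega> in M. \<bar>Z (grid k j) \<omega>\<bar> * indicator (G j) \<omega> \<le> \<bar>W \<omega>\<bar> * indicator (G j) \<omega>"
     using ZW[OF g[OF j]] by eventually_elim (auto simp: indicator_def)
   qed (intro integrable_real_mult_indicator integrable_abs Z W g GM j)+
   finally show "(LINT \<omega>|M. \<bar>Y (grid k j) \<omega>\<bar> * indicator (G j) \<omega>) \<le> (LINT \<omega>|M. \<bar>W \<omega>\<bar> * indicator (G j) \<omega>)" .
  qed
  also have "\<dots> = (LINT \<omega>|M. (\<Sum>j\<in>{1..2 ^ k}. \<bar>W \<omega>\<bar> * indicator (G j) \<omega>))"
   by (intro LINT_sum[symmetric] integrable_real_mult_indicator integrable_abs W GM)
  also have "\<dots> = (LINT \<omega>|M. \<bar>W \<omega>\<bar> * of_bool (K < \<bar>X \<omega>\<bar>))"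
   by (rule LINT_cong[OF refl split[symmetric]])
  finally show "(LINT \<omega>|M. \<bar>X \<omega>\<bar> * of_bool (K < \<bar>X \<omega>\<bar>)) \<le> (LINT \<omega>|M. \<bar>W \<omega>\<bar> * of_bool (K < \<bar>X \<omega>\<bar>))" .
 qed
 show "uniformly_integrable M ((\<lambda>\<tau> \<omega>. Y (\<tau> \<omega>) \<omega>) ` ST)"
 proof (rule uniformly_integrable_limits[OF UIS])
  fix X assume "X \<in> (\<lambda>\<tau> \<omega>. Y (\<tau> \<omega>) \<omega>) ` ST"
  then obtain \<tau> where X: "X = (\<lambda>\<omega>. Y (\<tau> \<omega>) \<omega>)" and \<tau>: "\<tau> \<in> ST" by (rule imageE)
  have "AE \<omega> in M. (\<lambda>k. Y (discretise \<tau> k \<omega>) \<omega>) \<longlonglongrightarrow> X \<omega>" unfolding X by (rule AE_I2) (rule lim[OF \<tau>])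
  then show "X \<in> borel_measurable M \<and> (\<exists>X'. (\<forall>k::nat. X' k \<in> S) \<and> (AE \<omega> in M. (\<lambda>k. X' k \<omega>) \<longlonglongrightarrow> X \<omega>))"
   unfolding X using Y\<tau>_m[OF \<tau>] S[OF \<tau>] by (intro conjI exI[of _ "\<lambda>k \<omega>. Y (discretise \<tau> k \<omega>) \<omega>"] allI)
 qed
 assume \<tau>: "\<tau> \<in> ST"
 have sp: "space M \<in> sets M" by simp
 have "(\<lambda>k. LINT \<omega>|M. Y (discretise \<tau> k \<omega>) \<omega> * indicator (space M) \<omega>) \<longlonglongrightarrow> (LINT \<omega>|M. Y (\<tau> \<omega>) \<omega> * indicator (space M) \<omega>)"
  by (rule Vitali_convergence_set[OF UIS S[OF \<tau>] _ Y\<tau>_m[OF \<tau>] sp]) (rule AE_I2, rule lim[OF \<tau>])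
 moreover have "(LINT \<omega>|M. X \<omega> * indicator (space M) \<omega>) = (LINT \<omega>|M. X \<omega>)" for X :: "'a \<Rightarrow> real"
  by (rule LINT_cong) (auto simp: indicator_def)
 ultimately have L: "(\<lambda>k. LINT \<omega>|M. Y (discretise \<tau> k \<omega>) \<omega>) \<longlonglongrightarrow> (LINT \<omega>|M. Y (\<tau> \<omega>) \<omega>)" by simp
 have E: "(LINT \<omega>|M. X (discretise \<tau> k \<omega>) \<omega>) = (\<Sum>j\<in>{1..2 ^ k}. LINT \<omega>|M. X (grid k j) \<omega> * indicator (cell \<tau> k j) \<omega>)"
  if X: "\<And>t. t \<in> {0..T} \<Longrightarrow> integrable M (X t)" for X :: "real \<Rightarrow> 'a \<Rightarrow> real" and k
 proof -
  have "(LINT \<omega>|M. X (discretise \<tau> k \<omega>) \<omega>) = (LINT \<omega>|M. (\<Sum>j\<in>{1..2 ^ k}. X (grid k j) \<omega> * indicator (cell \<tau> k j) \<omega>))"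
   by (rule LINT_cong[OF refl discretise_sum[OF \<tau>]])
  also have "\<dots> = (\<Sum>j\<in>{1..2 ^ k}. LINT \<omega>|M. X (grid k j) \<omega> * indicator (cell \<tau> k j) \<omega>)"
   by (intro LINT_sum integrable_real_mult_indicator X g cM \<tau>)
  finally show ?thesis .
 qed
 have "(LINT \<omega>|M. Y (discretise \<tau> k \<omega>) \<omega>) = (LINT \<omega>|M. Z (discretise \<tau> k \<omega>) \<omega>)" for k
 proof -
  have "(\<Sum>j\<in>{1..2 ^ k}. LINT \<omega>|M. Y (grid k j) \<omega> * indicator (cell \<tau> k j) \<omega>)
    = (\<Sum>j\<in>{1..2 ^ k}. LINT \<omega>|M. Z (grid k j) \<omega> * indicator (cell \<tau> k j) \<omega>)"
   by (intro sum.cong refl YZ g cell_F \<tau>)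
  moreover have "(LINT \<omega>|M. Y (discretise \<tau> k \<omega>) \<omega>) = (\<Sum>j\<in>{1..2 ^ k}. LINT \<omega>|M. Y (grid k j) \<omega> * indicator (cell \<tau> k j) \<omega>)"
   by (rule E) (rule iY)
  moreover have "(LINT \<omega>|M. Z (discretise \<tau> k \<omega>) \<omega>) = (\<Sum>j\<in>{1..2 ^ k}. LINT \<omega>|M. Z (grid k j) \<omega> * indicator (cell \<tau> k j) \<omega>)"
   by (rule E) (rule Z)
  ultimately show ?thesis by (simp only:)
 qed
 then show "(\<lambda>k. LINT \<omega>|M. Z (discretise \<tau> k \<omega>) \<omega>) \<longlonglongrightarrow> (LINT \<omega>|M. Y (\<tau> \<omega>) \<omega>)" using L by simp
qed

lemma discretise_ST: "\<tau> \<in> ST \<Longrightarrow> discretise \<tau> k \<in> ST"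
proof (rule STI)
 fix t assume \<tau>: "\<tau> \<in> ST"
 have "{\<omega>\<in>space M. discretise \<tau> k \<omega> \<le> t} = (\<Union>j\<in>{j\<in>{1..2 ^ k}. grid k j \<le> t}. cell \<tau> k j)"
 proof (intro equalityI subsetI)
  fix \<omega> assume "\<omega> \<in> {\<omega>\<in>space M. discretise \<tau> k \<omega> \<le> t}"
  then have w: "\<omega> \<in> space M" "grid k (cell_index \<tau> k \<omega>) \<le> t" by (auto simp: discretise_def)
  then show "\<omega> \<in> (\<Union>j\<in>{j\<in>{1..2 ^ k}. grid k j \<le> t}. cell \<tau> k j)"
   using cell_index_range[of \<tau> k \<omega>] cell_iff[OF \<tau> w(1) cell_index_range] by (intro UN_I[of "cell_index \<tau> k \<omega>"]) auto
 next
  fix \<omega> assume "\<omega> \<in> (\<Union>j\<in>{j\<in>{1..2 ^ k}. grid k j \<le> t}. cell \<tau> k j)"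
  then obtain j where j: "j \<in> {1..2 ^ k}" "grid k j \<le> t" "\<omega> \<in> cell \<tau> k j" by blast
  then have w: "\<omega> \<in> space M" by (simp add: cell_def)
  show "\<omega> \<in> {\<omega>\<in>space M. discretise \<tau> k \<omega> \<le> t}" using cell_iff[OF \<tau> w j(1)] j w by (simp add: discretise_def)
 qed
 also have "\<dots> \<in> sets (F t)"
 proof (rule sets.finite_UN)
  fix j assume "j \<in> {j\<in>{1..2 ^ k}. grid k j \<le> t}"
  then show "cell \<tau> k j \<in> sets (F t)" using sets_F_le[OF _ cell_F[OF \<tau>]] by simp
 qed simp
 finally show "{\<omega>\<in>space M. discretise \<tau> k \<omega> \<le> t} \<in> sets (F t)" .
qed (use discretise_props(1) in auto)

end

section \<open>The contract induced by a control\<close>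

locale contract_design = usual_filtered_prob_space M F T
 for M :: "'a measure" and F T +
 fixes n :: nat and \<mu>A \<mu>P :: "real measure" and f g :: "nat \<Rightarrow> real \<Rightarrow> 'a \<Rightarrow> real" and \<xi> :: "'a \<Rightarrow> real"
 assumes n_pos: "1 \<le> n"
  and atomless_A: "atomless_finite_borel T \<mu>A" and atomless_P: "atomless_finite_borel T \<mu>P"
  and full_A: "full_support T \<mu>A"
  and f_prog: "\<And>i. i \<in> {1..n} \<Longrightarrow> progressively_measurable F T (f i)"
  and g_prog: "\<And>i. i \<in> {1..n} \<Longrightarrow> progressively_measurable F T (g i)"
  and \<xi>_F: "\<xi> \<in> borel_measurable (F T)" and \<xi>_int: "integrable M \<xi>"
  and f_less: "\<And>i t \<omega>. i \<in> {1..<n} \<Longrightarrow> t \<in> {0..T} \<Longrightarrow> \<omega> \<in> space M \<Longrightarrow> f i t \<omega> < f (i + 1) t \<omega>"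
  and fg_int: "\<And>i. i \<in> {1..n} \<Longrightarrow>
   (\<integral>\<^sup>+\<omega>. ((\<integral>\<^sup>+t. ennreal \<bar>f i t \<omega>\<bar> \<partial>\<mu>A) + (\<integral>\<^sup>+t. ennreal \<bar>g i t \<omega>\<bar> \<partial>\<mu>P)) \<partial>M) < \<infinity>"

sublocale contract_design \<subseteq> A: timed_prob_space M F T \<mu>A
 by unfold_locales (rule atomless_A)

sublocale contract_design \<subseteq> P: timed_prob_space M F T \<mu>P
 by unfold_locales (rule atomless_P)

context contract_design
begin

lemma f_jint: "i \<in> {1..n} \<Longrightarrow> A.jint (f i)"
proof (rule A.jintI_nn[OF A.progressive_joint[OF f_prog]])
 assume i: "i \<in> {1..n}"
 have "(\<integral>\<^sup>+\<omega>. (\<integral>\<^sup>+t. ennreal \<bar>f i t \<omega>\<bar> \<partial>\<mu>A) \<partial>M)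
   \<le> (\<integral>\<^sup>+\<omega>. ((\<integral>\<^sup>+t. ennreal \<bar>f i t \<omega>\<bar> \<partial>\<mu>A) + (\<integral>\<^sup>+t. ennreal \<bar>g i t \<omega>\<bar> \<partial>\<mu>P)) \<partial>M)"
  by (rule nn_integral_mono) simp
 also note fg_int[OF i]
 finally show "(\<integral>\<^sup>+\<omega>. (\<integral>\<^sup>+t. ennreal \<bar>f i t \<omega>\<bar> \<partial>\<mu>A) \<partial>M) < \<infinity>" .
qed

lemma g_jint: "i \<in> {1..n} \<Longrightarrow> P.jint (g i)"
proof (rule P.jintI_nn[OF P.progressive_joint[OF g_prog]])
 assume i: "i \<in> {1..n}"
 have "(\<integral>\<^sup>+\<omega>. (\<integral>\<^sup>+t. ennreal \<bar>g i t \<omega>\<bar> \<partial>\<mu>P) \<partial>M)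
   \<le> (\<integral>\<^sup>+\<omega>. ((\<integral>\<^sup>+t. ennreal \<bar>f i t \<omega>\<bar> \<partial>\<mu>A) + (\<integral>\<^sup>+t. ennreal \<bar>g i t \<omega>\<bar> \<partial>\<mu>P)) \<partial>M)"
  by (rule nn_integral_mono) simp
 also note fg_int[OF i]
 finally show "(\<integral>\<^sup>+\<omega>. (\<integral>\<^sup>+t. ennreal \<bar>g i t \<omega>\<bar> \<partial>\<mu>P) \<partial>M) < \<infinity>" .
qed

lemma interp_less: "t \<in> {0..T} \<Longrightarrow> \<omega> \<in> space M \<Longrightarrow> l < l' \<Longrightarrow> interp n f t \<omega> l < interp n f t \<omega> l'"
 using f_less by (intro interp_strict_mono n_pos) auto

lemma interp_le: "t \<in> {0..T} \<Longrightarrow> \<omega> \<in> space M \<Longrightarrow> l \<le> l' \<Longrightarrow> interp n f t \<omega> l \<le> interp n f t \<omega> l'"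
 using f_less by (intro interp_mono n_pos) auto

lemma interp_progressive:
 assumes L: "progressively_measurable F T L"
 shows "progressively_measurable F T (\<lambda>t \<omega>. interp n f t \<omega> (L t \<omega>))"
 unfolding progressively_measurable_def
proof
 fix t assume t: "t \<in> {0..T}"
 have "(\<lambda>x. interp n f (fst x) (snd x) (L (fst x) (snd x))) \<in> borel_measurable (restrict_space borel {0..t} \<Otimes>\<^sub>M F t)"
 proof (rule interp_measurable[OF n_pos])
  show "(\<lambda>x. f i (fst x) (snd x)) \<in> borel_measurable (restrict_space borel {0..t} \<Otimes>\<^sub>M F t)" if "i \<in> {1..n}" for i
   using progressiveD[OF f_prog[OF that] t] by (simp only: case_prod_beta')
  show "(\<lambda>x. L (fst x) (snd x)) \<in> borel_measurable (restrict_space borel {0..t} \<Otimes>\<^sub>M F t)"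
   using progressiveD[OF L t] by (simp only: case_prod_beta')
 qed
 then show "(\<lambda>(s, \<omega>). interp n f s \<omega> (L s \<omega>)) \<in> borel_measurable (restrict_space borel {0..t} \<Otimes>\<^sub>M F t)"
  by (simp only: case_prod_beta')
qed

lemma interp_jint:
 assumes L: "progressively_measurable F T L" and b: "\<And>t \<omega>. t \<in> {0..T} \<Longrightarrow> \<omega> \<in> space M \<Longrightarrow> 0 \<le> L t \<omega> \<and> L t \<omega> \<le> real n"
 shows "A.jint (\<lambda>t \<omega>. interp n f t \<omega> (L t \<omega>))"
proof (rule A.jint_bound)
 show "A.jint (\<lambda>t \<omega>. 1 + (\<Sum>i\<in>{1..n}. \<bar>f i t \<omega>\<bar>))"
  by (intro A.jint_add A.jint_const A.jint_sum A.jint_abs f_jint)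
 show "(\<lambda>(t, \<omega>). interp n f t \<omega> (L t \<omega>)) \<in> borel_measurable (\<mu>A \<Otimes>\<^sub>M M)"
  by (rule A.progressive_joint[OF interp_progressive[OF L]])
 fix t \<omega> assume "t \<in> {0..T}" "\<omega> \<in> space M"
 from b[OF this] show "\<bar>interp n f t \<omega> (L t \<omega>)\<bar> \<le> 1 + (\<Sum>i\<in>{1..n}. \<bar>f i t \<omega>\<bar>)" by (intro interp_bound n_pos) auto
qed

definition rate :: "(real \<Rightarrow> 'a \<Rightarrow> real) \<Rightarrow> real \<Rightarrow> 'a \<Rightarrow> real" where
 "rate L t \<omega> = interp n f t \<omega> (left_lim L t \<omega>)"

abbreviation "\<L> \<equiv> controls_mono M F T n"

lemma left_lim_progressive: "L \<in> \<L> \<Longrightarrow> progressively_measurable F T (left_lim L)"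
 by (rule optional_progressive[OF left_lim_optional])

lemma rate_progressive: "L \<in> \<L> \<Longrightarrow> progressively_measurable F T (rate L)"
 unfolding rate_def by (rule interp_progressive[OF left_lim_progressive])

lemma rate_jint: "L \<in> \<L> \<Longrightarrow> A.jint (rate L)"
 unfolding rate_def by (rule interp_jint[OF left_lim_progressive left_lim_range])

text \<open>What remains to be paid after time \<open>t\<close>; the contract is its conditional expectation.\<close>

definition claim :: "(real \<Rightarrow> 'a \<Rightarrow> real) \<Rightarrow> real \<Rightarrow> 'a \<Rightarrow> real" where
 "claim L t \<omega> = \<xi> \<omega> + (LINT s:{t<..T}|\<mu>A. rate L s \<omega>)"

lemma claim_integrable: "L \<in> \<L> \<Longrightarrow> \<tau> \<in> ST \<Longrightarrow> integrable M (\<lambda>\<omega>. claim L (\<tau> \<omega>) \<omega>)"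
 unfolding claim_def by (rule LINT_integrable_add[OF \<xi>_int A.jint_after[OF rate_jint]])

lemma claim_integrable_at: "L \<in> \<L> \<Longrightarrow> t \<in> {0..T} \<Longrightarrow> integrable M (claim L t)"
 using claim_integrable[of L "\<lambda>_. t"] ST_const[of t] by simp

lemma claim_expectation:
 "L \<in> \<L> \<Longrightarrow> \<tau> \<in> ST \<Longrightarrow> (LINT \<omega>|M. claim L (\<tau> \<omega>) \<omega>) = (LINT \<omega>|M. \<xi> \<omega>) + (LINT \<omega>|M. (LINT s:{\<tau> \<omega><..T}|\<mu>A. rate L s \<omega>))"
 unfolding claim_def by (rule LINT_add[OF \<xi>_int A.jint_after[OF rate_jint]])

lemma claim_tendsto:
 assumes L: "L \<in> \<L>" and \<tau>: "\<tau> \<in> ST" and \<rho>: "\<And>k::nat. \<rho> k \<in> ST" and lim: "AE \<omega> in M. (\<lambda>k. \<rho> k \<omega>) \<longlonglongrightarrow> \<tau> \<omega>"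
 shows "(\<lambda>k. LINT \<omega>|M. claim L (\<rho> k \<omega>) \<omega>) \<longlonglongrightarrow> (LINT \<omega>|M. claim L (\<tau> \<omega>) \<omega>)"
 unfolding claim_expectation[OF L \<tau>] claim_expectation[OF L \<rho>]
 by (rule tendsto_add[OF tendsto_const A.jint_after_tendsto[OF rate_jint[OF L] \<rho> \<tau> lim]])

text \<open>The claim is continuous in time and dominated by \<open>\<bar>\<xi>\<bar>\<close> plus the total of the absolute rates, so the
 values at discretised times, where the defining conditional expectations apply, converge.\<close>

lemma contract_value:
 assumes L: "L \<in> \<L>" and Y: "contract_of M F T n \<mu>A f \<xi> L Y"
 shows contract_class_D: "class_D M F T Y"
  and contract_expectation: "\<tau> \<in> ST \<Longrightarrow> (LINT \<omega>|M. Y (\<tau> \<omega>) \<omega>) = (LINT \<omega>|M. claim L (\<tau> \<omega>) \<omega>)"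
proof -
 define W where "W \<omega> = \<bar>\<xi> \<omega>\<bar> + (LINT s|\<mu>A. \<bar>rate L s \<omega>\<bar>)" for \<omega>
 have c: "cadlag_adapted M F T Y" using Y by (simp add: contract_of_def)
 have eq: "AE \<omega> in M. Y t \<omega> = real_cond_exp M (F t) (claim L t) \<omega>" if "t \<in> {0..T}" for t
  using Y that unfolding contract_of_def claim_def[abs_def] rate_def by blast
 have W: "integrable M W" unfolding W_def
  by (intro LINT_integrable_add integrable_abs \<xi>_int A.jint_integral A.jint_abs rate_jint[OF L])
 have Z: "integrable M (claim L t)" if "t \<in> {0..T}" for t by (rule claim_integrable_at[OF L that])
 have ZW: "AE \<omega> in M. \<bar>claim L t \<omega>\<bar> \<le> W \<omega>" if "t \<in> {0..T}" for t
  using A.jint_AE[OF rate_jint[OF L]]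
 proof eventually_elim
  case (elim \<omega>)
  have "\<bar>claim L t \<omega>\<bar> \<le> \<bar>\<xi> \<omega>\<bar> + \<bar>LINT s:{t<..T}|\<mu>A. rate L s \<omega>\<bar>" unfolding claim_def by (rule abs_triangle_ineq)
  also have "\<dots> \<le> W \<omega>" unfolding W_def using A.path_abs_le(2)[OF elim] by (rule add_left_mono)
  finally show ?case .
 qed
 have Yi: "integrable M (Y t)" and YZ: "A \<in> sets (F t) \<Longrightarrow> (LINT \<omega>|M. Y t \<omega> * indicator A \<omega>) = (LINT \<omega>|M. claim L t \<omega> * indicator A \<omega>)"
  if t: "t \<in> {0..T}" for t A
 proof -
  interpret S: finite_measure_subalgebra M "F t" by (rule cond_exp_subalgebra[OF t])
  have mY: "Y t \<in> borel_measurable M" using c t measurable_F_le unfolding cadlag_adapted_def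
   by (meson measurable_from_subalg subalgebra_F)
  have mc: "real_cond_exp M (F t) (claim L t) \<in> borel_measurable M" by (rule borel_measurable_integrable[OF S.real_cond_exp_int(1)[OF Z[OF t]]])
  show "integrable M (Y t)"
   by (rule integrable_cong_AE[THEN iffD2, OF mY mc eq[OF t] S.real_cond_exp_int(1)[OF Z[OF t]]])
  assume A: "A \<in> sets (F t)"
  have AM: "A \<in> sets M" using A sets_F_subset[OF t] by blast
  have "(LINT \<omega>|M. Y t \<omega> * indicator A \<omega>) = (LINT \<omega>|M. real_cond_exp M (F t) (claim L t) \<omega> * indicator A \<omega>)"
  proof (rule integral_cong_AE)
   show "AE \<omega> in M. Y t \<omega> * indicator A \<omega> = real_cond_exp M (F t) (claim L t) \<omega> * indicator A \<omega>"
    using eq[OF t] by eventually_elim simp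
  qed (use mY mc AM in \<open>auto intro!: borel_measurable_times\<close>)
  also have "\<dots> = (LINT \<omega>|M. claim L t \<omega> * indicator A \<omega>)"
   using S.real_cond_exp_intA[OF Z[OF t] A] by (simp add: set_lebesgue_integral_def mult.commute)
  finally show "(LINT \<omega>|M. Y t \<omega> * indicator A \<omega>) = (LINT \<omega>|M. claim L t \<omega> * indicator A \<omega>)" .
 qed
 show "class_D M F T Y" unfolding class_D_def by (rule sampling_UI[OF c W Z ZW Yi YZ])
 assume \<tau>: "\<tau> \<in> ST"
 have "(\<lambda>k. LINT \<omega>|M. claim L (discretise \<tau> k \<omega>) \<omega>) \<longlonglongrightarrow> (LINT \<omega>|M. claim L (\<tau> \<omega>) \<omega>)"
  by (rule claim_tendsto[OF L \<tau> discretise_ST[OF \<tau>] AE_I2]) (rule discretise_props(4)[OF \<tau>])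
 moreover have "(\<lambda>k. LINT \<omega>|M. claim L (discretise \<tau> k \<omega>) \<omega>) \<longlonglongrightarrow> (LINT \<omega>|M. Y (\<tau> \<omega>) \<omega>)"
  by (rule sampling_eq[OF c W Z ZW Yi YZ \<tau>])
 ultimately show "(LINT \<omega>|M. Y (\<tau> \<omega>) \<omega>) = (LINT \<omega>|M. claim L (\<tau> \<omega>) \<omega>)" by (rule LIMSEQ_unique[rotated])
qed

lemma contract_admissible:
 assumes L: "L \<in> \<L>" and Y: "contract_of M F T n \<mu>A f \<xi> L Y"
 shows "Y \<in> contracts M F T \<xi>"
 unfolding contracts_def
proof (intro CollectI conjI)
 show "optional_process M F T Y" using Y cadlag_optional by (simp add: contract_of_def)
 show "class_D M F T Y" by (rule contract_class_D[OF L Y])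
 show "USCE M F T Y" unfolding USCE_def
 proof (intro ballI allI impI)
  fix \<tau> and \<rho> :: "nat \<Rightarrow> 'a \<Rightarrow> real"
  assume \<tau>: "\<tau> \<in> ST" and \<rho>: "\<forall>k. \<rho> k \<in> ST" and lim: "AE \<omega> in M. (\<lambda>k. \<rho> k \<omega>) \<longlonglongrightarrow> \<tau> \<omega>"
  have \<rho>': "\<rho> k \<in> ST" for k using \<rho> by simp
  have "(\<lambda>k. LINT \<omega>|M. Y (\<rho> k \<omega>) \<omega>) \<longlonglongrightarrow> (LINT \<omega>|M. Y (\<tau> \<omega>) \<omega>)"
   unfolding contract_expectation[OF L Y \<tau>] contract_expectation[OF L Y \<rho>'] by (rule claim_tendsto[OF L \<tau> \<rho>' lim])
  then have "(\<lambda>k. ereal (LINT \<omega>|M. Y (\<rho> k \<omega>) \<omega>)) \<longlonglongrightarrow> ereal (LINT \<omega>|M. Y (\<tau> \<omega>) \<omega>)" by (rule tendsto_ereal)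
  from lim_imp_Limsup[OF sequentially_bot this]
  show "limsup (\<lambda>k. ereal (LINT \<omega>|M. Y (\<rho> k \<omega>) \<omega>)) \<le> ereal (LINT \<omega>|M. Y (\<tau> \<omega>) \<omega>)" by simp
 qed
 have T: "T \<in> {0..T}" using T_nonneg by simp
 interpret S: finite_measure_subalgebra M "F T" by (rule cond_exp_subalgebra[OF T])
 have "AE \<omega> in M. Y T \<omega> = real_cond_exp M (F T) (\<lambda>\<omega>. \<xi> \<omega> + (LINT s:{T<..T}|\<mu>A. interp n f s \<omega> (left_lim L s \<omega>))) \<omega>"
  using Y T unfolding contract_of_def by blast
 then have "AE \<omega> in M. Y T \<omega> = real_cond_exp M (F T) \<xi> \<omega>" by (simp add: set_lebesgue_integral_def)
 with S.real_cond_exp_F_meas[OF \<xi>_int \<xi>_F] show "AE \<omega> in M. \<xi> \<omega> \<le> Y T \<omega>" by eventually_elim simp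
qed

lemma path_integral_tendsto:
 fixes h :: "real \<Rightarrow> real"
 assumes "integrable \<mu>A h"
 shows "((\<lambda>t. LINT s:{0..t}|\<mu>A. h s) \<longlongrightarrow> (LINT s:{0..c}|\<mu>A. h s)) (at c within S)"
 unfolding tendsto_at_iff_sequentially o_def by (intro allI impI A.LINT_upto_tendsto[OF assms])

text \<open>The cadlag version of \<open>E[claim L t | F t]\<close> is a cadlag martingale minus the continuous process of
 rates already paid.\<close>

lemma contract_exists:
 assumes L: "L \<in> \<L>"
 shows "\<exists>Y. contract_of M F T n \<mu>A f \<xi> L Y"
proof -
 define Z where "Z \<omega> = \<xi> \<omega> + (LINT s|\<mu>A. rate L s \<omega>)" for \<omega>
 have Z: "integrable M Z" unfolding Z_def by (intro LINT_integrable_add \<xi>_int A.jint_integral rate_jint[OF L])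
 obtain X where X: "cadlag_adapted M F T X" "closes Z X" by (rule cadlag_version[OF Z])
 obtain N where N: "{\<omega>\<in>space M. \<not> integrable \<mu>A (\<lambda>t. rate L t \<omega>)} \<subseteq> N" "emeasure M N = 0" "N \<in> sets M"
  using A.jint_AE[OF rate_jint[OF L]] by (rule AE_E)
 define I where "I t \<omega> = (if \<omega> \<in> N then 0 else LINT s:{0..t}|\<mu>A. rate L s \<omega>)" for t \<omega>
 have IN: "AE \<omega> in M. \<omega> \<notin> N" using N(2,3) by (intro AE_not_in null_setsI)
 have Ieq: "AE \<omega> in M. (LINT s:{0..t}|\<mu>A. rate L s \<omega>) = I t \<omega>" for t
  using IN by eventually_elim (simp add: I_def)
 have Im: "I t \<in> borel_measurable (F t)" if t: "t \<in> {0..T}" for t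
  by (rule F_measurable_AE_cong[OF A.adapted_integral[OF rate_progressive[OF L] t] Ieq t])
 have Ilim: "((\<lambda>t. I t \<omega>) \<longlongrightarrow> I c \<omega>) (at c within S)" if w: "\<omega> \<in> space M" for \<omega> c S
 proof (cases "\<omega> \<in> N")
  case False
  then have "integrable \<mu>A (\<lambda>t. rate L t \<omega>)" using N(1) w by blast
  from path_integral_tendsto[OF this] show ?thesis using False by (simp add: I_def)
 qed (simp add: I_def)
 have Ii: "integrable M (I t)" if t: "t \<in> {0..T}" for t
 proof (rule integrable_cong_AE[THEN iffD1, OF _ _ Ieq[of t]])
  show i: "integrable M (\<lambda>\<omega>. LINT s:{0..t}|\<mu>A. rate L s \<omega>)" by (rule A.jint_upto[OF rate_jint[OF L] ST_const[OF t]])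
  show "(\<lambda>\<omega>. LINT s:{0..t}|\<mu>A. rate L s \<omega>) \<in> borel_measurable M" by (rule borel_measurable_integrable[OF i])
  show "I t \<in> borel_measurable M" by (rule measurable_from_subalg[OF subalgebra_F[OF t] Im[OF t]])
 qed
 define Y where "Y t \<omega> = X t \<omega> - I t \<omega>" for t \<omega>
 have "cadlag_adapted M F T Y" unfolding cadlag_adapted_def
 proof (intro conjI ballI)
  show "Y t \<in> borel_measurable (F t)" if t: "t \<in> {0..T}" for t
   unfolding Y_def using closesD(1)[OF X(2) t] Im[OF t] by (rule borel_measurable_diff)
  fix \<omega> assume w: "\<omega> \<in> space M"
  show "((\<lambda>s. Y s \<omega>) \<longlongrightarrow> Y t \<omega>) (at_right t)" if "t \<in> {0..<T}" for t
  proof -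
   have "((\<lambda>s. X s \<omega>) \<longlongrightarrow> X t \<omega>) (at_right t)" using X(1) w that by (simp add: cadlag_adapted_def)
   then show ?thesis unfolding Y_def using Ilim[OF w] by (rule tendsto_diff)
  qed
  show "\<exists>l. ((\<lambda>s. Y s \<omega>) \<longlongrightarrow> l) (at_left t)" if "t \<in> {0<..T}" for t
  proof -
   have "\<exists>l. ((\<lambda>s. X s \<omega>) \<longlongrightarrow> l) (at_left t)" using X(1) w that by (simp add: cadlag_adapted_def)
   then obtain l where "((\<lambda>s. X s \<omega>) \<longlongrightarrow> l) (at_left t)" by (rule exE)
   from tendsto_diff[OF this Ilim[OF w, of t]] show ?thesis unfolding Y_def by (rule exI)
  qed
 qed
 moreover have "AE \<omega> in M. Y t \<omega> = real_cond_exp M (F t) (claim L t) \<omega>" if t: "t \<in> {0..T}" for t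
 proof -
  interpret S: finite_measure_subalgebra M "F t" by (rule cond_exp_subalgebra[OF t])
  have c: "AE \<omega> in M. claim L t \<omega> = Z \<omega> - I t \<omega>"
   using IN A.jint_AE[OF rate_jint[OF L]]
  proof eventually_elim
   case (elim \<omega>)
   from A.LINT_split_total[OF elim(2), of t T] t show ?case using elim(1) by (simp add: claim_def Z_def I_def)
  qed
  have iY: "integrable M (Y t)" unfolding Y_def by (intro LINT_integrable_diff closesD(2)[OF X(2) t] Ii t)
  have "AE \<omega> in M. real_cond_exp M (F t) (claim L t) \<omega> = Y t \<omega>"
  proof (rule S.real_cond_exp_charact[OF _ claim_integrable_at[OF L t] iY])
   show "Y t \<in> borel_measurable (F t)" unfolding Y_def using closesD(1)[OF X(2) t] Im[OF t] by (rule borel_measurable_diff)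
   fix A assume A: "A \<in> sets (F t)"
   have AM: "A \<in> sets M" using A sets_F_subset[OF t] by blast
   note i = integrable_real_mult_indicator[OF AM]
   have "(LINT \<omega>|M. claim L t \<omega> * indicator A \<omega>) = (LINT \<omega>|M. Z \<omega> * indicator A \<omega> - I t \<omega> * indicator A \<omega>)"
   proof (rule integral_cong_AE)
    show "AE \<omega> in M. claim L t \<omega> * indicator A \<omega> = Z \<omega> * indicator A \<omega> - I t \<omega> * indicator A \<omega>"
     using c by eventually_elim (simp add: left_diff_distrib)
   qed (intro borel_measurable_diff borel_measurable_integrable[OF i] claim_integrable_at L t Z Ii)+
   also have "\<dots> = (LINT \<omega>|M. Z \<omega> * indicator A \<omega>) - (LINT \<omega>|M. I t \<omega> * indicator A \<omega>)"
    by (rule LINT_diff[OF i[OF Z] i[OF Ii[OF t]]])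
   also have "\<dots> = (LINT \<omega>|M. X t \<omega> * indicator A \<omega>) - (LINT \<omega>|M. I t \<omega> * indicator A \<omega>)"
    unfolding closesD(3)[OF X(2) t A] ..
   also have "\<dots> = (LINT \<omega>|M. Y t \<omega> * indicator A \<omega>)" unfolding Y_def left_diff_distrib
    by (rule LINT_diff[symmetric, OF i[OF closesD(2)[OF X(2) t]] i[OF Ii[OF t]]])
   finally show "(LINT \<omega>:A|M. claim L t \<omega>) = (LINT \<omega>:A|M. Y t \<omega>)" by (simp add: set_lebesgue_integral_def mult.commute)
  qed
  then show ?thesis by eventually_elim simp
 qed
 ultimately have "contract_of M F T n \<mu>A f \<xi> L Y"
  unfolding contract_of_def claim_def[abs_def] rate_def by blast
 then show ?thesis by blast
qed

end

section \<open>Level times of a control\<close>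

text \<open>The hitting time of an arbitrary real level; real levels are needed for the approximation of \<open>i\<close> from below.\<close>

definition level_time :: "real \<Rightarrow> (real \<Rightarrow> 'a \<Rightarrow> real) \<Rightarrow> real \<Rightarrow> 'a \<Rightarrow> real" where
 "level_time T L c \<omega> = (if \<exists>t\<in>{0..T}. c \<le> L t \<omega> then Inf {t\<in>{0..T}. c \<le> L t \<omega>} else T)"

lemma hitting_time_eq: "hitting_time T L i = level_time T L (real i)"
 by (rule ext) (simp add: hitting_time_def level_time_def)

lemma level_time_le: "s \<in> {0..T} \<Longrightarrow> c \<le> L s \<omega> \<Longrightarrow> level_time T L c \<omega> \<le> s"
 unfolding level_time_def by (auto intro!: cInf_lower bdd_belowI[of _ 0])

lemma level_time_before: "0 \<le> s \<Longrightarrow> s \<le> T \<Longrightarrow> s < level_time T L c \<omega> \<Longrightarrow> L s \<omega> < c"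
 using level_time_le[of s T c L \<omega>] by (cases "L s \<omega> < c") auto

lemma level_time_range: "0 \<le> T \<Longrightarrow> 0 \<le> level_time T L c \<omega> \<and> level_time T L c \<omega> \<le> T"
proof (cases "\<exists>t\<in>{0..T}. c \<le> L t \<omega>")
 case True
 then obtain t where t: "t \<in> {0..T}" "c \<le> L t \<omega>" by (rule bexE)
 have "0 \<le> Inf {t\<in>{0..T}. c \<le> L t \<omega>}" using t by (intro cInf_greatest) auto
 then show ?thesis using True level_time_le[of t T c L \<omega>] t by (simp add: level_time_def)
qed (simp add: level_time_def)

lemma level_time_after:
 assumes m: "mono_on {0..T} (\<lambda>t. L t \<omega>)" and s: "level_time T L c \<omega> < s" "s \<le> T" and T: "0 \<le> T"
 shows "c \<le> L s \<omega>"
proof -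
 have e: "\<exists>t\<in>{0..T}. c \<le> L t \<omega>" using s by (auto simp: level_time_def split: if_splits)
 then have "Inf {t\<in>{0..T}. c \<le> L t \<omega>} < s" using s by (simp add: level_time_def)
 moreover have "{t\<in>{0..T}. c \<le> L t \<omega>} \<noteq> {}" using e by auto
 ultimately obtain t where t: "t \<in> {t\<in>{0..T}. c \<le> L t \<omega>}" "t < s" using cInf_lessD by meson
 have "L t \<omega> \<le> L s \<omega>" by (rule mono_onD[OF m]) (use t s in auto)
 then show ?thesis using t by auto
qed

lemma level_time_mono:
 assumes "c \<le> d" "0 \<le> T" shows "level_time T L c \<omega> \<le> level_time T L d \<omega>"
proof (cases "\<exists>t\<in>{0..T}. d \<le> L t \<omega>")
 case True
 then obtain t where t: "t \<in> {0..T}" "d \<le> L t \<omega>" by (rule bexE)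
 have "level_time T L c \<omega> \<le> Inf {t\<in>{0..T}. d \<le> L t \<omega>}"
  using t assms by (intro cInf_greatest) (auto intro!: level_time_le)
 then show ?thesis using True by (simp add: level_time_def)
next
 case False
 then show ?thesis using level_time_range[OF assms(2), of L c \<omega>] by (simp add: level_time_def[of T L d])
qed

context contract_design
begin

lemma level_time_ST:
 assumes L: "L \<in> \<L>"
 shows "level_time T L c \<in> ST"
proof (rule STI_less)
 fix t assume t: "t \<in> {0<..T}"
 have "{\<omega>\<in>space M. level_time T L c \<omega> < t} = (\<Union>q\<in>\<rat> \<inter> {0..<t}. {\<omega>\<in>space M. c \<le> L q \<omega>})"
 proof (intro equalityI subsetI)
  fix \<omega> assume w: "\<omega> \<in> {\<omega>\<in>space M. level_time T L c \<omega> < t}"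
  then obtain q where q: "q \<in> \<rat>" "level_time T L c \<omega> < q" "q < t" using Rats_dense_in_real by blast
  have "c \<le> L q \<omega>" by (rule level_time_after[OF controls_monoD(2)[OF L] q(2)]) (use w q t T_nonneg in auto)
  moreover have "0 \<le> q" using q level_time_range[OF T_nonneg, of L c \<omega>] by linarith
  ultimately show "\<omega> \<in> (\<Union>q\<in>\<rat> \<inter> {0..<t}. {\<omega>\<in>space M. c \<le> L q \<omega>})" using q w by auto
 next
  fix \<omega> assume "\<omega> \<in> (\<Union>q\<in>\<rat> \<inter> {0..<t}. {\<omega>\<in>space M. c \<le> L q \<omega>})"
  then obtain q where q: "0 \<le> q" "q < t" "\<omega> \<in> space M" "c \<le> L q \<omega>" by auto
  then have "level_time T L c \<omega> \<le> q" using t by (intro level_time_le) auto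
  then show "\<omega> \<in> {\<omega>\<in>space M. level_time T L c \<omega> < t}" using q by simp
 qed
 also have "\<dots> \<in> sets (F t)"
 proof (rule sets.countable_UN'')
  show "countable (\<rat> \<inter> {0..<t})" by (simp add: countable_rat countable_Int1)
  fix q assume q: "q \<in> \<rat> \<inter> {0..<t}"
  have "L q \<in> borel_measurable (F q)" using q t by (intro optional_adapted[OF controls_monoD(1)[OF L]]) auto
  then have "{\<omega>\<in>space M. c \<le> L q \<omega>} \<in> sets (F q)" unfolding space_F[of q, symmetric] by measurable
  then show "{\<omega>\<in>space M. c \<le> L q \<omega>} \<in> sets (F t)" using q by (intro sets_F_le[of q t]) auto
 qed
 finally show "{\<omega>\<in>space M. level_time T L c \<omega> < t} \<in> sets (F t)" .
qed (rule level_time_range[OF T_nonneg])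

lemma left_lim_level:
 assumes L: "L \<in> \<L>" and w: "\<omega> \<in> space M" and t: "t \<in> {0..T}"
 shows left_lim_before_level: "t < level_time T L c \<omega> \<Longrightarrow> left_lim L t \<omega> < c"
  and left_lim_after_level: "level_time T L c \<omega> < t \<Longrightarrow> c \<le> left_lim L t \<omega>"
proof -
 show "left_lim L t \<omega> < c" if "t < level_time T L c \<omega>"
 proof -
  have "left_lim L t \<omega> \<le> L t \<omega>"
  proof (rule left_lim_le[OF L w t])
   show "0 \<le> L t \<omega>" using controls_monoD(3)[OF L t w] by simp
   show "L s \<omega> \<le> L t \<omega>" if "0 \<le> s" "s < t" for s
    by (rule mono_onD[OF controls_monoD(2)[OF L w]]) (use that t in auto)
  qed
  also have "L t \<omega> < c" using t that by (intro level_time_before[of t T L c \<omega>]) auto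
  finally show ?thesis .
 qed
 show "c \<le> left_lim L t \<omega>" if lt: "level_time T L c \<omega> < t"
 proof -
  obtain s where s: "level_time T L c \<omega> < s" "s < t" using dense[OF lt] by blast
  have s0: "0 \<le> s" using s level_time_range[OF T_nonneg, of L c \<omega>] by linarith
  have "c \<le> L s \<omega>" by (rule level_time_after[OF controls_monoD(2)[OF L w] s(1)]) (use s t T_nonneg in auto)
  also have "\<dots> \<le> left_lim L t \<omega>" using s0 s t by (intro left_lim_ge[OF L w]) auto
  finally show ?thesis .
 qed
qed

lemma rate_level:
 assumes L: "L \<in> \<L>" and w: "\<omega> \<in> space M" and t: "t \<in> {0..T}" and i: "i \<in> {1..n}"
 shows rate_before_level: "t < level_time T L (real i) \<omega> \<Longrightarrow> rate L t \<omega> < f i t \<omega>"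
  and rate_after_level: "level_time T L (real i) \<omega> < t \<Longrightarrow> f i t \<omega> \<le> rate L t \<omega>"
proof -
 have e: "f i t \<omega> = interp n f t \<omega> (real i)" by (rule interp_nat[OF i, symmetric])
 show "rate L t \<omega> < f i t \<omega>" if "t < level_time T L (real i) \<omega>"
  unfolding e rate_def by (rule interp_less[OF t w left_lim_before_level[OF L w t that]])
 show "f i t \<omega> \<le> rate L t \<omega>" if "level_time T L (real i) \<omega> < t"
  unfolding e rate_def by (rule interp_le[OF t w left_lim_after_level[OF L w t that]])
qed

text \<open>Off the single time point at which the level \<open>i\<close> is reached, the indicators in \<open>J\<close> are those of the time
 before and after the hitting time.\<close>

lemma J_eq:
 assumes L: "L \<in> \<L>"
 shows "J M T n \<mu>A \<mu>P f g \<xi> L = (\<Sum>i=1..n. (LINT \<omega>|M. (LINT t:{0..hitting_time T L i \<omega>}|\<mu>P. g i t \<omega>))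
  - (LINT \<omega>|M. claim L (hitting_time T L i \<omega>) \<omega>))"
proof -
 define h where "h i = hitting_time T L i" for i
 have h: "h i \<in> ST" for i unfolding h_def hitting_time_eq by (rule level_time_ST[OF L])
 have G: "(LINT t:{0..T}|\<mu>P. g i t \<omega> * of_bool (left_lim L t \<omega> < real i)) = (LINT t:{0..h i \<omega>}|\<mu>P. g i t \<omega>)"
  if i: "i \<in> {1..n}" and w: "\<omega> \<in> space M" for i \<omega>
 proof -
  have gm: "(\<lambda>t. g i t \<omega>) \<in> borel_measurable \<mu>P"
   using measurable_Pair1[OF P.progressive_joint[OF g_prog[OF i]] w] by simp
  have lm: "(\<lambda>t. left_lim L t \<omega>) \<in> borel_measurable \<mu>P"
   using measurable_Pair1[OF P.progressive_joint[OF left_lim_progressive[OF L]] w] by simp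
  have bm: "(\<lambda>t. of_bool (left_lim L t \<omega> < real i) :: real) \<in> borel_measurable \<mu>P"
   unfolding of_bool_def using lm by measurable
  have im: "(\<lambda>t. indicator {0..c} t :: real) \<in> borel_measurable \<mu>P" for c by (rule P.borel_\<mu>) simp
  have "(LINT t|\<mu>P. indicator {0..T} t * (g i t \<omega> * of_bool (left_lim L t \<omega> < real i))) = (LINT t|\<mu>P. indicator {0..h i \<omega>} t * g i t \<omega>)"
  proof (rule integral_cong_AE)
   show "AE t in \<mu>P. indicator {0..T} t * (g i t \<omega> * of_bool (left_lim L t \<omega> < real i)) = indicator {0..h i \<omega>} t * g i t \<omega>"
    using P.AE_\<mu>_neq[of "h i \<omega>"] AE_space
   proof eventually_elim
    case (elim t)
    then have t: "t \<in> {0..T}" by (simp add: P.space_\<mu>)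
    show ?case
     using left_lim_level[OF L w t, of "real i"] elim(1) t unfolding h_def hitting_time_eq
     by (cases "t < level_time T L (real i) \<omega>") (auto simp: indicator_def)
   qed
  qed (intro borel_measurable_times im gm bm)+
  then show ?thesis unfolding P.set_LINT_\<mu> .
 qed
 have R: "(LINT t:{0..T}|\<mu>A. interp n f t \<omega> (left_lim L t \<omega>) * of_bool (real i \<le> left_lim L t \<omega>)) = (LINT t:{h i \<omega><..T}|\<mu>A. rate L t \<omega>)"
  if i: "i \<in> {1..n}" and w: "\<omega> \<in> space M" for i \<omega>
 proof -
  have rm: "(\<lambda>t. rate L t \<omega>) \<in> borel_measurable \<mu>A"
   using measurable_Pair1[OF A.progressive_joint[OF rate_progressive[OF L]] w] by simp
  have lm: "(\<lambda>t. left_lim L t \<omega>) \<in> borel_measurable \<mu>A"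
   using measurable_Pair1[OF A.progressive_joint[OF left_lim_progressive[OF L]] w] by simp
  have bm: "(\<lambda>t. of_bool (real i \<le> left_lim L t \<omega>) :: real) \<in> borel_measurable \<mu>A"
   unfolding of_bool_def using lm by measurable
  have im: "(\<lambda>t. indicator {0..T} t :: real) \<in> borel_measurable \<mu>A" by (rule A.borel_\<mu>) simp
  have im': "(\<lambda>t. indicator {c<..T} t :: real) \<in> borel_measurable \<mu>A" for c by (rule A.borel_\<mu>) simp
  have "(LINT t|\<mu>A. indicator {0..T} t * (rate L t \<omega> * of_bool (real i \<le> left_lim L t \<omega>))) = (LINT t|\<mu>A. indicator {h i \<omega><..T} t * rate L t \<omega>)"
  proof (rule integral_cong_AE)
   show "AE t in \<mu>A. indicator {0..T} t * (rate L t \<omega> * of_bool (real i \<le> left_lim L t \<omega>)) = indicator {h i \<omega><..T} t * rate L t \<omega>"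
    using A.AE_\<mu>_neq[of "h i \<omega>"] AE_space
   proof eventually_elim
    case (elim t)
    then have t: "t \<in> {0..T}" by (simp add: A.space_\<mu>)
    show ?case
     using left_lim_level[OF L w t, of "real i"] elim(1) t unfolding h_def hitting_time_eq
     by (cases "t < level_time T L (real i) \<omega>") (auto simp: indicator_def)
   qed
  qed (intro borel_measurable_times im im' rm bm)+
  then show ?thesis unfolding A.set_LINT_\<mu> rate_def .
 qed
 have gi: "integrable M (\<lambda>\<omega>. LINT t:{0..h i \<omega>}|\<mu>P. g i t \<omega>)" if "i \<in> {1..n}" for i
  by (rule P.jint_upto[OF g_jint[OF that] h])
 have ci: "integrable M (\<lambda>\<omega>. claim L (h i \<omega>) \<omega>)" for i by (rule claim_integrable[OF L h])
 have "J M T n \<mu>A \<mu>P f g \<xi> L = (LINT \<omega>|M. (\<Sum>i=1..n. (LINT t:{0..h i \<omega>}|\<mu>P. g i t \<omega>) - claim L (h i \<omega>) \<omega>))"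
  unfolding J_def
 proof (rule LINT_cong[OF refl], rule sum.cong[OF refl])
  fix \<omega> i assume w: "\<omega> \<in> space M" and i: "i \<in> {1..n}"
  show "(LINT t:{0..T}|\<mu>P. g i t \<omega> * of_bool (left_lim L t \<omega> < real i)) -
    (LINT t:{0..T}|\<mu>A. interp n f t \<omega> (left_lim L t \<omega>) * of_bool (real i \<le> left_lim L t \<omega>)) - \<xi> \<omega>
    = (LINT t:{0..h i \<omega>}|\<mu>P. g i t \<omega>) - claim L (h i \<omega>) \<omega>"
   unfolding G[OF i w] R[OF i w] claim_def by simp
 qed
 also have "\<dots> = (\<Sum>i=1..n. LINT \<omega>|M. (LINT t:{0..h i \<omega>}|\<mu>P. g i t \<omega>) - claim L (h i \<omega>) \<omega>)"
  by (intro LINT_sum LINT_integrable_diff gi ci)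
 also have "\<dots> = (\<Sum>i=1..n. (LINT \<omega>|M. (LINT t:{0..h i \<omega>}|\<mu>P. g i t \<omega>)) - (LINT \<omega>|M. claim L (h i \<omega>) \<omega>))"
  by (intro sum.cong refl LINT_diff gi ci)
 finally show ?thesis unfolding h_def .
qed

text \<open>Integrating a rate that changes sign from positive to nonpositive at \<open>c\<close>.\<close>

lemma path_argmax:
 fixes G :: "real \<Rightarrow> real"
 assumes G: "integrable \<mu>A G" and c: "c \<in> {0..T}" and s: "s \<in> {0..T}"
  and pos: "\<And>t. t \<in> {0..T} \<Longrightarrow> t < c \<Longrightarrow> 0 < G t" and neg: "\<And>t. t \<in> {0..T} \<Longrightarrow> c < t \<Longrightarrow> G t \<le> 0"
 shows path_argmax_le: "(LINT t:{0..s}|\<mu>A. G t) \<le> (LINT t:{0..c}|\<mu>A. G t)"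
  and path_argmax_less: "s < c \<Longrightarrow> (LINT t:{0..s}|\<mu>A. G t) < (LINT t:{0..c}|\<mu>A. G t)"
proof -
 have less: "(LINT t:{0..s}|\<mu>A. G t) < (LINT t:{0..c}|\<mu>A. G t)" if sc: "s < c"
 proof -
  have nn: "AE t in \<mu>A. 0 \<le> indicator {s<..c} t * G t"
   using A.AE_\<mu>_neq[of c] AE_space
  proof eventually_elim
   case (elim t)
   then show ?case using pos[of t] by (auto simp: indicator_def A.space_\<mu>)
  qed
  have i: "integrable \<mu>A (\<lambda>t. indicator {s<..c} t * G t)" by (rule A.integrable_window[OF G])
  have "0 < (LINT t|\<mu>A. indicator {s<..c} t * G t)"
  proof (rule ccontr)
   assume "\<not> 0 < (LINT t|\<mu>A. indicator {s<..c} t * G t)"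
   then have "(LINT t|\<mu>A. indicator {s<..c} t * G t) = 0" using integral_nonneg_AE[OF nn] by linarith
   then have "AE t in \<mu>A. indicator {s<..c} t * G t = 0" using integral_nonneg_eq_0_iff_AE[OF i nn] by simp
   then have "\<exists>t\<in>{s<..<c}. indicator {s<..c} t * G t = 0"
    using s c sc by (intro A.full_support_witness[OF full_A]) auto
   then obtain t where t: "t \<in> {s<..<c}" "indicator {s<..c} t * G t = 0" by (rule bexE)
   then show False using pos[of t] s c by (auto simp: indicator_def)
  qed
  then show ?thesis using A.LINT_split_upto[OF G, of s c] s c sc by (simp add: A.set_LINT_\<mu>)
 qed
 then show "s < c \<Longrightarrow> (LINT t:{0..s}|\<mu>A. G t) < (LINT t:{0..c}|\<mu>A. G t)" .
 show "(LINT t:{0..s}|\<mu>A. G t) \<le> (LINT t:{0..c}|\<mu>A. G t)"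
 proof (cases "s < c")
  case False
  have "0 \<le> (LINT t|\<mu>A. - (indicator {c<..s} t * G t))"
  proof (rule integral_nonneg_AE)
   show "AE t in \<mu>A. 0 \<le> - (indicator {c<..s} t * G t)" using AE_space
   proof eventually_elim
    case (elim t)
    then show ?case using neg[of t] by (auto simp: indicator_def A.space_\<mu>)
   qed
  qed
  then have "(LINT t:{c<..s}|\<mu>A. G t) \<le> 0" by (simp add: A.set_LINT_\<mu>)
  then show ?thesis using A.LINT_split_upto[OF G, of c s] s c False by simp
 qed (use less in simp)
qed

text \<open>Adding and subtracting the payments made before \<open>\<tau>\<close> turns the claim at \<open>\<tau>\<close> into a constant.\<close>

lemma contract_payoff:
 assumes L: "L \<in> \<L>" and Y: "contract_of M F T n \<mu>A f \<xi> L Y" and i: "i \<in> {1..n}" and \<tau>: "\<tau> \<in> ST"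
 shows "agent_payoff M \<mu>A (f i) Y \<tau> = (LINT \<omega>|M. \<xi> \<omega>) + (LINT \<omega>|M. (LINT t|\<mu>A. rate L t \<omega>))
  + (LINT \<omega>|M. (LINT t:{0..\<tau> \<omega>}|\<mu>A. f i t \<omega> - rate L t \<omega>))"
proof -
 note r = rate_jint[OF L] and f = f_jint[OF i]
 have a: "(LINT \<omega>|M. (LINT t|\<mu>A. rate L t \<omega>)) = (LINT \<omega>|M. (LINT t:{0..\<tau> \<omega>}|\<mu>A. rate L t \<omega>)) + (LINT \<omega>|M. (LINT t:{\<tau> \<omega><..T}|\<mu>A. rate L t \<omega>))"
  (is "?l = _")
 proof -
  have "?l = (LINT \<omega>|M. (LINT t:{0..\<tau> \<omega>}|\<mu>A. rate L t \<omega>) + (LINT t:{\<tau> \<omega><..T}|\<mu>A. rate L t \<omega>))"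
  proof (rule integral_cong_AE)
   show "AE \<omega> in M. (LINT t|\<mu>A. rate L t \<omega>) = (LINT t:{0..\<tau> \<omega>}|\<mu>A. rate L t \<omega>) + (LINT t:{\<tau> \<omega><..T}|\<mu>A. rate L t \<omega>)"
    using A.jint_AE[OF r] AE_space
   proof eventually_elim
    case (elim \<omega>)
    then show ?case using A.LINT_split_total[OF elim(1), of "\<tau> \<omega>" T] STD_range[OF \<tau> elim(2)] by simp
   qed
  qed (intro borel_measurable_add borel_measurable_integrable A.jint_integral A.jint_upto A.jint_after r \<tau>)+
  also have "\<dots> = (LINT \<omega>|M. (LINT t:{0..\<tau> \<omega>}|\<mu>A. rate L t \<omega>)) + (LINT \<omega>|M. (LINT t:{\<tau> \<omega><..T}|\<mu>A. rate L t \<omega>))"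
   by (intro LINT_add A.jint_upto A.jint_after r \<tau>)
  finally show ?thesis .
 qed
 have b: "(LINT \<omega>|M. (LINT t:{0..\<tau> \<omega>}|\<mu>A. f i t \<omega> - rate L t \<omega>)) = (LINT \<omega>|M. (LINT t:{0..\<tau> \<omega>}|\<mu>A. f i t \<omega>)) - (LINT \<omega>|M. (LINT t:{0..\<tau> \<omega>}|\<mu>A. rate L t \<omega>))"
  (is "?l = _")
 proof -
  have "?l = (LINT \<omega>|M. (LINT t:{0..\<tau> \<omega>}|\<mu>A. f i t \<omega>) - (LINT t:{0..\<tau> \<omega>}|\<mu>A. rate L t \<omega>))"
  proof (rule integral_cong_AE)
   show "AE \<omega> in M. (LINT t:{0..\<tau> \<omega>}|\<mu>A. f i t \<omega> - rate L t \<omega>) = (LINT t:{0..\<tau> \<omega>}|\<mu>A. f i t \<omega>) - (LINT t:{0..\<tau> \<omega>}|\<mu>A. rate L t \<omega>)"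
    using A.jint_AE[OF r] A.jint_AE[OF f]
   proof eventually_elim
    case (elim \<omega>)
    show ?case unfolding A.set_LINT_\<mu> right_diff_distrib
     by (rule LINT_diff[OF A.integrable_window(2)[OF elim(2)] A.integrable_window(2)[OF elim(1)]])
   qed
  qed (intro borel_measurable_diff borel_measurable_integrable A.jint_upto A.jint_diff r f \<tau>)+
  also have "\<dots> = (LINT \<omega>|M. (LINT t:{0..\<tau> \<omega>}|\<mu>A. f i t \<omega>)) - (LINT \<omega>|M. (LINT t:{0..\<tau> \<omega>}|\<mu>A. rate L t \<omega>))"
   by (intro LINT_diff A.jint_upto r f \<tau>)
  finally show ?thesis .
 qed
 show ?thesis
  unfolding A.agent_payoff_split[OF f contract_class_D[OF L Y] \<tau>] contract_expectation[OF L Y \<tau>] claim_expectation[OF L \<tau>] a b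
  by simp
qed

text \<open>Against the rate of \<open>L\<close> agent \<open>i\<close> gains \<open>f i - rate L\<close>, which is positive up to the level time of
 \<open>i\<close>. So if stopping at \<open>\<sigma>\<close> loses at least the gain missed between \<open>\<sigma>\<close> and the level time, then
 the level time is optimal, and full support of the measure makes an earlier \<open>\<sigma>\<close> strictly worse.\<close>

lemma smallest_optimal_if_waiting_pays:
 assumes L: "L \<in> \<L>" and i: "i \<in> {1..n}"
  and main: "\<And>\<sigma>. \<sigma> \<in> ST \<Longrightarrow> agent_payoff M \<mu>A (f i) Y \<sigma>
   + ((LINT \<omega>|M. (LINT t:{0..max (\<sigma> \<omega>) (hitting_time T L i \<omega>)}|\<mu>A. f i t \<omega> - rate L t \<omega>))
    - (LINT \<omega>|M. (LINT t:{0..\<sigma> \<omega>}|\<mu>A. f i t \<omega> - rate L t \<omega>)))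
   \<le> agent_payoff M \<mu>A (f i) Y (hitting_time T L i)"
 shows "smallest_optimal M F T \<mu>A (f i) Y (hitting_time T L i)"
proof -
 define h where "h = hitting_time T L i"
 have h: "h \<in> ST" unfolding h_def hitting_time_eq by (rule level_time_ST[OF L])
 define G where "G t \<omega> = f i t \<omega> - rate L t \<omega>" for t \<omega>
 have G: "A.jint G" unfolding G_def by (rule A.jint_diff[OF f_jint[OF i] rate_jint[OF L]])
 have x: "(\<lambda>\<omega>. max (\<sigma> \<omega>) (h \<omega>)) \<in> ST" if "\<sigma> \<in> ST" for \<sigma> by (rule ST_max[OF that h])
 define D where "D \<sigma> \<omega> = (LINT t:{0..max (\<sigma> \<omega>) (h \<omega>)}|\<mu>A. G t \<omega>) - (LINT t:{0..\<sigma> \<omega>}|\<mu>A. G t \<omega>)" for \<sigma> \<omega>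
 have Di: "integrable M (D \<sigma>)" if "\<sigma> \<in> ST" for \<sigma>
  unfolding D_def by (rule LINT_integrable_diff[OF A.jint_upto[OF G x[OF that]] A.jint_upto[OF G that]])
 have gain: "agent_payoff M \<mu>A (f i) Y \<sigma> + (LINT \<omega>|M. D \<sigma> \<omega>) \<le> agent_payoff M \<mu>A (f i) Y h" if \<sigma>: "\<sigma> \<in> ST" for \<sigma>
  unfolding D_def LINT_diff[OF A.jint_upto[OF G x[OF \<sigma>]] A.jint_upto[OF G \<sigma>]]
  using main[OF \<sigma>] unfolding G_def h_def .
 have pos: "AE \<omega> in M. 0 \<le> D \<sigma> \<omega> \<and> (\<sigma> \<omega> < h \<omega> \<longrightarrow> 0 < D \<sigma> \<omega>)" if \<sigma>: "\<sigma> \<in> ST" for \<sigma>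
  using A.jint_AE[OF G] AE_space
 proof eventually_elim
  case (elim \<omega>)
  have r: "h \<omega> \<in> {0..T}" "\<sigma> \<omega> \<in> {0..T}" using STD_range[OF h elim(2)] STD_range[OF \<sigma> elim(2)] by auto
  have pos: "0 < G t \<omega>" if "t \<in> {0..T}" "t < h \<omega>" for t
   using rate_before_level[OF L elim(2) that(1) i] that(2) by (simp add: h_def hitting_time_eq G_def)
  have neg: "G t \<omega> \<le> 0" if "t \<in> {0..T}" "h \<omega> < t" for t
   using rate_after_level[OF L elim(2) that(1) i] that(2) by (simp add: h_def hitting_time_eq G_def)
  show ?case
  proof (cases "\<sigma> \<omega> < h \<omega>")
   case True
   then have "D \<sigma> \<omega> = (LINT t:{0..h \<omega>}|\<mu>A. G t \<omega>) - (LINT t:{0..\<sigma> \<omega>}|\<mu>A. G t \<omega>)" by (simp add: D_def max_def)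
   then show ?thesis using path_argmax_less[OF elim(1) r pos neg True] by simp
  next
   case False
   then show ?thesis by (simp add: D_def max_def)
  qed
 qed
 have D0: "AE \<omega> in M. 0 \<le> D \<sigma> \<omega>" if "\<sigma> \<in> ST" for \<sigma> using pos[OF that] by eventually_elim simp
 have "agent_optimal M F T \<mu>A (f i) Y h" unfolding A.agent_optimal_iff
 proof (intro conjI ballI h)
  fix \<sigma> assume \<sigma>: "\<sigma> \<in> ST"
  from gain[OF \<sigma>] integral_nonneg_AE[OF D0[OF \<sigma>]] show "agent_payoff M \<mu>A (f i) Y \<sigma> \<le> agent_payoff M \<mu>A (f i) Y h" by linarith
 qed
 moreover have "AE \<omega> in M. h \<omega> \<le> \<sigma> \<omega>" if o: "agent_optimal M F T \<mu>A (f i) Y \<sigma>" for \<sigma>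
 proof -
  have \<sigma>: "\<sigma> \<in> ST" using o unfolding A.agent_optimal_iff by (rule conjunct1)
  have "agent_payoff M \<mu>A (f i) Y h \<le> agent_payoff M \<mu>A (f i) Y \<sigma>"
   using conjunct2[OF o[unfolded A.agent_optimal_iff]] h by (rule bspec)
  then have "(LINT \<omega>|M. D \<sigma> \<omega>) = 0" using gain[OF \<sigma>] integral_nonneg_AE[OF D0[OF \<sigma>]] by linarith
  then have "AE \<omega> in M. D \<sigma> \<omega> = 0" using integral_nonneg_eq_0_iff_AE[OF Di[OF \<sigma>] D0[OF \<sigma>]] by simp
  then show ?thesis using pos[OF \<sigma>]
  proof eventually_elim
   case (elim \<omega>)
   then show ?case by (cases "\<sigma> \<omega> < h \<omega>") auto
  qed
 qed
 ultimately show ?thesis unfolding smallest_optimal_def h_def by (intro conjI allI impI)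
qed

text \<open>Against the contract of \<open>L\<close> an agent earns exactly \<open>f i - rate L\<close>, up to a constant, and this rate
 is nonpositive after the level time.\<close>

lemma hitting_time_smallest_optimal:
 assumes L: "L \<in> \<L>" and Y: "contract_of M F T n \<mu>A f \<xi> L Y" and i: "i \<in> {1..n}"
 shows "smallest_optimal M F T \<mu>A (f i) Y (hitting_time T L i)"
proof (rule smallest_optimal_if_waiting_pays[OF L i])
 fix \<sigma> assume \<sigma>: "\<sigma> \<in> ST"
 define h where "h = hitting_time T L i"
 have h: "h \<in> ST" unfolding h_def hitting_time_eq by (rule level_time_ST[OF L])
 have x: "(\<lambda>\<omega>. max (\<sigma> \<omega>) (h \<omega>)) \<in> ST" by (rule ST_max[OF \<sigma> h])
 have G: "A.jint (\<lambda>t \<omega>. f i t \<omega> - rate L t \<omega>)" by (rule A.jint_diff[OF f_jint[OF i] rate_jint[OF L]])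
 have "(LINT \<omega>|M. (LINT t:{0..max (\<sigma> \<omega>) (h \<omega>)}|\<mu>A. f i t \<omega> - rate L t \<omega>)) \<le> (LINT \<omega>|M. (LINT t:{0..h \<omega>}|\<mu>A. f i t \<omega> - rate L t \<omega>))"
 proof (rule integral_mono_AE[OF A.jint_upto[OF G x] A.jint_upto[OF G h]])
  show "AE \<omega> in M. (LINT t:{0..max (\<sigma> \<omega>) (h \<omega>)}|\<mu>A. f i t \<omega> - rate L t \<omega>) \<le> (LINT t:{0..h \<omega>}|\<mu>A. f i t \<omega> - rate L t \<omega>)"
   using A.jint_AE[OF G] AE_space
  proof eventually_elim
   case (elim \<omega>)
   have r: "h \<omega> \<in> {0..T}" "max (\<sigma> \<omega>) (h \<omega>) \<in> {0..T}" using STD_range[OF h elim(2)] STD_range[OF x elim(2)] by auto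
   show ?case
   proof (rule path_argmax_le[OF elim(1) r])
    fix t assume t: "t \<in> {0..T}"
    show "0 < f i t \<omega> - rate L t \<omega>" if "t < h \<omega>"
     using rate_before_level[OF L elim(2) t i] that by (simp add: h_def hitting_time_eq)
    show "f i t \<omega> - rate L t \<omega> \<le> 0" if "h \<omega> < t"
     using rate_after_level[OF L elim(2) t i] that by (simp add: h_def hitting_time_eq)
   qed
  qed
 qed
 then show "agent_payoff M \<mu>A (f i) Y \<sigma>
   + ((LINT \<omega>|M. (LINT t:{0..max (\<sigma> \<omega>) (hitting_time T L i \<omega>)}|\<mu>A. f i t \<omega> - rate L t \<omega>))
    - (LINT \<omega>|M. (LINT t:{0..\<sigma> \<omega>}|\<mu>A. f i t \<omega> - rate L t \<omega>)))
   \<le> agent_payoff M \<mu>A (f i) Y (hitting_time T L i)"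
  unfolding contract_payoff[OF L Y i \<sigma>] contract_payoff[OF L Y i h[unfolded h_def]] h_def by linarith
qed

lemma contractsD:
 assumes "Y \<in> contracts M F T \<xi>"
 shows "class_D M F T Y" "USCE M F T Y" "AE \<omega> in M. \<xi> \<omega> \<le> Y T \<omega>"
 using assms by (simp_all add: contracts_def)

lemma smallest_optimalD:
 assumes "smallest_optimal M F T \<mu>A \<phi> Y \<tau>"
 shows "\<tau> \<in> ST" "\<sigma> \<in> ST \<Longrightarrow> agent_payoff M \<mu>A \<phi> Y \<sigma> \<le> agent_payoff M \<mu>A \<phi> Y \<tau>"
  "agent_optimal M F T \<mu>A \<phi> Y \<sigma> \<Longrightarrow> AE \<omega> in M. \<tau> \<omega> \<le> \<sigma> \<omega>" "agent_optimal M F T \<mu>A \<phi> Y \<tau>"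
proof -
 show o: "agent_optimal M F T \<mu>A \<phi> Y \<tau>" using assms unfolding smallest_optimal_def by (rule conjunct1)
 show "\<tau> \<in> ST" using o unfolding A.agent_optimal_iff by (rule conjunct1)
 show "agent_payoff M \<mu>A \<phi> Y \<sigma> \<le> agent_payoff M \<mu>A \<phi> Y \<tau>" if "\<sigma> \<in> ST"
  using o that unfolding A.agent_optimal_iff by (elim conjE) (erule bspec)
 show "agent_optimal M F T \<mu>A \<phi> Y \<sigma> \<Longrightarrow> AE \<omega> in M. \<tau> \<omega> \<le> \<sigma> \<omega>"
  using assms unfolding smallest_optimal_def by (elim conjE allE) (erule mp)
qed

lemma tau_hat_smallest:
 assumes Y: "Y \<in> contracts M F T \<xi>" and i: "i \<in> {1..n}"
 shows "smallest_optimal M F T \<mu>A (f i) Y (tau_hat M F T \<mu>A (f i) Y)"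
 unfolding tau_hat_def by (rule someI_ex[OF A.smallest_optimal_exists[OF f_jint[OF i] contractsD(1,2)[OF Y]]])

lemma principal_payoff_eq:
 assumes Y: "Y \<in> contracts M F T \<xi>" and \<tau>: "\<And>i. i \<in> {1..n} \<Longrightarrow> smallest_optimal M F T \<mu>A (f i) Y (\<tau> i)"
 shows "principal_payoff M F T n \<mu>A \<mu>P f g Y = (\<Sum>i=1..n. (LINT \<omega>|M. (LINT t:{0..\<tau> i \<omega>}|\<mu>P. g i t \<omega>)) - (LINT \<omega>|M. Y (\<tau> i \<omega>) \<omega>))"
proof -
 define s where "s i = tau_hat M F T \<mu>A (f i) Y" for i
 have s: "smallest_optimal M F T \<mu>A (f i) Y (s i)" if "i \<in> {1..n}" for i unfolding s_def by (rule tau_hat_smallest[OF Y that])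
 note sS = smallest_optimalD(1)[OF s] and tS = smallest_optimalD(1)[OF \<tau>]
 have eq: "AE \<omega> in M. s i \<omega> = \<tau> i \<omega>" if i: "i \<in> {1..n}" for i
  using smallest_optimalD(3)[OF s[OF i] smallest_optimalD(4)[OF \<tau>[OF i]]] smallest_optimalD(3)[OF \<tau>[OF i] smallest_optimalD(4)[OF s[OF i]]]
  by eventually_elim simp
 have gi: "integrable M (\<lambda>\<omega>. LINT t:{0..\<theta> \<omega>}|\<mu>P. g i t \<omega>)" if "i \<in> {1..n}" "\<theta> \<in> ST" for i \<theta>
  by (rule P.jint_upto[OF g_jint[OF that(1)] that(2)])
 note Yi = class_D_integrable[OF contractsD(1)[OF Y]]
 have "principal_payoff M F T n \<mu>A \<mu>P f g Y = (LINT \<omega>|M. (\<Sum>i=1..n. (LINT t:{0..s i \<omega>}|\<mu>P. g i t \<omega>) - Y (s i \<omega>) \<omega>))"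
  unfolding principal_payoff_def s_def ..
 also have "\<dots> = (\<Sum>i=1..n. LINT \<omega>|M. (LINT t:{0..s i \<omega>}|\<mu>P. g i t \<omega>) - Y (s i \<omega>) \<omega>)"
  by (intro LINT_sum LINT_integrable_diff gi Yi sS)
 also have "\<dots> = (\<Sum>i=1..n. LINT \<omega>|M. (LINT t:{0..\<tau> i \<omega>}|\<mu>P. g i t \<omega>) - Y (\<tau> i \<omega>) \<omega>)"
 proof (intro sum.cong refl integral_cong_AE)
  fix i assume i: "i \<in> {1..n}"
  show "(\<lambda>\<omega>. (LINT t:{0..s i \<omega>}|\<mu>P. g i t \<omega>) - Y (s i \<omega>) \<omega>) \<in> borel_measurable M"
   by (intro borel_measurable_diff borel_measurable_integrable gi Yi sS i)
  show "(\<lambda>\<omega>. (LINT t:{0..\<tau> i \<omega>}|\<mu>P. g i t \<omega>) - Y (\<tau> i \<omega>) \<omega>) \<in> borel_measurable M"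
   by (intro borel_measurable_diff borel_measurable_integrable gi Yi tS i)
  show "AE \<omega> in M. (LINT t:{0..s i \<omega>}|\<mu>P. g i t \<omega>) - Y (s i \<omega>) \<omega> = (LINT t:{0..\<tau> i \<omega>}|\<mu>P. g i t \<omega>) - Y (\<tau> i \<omega>) \<omega>"
   using eq[OF i] by eventually_elim simp
 qed
 also have "\<dots> = (\<Sum>i=1..n. (LINT \<omega>|M. (LINT t:{0..\<tau> i \<omega>}|\<mu>P. g i t \<omega>)) - (LINT \<omega>|M. Y (\<tau> i \<omega>) \<omega>))"
  by (intro sum.cong refl LINT_diff gi Yi tS)
 finally show ?thesis .
qed

lemma contract_principal_payoff:
 assumes L: "L \<in> \<L>" and Y: "contract_of M F T n \<mu>A f \<xi> L Y"
 shows "principal_payoff M F T n \<mu>A \<mu>P f g Y = J M T n \<mu>A \<mu>P f g \<xi> L"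
proof -
 have h: "hitting_time T L i \<in> ST" for i unfolding hitting_time_eq by (rule level_time_ST[OF L])
 have "principal_payoff M F T n \<mu>A \<mu>P f g Y = (\<Sum>i=1..n. (LINT \<omega>|M. (LINT t:{0..hitting_time T L i \<omega>}|\<mu>P. g i t \<omega>))
  - (LINT \<omega>|M. Y (hitting_time T L i \<omega>) \<omega>))"
  by (rule principal_payoff_eq[OF contract_admissible[OF L Y]]) (rule hitting_time_smallest_optimal[OF L Y])
 then show ?thesis unfolding J_eq[OF L] contract_expectation[OF L Y h] .
qed

end

section \<open>From a contract to an integer-valued control\<close>

text \<open>The optimal times are ordered almost surely only; their running maxima are ordered on every path.\<close>

primrec run_max :: "(nat \<Rightarrow> 'a \<Rightarrow> real) \<Rightarrow> nat \<Rightarrow> 'a \<Rightarrow> real" where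
 "run_max \<tau> 0 \<omega> = 0"
| "run_max \<tau> (Suc i) \<omega> = max (run_max \<tau> i \<omega>) (\<tau> (Suc i) \<omega>)"

lemma run_max_mono: "i \<le> j \<Longrightarrow> run_max \<tau> i \<omega> \<le> run_max \<tau> j \<omega>"
 by (rule lift_Suc_mono_le[of "\<lambda>i. run_max \<tau> i \<omega>"]) auto

lemma step_right_continuous:
 fixes c t :: real
 shows "((\<lambda>s. indicat_real {c..} s) \<longlongrightarrow> indicat_real {c..} t) (at_right t)"
proof (cases "t < c")
 case True
 have "\<forall>\<^sub>F s in at_right t. indicat_real {c..} s = indicat_real {c..} t"
  using eventually_at_right_real[OF True] by eventually_elim (use True in \<open>auto simp: indicator_def\<close>)
 then show ?thesis by (rule tendsto_eventually)
next
 case False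
 have "\<forall>\<^sub>F s in at_right t. indicat_real {c..} s = indicat_real {c..} t"
  using eventually_at_right_less[of t] by eventually_elim (use False in \<open>auto simp: indicator_def\<close>)
 then show ?thesis by (rule tendsto_eventually)
qed

lemma step_left_limit:
 fixes c t :: real
 shows "((\<lambda>s. indicat_real {c..} s) \<longlongrightarrow> indicat_real {c<..} t) (at_left t)"
proof (cases "c < t")
 case True
 have "\<forall>\<^sub>F s in at_left t. indicat_real {c..} s = indicat_real {c<..} t"
  using eventually_at_left_real[OF True] by eventually_elim (use True in \<open>auto simp: indicator_def\<close>)
 then show ?thesis by (rule tendsto_eventually)
next
 case False
 have lt: "t - 1 < t" by simp
 have "\<forall>\<^sub>F s in at_left t. indicat_real {c..} s = indicat_real {c<..} t"
  using eventually_at_left_real[OF lt] by eventually_elim (use False in \<open>auto simp: indicator_def\<close>)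
 then show ?thesis by (rule tendsto_eventually)
qed

context contract_design
begin

definition count_stopped :: "(nat \<Rightarrow> 'a \<Rightarrow> real) \<Rightarrow> real \<Rightarrow> 'a \<Rightarrow> real" where
 "count_stopped \<sigma> t \<omega> = (\<Sum>i=1..n. indicat_real {\<sigma> i \<omega>..} t)"

lemma count_stopped_card: "count_stopped \<sigma> t \<omega> = real (card {i\<in>{1..n}. \<sigma> i \<omega> \<le> t})"
proof -
 have "count_stopped \<sigma> t \<omega> = (\<Sum>i\<in>{1..n}. if \<sigma> i \<omega> \<le> t then 1 else 0)"
  unfolding count_stopped_def by (rule sum.cong) (auto simp: indicator_def)
 also have "\<dots> = real (card {i\<in>{1..n}. \<sigma> i \<omega> \<le> t})" by (simp add: sum.inter_filter[symmetric])
 finally show ?thesis .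
qed

lemma count_stopped_ge_iff:
 assumes m: "\<And>i j. i \<le> j \<Longrightarrow> \<sigma> i \<omega> \<le> \<sigma> j \<omega>" and i: "i \<in> {1..n}"
 shows "real i \<le> count_stopped \<sigma> t \<omega> \<longleftrightarrow> \<sigma> i \<omega> \<le> t"
proof
 assume "\<sigma> i \<omega> \<le> t"
 have "{1..i} \<subseteq> {j\<in>{1..n}. \<sigma> j \<omega> \<le> t}"
 proof
  fix j assume j: "j \<in> {1..i}"
  then have "\<sigma> j \<omega> \<le> \<sigma> i \<omega>" by (intro m) simp
  then show "j \<in> {j\<in>{1..n}. \<sigma> j \<omega> \<le> t}" using j i \<open>\<sigma> i \<omega> \<le> t\<close> by simp
 qed
 then have "card {1..i} \<le> card {j\<in>{1..n}. \<sigma> j \<omega> \<le> t}" by (rule card_mono[rotated]) simp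
 then show "real i \<le> count_stopped \<sigma> t \<omega>" unfolding count_stopped_card by simp
next
 assume a: "real i \<le> count_stopped \<sigma> t \<omega>"
 show "\<sigma> i \<omega> \<le> t"
 proof (rule ccontr)
  assume neg: "\<not> \<sigma> i \<omega> \<le> t"
  have "{j\<in>{1..n}. \<sigma> j \<omega> \<le> t} \<subseteq> {1..<i}"
  proof
   fix j assume j: "j \<in> {j\<in>{1..n}. \<sigma> j \<omega> \<le> t}"
   have "\<not> i \<le> j" using m[of i j] j neg by auto
   then show "j \<in> {1..<i}" using j by simp
  qed
  then have "card {j\<in>{1..n}. \<sigma> j \<omega> \<le> t} \<le> card {1..<i}" by (rule card_mono[rotated]) simp
  moreover have "i \<le> card {j\<in>{1..n}. \<sigma> j \<omega> \<le> t}" using a unfolding count_stopped_card by (simp only: of_nat_le_iff)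
  ultimately have "i \<le> card {1..<i}" by (rule order_trans[rotated])
  then show False using i by (simp only: card_atLeastLessThan atLeastAtMost_iff) linarith
 qed
qed

lemma count_stopped_control:
 assumes \<sigma>: "\<And>i. \<sigma> i \<in> ST"
 shows "count_stopped \<sigma> \<in> controls_int M F T n"
proof -
 have c: "cadlag_adapted M F T (count_stopped \<sigma>)" unfolding cadlag_adapted_def
 proof (intro conjI ballI)
  fix t assume t: "t \<in> {0..T}"
  have "(\<lambda>\<omega>. indicat_real {\<sigma> i \<omega>..} t) \<in> borel_measurable (F t)" for i
  proof (rule measurable_cong[THEN iffD1])
   show "indicat_real {\<omega>\<in>space M. \<sigma> i \<omega> \<le> t} \<omega> = indicat_real {\<sigma> i \<omega>..} t" if "\<omega> \<in> space (F t)" for \<omega>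
    using that by (simp add: indicator_def space_F)
   show "indicat_real {\<omega>\<in>space M. \<sigma> i \<omega> \<le> t} \<in> borel_measurable (F t)"
    by (rule borel_measurable_indicator[OF STD_le[OF \<sigma>]])
  qed
  then show "count_stopped \<sigma> t \<in> borel_measurable (F t)" unfolding count_stopped_def by (intro borel_measurable_sum)
 next
  fix \<omega> t
  show "((\<lambda>s. count_stopped \<sigma> s \<omega>) \<longlongrightarrow> count_stopped \<sigma> t \<omega>) (at_right t)"
   unfolding count_stopped_def by (rule tendsto_sum) (rule step_right_continuous)
  have "((\<lambda>s. count_stopped \<sigma> s \<omega>) \<longlongrightarrow> (\<Sum>i=1..n. indicat_real {\<sigma> i \<omega><..} t)) (at_left t)"
   unfolding count_stopped_def by (rule tendsto_sum) (rule step_left_limit)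
  then show "\<exists>l. ((\<lambda>s. count_stopped \<sigma> s \<omega>) \<longlongrightarrow> l) (at_left t)" by (rule exI)
 qed
 have card: "card {i\<in>{1..n}. \<sigma> i \<omega> \<le> t} \<le> n" for \<omega> t
 proof -
  have "card {i\<in>{1..n}. \<sigma> i \<omega> \<le> t} \<le> card {1..n}" by (rule card_mono) (simp, rule Collect_subset)
  then show ?thesis by simp
 qed
 have int: "count_stopped \<sigma> t \<omega> \<in> real ` {0..n}" for t \<omega>
  unfolding count_stopped_card using card[of \<omega> t] by (intro imageI) simp
 have "mono_on {0..T} (\<lambda>t. count_stopped \<sigma> t \<omega>)" for \<omega>
  unfolding count_stopped_def by (rule mono_onI, rule sum_mono) (auto simp: indicator_def)
 moreover have "count_stopped \<sigma> t \<omega> \<in> {0..real n}" for t \<omega> unfolding count_stopped_card using card[of \<omega> t] by simp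
 ultimately show ?thesis
  unfolding controls_int_def controls_mono_def controls_def
  using cadlag_optional[OF c] int by (intro CollectI conjI ballI AE_I2)
qed

lemma count_stopped_hitting:
 assumes \<sigma>: "\<And>i. \<sigma> i \<in> ST" and m: "\<And>i j \<omega>. i \<le> j \<Longrightarrow> \<sigma> i \<omega> \<le> \<sigma> j \<omega>" and i: "i \<in> {1..n}" and w: "\<omega> \<in> space M"
 shows "hitting_time T (count_stopped \<sigma>) i \<omega> = \<sigma> i \<omega>"
proof -
 have r: "0 \<le> \<sigma> i \<omega>" "\<sigma> i \<omega> \<le> T" using STD_range[OF \<sigma> w] by auto
 have iff: "real i \<le> count_stopped \<sigma> t \<omega> \<longleftrightarrow> \<sigma> i \<omega> \<le> t" for t by (rule count_stopped_ge_iff[OF m i])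
 have "{t\<in>{0..T}. real i \<le> count_stopped \<sigma> t \<omega>} = {\<sigma> i \<omega>..T}" unfolding iff
 proof (intro equalityI subsetI)
  fix t assume "t \<in> {t\<in>{0..T}. \<sigma> i \<omega> \<le> t}"
  then show "t \<in> {\<sigma> i \<omega>..T}" by simp
 next
  fix t assume "t \<in> {\<sigma> i \<omega>..T}"
  then show "t \<in> {t\<in>{0..T}. \<sigma> i \<omega> \<le> t}" using r(1) unfolding mem_Collect_eq atLeastAtMost_iff by linarith
 qed
 moreover have "\<exists>t\<in>{0..T}. real i \<le> count_stopped \<sigma> t \<omega>"
  by (rule bexI[of _ T]) (unfold iff atLeastAtMost_iff, use r T_nonneg in simp_all)
 moreover have "Inf {\<sigma> i \<omega>..T} = \<sigma> i \<omega>" using r(2) by (rule cInf_atLeastAtMost)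
 ultimately show ?thesis unfolding hitting_time_def by (simp only: if_True simp_thms)
qed

lemma count_stopped_rate:
 assumes \<sigma>: "\<And>i. \<sigma> i \<in> ST" and m: "\<And>i j \<omega>. i \<le> j \<Longrightarrow> \<sigma> i \<omega> \<le> \<sigma> j \<omega>" and end_T: "\<And>\<omega>. \<omega> \<in> space M \<Longrightarrow> \<sigma> (Suc n) \<omega> = T"
  and i: "i \<in> {1..n}" and w: "\<omega> \<in> space M" and t: "\<sigma> i \<omega> < t" "t \<le> \<sigma> (Suc i) \<omega>"
 shows "rate (count_stopped \<sigma>) t \<omega> = f i t \<omega>"
proof -
 have L: "count_stopped \<sigma> \<in> \<L>" using count_stopped_control[of \<sigma>, OF \<sigma>] by (simp add: controls_int_def)
 have tr: "t \<in> {0..T}" using t STD_range[OF \<sigma> w, of i] STD_range[OF \<sigma> w, of "Suc i"] unfolding atLeastAtMost_iff by linarith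
 have "real i \<le> left_lim (count_stopped \<sigma>) t \<omega>"
 proof (rule left_lim_after_level[OF L w tr])
  have e: "hitting_time T (count_stopped \<sigma>) i \<omega> = \<sigma> i \<omega>" by (rule count_stopped_hitting[OF \<sigma> m i w])
  show "level_time T (count_stopped \<sigma>) (real i) \<omega> < t"
   unfolding hitting_time_eq[symmetric] e by (rule t(1))
 qed
 moreover have "left_lim (count_stopped \<sigma>) t \<omega> \<le> real i"
 proof (rule left_lim_le[OF L w tr])
  fix s assume s: "0 \<le> s" "s < t"
  show "count_stopped \<sigma> s \<omega> \<le> real i"
  proof (cases "i < n")
   case True
   then have i': "Suc i \<in> {1..n}" by simp
   have "\<not> \<sigma> (Suc i) \<omega> \<le> s" using s t(2) by linarith
   moreover have "real (Suc i) \<le> count_stopped \<sigma> s \<omega> \<longleftrightarrow> \<sigma> (Suc i) \<omega> \<le> s"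
    by (rule count_stopped_ge_iff[OF m i'])
   ultimately have "\<not> real (Suc i) \<le> count_stopped \<sigma> s \<omega>" by (simp only: simp_thms)
   then show ?thesis unfolding count_stopped_card of_nat_le_iff by linarith
  next
   case False
   then have "i = n" using i by simp
   then show ?thesis using controls_monoD(3)[OF L _ w, of s] s tr unfolding atLeastAtMost_iff by simp
  qed
 qed simp
 ultimately have "left_lim (count_stopped \<sigma>) t \<omega> = real i" by (rule antisym[rotated])
 then show ?thesis unfolding rate_def by (simp add: interp_nat[OF i])
qed

text \<open>A later agent values continuation more, so by modularity of the payoff the minimum of the two
 optimal times is already optimal for the earlier agent.\<close>

lemma optimal_times_ordered:
 assumes Y: "Y \<in> contracts M F T \<xi>" and i: "i \<in> {1..<n}"
  and \<sigma>: "smallest_optimal M F T \<mu>A (f i) Y \<sigma>" and \<tau>: "smallest_optimal M F T \<mu>A (f (Suc i)) Y \<tau>"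
 shows "AE \<omega> in M. \<sigma> \<omega> \<le> \<tau> \<omega>"
proof -
 have i': "i \<in> {1..n}" "Suc i \<in> {1..n}" using i by auto
 note f = f_jint[OF i'(1)] f_jint[OF i'(2)] and D = contractsD(1)[OF Y]
 note s = smallest_optimalD(1)[OF \<sigma>] and t = smallest_optimalD(1)[OF \<tau>]
 define m where "m \<omega> = min (\<sigma> \<omega>) (\<tau> \<omega>)" for \<omega>
 define x where "x \<omega> = max (\<sigma> \<omega>) (\<tau> \<omega>)" for \<omega>
 have m: "m \<in> ST" unfolding m_def by (rule ST_min[OF s t])
 have x: "x \<in> ST" unfolding x_def by (rule ST_max[OF s t])
 let ?H = "agent_payoff M \<mu>A (f i) Y" and ?K = "agent_payoff M \<mu>A (f (Suc i)) Y"
 have mod: "?H m + ?H x = ?H \<sigma> + ?H \<tau>"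
  unfolding m_def x_def by (rule A.agent_payoff_modular[OF f(1) D s t])
 have up: "integrable M (\<lambda>\<omega>. LINT u:{0..\<theta> \<omega>}|\<mu>A. f j u \<omega>)" if "j \<in> {1..n}" "\<theta> \<in> ST" for j \<theta>
  by (rule A.jint_upto[OF f_jint[OF that(1)] that(2)])
 have "(LINT \<omega>|M. (LINT u:{0..\<tau> \<omega>}|\<mu>A. f (Suc i) u \<omega>) + (LINT u:{0..x \<omega>}|\<mu>A. f i u \<omega>))
   \<le> (LINT \<omega>|M. (LINT u:{0..x \<omega>}|\<mu>A. f (Suc i) u \<omega>) + (LINT u:{0..\<tau> \<omega>}|\<mu>A. f i u \<omega>))"
 proof (rule integral_mono_AE)
  show "AE \<omega> in M. (LINT u:{0..\<tau> \<omega>}|\<mu>A. f (Suc i) u \<omega>) + (LINT u:{0..x \<omega>}|\<mu>A. f i u \<omega>)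
   \<le> (LINT u:{0..x \<omega>}|\<mu>A. f (Suc i) u \<omega>) + (LINT u:{0..\<tau> \<omega>}|\<mu>A. f i u \<omega>)"
   using A.jint_AE[OF f(1)] A.jint_AE[OF f(2)] AE_space
  proof eventually_elim
   case (elim \<omega>)
   have r: "0 \<le> \<tau> \<omega>" "\<tau> \<omega> \<le> x \<omega>" "x \<omega> \<le> T" using STD_range[OF t elim(3)] STD_range[OF x elim(3)] by (auto simp: x_def)
   have "(LINT u:{\<tau> \<omega><..x \<omega>}|\<mu>A. f i u \<omega>) \<le> (LINT u:{\<tau> \<omega><..x \<omega>}|\<mu>A. f (Suc i) u \<omega>)"
    unfolding A.set_LINT_\<mu>
   proof (rule integral_mono[OF A.integrable_window(1)[OF elim(1)] A.integrable_window(1)[OF elim(2)]])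
    fix u assume "u \<in> space \<mu>A"
    then show "indicator {\<tau> \<omega><..x \<omega>} u * f i u \<omega> \<le> indicator {\<tau> \<omega><..x \<omega>} u * f (Suc i) u \<omega>"
     using f_less[OF i, of u \<omega>] elim(3) by (auto simp: indicator_def A.space_\<mu>)
   qed
   then show ?case using A.LINT_split_upto[OF elim(1) r] A.LINT_split_upto[OF elim(2) r] by simp
  qed
 qed (intro LINT_integrable_add up i' x t)+
 then have "(LINT \<omega>|M. (LINT u:{0..\<tau> \<omega>}|\<mu>A. f (Suc i) u \<omega>)) + (LINT \<omega>|M. (LINT u:{0..x \<omega>}|\<mu>A. f i u \<omega>))
   \<le> (LINT \<omega>|M. (LINT u:{0..x \<omega>}|\<mu>A. f (Suc i) u \<omega>)) + (LINT \<omega>|M. (LINT u:{0..\<tau> \<omega>}|\<mu>A. f i u \<omega>))"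
  unfolding LINT_add[OF up[OF i'(2) t] up[OF i'(1) x]]
   LINT_add[OF up[OF i'(2) x] up[OF i'(1) t]] .
 then have "?H x \<le> ?H \<tau>"
  using smallest_optimalD(2)[OF \<tau> x]
  unfolding A.agent_payoff_split[OF f(1) D x] A.agent_payoff_split[OF f(1) D t] A.agent_payoff_split[OF f(2) D x] A.agent_payoff_split[OF f(2) D t]
  by linarith
 then have "?H \<sigma> \<le> ?H m" using mod by linarith
 then have "agent_optimal M F T \<mu>A (f i) Y m"
  unfolding A.agent_optimal_iff
 proof (intro conjI ballI m)
  fix \<rho> assume "\<rho> \<in> ST"
  from smallest_optimalD(2)[OF \<sigma> this] \<open>?H \<sigma> \<le> ?H m\<close> show "?H \<rho> \<le> ?H m" by (rule order_trans)
 qed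
 from smallest_optimalD(3)[OF \<sigma> this] show ?thesis by eventually_elim (simp add: m_def)
qed

lemma smallest_optimal_cong:
 assumes Y: "Y \<in> contracts M F T \<xi>" and i: "i \<in> {1..n}" and \<sigma>: "smallest_optimal M F T \<mu>A (f i) Y \<sigma>"
  and \<tau>: "\<tau> \<in> ST" and eq: "AE \<omega> in M. \<sigma> \<omega> = \<tau> \<omega>"
 shows "smallest_optimal M F T \<mu>A (f i) Y \<tau>"
 unfolding smallest_optimal_def
proof (intro conjI allI impI)
 show "agent_optimal M F T \<mu>A (f i) Y \<tau>"
  unfolding A.agent_optimal_iff A.agent_payoff_cong[OF f_jint[OF i] contractsD(1)[OF Y] smallest_optimalD(1)[OF \<sigma>] \<tau> eq, symmetric]
  using \<tau> smallest_optimalD(2)[OF \<sigma>] by (intro conjI ballI)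
 show "AE \<omega> in M. \<tau> \<omega> \<le> \<rho> \<omega>" if "agent_optimal M F T \<mu>A (f i) Y \<rho>" for \<rho>
  using smallest_optimalD(3)[OF \<sigma> that] eq by eventually_elim simp
qed

text \<open>If each agent \<open>i\<close> stops at \<open>\<sigma> i\<close>, then between \<open>\<sigma> i\<close> and \<open>\<sigma> (i + 1)\<close> the contract must decrease in
 expectation at least at the rate \<open>f i\<close>, since agent \<open>i\<close> does not wait; the contract of the
 control decreases exactly at this rate.\<close>

lemma claim_le_contract:
 assumes Y: "Y \<in> contracts M F T \<xi>"
  and \<sigma>: "\<And>i. \<sigma> i \<in> ST" and m: "\<And>i j \<omega>. i \<le> j \<Longrightarrow> \<sigma> i \<omega> \<le> \<sigma> j \<omega>" and end_T: "\<And>\<omega>. \<omega> \<in> space M \<Longrightarrow> \<sigma> (Suc n) \<omega> = T"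
  and opt: "\<And>i. i \<in> {1..n} \<Longrightarrow> smallest_optimal M F T \<mu>A (f i) Y (\<sigma> i)"
  and i: "1 \<le> i" "i \<le> Suc n"
 shows "(LINT \<omega>|M. claim (count_stopped \<sigma>) (\<sigma> i \<omega>) \<omega>) \<le> (LINT \<omega>|M. Y (\<sigma> i \<omega>) \<omega>)"
 using i(2,1)
proof (induction i rule: inc_induct)
 case base
 have L: "count_stopped \<sigma> \<in> \<L>" using count_stopped_control[of \<sigma>, OF \<sigma>] by (simp add: controls_int_def)
 have "(LINT \<omega>|M. claim (count_stopped \<sigma>) (\<sigma> (Suc n) \<omega>) \<omega>) = (LINT \<omega>|M. \<xi> \<omega>)"
  by (rule LINT_cong[OF refl]) (simp add: end_T claim_def set_lebesgue_integral_def)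
 also have "\<dots> \<le> (LINT \<omega>|M. Y (\<sigma> (Suc n) \<omega>) \<omega>)"
 proof (rule integral_mono_AE[OF \<xi>_int class_D_integrable[OF contractsD(1)[OF Y] \<sigma>]])
  show "AE \<omega> in M. \<xi> \<omega> \<le> Y (\<sigma> (Suc n) \<omega>) \<omega>" using contractsD(3)[OF Y] AE_space by eventually_elim (simp add: end_T)
 qed
 finally show ?case .
next
 case (step i)
 have L: "count_stopped \<sigma> \<in> \<L>" using count_stopped_control[of \<sigma>, OF \<sigma>] by (simp add: controls_int_def)
 have i: "i \<in> {1..n}" using step by auto
 note f = f_jint[OF i] and r = rate_jint[OF L]
 have bt: "integrable M (\<lambda>\<omega>. LINT u:{\<sigma> i \<omega><..\<sigma> (Suc i) \<omega>}|\<mu>A. f i u \<omega>)" by (rule A.jint_between[OF f \<sigma> \<sigma>])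
 have up: "integrable M (\<lambda>\<omega>. LINT u:{0..\<sigma> j \<omega>}|\<mu>A. f i u \<omega>)" for j by (rule A.jint_upto[OF f \<sigma>])
 have "(LINT \<omega>|M. claim (count_stopped \<sigma>) (\<sigma> i \<omega>) \<omega>) = (LINT \<omega>|M. (LINT u:{\<sigma> i \<omega><..\<sigma> (Suc i) \<omega>}|\<mu>A. f i u \<omega>) + claim (count_stopped \<sigma>) (\<sigma> (Suc i) \<omega>) \<omega>)"
 proof (rule integral_cong_AE)
  show "AE \<omega> in M. claim (count_stopped \<sigma>) (\<sigma> i \<omega>) \<omega> = (LINT u:{\<sigma> i \<omega><..\<sigma> (Suc i) \<omega>}|\<mu>A. f i u \<omega>) + claim (count_stopped \<sigma>) (\<sigma> (Suc i) \<omega>) \<omega>"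
   using A.jint_AE[OF r] AE_space
  proof eventually_elim
   case (elim \<omega>)
   have b: "0 \<le> \<sigma> i \<omega>" "\<sigma> i \<omega> \<le> \<sigma> (Suc i) \<omega>" "\<sigma> (Suc i) \<omega> \<le> T"
    using STD_range[OF \<sigma> elim(2)] m[of i "Suc i"] by auto
   have "(LINT u:{\<sigma> i \<omega><..\<sigma> (Suc i) \<omega>}|\<mu>A. f i u \<omega>) = (LINT u:{\<sigma> i \<omega><..\<sigma> (Suc i) \<omega>}|\<mu>A. rate (count_stopped \<sigma>) u \<omega>)"
    unfolding A.set_LINT_\<mu>
   proof (rule LINT_cong[OF refl])
    fix u
    show "indicator {\<sigma> i \<omega><..\<sigma> (Suc i) \<omega>} u * f i u \<omega> = indicator {\<sigma> i \<omega><..\<sigma> (Suc i) \<omega>} u * rate (count_stopped \<sigma>) u \<omega>"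
     using count_stopped_rate[of \<sigma> i \<omega> u, OF \<sigma> m end_T i elim(2)] by (cases "u \<in> {\<sigma> i \<omega><..\<sigma> (Suc i) \<omega>}") auto
   qed
   then show ?case unfolding claim_def using A.LINT_split_after[OF elim(1) b] by simp
  qed
 qed (intro borel_measurable_add borel_measurable_integrable[OF claim_integrable[OF L \<sigma>]] borel_measurable_integrable[OF bt])+
 also have "\<dots> = (LINT \<omega>|M. (LINT u:{\<sigma> i \<omega><..\<sigma> (Suc i) \<omega>}|\<mu>A. f i u \<omega>)) + (LINT \<omega>|M. claim (count_stopped \<sigma>) (\<sigma> (Suc i) \<omega>) \<omega>)"
  by (rule LINT_add[OF bt claim_integrable[OF L \<sigma>]])
 also have "\<dots> \<le> (LINT \<omega>|M. (LINT u:{\<sigma> i \<omega><..\<sigma> (Suc i) \<omega>}|\<mu>A. f i u \<omega>)) + (LINT \<omega>|M. Y (\<sigma> (Suc i) \<omega>) \<omega>)"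
  using step.IH by simp
 also have "\<dots> \<le> (LINT \<omega>|M. Y (\<sigma> i \<omega>) \<omega>)"
 proof -
  have "(LINT \<omega>|M. (LINT u:{0..\<sigma> (Suc i) \<omega>}|\<mu>A. f i u \<omega>)) = (LINT \<omega>|M. (LINT u:{0..\<sigma> i \<omega>}|\<mu>A. f i u \<omega>) + (LINT u:{\<sigma> i \<omega><..\<sigma> (Suc i) \<omega>}|\<mu>A. f i u \<omega>))"
  proof (rule integral_cong_AE)
   show "AE \<omega> in M. (LINT u:{0..\<sigma> (Suc i) \<omega>}|\<mu>A. f i u \<omega>) = (LINT u:{0..\<sigma> i \<omega>}|\<mu>A. f i u \<omega>) + (LINT u:{\<sigma> i \<omega><..\<sigma> (Suc i) \<omega>}|\<mu>A. f i u \<omega>)"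
    using A.jint_AE[OF f] AE_space
   proof eventually_elim
    case (elim \<omega>)
    show ?case by (rule A.LINT_split_upto[OF elim(1)]) (use STD_range[OF \<sigma> elim(2)] m[of i "Suc i"] in auto)
   qed
  qed (intro borel_measurable_add borel_measurable_integrable[OF up] borel_measurable_integrable[OF bt])+
  also have "\<dots> = (LINT \<omega>|M. (LINT u:{0..\<sigma> i \<omega>}|\<mu>A. f i u \<omega>)) + (LINT \<omega>|M. (LINT u:{\<sigma> i \<omega><..\<sigma> (Suc i) \<omega>}|\<mu>A. f i u \<omega>))"
   by (rule LINT_add[OF up bt])
  finally show ?thesis
   using smallest_optimalD(2)[OF opt[OF i] \<sigma>[of "Suc i"]]
   unfolding A.agent_payoff_split[OF f contractsD(1)[OF Y] \<sigma>] by linarith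
 qed
 finally show ?case .
qed

text \<open>The time \<open>T\<close> is appended as the stopping time of an additional agent \<open>n + 1\<close>.\<close>

lemma payoff_le_control:
 assumes Y: "Y \<in> contracts M F T \<xi>"
 shows "\<exists>L\<in>controls_int M F T n. principal_payoff M F T n \<mu>A \<mu>P f g Y \<le> J M T n \<mu>A \<mu>P f g \<xi> L"
proof -
 define \<tau> where "\<tau> i = (if i \<in> {1..n} then tau_hat M F T \<mu>A (f i) Y else (\<lambda>_. T))" for i
 have \<tau>opt: "smallest_optimal M F T \<mu>A (f i) Y (\<tau> i)" if "i \<in> {1..n}" for i
  using tau_hat_smallest[OF Y that] that by (simp add: \<tau>_def)
 have \<tau>: "\<tau> i \<in> ST" for i
  using smallest_optimalD(1)[OF \<tau>opt, of i] ST_const[of T] T_nonneg by (cases "i \<in> {1..n}") (auto simp: \<tau>_def)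
 define \<sigma> where "\<sigma> i \<omega> = run_max \<tau> i \<omega>" for i \<omega>
 have \<sigma>: "\<sigma> i \<in> ST" for i
 proof (induction i)
  case 0
  show ?case using ST_const[of 0] T_nonneg by (simp add: \<sigma>_def[abs_def])
 next
  case (Suc i)
  from ST_max[OF Suc \<tau>[of "Suc i"]] show ?case by (simp add: \<sigma>_def[abs_def])
 qed
 have m: "\<sigma> i \<omega> \<le> \<sigma> j \<omega>" if "i \<le> j" for i j \<omega> unfolding \<sigma>_def by (rule run_max_mono[OF that])
 have end_T: "\<sigma> (Suc n) \<omega> = T" if w: "\<omega> \<in> space M" for \<omega>
 proof -
  have "T \<le> \<sigma> (Suc n) \<omega>" by (simp add: \<sigma>_def \<tau>_def)
  then show ?thesis using STD_range[OF \<sigma> w, of "Suc n"] by simp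
 qed
 have eq: "AE \<omega> in M. \<tau> i \<omega> = \<sigma> i \<omega>" if "1 \<le> i" "i \<le> n" for i
  using that
 proof (induction i rule: dec_induct)
  case base
  show ?case using AE_space
  proof eventually_elim
   case (elim \<omega>)
   then show ?case using STD_range[OF \<tau>, of \<omega> 1] by (simp add: \<sigma>_def)
  qed
 next
  case (step i)
  have i: "i \<in> {1..<n}" "i \<in> {1..n}" "Suc i \<in> {1..n}" using step by auto
  have ih: "AE \<omega> in M. \<tau> i \<omega> = \<sigma> i \<omega>" using step by simp
  have "AE \<omega> in M. \<tau> i \<omega> \<le> \<tau> (Suc i) \<omega>" by (rule optimal_times_ordered[OF Y i(1) \<tau>opt[OF i(2)] \<tau>opt[OF i(3)]])
  then show ?case using ih by eventually_elim (simp add: \<sigma>_def)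
 qed
 have opt: "smallest_optimal M F T \<mu>A (f i) Y (\<sigma> i)" if "i \<in> {1..n}" for i
 proof (rule smallest_optimal_cong[OF Y that \<tau>opt[OF that] \<sigma>])
  show "AE \<omega> in M. \<tau> i \<omega> = \<sigma> i \<omega>" by (rule eq) (use that in simp_all)
 qed
 have Li: "count_stopped \<sigma> \<in> controls_int M F T n" by (rule count_stopped_control) (rule \<sigma>)
 then have L: "count_stopped \<sigma> \<in> \<L>" by (simp add: controls_int_def)
 have h: "(LINT \<omega>|M. X (hitting_time T (count_stopped \<sigma>) i \<omega>) \<omega>) = (LINT \<omega>|M. X (\<sigma> i \<omega>) \<omega>)" if "i \<in> {1..n}" for X :: "real \<Rightarrow> 'a \<Rightarrow> real" and i
  by (rule LINT_cong[OF refl]) (simp add: count_stopped_hitting[OF \<sigma> m that])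
 have "principal_payoff M F T n \<mu>A \<mu>P f g Y = (\<Sum>i=1..n. (LINT \<omega>|M. (LINT t:{0..\<sigma> i \<omega>}|\<mu>P. g i t \<omega>)) - (LINT \<omega>|M. Y (\<sigma> i \<omega>) \<omega>))"
  by (rule principal_payoff_eq[OF Y opt])
 also have "\<dots> \<le> (\<Sum>i=1..n. (LINT \<omega>|M. (LINT t:{0..\<sigma> i \<omega>}|\<mu>P. g i t \<omega>)) - (LINT \<omega>|M. claim (count_stopped \<sigma>) (\<sigma> i \<omega>) \<omega>))"
 proof (rule sum_mono, rule diff_left_mono)
  fix i assume "i \<in> {1..n}"
  then show "(LINT \<omega>|M. claim (count_stopped \<sigma>) (\<sigma> i \<omega>) \<omega>) \<le> (LINT \<omega>|M. Y (\<sigma> i \<omega>) \<omega>)"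
   by (intro claim_le_contract[OF Y \<sigma> m end_T opt]) auto
 qed
 also have "\<dots> = J M T n \<mu>A \<mu>P f g \<xi> (count_stopped \<sigma>)"
  unfolding J_eq[OF L]
 proof (rule sum.cong[OF refl])
  fix i assume i: "i \<in> {1..n}"
  show "(LINT \<omega>|M. (LINT t:{0..\<sigma> i \<omega>}|\<mu>P. g i t \<omega>)) - (LINT \<omega>|M. claim (count_stopped \<sigma>) (\<sigma> i \<omega>) \<omega>)
   = (LINT \<omega>|M. (LINT t:{0..hitting_time T (count_stopped \<sigma>) i \<omega>}|\<mu>P. g i t \<omega>)) - (LINT \<omega>|M. claim (count_stopped \<sigma>) (hitting_time T (count_stopped \<sigma>) i \<omega>) \<omega>)"
   using h[OF i, of "\<lambda>r \<omega>. LINT t:{0..r}|\<mu>P. g i t \<omega>"] h[OF i, of "claim (count_stopped \<sigma>)"] by simp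
 qed
 finally show ?thesis using Li by (rule bexI)
qed

lemma values_equal:
 shows V_eq_sup_mono: "V_P M F T n \<mu>A \<mu>P f g \<xi> = (SUP L\<in>\<L>. ereal (J M T n \<mu>A \<mu>P f g \<xi> L))"
  and sup_mono_eq_sup_int: "(SUP L\<in>\<L>. ereal (J M T n \<mu>A \<mu>P f g \<xi> L)) = (SUP L\<in>controls_int M F T n. ereal (J M T n \<mu>A \<mu>P f g \<xi> L))"
proof -
 let ?V = "V_P M F T n \<mu>A \<mu>P f g \<xi>" and ?m = "SUP L\<in>\<L>. ereal (J M T n \<mu>A \<mu>P f g \<xi> L)"
  and ?i = "SUP L\<in>controls_int M F T n. ereal (J M T n \<mu>A \<mu>P f g \<xi> L)"
 have 1: "?V \<le> ?i" unfolding V_P_def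
 proof (rule SUP_least)
  fix Y assume "Y \<in> contracts M F T \<xi>"
  from payoff_le_control[OF this] obtain L where L: "L \<in> controls_int M F T n" "principal_payoff M F T n \<mu>A \<mu>P f g Y \<le> J M T n \<mu>A \<mu>P f g \<xi> L"
   by (rule bexE)
  then have "ereal (principal_payoff M F T n \<mu>A \<mu>P f g Y) \<le> ereal (J M T n \<mu>A \<mu>P f g \<xi> L)" by simp
  also have "\<dots> \<le> ?i" by (rule SUP_upper[OF L(1)])
  finally show "ereal (principal_payoff M F T n \<mu>A \<mu>P f g Y) \<le> ?i" .
 qed
 have 2: "?i \<le> ?m" by (rule SUP_subset_mono) (auto simp: controls_int_def)
 have 3: "?m \<le> ?V"
 proof (rule SUP_least)
  fix L assume L: "L \<in> \<L>"
  obtain Y where Y: "contract_of M F T n \<mu>A f \<xi> L Y" using contract_exists[OF L] by (rule exE)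
  show "ereal (J M T n \<mu>A \<mu>P f g \<xi> L) \<le> ?V"
   unfolding V_P_def contract_principal_payoff[OF L Y, symmetric] by (rule SUP_upper[OF contract_admissible[OF L Y]])
 qed
 show "?V = ?m" by (rule antisym[OF order_trans[OF 1 2] 3])
 show "?m = ?i" by (rule antisym[OF order_trans[OF 3 1] 2])
qed

lemma optimal_control_contract:
 assumes L: "optimal_control M F T n \<mu>A \<mu>P f g \<xi> L" and Y: "contract_of M F T n \<mu>A f \<xi> L Y"
 shows "optimal_contract M F T n \<mu>A \<mu>P f g \<xi> Y"
proof -
 have L': "L \<in> \<L>" "ereal (J M T n \<mu>A \<mu>P f g \<xi> L) = V_P M F T n \<mu>A \<mu>P f g \<xi>"
  using L unfolding optimal_control_def V_eq_sup_mono by (rule conjunct1, rule conjunct2)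
 show ?thesis unfolding optimal_contract_def contract_principal_payoff[OF L'(1) Y]
  using contract_admissible[OF L'(1) Y] L'(2) by (rule conjI)
qed

end

section \<open>The truncated running supremum\<close>

context usual_filtered_prob_space
begin

lemma truncated_sup_ereal:
 "ereal (truncated_sup n L t \<omega>) = min (max 0 (SUP s\<in>{0..<t}. ereal (L s \<omega>))) (ereal (real n))"
proof -
 define e where "e = min (max 0 (SUP s\<in>{0..<t}. ereal (L s \<omega>))) (ereal (real n))"
 have "0 \<le> e" "e \<le> ereal (real n)" by (simp_all add: e_def)
 then have "\<bar>e\<bar> \<noteq> \<infinity>" by (cases e) auto
 then show ?thesis unfolding truncated_sup_def e_def[symmetric] by (rule ereal_real')
qed

lemma truncated_sup_range: "0 \<le> truncated_sup n L t \<omega>" "truncated_sup n L t \<omega> \<le> real n"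
proof -
 have "ereal 0 \<le> ereal (truncated_sup n L t \<omega>)" "ereal (truncated_sup n L t \<omega>) \<le> ereal (real n)"
  unfolding truncated_sup_ereal by (simp_all add: zero_ereal_def[symmetric])
 then show "0 \<le> truncated_sup n L t \<omega>" "truncated_sup n L t \<omega> \<le> real n" by simp_all
qed

text \<open>For the levels that truncation does not affect, strict inequality is attained by a value of \<open>L\<close>.\<close>

lemma truncated_sup_greater:
 assumes "0 \<le> a" "a < real n"
 shows "a < truncated_sup n L t \<omega> \<longleftrightarrow> (\<exists>s\<in>{0..<t}. a < L s \<omega>)"
proof -
 have "a < truncated_sup n L t \<omega> \<longleftrightarrow> ereal a < ereal (truncated_sup n L t \<omega>)" by simp
 also have "\<dots> \<longleftrightarrow> ereal a < (SUP s\<in>{0..<t}. ereal (L s \<omega>))"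
  unfolding truncated_sup_ereal using assms by (simp add: less_max_iff_disj)
 also have "\<dots> \<longleftrightarrow> (\<exists>s\<in>{0..<t}. a < L s \<omega>)" unfolding less_SUP_iff by simp
 finally show ?thesis .
qed

lemma truncated_sup_mono:
 assumes "s \<le> t" shows "truncated_sup n L s \<omega> \<le> truncated_sup n L t \<omega>"
proof (rule ccontr)
 define a where "a = truncated_sup n L t \<omega>"
 assume "\<not> truncated_sup n L s \<omega> \<le> truncated_sup n L t \<omega>"
 then have a: "a < truncated_sup n L s \<omega>" by (simp add: a_def)
 have r: "0 \<le> a" "a < real n" using a truncated_sup_range[of n L] by (auto simp: a_def intro: less_le_trans)
 obtain u where "u \<in> {0..<s}" "a < L u \<omega>" using a unfolding truncated_sup_greater[OF r] by (rule bexE)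
 then have "\<exists>u\<in>{0..<t}. a < L u \<omega>" using assms by (intro bexI[of _ u]) auto
 then have "a < truncated_sup n L t \<omega>" unfolding truncated_sup_greater[OF r] .
 then show False by (simp add: a_def)
qed

text \<open>The event that \<open>L\<close> exceeds \<open>a\<close> before \<open>t\<close> is the projection of a progressively measurable set.\<close>

lemma truncated_sup_adapted:
 assumes L: "optional_process M F T L" and t: "t \<in> {0..T}"
 shows "truncated_sup n L t \<in> borel_measurable (F t)"
proof (rule borel_measurableI_greater)
 fix a :: real
 consider "a < 0" | "real n \<le> a" | "0 \<le> a" "a < real n" by linarith
 then show "{\<omega>\<in>space (F t). a < truncated_sup n L t \<omega>} \<in> sets (F t)"
 proof cases
  case 1
  then have "{\<omega>\<in>space (F t). a < truncated_sup n L t \<omega>} = space (F t)"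
   using truncated_sup_range(1)[of n L t] by (auto intro: less_le_trans)
  then show ?thesis by simp
 next
  case 2
  have "\<not> a < truncated_sup n L t \<omega>" for \<omega> using 2 truncated_sup_range(2)[of n L t \<omega>] by linarith
  then show ?thesis by simp
 next
  case 3
  let ?N = "restrict_space borel {0..t} \<Otimes>\<^sub>M F t"
  define D where "D = {x\<in>space ?N. fst x < t \<and> a < L (fst x) (snd x)}"
  have m: "(\<lambda>x. L (fst x) (snd x)) \<in> borel_measurable ?N"
   using progressiveD[OF optional_progressive[OF L] t] by (simp only: case_prod_beta')
  have f: "fst \<in> borel_measurable ?N" by (rule fst_restrict_borel)
  have D: "D \<in> sets ?N" unfolding D_def using m f by measurable
  have "{\<omega>\<in>space (F t). a < truncated_sup n L t \<omega>} = snd ` D"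
  proof (intro equalityI subsetI)
   fix \<omega> assume w: "\<omega> \<in> {\<omega>\<in>space (F t). a < truncated_sup n L t \<omega>}"
   then have "\<exists>s\<in>{0..<t}. a < L s \<omega>" unfolding truncated_sup_greater[OF 3, symmetric] by simp
   then obtain s where s: "s \<in> {0..<t}" "a < L s \<omega>" by (rule bexE)
   then have "(s, \<omega>) \<in> D" using w by (simp add: D_def space_pair_measure space_restrict_space)
   from imageI[OF this, of snd] show "\<omega> \<in> snd ` D" by simp
  next
   fix \<omega> assume "\<omega> \<in> snd ` D"
   then obtain x where x: "x \<in> D" "\<omega> = snd x" by (rule imageE)
   then have "fst x \<in> {0..<t}" "a < L (fst x) \<omega>" "\<omega> \<in> space (F t)" by (auto simp: D_def space_pair_measure space_restrict_space)
   then have "\<exists>s\<in>{0..<t}. a < L s \<omega>" by (intro bexI[of _ "fst x"])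
   then show "\<omega> \<in> {\<omega>\<in>space (F t). a < truncated_sup n L t \<omega>}" unfolding truncated_sup_greater[OF 3, symmetric] using \<open>\<omega> \<in> space (F t)\<close> by simp
  qed
  also have "\<dots> \<in> sets (F t)" by (rule measurable_projection_F[OF t D])
  finally show ?thesis .
 qed
qed

text \<open>The supremum runs over the times strictly before \<open>t\<close>; left-continuity makes the process optional.\<close>

lemma truncated_sup_left_continuous:
 assumes t: "t \<in> {0..T}"
 shows "sup_before (truncated_sup n L) t \<omega> = truncated_sup n L t \<omega>"
proof -
 let ?S = "truncated_sup n L"
 have m: "mono_on {0..T} (\<lambda>t. ?S t \<omega>)" by (rule mono_onI) (rule truncated_sup_mono)
 have b: "0 \<le> ?S t \<omega> \<and> ?S t \<omega> \<le> real n" for t using truncated_sup_range[of n L t \<omega>] by simp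
 note props = sup_before_props[where L="?S" and \<omega>=\<omega> and c="real n", OF m b]
 show ?thesis
 proof (rule antisym)
  show "sup_before ?S t \<omega> \<le> ?S t \<omega>"
   by (rule sup_before_le[where L="?S" and \<omega>=\<omega> and c="real n", OF m b t]) (use b in \<open>auto intro: truncated_sup_mono\<close>)
  show "?S t \<omega> \<le> sup_before ?S t \<omega>"
  proof (rule ccontr)
   define a where "a = sup_before ?S t \<omega>"
   assume "\<not> ?S t \<omega> \<le> sup_before ?S t \<omega>"
   then have a: "a < ?S t \<omega>" by (simp add: a_def)
   have r: "0 \<le> a" "a < real n"
    using sup_before_nonneg[where L="?S" and \<omega>=\<omega> and c="real n", OF m b t] a b[of t] by (auto simp: a_def)
   obtain s where s: "s \<in> {0..<t}" "a < L s \<omega>" using a unfolding truncated_sup_greater[OF r] by (rule bexE)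
   obtain u where u: "s < u" "u < t" using s dense[of s t] by auto
   have "\<exists>s\<in>{0..<u}. a < L s \<omega>" using s u by (intro bexI[of _ s]) auto
   then have "a < ?S u \<omega>" unfolding truncated_sup_greater[OF r] .
   also have "?S u \<omega> \<le> a" unfolding a_def
    by (rule sup_before_ge[where L="?S" and \<omega>=\<omega> and c="real n", OF m b]) (use s u t in auto)
   finally show False by simp
  qed
 qed
qed

lemma truncated_sup_control:
 assumes L: "optional_process M F T L"
 shows "truncated_sup n L \<in> controls_mono M F T n"
proof -
 have "optional_process M F T (sup_before (truncated_sup n L))"
  by (rule sup_before_optional[where c="real n"]) (auto intro!: truncated_sup_adapted[OF L] simp: truncated_sup_range)
 moreover have "optional_process M F T (sup_before (truncated_sup n L)) \<longleftrightarrow> optional_process M F T (truncated_sup n L)"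
  by (rule optional_cong) (rule truncated_sup_left_continuous)
 ultimately have "optional_process M F T (truncated_sup n L)" by (rule iffD1[rotated])
 moreover have "mono_on {0..T} (\<lambda>t. truncated_sup n L t \<omega>)" for \<omega> by (rule mono_onI) (rule truncated_sup_mono)
 ultimately show ?thesis
  unfolding controls_mono_def controls_def by (simp add: truncated_sup_range)
qed

lemma truncated_sup_left_lim:
 "optional_process M F T L \<Longrightarrow> t \<in> {0..T} \<Longrightarrow> \<omega> \<in> space M \<Longrightarrow> left_lim (truncated_sup n L) t \<omega> = truncated_sup n L t \<omega>"
 using left_lim_eq[OF truncated_sup_control] truncated_sup_left_continuous by simp

lemma pre_sigma_subalgebra:
 assumes \<tau>: "\<tau> \<in> ST"
 shows "finite_measure_subalgebra M (pre_sigma \<tau>)"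
proof -
 have "A \<in> sets M" if A: "A \<in> sets (pre_sigma \<tau>)" for A
 proof -
  have "A \<subseteq> space M" using sets.sets_into_space[OF A] by (simp add: space_pre_sigma)
  then have "{\<omega>\<in>A. \<tau> \<omega> \<le> T} = A" using STD_range[OF \<tau>] by auto
  then have "A \<in> sets (F T)" using sets_pre_sigmaD[OF STD_stop[OF \<tau>] A, of T] by simp
  then show ?thesis using sets_F_subset[of T] T_nonneg by auto
 qed
 then have "subalgebra M (pre_sigma \<tau>)" by (auto simp: subalgebra_def space_pre_sigma)
 then show ?thesis by (simp add: finite_measure_subalgebra_def finite_measure_subalgebra_axioms_def finite_measure_axioms)
qed

end

section \<open>Crossing times of a control\<close>

context contract_design
begin

text \<open>The first time at which \<open>L\<close> strictly exceeds \<open>c\<close>. Unlike at the level time of \<open>c\<close>, after this time the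
 level has been exceeded strictly, even if \<open>L\<close> rests at \<open>c\<close> for a while.\<close>

definition crossing :: "(real \<Rightarrow> 'a \<Rightarrow> real) \<Rightarrow> real \<Rightarrow> 'a \<Rightarrow> real" where
 "crossing L c \<omega> = (INF m. level_time T L (c + 1 / real (Suc m)) \<omega>)"

lemma crossing_ST: "L \<in> \<L> \<Longrightarrow> crossing L c \<in> ST"
 using ST_INF[of "\<lambda>m. level_time T L (c + 1 / real (Suc m))"] level_time_ST by (simp add: crossing_def[abs_def])

lemma crossing_bdd: "bdd_below (range (\<lambda>m. level_time T L (c + 1 / real (Suc m)) \<omega>))"
 by (rule bdd_belowI2[of _ 0]) (simp add: level_time_range[OF T_nonneg])

lemma crossing_le: "crossing L c \<omega> \<le> level_time T L (c + 1 / real (Suc m)) \<omega>"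
 unfolding crossing_def by (rule cINF_lower[OF crossing_bdd UNIV_I])

lemma crossing_before:
 assumes "0 \<le> s" "s \<le> T" "s < crossing L c \<omega>"
 shows "L s \<omega> \<le> c"
proof (rule field_le_epsilon)
 fix e :: real assume "0 < e"
 then obtain m where m: "1 / real (Suc m) < e" using nat_approx_posE by blast
 have "L s \<omega> < c + 1 / real (Suc m)"
  by (rule level_time_before[OF assms(1,2)]) (use assms(3) crossing_le[of L c \<omega> m] in linarith)
 then show "L s \<omega> \<le> c + e" using m by linarith
qed

lemma crossing_after:
 assumes m: "mono_on {0..T} (\<lambda>t. L t \<omega>)" and t: "crossing L c \<omega> < t" "t \<le> T"
 shows "c < L t \<omega>"
proof -
 obtain k where k: "level_time T L (c + 1 / real (Suc k)) \<omega> < t"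
  using t(1) unfolding crossing_def cINF_less_iff[OF UNIV_not_empty crossing_bdd] by (rule bexE)
 have "c + 1 / real (Suc k) \<le> L t \<omega>" by (rule level_time_after[OF m k t(2) T_nonneg])
 moreover have "0 < 1 / real (Suc k)" by simp
 ultimately show ?thesis by linarith
qed

lemma crossing_le_level: "c < d \<Longrightarrow> crossing L c \<omega> \<le> level_time T L d \<omega>"
proof -
 assume "c < d"
 then obtain m where m: "1 / real (Suc m) < d - c" using nat_approx_posE[of "d - c"] by auto
 have "crossing L c \<omega> \<le> level_time T L (c + 1 / real (Suc m)) \<omega>" by (rule crossing_le)
 also have "\<dots> \<le> level_time T L d \<omega>" using m by (intro level_time_mono T_nonneg) linarith
 finally show ?thesis .
qed

lemma level_le_crossing: "level_time T L c \<omega> \<le> crossing L c \<omega>"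
 unfolding crossing_def by (rule cINF_greatest) (simp, rule level_time_mono[OF _ T_nonneg], simp)

lemma crossing_mono: "c \<le> d \<Longrightarrow> crossing L c \<omega> \<le> crossing L d \<omega>"
 using crossing_le_level[of c d L \<omega>] level_le_crossing[of L d \<omega>] by (cases "c = d") auto

definition level_below :: "nat \<Rightarrow> nat \<Rightarrow> real" where
 "level_below i k = real i - 1 / real (k + 2)"

lemma level_below_props:
 "real i - 1 < level_below i k" "level_below i k < real i" "j \<le> k \<Longrightarrow> level_below i j \<le> level_below i k"
 by (auto simp: level_below_def frac_le)

lemma level_below_tendsto: "(\<lambda>k. level_below i k) \<longlonglongrightarrow> real i"
proof -
 have "(\<lambda>k. 1 / real (k + 2)) \<longlonglongrightarrow> 0" using LIMSEQ_ignore_initial_segment[OF lim_1_over_n, of 2] by simp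
 from tendsto_diff[OF tendsto_const this, of "real i"] show ?thesis unfolding level_below_def by simp
qed

lemma crossing_incseq: "incseq (\<lambda>k. crossing L (level_below i k) \<omega>)"
 by (rule monoI) (rule crossing_mono[OF level_below_props(3)])

lemma crossing_SUP:
 assumes L: "L \<in> \<L>" and left: "\<And>t. t \<in> {0..T} \<Longrightarrow> left_lim L t \<omega> = L t \<omega>" and w: "\<omega> \<in> space M"
 shows "(SUP k. crossing L (level_below i k) \<omega>) = hitting_time T L i \<omega>"
proof (rule antisym)
 have le: "crossing L (level_below i k) \<omega> \<le> hitting_time T L i \<omega>" for k
  unfolding hitting_time_eq by (rule crossing_le_level[OF level_below_props(2)])
 then show "(SUP k. crossing L (level_below i k) \<omega>) \<le> hitting_time T L i \<omega>" by (intro cSUP_least) simp_all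
 have bdd: "bdd_above (range (\<lambda>k. crossing L (level_below i k) \<omega>))" using le by (intro bdd_aboveI2)
 show "hitting_time T L i \<omega> \<le> (SUP k. crossing L (level_below i k) \<omega>)"
 proof (rule ccontr)
  assume "\<not> hitting_time T L i \<omega> \<le> (SUP k. crossing L (level_below i k) \<omega>)"
  then obtain t where t: "(SUP k. crossing L (level_below i k) \<omega>) < t" "t < hitting_time T L i \<omega>"
   using dense by (metis not_le_imp_less)
  have c: "crossing L (level_below i k) \<omega> < t" for k using cSUP_upper[OF UNIV_I bdd, of k] t(1) by linarith
  have "0 \<le> crossing L (level_below i 0) \<omega>" using STD_range[OF crossing_ST[OF L] w] by simp
  then have t0: "0 \<le> t" using c[of 0] by linarith
  have tT: "t \<le> T" using t(2) level_time_range[OF T_nonneg, of L "real i" \<omega>] by (simp add: hitting_time_eq)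
  have "level_below i k \<le> L t \<omega>" for k using crossing_after[OF controls_monoD(2)[OF L w] c tT] by (rule less_imp_le)
  then have "real i \<le> L t \<omega>" by (intro LIMSEQ_le_const2[OF level_below_tendsto]) simp
  then have "hitting_time T L i \<omega> \<le> t" unfolding hitting_time_eq using t0 tT by (intro level_time_le) simp_all
  then show False using t(2) by simp
 qed
qed

text \<open>On \<open>[i - 1, i]\<close> the interpolation is affine, which makes the error of replacing \<open>i\<close> by a smaller level
 proportional to the distance.\<close>

lemma interp_affine:
 assumes i: "i \<in> {1..n}" and c: "real i - 1 < c" "c < real i"
 shows "f i t \<omega> - interp n f t \<omega> c = (real i - c) * (f i t \<omega> - interp n f t \<omega> (real i - 1))"
proof (cases "i = 1")
 case True
 then show ?thesis using c by (simp add: interp_def)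
next
 case False
 then have i2: "2 \<le> i" using i by auto
 have e: "real i - 1 = real (i - 1)" using i2 by simp
 have fl: "\<lfloor>c\<rfloor> = int (i - 1)" using c i2 by (intro floor_unique) auto
 have "\<not> c \<le> 1" using c i2 by linarith
 moreover have "\<not> real n \<le> c" using c i by auto
 ultimately have "interp n f t \<omega> c = (real (i - 1) + 1 - c) * f (i - 1) t \<omega> + (c - real (i - 1)) * f (i - 1 + 1) t \<omega>"
  unfolding interp_def Let_def fl nat_int by (simp only: if_False)
 moreover have "i - 1 + 1 = i" using i2 by simp
 moreover have "interp n f t \<omega> (real i - 1) = f (i - 1) t \<omega>" unfolding e using i i2 by (intro interp_nat) auto
 ultimately show ?thesis by (simp add: e[symmetric] algebra_simps)
qed

end

section \<open>From an optimal contract to an optimal control\<close>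

context contract_design
begin

text \<open>The payment rate in the representation of a contract, started at time \<open>r\<close>.\<close>

definition tail_rate :: "(real \<Rightarrow> 'a \<Rightarrow> real) \<Rightarrow> real \<Rightarrow> real \<Rightarrow> 'a \<Rightarrow> real" where
 "tail_rate L r t \<omega> = interp n f t \<omega> (SUP s\<in>{r..<t}. L s \<omega>)"

lemma representsD:
 assumes R: "represents M F T n \<mu>A f \<xi> L Y" and \<tau>: "\<tau> \<in> ST"
 shows "AE \<omega> in M. AE t in \<mu>A. t \<in> {\<tau> \<omega><..T} \<longrightarrow> bdd_above ((\<lambda>s. L s \<omega>) ` {\<tau> \<omega>..<t})"
  and "AE \<omega> in M. set_integrable \<mu>A {\<tau> \<omega><..T} (\<lambda>t. tail_rate L (\<tau> \<omega>) t \<omega>)"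
  and "integrable M (\<lambda>\<omega>. LINT t:{\<tau> \<omega><..T}|\<mu>A. tail_rate L (\<tau> \<omega>) t \<omega>)"
  and "AE \<omega> in M. Y (\<tau> \<omega>) \<omega> = real_cond_exp M (pre_sigma \<tau>) (\<lambda>\<omega>. \<xi> \<omega> + (LINT t:{\<tau> \<omega><..T}|\<mu>A. tail_rate L (\<tau> \<omega>) t \<omega>)) \<omega>"
proof -
 note a = bspec[OF R[unfolded represents_def] \<tau>]
 show "AE \<omega> in M. AE t in \<mu>A. t \<in> {\<tau> \<omega><..T} \<longrightarrow> bdd_above ((\<lambda>s. L s \<omega>) ` {\<tau> \<omega>..<t})"
  by (rule conjunct1[OF a])
 show "AE \<omega> in M. set_integrable \<mu>A {\<tau> \<omega><..T} (\<lambda>t. tail_rate L (\<tau> \<omega>) t \<omega>)"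
  unfolding tail_rate_def by (rule conjunct1[OF conjunct2[OF a]])
 show "integrable M (\<lambda>\<omega>. LINT t:{\<tau> \<omega><..T}|\<mu>A. tail_rate L (\<tau> \<omega>) t \<omega>)"
  unfolding tail_rate_def by (rule conjunct1[OF conjunct2[OF conjunct2[OF a]]])
 show "AE \<omega> in M. Y (\<tau> \<omega>) \<omega> = real_cond_exp M (pre_sigma \<tau>) (\<lambda>\<omega>. \<xi> \<omega> + (LINT t:{\<tau> \<omega><..T}|\<mu>A. tail_rate L (\<tau> \<omega>) t \<omega>)) \<omega>"
  unfolding tail_rate_def by (rule conjunct2[OF conjunct2[OF conjunct2[OF a]]])
qed

lemma represented_expectation:
 assumes D: "class_D M F T Y" and R: "represents M F T n \<mu>A f \<xi> L Y" and \<tau>: "\<tau> \<in> ST"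
 shows "(LINT \<omega>|M. Y (\<tau> \<omega>) \<omega>) = (LINT \<omega>|M. \<xi> \<omega>) + (LINT \<omega>|M. (LINT t:{\<tau> \<omega><..T}|\<mu>A. tail_rate L (\<tau> \<omega>) t \<omega>))"
proof -
 interpret S: finite_measure_subalgebra M "pre_sigma \<tau>" by (rule pre_sigma_subalgebra[OF \<tau>])
 let ?X = "\<lambda>\<omega>. \<xi> \<omega> + (LINT t:{\<tau> \<omega><..T}|\<mu>A. tail_rate L (\<tau> \<omega>) t \<omega>)"
 have X: "integrable M ?X" by (rule LINT_integrable_add[OF \<xi>_int representsD(3)[OF R \<tau>]])
 have "(LINT \<omega>|M. Y (\<tau> \<omega>) \<omega>) = (LINT \<omega>|M. real_cond_exp M (pre_sigma \<tau>) ?X \<omega>)"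
  by (rule integral_cong_AE[OF borel_measurable_integrable[OF class_D_integrable[OF D \<tau>]]
   borel_measurable_integrable[OF S.real_cond_exp_int(1)[OF X]] representsD(4)[OF R \<tau>]])
 also have "\<dots> = (LINT \<omega>|M. ?X \<omega>)" by (rule S.real_cond_exp_int(2)[OF X])
 also have "\<dots> = (LINT \<omega>|M. \<xi> \<omega>) + (LINT \<omega>|M. (LINT t:{\<tau> \<omega><..T}|\<mu>A. tail_rate L (\<tau> \<omega>) t \<omega>))"
  by (rule LINT_add[OF \<xi>_int representsD(3)[OF R \<tau>]])
 finally show ?thesis .
qed

context
 fixes L :: "real \<Rightarrow> 'a \<Rightarrow> real" and S :: "real \<Rightarrow> 'a \<Rightarrow> real"
 assumes L: "optional_process M F T L"
 defines "S \<equiv> truncated_sup n L"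
begin

lemma S_control: "S \<in> \<L>"
 unfolding S_def by (rule truncated_sup_control[OF L])

lemma S_left: "t \<in> {0..T} \<Longrightarrow> \<omega> \<in> space M \<Longrightarrow> left_lim S t \<omega> = S t \<omega>"
 unfolding S_def by (rule truncated_sup_left_lim[OF L])

text \<open>If \<open>L\<close> exceeded \<open>c\<close> at \<open>u\<close>, then \<open>S\<close> would exceed \<open>c\<close> immediately afterwards.\<close>

lemma before_crossing:
 assumes w: "\<omega> \<in> space M" and c: "0 \<le> c" "c < real n" and u: "0 \<le> u" "u < crossing S c \<omega>"
 shows "L u \<omega> \<le> c"
proof (rule ccontr)
 assume neg: "\<not> L u \<omega> \<le> c"
 obtain v where v: "u < v" "v < crossing S c \<omega>" using dense[OF u(2)] by (elim exE conjE)
 have vT: "v \<le> T" using v(2) STD_range[OF crossing_ST[OF S_control] w, of c] by linarith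
 have "\<exists>s\<in>{0..<v}. c < L s \<omega>" using u v neg by (intro bexI[of _ u]) auto
 then have "c < S v \<omega>" unfolding S_def truncated_sup_greater[OF c] .
 moreover have "S v \<omega> \<le> c" by (rule crossing_before[OF _ vT v(2)]) (use u v in simp)
 ultimately show False by simp
qed

lemma after_crossing:
 assumes w: "\<omega> \<in> space M" and c: "0 \<le> c" "c < real n" and t: "crossing S c \<omega> < t" "t \<le> T"
 shows "\<exists>u\<in>{crossing S c \<omega>..<t}. c < L u \<omega>"
proof -
 have "c < S t \<omega>" by (rule crossing_after[OF controls_monoD(2)[OF S_control w] t])
 then have "\<exists>u\<in>{0..<t}. c < L u \<omega>" unfolding S_def truncated_sup_greater[OF c] .
 then obtain u where u: "u \<in> {0..<t}" "c < L u \<omega>" by (rule bexE)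
 have "\<not> u < crossing S c \<omega>" using before_crossing[OF w c, of u] u by auto
 then show ?thesis using u by (intro bexI[of _ u]) auto
qed

text \<open>After the crossing time of \<open>c\<close> the values of \<open>L\<close> before it no longer influence the running supremum.\<close>

lemma sup_after_crossing:
 assumes w: "\<omega> \<in> space M" and c: "0 \<le> c" "c < real n" and t: "crossing S c \<omega> < t" "t \<le> T"
  and b: "bdd_above ((\<lambda>s. L s \<omega>) ` {crossing S c \<omega>..<t})"
 shows "c < (SUP s\<in>{crossing S c \<omega>..<t}. L s \<omega>)" (is ?a)
  and "0 \<le> u \<Longrightarrow> u < t \<Longrightarrow> L u \<omega> \<le> (SUP s\<in>{crossing S c \<omega>..<t}. L s \<omega>)"
  and "S t \<omega> \<le> (SUP s\<in>{crossing S c \<omega>..<t}. L s \<omega>)"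
proof -
 let ?r = "SUP s\<in>{crossing S c \<omega>..<t}. L s \<omega>"
 obtain v where v: "v \<in> {crossing S c \<omega>..<t}" "c < L v \<omega>" using after_crossing[OF w c t] by (rule bexE)
 have "L v \<omega> \<le> ?r" by (rule cSUP_upper[OF v(1) b])
 then show 1: "c < ?r" using v(2) by linarith
 have 2: "L u \<omega> \<le> ?r" if u: "0 \<le> u" "u < t" for u
 proof (cases "u < crossing S c \<omega>")
  case True
  from before_crossing[OF w c u(1) True] 1 show ?thesis by linarith
 next
  case False
  then show ?thesis using u by (intro cSUP_upper[OF _ b]) auto
 qed
 then show "0 \<le> u \<Longrightarrow> u < t \<Longrightarrow> L u \<omega> \<le> ?r" .
 show "S t \<omega> \<le> ?r"
 proof (rule ccontr)
  assume "\<not> S t \<omega> \<le> ?r"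
  then have lt: "?r < S t \<omega>" by simp
  have r: "0 \<le> ?r" "?r < real n" using 1 c lt truncated_sup_range(2)[of n L t \<omega>] unfolding S_def by linarith+
  obtain u where u: "u \<in> {0..<t}" "?r < L u \<omega>" using lt unfolding S_def truncated_sup_greater[OF r[unfolded S_def]] by (rule bexE)
  then show False using 2[of u] by (auto simp: S_def)
 qed
qed

lemma sup_before_crossing:
 assumes w: "\<omega> \<in> space M" and c: "0 \<le> c" "c < real n" and s: "0 \<le> s" "s < t" and t: "t \<le> crossing S c \<omega>"
 shows "(SUP u\<in>{s..<t}. L u \<omega>) \<le> S t \<omega>"
proof (rule cSUP_least)
 show "{s..<t} \<noteq> {}" using s by simp
 fix u assume u: "u \<in> {s..<t}"
 show "L u \<omega> \<le> S t \<omega>"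
 proof (rule ccontr)
  define a where "a = S t \<omega>"
  assume "\<not> L u \<omega> \<le> S t \<omega>"
  then have a: "a < L u \<omega>" by (simp add: a_def)
  have "L u \<omega> \<le> c" by (rule before_crossing[OF w c]) (use u s t in auto)
  then have r: "0 \<le> a" "a < real n" using a c truncated_sup_range(1)[of n L t \<omega>] by (auto simp: a_def S_def)
  have "\<exists>s\<in>{0..<t}. a < L s \<omega>" using a u s by (intro bexI[of _ u]) auto
  then have "a < truncated_sup n L t \<omega>" unfolding truncated_sup_greater[OF r] .
  then show False by (simp add: a_def S_def)
 qed
qed

text \<open>The comparison holds between the integrands. Up to the crossing time \<open>r\<close> of \<open>c\<close> the represented rate is at
 most the rate of \<open>S\<close>, so waiting from \<open>s\<close> to \<open>r\<close> gains at least \<open>f i - rate S\<close>; after \<open>r\<close> the rate started at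
 \<open>r\<close> is at least \<open>interp c\<close> and at least the rate started at \<open>s\<close>. As \<open>c < i\<close>, waiting beyond \<open>r\<close> gains at most
 \<open>f i - interp c\<close>, the error term.\<close>

lemma switching_path:
 assumes w: "\<omega> \<in> space M" and i: "i \<in> {1..n}" and c: "real i - 1 < c" "c < real i" and s: "s \<in> {0..T}"
  and r: "r = crossing S c \<omega>"
  and bs: "AE t in \<mu>A. t \<in> {s<..T} \<longrightarrow> bdd_above ((\<lambda>u. L u \<omega>) ` {s..<t})"
  and br: "AE t in \<mu>A. t \<in> {r<..T} \<longrightarrow> bdd_above ((\<lambda>u. L u \<omega>) ` {r..<t})"
  and int_s: "set_integrable \<mu>A {s<..T} (\<lambda>t. tail_rate L s t \<omega>)"
  and int_r: "set_integrable \<mu>A {r<..T} (\<lambda>t. tail_rate L r t \<omega>)"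
  and fi: "integrable \<mu>A (\<lambda>t. f i t \<omega>)" and ri: "integrable \<mu>A (\<lambda>t. rate S t \<omega>)" and ci: "integrable \<mu>A (\<lambda>t. interp n f t \<omega> c)"
 shows "(LINT t:{0..s}|\<mu>A. f i t \<omega>) + (LINT t:{s<..T}|\<mu>A. tail_rate L s t \<omega>)
   + ((LINT t:{0..max s r}|\<mu>A. f i t \<omega> - rate S t \<omega>) - (LINT t:{0..s}|\<mu>A. f i t \<omega> - rate S t \<omega>))
  \<le> (LINT t:{0..r}|\<mu>A. f i t \<omega>) + (LINT t:{r<..T}|\<mu>A. tail_rate L r t \<omega>) + (LINT t|\<mu>A. f i t \<omega> - interp n f t \<omega> c)"
proof -
 have c': "0 \<le> c" "c < real n" using c i by auto
 have rT: "0 \<le> r" "r \<le> T" unfolding r using STD_range[OF crossing_ST[OF S_control] w, of c] by auto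
 define G where "G t = f i t \<omega> - rate S t \<omega>" for t
 have Gi: "integrable \<mu>A G" unfolding G_def by (rule LINT_integrable_diff[OF fi ri])
 let ?a = "\<lambda>t. indicator {0..s} t * f i t \<omega>" and ?b = "\<lambda>t. indicator {s<..T} t * tail_rate L s t \<omega>"
  and ?c = "\<lambda>t. indicator {0..max s r} t * G t" and ?d = "\<lambda>t. indicator {0..s} t * G t"
  and ?a' = "\<lambda>t. indicator {0..r} t * f i t \<omega>" and ?b' = "\<lambda>t. indicator {r<..T} t * tail_rate L r t \<omega>"
  and ?e = "\<lambda>t. f i t \<omega> - interp n f t \<omega> c"
 have ia: "integrable \<mu>A ?a" "integrable \<mu>A ?a'" by (rule A.integrable_window(2)[OF fi])+
 have ib: "integrable \<mu>A ?b" "integrable \<mu>A ?b'" using int_s int_r unfolding set_integrable_def real_scaleR_def .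
 have ic: "integrable \<mu>A ?c" "integrable \<mu>A ?d" by (rule A.integrable_window(2)[OF Gi])+
 have ie: "integrable \<mu>A ?e" by (rule LINT_integrable_diff[OF fi ci])
 have le: "AE t in \<mu>A. ?a t + ?b t + (?c t - ?d t) \<le> ?a' t + ?b' t + ?e t"
  using bs br AE_space
 proof eventually_elim
  case (elim t)
  then have t: "t \<in> {0..T}" by (simp add: A.space_\<mu>)
  have e: "f i t \<omega> = interp n f t \<omega> (real i)" by (rule interp_nat[OF i, symmetric])
  have e0: "0 \<le> ?e t" unfolding e using interp_le[OF t w, of c "real i"] c by simp
  have rs: "rate S t \<omega> = interp n f t \<omega> (S t \<omega>)" unfolding rate_def S_left[OF t w] ..
  show ?case
  proof (cases "t \<le> s")
   case ts: True
   show ?thesis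
   proof (cases "t \<le> r")
    case True
    then show ?thesis using ts e0 t by (auto simp: indicator_def)
   next
    case False
    have "c < (SUP s\<in>{crossing S c \<omega>..<t}. L s \<omega>)"
     by (rule sup_after_crossing(1)[OF w c']) (use False elim(2) t in \<open>auto simp: r\<close>)
    then have "interp n f t \<omega> c \<le> tail_rate L r t \<omega>" unfolding tail_rate_def r by (intro interp_le[OF t w] less_imp_le)
    then show ?thesis using ts False t by (auto simp: indicator_def)
   qed
  next
   case ts: False
   show ?thesis
   proof (cases "t \<le> r")
    case True
    have "(SUP u\<in>{s..<t}. L u \<omega>) \<le> S t \<omega>" by (rule sup_before_crossing[OF w c']) (use True ts s in \<open>auto simp: r\<close>)
    then have "tail_rate L s t \<omega> \<le> rate S t \<omega>" unfolding tail_rate_def rs by (rule interp_le[OF t w])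
    then show ?thesis using ts True t e0 by (auto simp: indicator_def G_def)
   next
    case False
    have "(SUP u\<in>{s..<t}. L u \<omega>) \<le> (SUP u\<in>{r..<t}. L u \<omega>)"
    proof (rule cSUP_least)
     show "{s..<t} \<noteq> {}" using ts by simp
     fix u assume u: "u \<in> {s..<t}"
     show "L u \<omega> \<le> (SUP u\<in>{r..<t}. L u \<omega>)" unfolding r
      by (rule sup_after_crossing(2)[OF w c']) (use False elim(2) t u s in \<open>auto simp: r\<close>)
    qed
    then have "tail_rate L s t \<omega> \<le> tail_rate L r t \<omega>" unfolding tail_rate_def by (rule interp_le[OF t w])
    then show ?thesis using ts False t e0 by (auto simp: indicator_def)
   qed
  qed
 qed
 have "(LINT t|\<mu>A. ?a t + ?b t + (?c t - ?d t)) \<le> (LINT t|\<mu>A. ?a' t + ?b' t + ?e t)"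
  by (rule integral_mono_AE[OF _ _ le])
   (intro LINT_integrable_add LINT_integrable_diff ia ib ic ie)+
 moreover have "(LINT t|\<mu>A. ?a t + ?b t + (?c t - ?d t)) = (LINT t|\<mu>A. ?a t) + (LINT t|\<mu>A. ?b t) + ((LINT t|\<mu>A. ?c t) - (LINT t|\<mu>A. ?d t))"
  by (simp only: LINT_add LINT_diff LINT_integrable_add LINT_integrable_diff ia ib ic)
 moreover have "(LINT t|\<mu>A. ?a' t + ?b' t + ?e t) = (LINT t|\<mu>A. ?a' t) + (LINT t|\<mu>A. ?b' t) + (LINT t|\<mu>A. ?e t)"
  by (simp only: LINT_add LINT_integrable_add ia ib ie)
 ultimately show ?thesis unfolding A.set_LINT_\<mu> G_def by linarith
qed

context
 fixes Y :: "real \<Rightarrow> 'a \<Rightarrow> real"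
 assumes Y: "Y \<in> contracts M F T \<xi>" and R: "represents M F T n \<mu>A f \<xi> L Y"
begin

lemma interp_const_jint: "0 \<le> c \<Longrightarrow> c \<le> real n \<Longrightarrow> A.jint (\<lambda>t \<omega>. interp n f t \<omega> c)"
 by (rule interp_jint) (simp_all add: progressively_measurable_def)

text \<open>The expectation of the pathwise comparison, in the limit of levels increasing to \<open>i\<close>: every
 stopping time does worse than the level time of \<open>i\<close>, by at least what agent \<open>i\<close> would gain
 from waiting against the rate of \<open>S\<close>.\<close>

lemma switching_payoff:
 assumes i: "i \<in> {1..n}" and \<tau>: "\<tau> \<in> ST"
 shows "agent_payoff M \<mu>A (f i) Y \<tau>
   + ((LINT \<omega>|M. (LINT t:{0..max (\<tau> \<omega>) (hitting_time T S i \<omega>)}|\<mu>A. f i t \<omega> - rate S t \<omega>)) - (LINT \<omega>|M. (LINT t:{0..\<tau> \<omega>}|\<mu>A. f i t \<omega> - rate S t \<omega>)))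
  \<le> agent_payoff M \<mu>A (f i) Y (hitting_time T S i)"
proof -
 note f = f_jint[OF i] and D = contractsD(1)[OF Y] and U = contractsD(2)[OF Y]
 define h where "h = hitting_time T S i"
 have h: "h \<in> ST" unfolding h_def hitting_time_eq by (rule level_time_ST[OF S_control])
 define c where "c k = level_below i k" for k
 define \<rho> where "\<rho> k = crossing S (c k)" for k
 define G where "G t \<omega> = f i t \<omega> - rate S t \<omega>" for t \<omega>
 define I where "I \<sigma> \<omega> = (LINT t:{\<sigma> \<omega><..T}|\<mu>A. tail_rate L (\<sigma> \<omega>) t \<omega>)" for \<sigma> \<omega>
 define K where "K = (LINT \<omega>|M. (LINT t|\<mu>A. f i t \<omega> - interp n f t \<omega> (real i - 1)))"
 have ck: "real i - 1 < c k" "c k < real i" for k unfolding c_def by (rule level_below_props)+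
 have ck': "0 \<le> c k" "c k \<le> real n" for k using ck[of k] i by auto
 have \<rho>: "\<rho> k \<in> ST" for k unfolding \<rho>_def by (rule crossing_ST[OF S_control])
 have G: "A.jint G" unfolding G_def by (rule A.jint_diff[OF f rate_jint[OF S_control]])
 have Ii: "integrable M (I \<sigma>)" if "\<sigma> \<in> ST" for \<sigma> unfolding I_def by (rule representsD(3)[OF R that])
 have x: "(\<lambda>\<omega>. max (\<tau> \<omega>) (\<sigma> \<omega>)) \<in> ST" if "\<sigma> \<in> ST" for \<sigma> by (rule ST_max[OF \<tau> that])
 have pay: "agent_payoff M \<mu>A (f i) Y \<sigma> = (LINT \<omega>|M. (LINT t:{0..\<sigma> \<omega>}|\<mu>A. f i t \<omega>)) + ((LINT \<omega>|M. \<xi> \<omega>) + (LINT \<omega>|M. I \<sigma> \<omega>))"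
  if "\<sigma> \<in> ST" for \<sigma>
  unfolding A.agent_payoff_split[OF f D that] represented_expectation[OF D R that] I_def ..
 define X where "X k = (LINT \<omega>|M. (LINT t:{0..max (\<tau> \<omega>) (\<rho> k \<omega>)}|\<mu>A. G t \<omega>))" for k
 define X0 where "X0 = (LINT \<omega>|M. (LINT t:{0..\<tau> \<omega>}|\<mu>A. G t \<omega>))"
 define X1 where "X1 = (LINT \<omega>|M. (LINT t:{0..max (\<tau> \<omega>) (h \<omega>)}|\<mu>A. G t \<omega>))"
 have step: "agent_payoff M \<mu>A (f i) Y \<tau> + (X k - X0) \<le> agent_payoff M \<mu>A (f i) Y (\<rho> k) + (real i - c k) * K" for k
 proof -
  have di: "A.jint (\<lambda>t \<omega>. f i t \<omega> - interp n f t \<omega> (c k))" by (rule A.jint_diff[OF f interp_const_jint[OF ck']])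
  note ints = A.jint_upto[OF f \<tau>] A.jint_upto[OF f \<rho>] Ii[OF \<tau>] Ii[OF \<rho>] A.jint_upto[OF G x[OF \<rho>]] A.jint_upto[OF G \<tau>] A.jint_integral[OF di]
  have "(LINT \<omega>|M. (LINT t:{0..\<tau> \<omega>}|\<mu>A. f i t \<omega>) + I \<tau> \<omega> + ((LINT t:{0..max (\<tau> \<omega>) (\<rho> k \<omega>)}|\<mu>A. G t \<omega>) - (LINT t:{0..\<tau> \<omega>}|\<mu>A. G t \<omega>)))
   \<le> (LINT \<omega>|M. (LINT t:{0..\<rho> k \<omega>}|\<mu>A. f i t \<omega>) + I (\<rho> k) \<omega> + (LINT t|\<mu>A. f i t \<omega> - interp n f t \<omega> (c k)))"
  proof (rule integral_mono_AE)
   show "AE \<omega> in M. (LINT t:{0..\<tau> \<omega>}|\<mu>A. f i t \<omega>) + I \<tau> \<omega> + ((LINT t:{0..max (\<tau> \<omega>) (\<rho> k \<omega>)}|\<mu>A. G t \<omega>) - (LINT t:{0..\<tau> \<omega>}|\<mu>A. G t \<omega>))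
    \<le> (LINT t:{0..\<rho> k \<omega>}|\<mu>A. f i t \<omega>) + I (\<rho> k) \<omega> + (LINT t|\<mu>A. f i t \<omega> - interp n f t \<omega> (c k))"
    using representsD(1)[OF R \<tau>] representsD(1)[OF R \<rho>[of k]] representsD(2)[OF R \<tau>] representsD(2)[OF R \<rho>[of k]]
     A.jint_AE[OF f] A.jint_AE[OF rate_jint[OF S_control]] A.jint_AE[OF interp_const_jint[OF ck'[of k]]] AE_space
   proof eventually_elim
    case (elim \<omega>)
    have s: "\<tau> \<omega> \<in> {0..T}" using STD_range[OF \<tau> elim(8)] by simp
    have r: "\<rho> k \<omega> = crossing S (c k) \<omega>" unfolding \<rho>_def ..
    show ?case unfolding I_def G_def
     by (rule switching_path[OF elim(8) i ck s r elim(1-7)])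
   qed
  qed (intro LINT_integrable_add LINT_integrable_diff ints)+
  moreover have "(LINT \<omega>|M. (LINT t:{0..\<tau> \<omega>}|\<mu>A. f i t \<omega>) + I \<tau> \<omega> + ((LINT t:{0..max (\<tau> \<omega>) (\<rho> k \<omega>)}|\<mu>A. G t \<omega>) - (LINT t:{0..\<tau> \<omega>}|\<mu>A. G t \<omega>)))
   = (LINT \<omega>|M. (LINT t:{0..\<tau> \<omega>}|\<mu>A. f i t \<omega>)) + (LINT \<omega>|M. I \<tau> \<omega>) + (X k - X0)"
   unfolding X_def X0_def
   by (simp only: LINT_add LINT_diff LINT_integrable_add LINT_integrable_diff ints)
  moreover have "(LINT \<omega>|M. (LINT t:{0..\<rho> k \<omega>}|\<mu>A. f i t \<omega>) + I (\<rho> k) \<omega> + (LINT t|\<mu>A. f i t \<omega> - interp n f t \<omega> (c k)))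
   = (LINT \<omega>|M. (LINT t:{0..\<rho> k \<omega>}|\<mu>A. f i t \<omega>)) + (LINT \<omega>|M. I (\<rho> k) \<omega>) + (LINT \<omega>|M. (LINT t|\<mu>A. f i t \<omega> - interp n f t \<omega> (c k)))"
   by (simp only: LINT_add LINT_integrable_add ints)
  moreover have "(LINT \<omega>|M. (LINT t|\<mu>A. f i t \<omega> - interp n f t \<omega> (c k))) = (real i - c k) * K"
   unfolding interp_affine[OF i ck] K_def by simp
  ultimately show ?thesis unfolding pay[OF \<tau>] pay[OF \<rho>] by linarith
 qed
 have inc: "incseq (\<lambda>k. \<rho> k \<omega>)" for \<omega> unfolding \<rho>_def c_def by (rule crossing_incseq)
 have SUP: "(SUP k. \<rho> k \<omega>) = h \<omega>" if w: "\<omega> \<in> space M" for \<omega>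
  unfolding \<rho>_def c_def h_def by (rule crossing_SUP[OF S_control S_left w]) (use w in auto)
 have lim: "(\<lambda>k. \<rho> k \<omega>) \<longlonglongrightarrow> h \<omega>" if w: "\<omega> \<in> space M" for \<omega>
  using LIMSEQ_incseq_SUP[OF ST_bdd(1)[OF \<rho> w] inc] unfolding SUP[OF w] .
 have Xlim: "X \<longlonglongrightarrow> X1" unfolding X_def X1_def
  by (rule A.jint_upto_tendsto[OF G x[OF \<rho>] x[OF h] AE_I2]) (rule tendsto_max[OF tendsto_const lim])
 have Klim: "(\<lambda>k. (real i - c k) * K) \<longlonglongrightarrow> (real i - real i) * K"
  unfolding c_def by (intro tendsto_mult tendsto_diff tendsto_const level_below_tendsto)
 have "agent_payoff M \<mu>A (f i) Y \<tau> + (X1 - X0) \<le> agent_payoff M \<mu>A (f i) Y h"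
 proof (rule field_le_epsilon)
  fix e :: real assume e: "0 < e"
  have e3: "0 < e / 3" using e by simp
  have sup: "(\<lambda>\<omega>. SUP k. \<rho> k \<omega>) \<in> ST" by (rule ST_SUP[OF \<rho>])
  have "agent_payoff M \<mu>A (f i) Y (\<lambda>\<omega>. SUP k. \<rho> k \<omega>) = agent_payoff M \<mu>A (f i) Y h"
   by (rule A.agent_payoff_cong[OF f D sup h AE_I2]) (rule SUP)
  then have 1: "\<forall>\<^sub>F k in sequentially. agent_payoff M \<mu>A (f i) Y (\<rho> k) \<le> agent_payoff M \<mu>A (f i) Y h + e / 3"
   using A.agent_payoff_increasing[OF f D U \<rho> inc e3] by simp
  have 2: "\<forall>\<^sub>F k in sequentially. X1 - e / 3 < X k" by (rule order_tendstoD(1)[OF Xlim]) (use e in simp)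
  have 3: "\<forall>\<^sub>F k in sequentially. (real i - c k) * K < e / 3" by (rule order_tendstoD(2)[OF Klim]) (use e in simp)
  from eventually_conj[OF 1 eventually_conj[OF 2 3]] obtain k where
   "agent_payoff M \<mu>A (f i) Y (\<rho> k) \<le> agent_payoff M \<mu>A (f i) Y h + e / 3 \<and> X1 - e / 3 < X k \<and> (real i - c k) * K < e / 3"
   using eventually_happens'[OF sequentially_bot] by (metis (no_types, lifting))
  then show "agent_payoff M \<mu>A (f i) Y \<tau> + (X1 - X0) \<le> agent_payoff M \<mu>A (f i) Y h + e" using step[of k] by linarith
 qed
 then show ?thesis unfolding X1_def X0_def G_def h_def .
qed

lemma hitting_time_smallest_optimal_represented:
 "i \<in> {1..n} \<Longrightarrow> smallest_optimal M F T \<mu>A (f i) Y (hitting_time T S i)"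
 by (rule smallest_optimal_if_waiting_pays[OF S_control _ switching_payoff])

text \<open>After a crossing time the represented rate is at least the rate of \<open>S\<close>, truncation at \<open>n\<close> being the only
 difference. The level times are limits of crossing times, along which \<open>Y\<close> is upper semicontinuous.\<close>

lemma claim_le_represented:
 assumes i: "i \<in> {1..n}"
 shows "(LINT \<omega>|M. claim S (hitting_time T S i \<omega>) \<omega>) \<le> (LINT \<omega>|M. Y (hitting_time T S i \<omega>) \<omega>)"
proof -
 note D = contractsD(1)[OF Y] and U = contractsD(2)[OF Y]
 define h where "h = hitting_time T S i"
 have h: "h \<in> ST" unfolding h_def hitting_time_eq by (rule level_time_ST[OF S_control])
 define \<rho> where "\<rho> k = crossing S (level_below i k)" for k
 have \<rho>: "\<rho> k \<in> ST" for k unfolding \<rho>_def by (rule crossing_ST[OF S_control])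
 have step: "(LINT \<omega>|M. claim S (\<rho> k \<omega>) \<omega>) \<le> (LINT \<omega>|M. Y (\<rho> k \<omega>) \<omega>)" for k
 proof -
  have c: "0 \<le> level_below i k" "level_below i k < real n" using level_below_props(1,2)[of i k] i by auto
  have "(LINT \<omega>|M. (LINT t:{\<rho> k \<omega><..T}|\<mu>A. rate S t \<omega>)) \<le> (LINT \<omega>|M. (LINT t:{\<rho> k \<omega><..T}|\<mu>A. tail_rate L (\<rho> k \<omega>) t \<omega>))"
  proof (rule integral_mono_AE[OF A.jint_after[OF rate_jint[OF S_control] \<rho>] representsD(3)[OF R \<rho>]])
   show "AE \<omega> in M. (LINT t:{\<rho> k \<omega><..T}|\<mu>A. rate S t \<omega>) \<le> (LINT t:{\<rho> k \<omega><..T}|\<mu>A. tail_rate L (\<rho> k \<omega>) t \<omega>)"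
    using representsD(1)[OF R \<rho>[of k]] representsD(2)[OF R \<rho>[of k]] A.jint_AE[OF rate_jint[OF S_control]] AE_space
   proof eventually_elim
    case (elim \<omega>)
    note w = elim(4)
    show ?case unfolding A.set_LINT_\<mu>
    proof (rule integral_mono_AE[OF A.integrable_window(1)[OF elim(3)]])
     show "integrable \<mu>A (\<lambda>t. indicator {\<rho> k \<omega><..T} t * tail_rate L (\<rho> k \<omega>) t \<omega>)"
      using elim(2) unfolding set_integrable_def real_scaleR_def .
     show "AE t in \<mu>A. indicator {\<rho> k \<omega><..T} t * rate S t \<omega> \<le> indicator {\<rho> k \<omega><..T} t * tail_rate L (\<rho> k \<omega>) t \<omega>"
      using elim(1) AE_space
     proof eventually_elim
      case (elim t)
      then have t: "t \<in> {0..T}" by (simp add: A.space_\<mu>)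
      show ?case
      proof (cases "\<rho> k \<omega> < t")
       case True
       have "S t \<omega> \<le> (SUP s\<in>{crossing S (level_below i k) \<omega>..<t}. L s \<omega>)"
        by (rule sup_after_crossing(3)[OF w c]) (use True elim(1) t in \<open>auto simp: \<rho>_def\<close>)
       then have "rate S t \<omega> \<le> tail_rate L (\<rho> k \<omega>) t \<omega>"
        unfolding rate_def tail_rate_def S_left[OF t w] \<rho>_def by (rule interp_le[OF t w])
       then show ?thesis by (simp add: indicator_def)
      qed (simp add: indicator_def)
     qed
    qed
   qed
  qed
  then show ?thesis unfolding represented_expectation[OF D R \<rho>] claim_expectation[OF S_control \<rho>] by simp
 qed
 have inc: "incseq (\<lambda>k. \<rho> k \<omega>)" for \<omega> unfolding \<rho>_def by (rule crossing_incseq)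
 have SUP: "(SUP k. \<rho> k \<omega>) = h \<omega>" if w: "\<omega> \<in> space M" for \<omega>
  unfolding \<rho>_def h_def by (rule crossing_SUP[OF S_control S_left w]) (use w in auto)
 have lim: "(\<lambda>k. \<rho> k \<omega>) \<longlonglongrightarrow> h \<omega>" if w: "\<omega> \<in> space M" for \<omega>
  using LIMSEQ_incseq_SUP[OF ST_bdd(1)[OF \<rho> w] inc] unfolding SUP[OF w] .
 have cl: "(\<lambda>k. LINT \<omega>|M. claim S (\<rho> k \<omega>) \<omega>) \<longlonglongrightarrow> (LINT \<omega>|M. claim S (h \<omega>) \<omega>)"
  by (rule claim_tendsto[OF S_control h \<rho> AE_I2]) (rule lim)
 have eq: "(LINT \<omega>|M. Y (SUP k. \<rho> k \<omega>) \<omega>) = (LINT \<omega>|M. Y (h \<omega>) \<omega>)"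
  by (rule LINT_cong[OF refl]) (simp only: SUP)
 have "(LINT \<omega>|M. claim S (h \<omega>) \<omega>) \<le> (LINT \<omega>|M. Y (h \<omega>) \<omega>)"
 proof (rule field_le_epsilon)
  fix e :: real assume e: "0 < e"
  have ev: "\<forall>\<^sub>F k in sequentially. (LINT \<omega>|M. claim S (\<rho> k \<omega>) \<omega>) \<le> (LINT \<omega>|M. Y (h \<omega>) \<omega>) + e"
   using USCE_increasing[OF D U \<rho> inc e] unfolding eq
  proof (rule eventually_mono)
   fix k assume "(LINT \<omega>|M. Y (\<rho> k \<omega>) \<omega>) \<le> (LINT \<omega>|M. Y (h \<omega>) \<omega>) + e"
   with step[of k] show "(LINT \<omega>|M. claim S (\<rho> k \<omega>) \<omega>) \<le> (LINT \<omega>|M. Y (h \<omega>) \<omega>) + e" by (rule order_trans)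
  qed
  show "(LINT \<omega>|M. claim S (h \<omega>) \<omega>) \<le> (LINT \<omega>|M. Y (h \<omega>) \<omega>) + e"
   by (rule tendsto_upperbound[OF cl ev sequentially_bot])
 qed
 then show ?thesis unfolding h_def .
qed

lemma represented_payoff_le: "principal_payoff M F T n \<mu>A \<mu>P f g Y \<le> J M T n \<mu>A \<mu>P f g \<xi> S"
proof -
 have "principal_payoff M F T n \<mu>A \<mu>P f g Y = (\<Sum>i=1..n. (LINT \<omega>|M. (LINT t:{0..hitting_time T S i \<omega>}|\<mu>P. g i t \<omega>)) - (LINT \<omega>|M. Y (hitting_time T S i \<omega>) \<omega>))"
  by (rule principal_payoff_eq[OF Y hitting_time_smallest_optimal_represented])
 also have "\<dots> \<le> J M T n \<mu>A \<mu>P f g \<xi> S"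
  unfolding J_eq[OF S_control] by (intro sum_mono diff_left_mono claim_le_represented)
 finally show ?thesis .
qed

end

lemma truncated_sup_optimal:
 assumes Y: "optimal_contract M F T n \<mu>A \<mu>P f g \<xi> Y" and R: "represents M F T n \<mu>A f \<xi> L Y"
 shows "optimal_control M F T n \<mu>A \<mu>P f g \<xi> S"
proof -
 have Y': "Y \<in> contracts M F T \<xi>" "ereal (principal_payoff M F T n \<mu>A \<mu>P f g Y) = V_P M F T n \<mu>A \<mu>P f g \<xi>"
  using Y unfolding optimal_contract_def by (rule conjunct1, rule conjunct2)
 let ?m = "SUP L\<in>\<L>. ereal (J M T n \<mu>A \<mu>P f g \<xi> L)"
 have "?m = ereal (principal_payoff M F T n \<mu>A \<mu>P f g Y)" unfolding Y'(2) V_eq_sup_mono ..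
 also have "\<dots> \<le> ereal (J M T n \<mu>A \<mu>P f g \<xi> S)" using represented_payoff_le[OF Y'(1) R] by simp
 finally have "?m \<le> ereal (J M T n \<mu>A \<mu>P f g \<xi> S)" .
 moreover have "ereal (J M T n \<mu>A \<mu>P f g \<xi> S) \<le> ?m" by (rule SUP_upper[OF S_control])
 ultimately show ?thesis unfolding optimal_control_def using S_control by (intro conjI antisym)
qed

end

end

theorem theorem2p2:
  fixes M :: "'a measure" and F :: "real \<Rightarrow> 'a measure" and T :: real and n :: nat
    and \<mu>A \<mu>P :: "real measure"
    and f g :: "nat \<Rightarrow> real \<Rightarrow> 'a \<Rightarrow> real" and \<xi> :: "'a \<Rightarrow> real"
  assumes "usual_filtered_prob_space M F T"
    and "n \<ge> 1"
    and "atomless_finite_borel T \<mu>A" and "atomless_finite_borel T \<mu>P"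
    and "full_support T \<mu>A"
    and "\<And>i. i \<in> {1..n} \<Longrightarrow> progressively_measurable F T (f i)"
    and "\<And>i. i \<in> {1..n} \<Longrightarrow> progressively_measurable F T (g i)"
    and "\<xi> \<in> borel_measurable (F T)" and "integrable M \<xi>"
    and "\<And>i t \<omega>. i \<in> {1..<n} \<Longrightarrow> t \<in> {0..T} \<Longrightarrow> \<omega> \<in> space M \<Longrightarrow> f i t \<omega> < f (i + 1) t \<omega>"
    and "\<And>i. i \<in> {1..n} \<Longrightarrow>
       (\<integral>\<^sup>+\<omega>. ((\<integral>\<^sup>+t. ennreal \<bar>f i t \<omega>\<bar> \<partial>\<mu>A) + (\<integral>\<^sup>+t. ennreal \<bar>g i t \<omega>\<bar> \<partial>\<mu>P)) \<partial>M) < \<infinity>"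
  shows "V_P M F T n \<mu>A \<mu>P f g \<xi> =
           (SUP L\<in>controls_mono M F T n. ereal (J M T n \<mu>A \<mu>P f g \<xi> L)) \<and>
         (SUP L\<in>controls_mono M F T n. ereal (J M T n \<mu>A \<mu>P f g \<xi> L)) =
           (SUP L\<in>controls_int M F T n. ereal (J M T n \<mu>A \<mu>P f g \<xi> L)) \<and>
         (\<forall>Lopt. optimal_control M F T n \<mu>A \<mu>P f g \<xi> Lopt \<longrightarrow>
            (\<exists>Y. contract_of M F T n \<mu>A f \<xi> Lopt Y) \<and>
            (\<forall>Y. contract_of M F T n \<mu>A f \<xi> Lopt Y \<longrightarrow>
               optimal_contract M F T n \<mu>A \<mu>P f g \<xi> Y \<and>
               (\<forall>i\<in>{1..n}. smallest_optimal M F T \<mu>A (f i) Y (hitting_time T Lopt i)))) \<and>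
         (\<forall>Yopt L. optimal_contract M F T n \<mu>A \<mu>P f g \<xi> Yopt \<longrightarrow>
            optional_process M F T L \<longrightarrow> represents M F T n \<mu>A f \<xi> L Yopt \<longrightarrow>
            truncated_sup n L \<in> controls_mono M F T n \<and>
            optimal_control M F T n \<mu>A \<mu>P f g \<xi> (truncated_sup n L) \<and>
            (\<exists>Y. contract_of M F T n \<mu>A f \<xi> (truncated_sup n L) Y) \<and>
            (\<forall>Y. contract_of M F T n \<mu>A f \<xi> (truncated_sup n L) Y \<longrightarrow>
               optimal_contract M F T n \<mu>A \<mu>P f g \<xi> Y \<and>
               (\<forall>i\<in>{1..n}. \<exists>\<tau>. smallest_optimal M F T \<mu>A (f i) Yopt \<tau> \<and>
                                smallest_optimal M F T \<mu>A (f i) Y \<tau>)))"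
proof -
  interpret contract_design M F T n \<mu>A \<mu>P f g \<xi>
    using assms by (intro contract_design.intro contract_design_axioms.intro)
  have control: "L \<in> controls_mono M F T n" if "optimal_control M F T n \<mu>A \<mu>P f g \<xi> L" for L
    using that unfolding optimal_control_def by (rule conjunct1)
  show ?thesis
  proof (intro conjI allI impI ballI)
    show "V_P M F T n \<mu>A \<mu>P f g \<xi> = (SUP L\<in>controls_mono M F T n. ereal (J M T n \<mu>A \<mu>P f g \<xi> L))"
      by (rule V_eq_sup_mono)
    show "(SUP L\<in>controls_mono M F T n. ereal (J M T n \<mu>A \<mu>P f g \<xi> L))
        = (SUP L\<in>controls_int M F T n. ereal (J M T n \<mu>A \<mu>P f g \<xi> L))"
      by (rule sup_mono_eq_sup_int)
  next
    fix L assume L: "optimal_control M F T n \<mu>A \<mu>P f g \<xi> L"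
    show "\<exists>Y. contract_of M F T n \<mu>A f \<xi> L Y" by (rule contract_exists[OF control[OF L]])
    fix Y assume Y: "contract_of M F T n \<mu>A f \<xi> L Y"
    show "optimal_contract M F T n \<mu>A \<mu>P f g \<xi> Y" by (rule optimal_control_contract[OF L Y])
    show "smallest_optimal M F T \<mu>A (f i) Y (hitting_time T L i)" if "i \<in> {1..n}" for i
      by (rule hitting_time_smallest_optimal[OF control[OF L] Y that])
  next
    fix Yopt L
    assume Yopt: "optimal_contract M F T n \<mu>A \<mu>P f g \<xi> Yopt" and L: "optional_process M F T L"
      and R: "represents M F T n \<mu>A f \<xi> L Yopt"
    have Yopt': "Yopt \<in> contracts M F T \<xi>" using Yopt unfolding optimal_contract_def by (rule conjunct1)
    show S: "truncated_sup n L \<in> controls_mono M F T n" by (rule truncated_sup_control[OF L])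
    show opt: "optimal_control M F T n \<mu>A \<mu>P f g \<xi> (truncated_sup n L)" by (rule truncated_sup_optimal[OF L Yopt R])
    show "\<exists>Y. contract_of M F T n \<mu>A f \<xi> (truncated_sup n L) Y" by (rule contract_exists[OF S])
    fix Y assume Y: "contract_of M F T n \<mu>A f \<xi> (truncated_sup n L) Y"
    show "optimal_contract M F T n \<mu>A \<mu>P f g \<xi> Y" by (rule optimal_control_contract[OF opt Y])
    fix i assume i: "i \<in> {1..n}"
    show "\<exists>\<tau>. smallest_optimal M F T \<mu>A (f i) Yopt \<tau> \<and> smallest_optimal M F T \<mu>A (f i) Y \<tau>"
      using hitting_time_smallest_optimal_represented[OF L Yopt' R i] hitting_time_smallest_optimal[OF S Y i]
      by (intro exI[of _ "hitting_time T (truncated_sup n L) i"] conjI)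
  qed
qed


end
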